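(* Let $G$, $H_0$, $V=vUv^*$, $H=H_0+V$, $R(\kappa)=(H+\kappa^2)^{-1}$ be as in the context, and assume that $V$ satisfies the assumption $(\mathrm A_\beta)$ of the context for some integer $\beta\ge4$. Assume that the threshold $0$ is an exceptional point of the third kind, i.e. $\mathcal E\supsetneq\mathsf E\supsetneq\{0\}$. Let $G_j$ be the coefficients in the asymptotic expansion $R(\kappa)=\sum_{j=-2}^{\beta-6}\kappa^jG_j+\mathcal O(\kappa^{\beta-5})$ in $\mathcal B^{\beta-2}$ as $\kappa\to0$, $\mathop{\mathrm{Re}}\kappa>0$. Then (each formula being asserted when the coefficient occurs in the expansion) $$\begin{aligned}G_0=(I-\mathsf P)\bigl[&G_{0,0}-G_{0,0}vm_0^\dagger v^*G_{0,1}-G_{0,1}vm_0^\dagger v^*G_{0,0}\\ &-G_{0,0}\bigl(I-vm_0^\dagger v^*G_{0,1}\bigr)vM_0^\dagger v^*\bigl(I-G_{0,1}vm_0^\dagger v^*\bigr)G_{0,0}\\ &+G_{0,0}vm_0^\dagger v^*G_{0,2}vm_0^\dagger v^*G_{0,0}\\ &+G_{0,0}vm_0^\dagger v^*G_{0,0}\mathsf PG_{0,0}vm_0^\dagger v^*G_{0,0}\bigr](I-\mathsf P),\end{aligned}$$ $$\begin{aligned}G_1&=-\widetilde{\mathcal P}+\mathcal PVG_{0,3}V\mathcal P-\mathcal PVG_{0,2}vm_0^\dagger v^*G_{0,2}V\mathcal P\\ &\quad-(I-\mathsf P)\bigl[I-G_{0,0}\bigl(I-vm_0^\dagger v^*G_{0,1}\bigr)vM_0^\dagger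 v^*\bigr]\bigl(I-G_{0,1}vm_0^\dagger v^*\bigr)G_{0,2}V\mathcal P\\ &\quad-\mathcal PVG_{0,2}\bigl(I-vm_0^\dagger v^*G_{0,1}\bigr)\bigl[I-vM_0^\dagger v^*\bigl(I-G_{0,1}vm_0^\dagger v^*\bigr)G_{0,0}\bigr](I-\mathsf P).\end{aligned}$$ Here $\widetilde{\mathcal P}=\sum_{\widetilde\gamma}|\Psi_{\widetilde\gamma}\rangle\langle\Psi_{\widetilde\gamma}|$ with $$\Psi_{\widetilde\gamma}=(I-\mathsf P)\bigl[I-G_{0,0}\bigl(I-vm_0^\dagger v^*G_{0,1}\bigr)vM_0^\dagger v^*\bigr]\mathbf n_{\widetilde\gamma},$$ where $\mathbf n_{\widetilde\gamma}$ is as in the context, and $\{\Psi_{\widetilde\gamma}\}$ is an orthonormal non-resonance basis (so $\widetilde{\mathcal P}$ is the associated orthogonal non-resonance projection). In particular, for any $\Psi_1\in\widetilde{\mathcal E}$ and $\Psi_2\in\mathcal E$ with $\Psi_1-\sum_{\alpha=1}^Nc_\alpha^{(1)}\mathbf n^{(\alpha)}\in\mathbb C\mathbf 1\oplus\mathcal L^{\beta-2}$ and $\Psi_2-\sum_{\alpha=1}^Nc_\alpha^{(2)}\mathbf 1^{(\alpha)}\in\mathcal L^{\beta-2}$ one has $\sum_{\alpha=1}^N\overline{c_\alpha^{(2)}}\,c_\alpha^{(1)}=0$.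
   Context: Graph. Let $(K,E_0)$ be a connected, finite, undirected, simple graph (no loops, no multiple edges), and for $\alpha=1,\dots,N$ let $(L_\alpha,E_\alpha)$ be a copy of the discrete half-line, $L_\alpha=\{1,2,\dots\}$, $E_\alpha=\{\{n,n+1\}: n\in L_\alpha\}$. Fix vertices $x_1,\dots,x_N\in K$ (not necessarily distinct). Let $G=K\cup L_1\cup\dots\cup L_N$ (disjoint union), with edges those of $E_0,E_1,\dots,E_N$ together with $\{x_\alpha,1^{(\alpha)}\}$, $\alpha=1,\dots,N$, where $1^{(\alpha)}$ is the point $1\in L_\alpha$. Free operator. For $u\colon K\to\mathbb C$ set $(h_0u)[x]=\sum_{y\in K,\{x,y\}\in E_0}(u[x]-u[y])+\sum_{\alpha=1}^Ns_\alpha[x]u[x]$, where $s_\alpha[x]=1$ if $x=x_\alpha$ and $0$ otherwise. For $u\colon L_\alpha\to\mathbb C$ set $(h_\alpha u)[1]=2u[1]-u[2]$ and $(h_\alpha u)[n]=2u[n]-u[n+1]-u[n-1]$ for $n\ge2$. Let $H_0=h_0\oplus h_1\oplus\dots\oplus h_N$, acting on all functions on $G$ decomposed as functions on $K,L_1,\dots,L_N$; on $\mathcal H=\ell^2(G)$ it is bounded and self-adjoint. The operator $h_0$ is invertible. Spaces. For $s\in\mathbb R$, $\mathcal L^s=\ell^{1,s}(G)$ is the space of $u\colon G\to\mathbb C$ with $\sum_{x\in K}|u[x]|+\sum_{\alpha}\sum_{n\in L_\alpha}(1+n^2)^{s/2}|u[n]|<\infty$; its dual $(\mathcal L^s)^*=\ell^{\infty,-s}(G)$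 is the space of $u$ with $\sup_{x\in K}|u[x]|<\infty$ and $\sup_{n\in L_\alpha}(1+n^2)^{-s/2}|u[n]|<\infty$ for all $\alpha$. Put $\mathcal B^s=\mathcal B(\mathcal L^s,(\mathcal L^s)^* )$. $\langle u,w\rangle=\sum_{x\in G}\overline{u[x]}w[x]$ whenever this converges absolutely (inner products are conjugate-linear in the first entry), and $|\Psi\rangle\langle\Phi|$ is the operator $u\mapsto\langle\Phi,u\rangle\Psi$. $(\Phi\cdot\Psi)[x]=\Phi[x]\Psi[x]$ is the pointwise product. Assumption $(\mathrm A_\beta)$, $\beta\ge1$: $V\in\mathcal B(\mathcal H)$ is self-adjoint, and there exist a Hilbert space $\mathcal K$, an injective operator $v\in\mathcal B(\mathcal K,\mathcal L^\beta)$ and a self-adjoint unitary operator $U\in\mathcal B(\mathcal K)$ such that $V=vUv^*\in\mathcal B((\mathcal L^\beta)^*,\mathcal L^\beta)$; such $\mathcal K,v,U$ are fixed. Put $H=H_0+V$ and $R(\kappa)=(H+\kappa^2)^{-1}$ for $-\kappa^2\notin\sigma(H)$. Free coefficients. $G_{0,j}=g_{0,j}\oplus g_{1,j}\oplus\dots\oplus g_{N,j}$ for $j$ even and $G_{0,j}=0\oplus g_{1,j}\oplus\dots\oplus g_{N,j}$ for $j$ odd, where $g_{0,2i}=(-1)^ih_0^{-i-1}$ on functions on $K$ and, for $\alpha\ge1$, $g_{\alpha,j}$ is given on $L_\alpha$ by the kernels (with $n\wedge m=\min\{n,m\}$, $n\vee m=\max\{n,m\}$): $g_{\alpha,0}[n,m]=n\wedge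 m$, $g_{\alpha,1}[n,m]=-nm$, $g_{\alpha,2}[n,m]=-\frac16(n\wedge m)+\frac16(n\wedge m)^3+\frac12nm(n\vee m)$, $g_{\alpha,3}[n,m]=\frac5{24}nm-\frac16n^3m-\frac16nm^3$. Eigenspaces. Let $\mathbf n^{(\alpha)}[x]=m$ if $x=m\in L_\alpha$ and $0$ otherwise; $\mathbf 1^{(\alpha)}[x]=1$ if $x\in L_\alpha$ and $0$ otherwise; $\mathbb C\mathbf n=\bigoplus_\alpha\mathbb C\mathbf n^{(\alpha)}$, $\mathbb C\mathbf 1=\bigoplus_\alpha\mathbb C\mathbf 1^{(\alpha)}$. Define $\widetilde{\mathcal E}=\{\Psi\in(\mathcal L^\beta)^*: H\Psi=0\}$, $\mathcal E=\widetilde{\mathcal E}\cap(\mathbb C\mathbf 1\oplus\mathcal L^{\beta-2})$, $\mathsf E=\widetilde{\mathcal E}\cap\mathcal L^{\beta-2}$. Intermediate operators. $M_0=U+v^*G_{0,0}v\in\mathcal B(\mathcal K)$, $Q$ is the orthogonal projection in $\mathcal K$ onto $\mathop{\mathrm{Ker}}M_0$, and $m_0=-\sum_{\alpha=1}^N|Qv^*\mathbf n^{(\alpha)}\rangle\langle Qv^*\mathbf n^{(\alpha)}|\in\mathcal B(\mathcal K)$. For a self-adjoint operator $A$ with closed range, $A^\dagger$ denotes the pseudo-inverse: zero on $\mathop{\mathrm{Ker}}A$ and the inverse of $A|_{(\mathop{\mathrm{Ker}}A)^\perp}$ on $(\mathop{\mathrm{Ker}}A)^\perp$. Projections. A set $\{\Psi_\gamma\}\subset\mathcal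 E$ is an orthonormal resonance basis if the classes $[\Psi_\gamma]$ form a basis of $\mathcal E/\mathsf E$, for every $\gamma$ and $\Psi\in\mathsf E$ one has $\overline\Psi\cdot\Psi_\gamma\in\mathcal L^0$ and $\langle\Psi,\Psi_\gamma\rangle=0$, and there is an orthonormal system $\{c^{(\gamma)}\}\subset\mathbb C^N$ with $\Psi_\gamma-\sum_\alpha c^{(\gamma)}_\alpha\mathbf 1^{(\alpha)}\in\mathcal L^{\beta-2}$ for every $\gamma$. The orthogonal resonance projection is $\mathcal P=\sum_\gamma|\Psi_\gamma\rangle\langle\Psi_\gamma|$. A basis $\{\Psi_\gamma\}$ of $\mathsf E$ is an orthonormal bound basis if $\overline{\Psi_{\gamma'}}\cdot\Psi_\gamma\in\mathcal L^0$ and $\langle\Psi_{\gamma'},\Psi_\gamma\rangle=\delta_{\gamma\gamma'}$; the orthogonal bound projection is $\mathsf P=\sum_\gamma|\Psi_\gamma\rangle\langle\Psi_\gamma|$. Both are independent of the choice of bases. A set $\{\Psi_{\gamma}\}\subset\widetilde{\mathcal E}$ is an orthonormal non-resonance basis if the classes form a basis of $\widetilde{\mathcal E}/\mathcal E$, for every $\gamma$ and $\Psi\in\mathsf E$ one has $\overline\Psi\cdot\Psi_\gamma\in\mathcal L^0$ and $\langle\Psi,\Psi_\gamma\rangle=0$, and there is an orthonormal system $\{c^{(\gamma)}\}\subset\mathbb C^N$ with $\Psi_\gamma-\sum_\alpha c_\alpha^{(\gamma)}\mathbf n^{(\alpha)}\in\mathbb C\mathbf 1\oplus\mathcal L^{\beta-2}$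 for every $\gamma$; the associated orthogonal non-resonance projection is $\sum_\gamma|\Psi_\gamma\rangle\langle\Psi_\gamma|$. Notation $\mathbf n_{\widetilde\gamma}$. Let $\{\Psi_\gamma\}\subset\mathcal E$ be an orthonormal resonance basis and set $c^{(\gamma)}_\alpha=-\langle\mathbf n^{(\alpha)},V\Psi_\gamma\rangle$; then $\{c^{(\gamma)}\}\subset\mathbb C^N$ is an orthonormal system. Take an orthonormal system $\{c^{(\widetilde\gamma)}\}\subset\mathbb C^N$ such that $\{c^{(\gamma)}\}\cup\{c^{(\widetilde\gamma)}\}$ is an orthonormal basis of $\mathbb C^N$, and put $\mathbf n_{\widetilde\gamma}=\sum_{\alpha=1}^Nc_\alpha^{(\widetilde\gamma)}\mathbf n^{(\alpha)}$. *)

theory Defs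
  imports "HOL-Analysis.Analysis" "HOL-Library.Function_Algebras"
begin

section \<open>Complex Hilbert spaces\<close>

class cscale =
  fixes scaleC :: "complex \<Rightarrow> 'a \<Rightarrow> 'a"  (infixr "*\<^sub>C" 75)

instantiation "fun" :: (type, cscale) cscale
begin
definition scaleC_fun :: "complex \<Rightarrow> ('a \<Rightarrow> 'b) \<Rightarrow> 'a \<Rightarrow> 'b"
  where "scaleC_fun c f = (\<lambda>x. c *\<^sub>C f x)"
instance ..
end

text \<open>The inner product is conjugate-linear in its first argument. Completeness is part of
  the class \<open>banach\<close>; positive definiteness follows from \<open>cinner_norm\<close>.\<close>

class complex_hilbert = banach + cscale +
  fixes cinner :: "'a \<Rightarrow> 'a \<Rightarrow> complex"
  assumes scaleC_add_right: "c *\<^sub>C (x + y) = c *\<^sub>C x + c *\<^sub>C y"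
    and scaleC_add_left: "(c + d) *\<^sub>C x = c *\<^sub>C x + d *\<^sub>C x"
    and scaleC_scaleC: "c *\<^sub>C (d *\<^sub>C x) = (c * d) *\<^sub>C x"
    and scaleC_of_real: "complex_of_real r *\<^sub>C x = r *\<^sub>R x"
    and cinner_commute: "cinner x y = cnj (cinner y x)"
    and cinner_add_right: "cinner x (y + z) = cinner x y + cinner x z"
    and cinner_scaleC_right: "cinner x (c *\<^sub>C y) = c * cinner x y"
    and cinner_norm: "cinner x x = complex_of_real ((norm x)\<^sup>2)"

instantiation complex :: complex_hilbert
begin
definition scaleC_complex :: "complex \<Rightarrow> complex \<Rightarrow> complex"
  where "scaleC_complex c x = c * x"
definition cinner_complex :: "complex \<Rightarrow> complex \<Rightarrow> complex"
  where "cinner_complex x y = cnj x * y"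
instance
  by standard
    (auto simp: scaleC_complex_def cinner_complex_def algebra_simps scaleR_conv_of_real
      complex_norm_square[symmetric] simp flip: of_real_power)
end

text \<open>Bounded operators between linear subspaces \<open>S\<close> and \<open>T\<close> of ambient vector spaces, which
  carry the norms \<open>nS\<close> and \<open>nT\<close>. Operators are represented by total functions, of which only
  the values on \<open>S\<close> matter.\<close>

definition bounded_operator ::
  "'x set \<Rightarrow> ('x \<Rightarrow> real) \<Rightarrow> 'y set \<Rightarrow> ('y \<Rightarrow> real) \<Rightarrow> ('x::{plus,cscale} \<Rightarrow> 'y::{plus,cscale}) \<Rightarrow> bool"
  where "bounded_operator S nS T nT A \<longleftrightarrow>
    (\<forall>u\<in>S. A u \<in> T) \<and>
    (\<forall>u\<in>S. \<forall>w\<in>S. A (u + w) = A u + A w) \<and>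
    (\<forall>c. \<forall>u\<in>S. A (c *\<^sub>C u) = c *\<^sub>C A u) \<and>
    (\<exists>C. \<forall>u\<in>S. nT (A u) \<le> C * nS u)"

definition self_adjoint_unitary :: "('k::complex_hilbert \<Rightarrow> 'k) \<Rightarrow> bool"
  where "self_adjoint_unitary U \<longleftrightarrow>
    bounded_operator UNIV norm UNIV norm U \<and>
    (\<forall>x y. cinner (U x) y = cinner x (U y)) \<and>
    (\<forall>x y. cinner (U x) (U y) = cinner x y) \<and> surj U"

definition Ker :: "('k \<Rightarrow> 'k::zero) \<Rightarrow> 'k set"
  where "Ker A = {k. A k = 0}"

definition orth_compl :: "'k::complex_hilbert set \<Rightarrow> 'k set"
  where "orth_compl S = {k. \<forall>s\<in>S. cinner s k = 0}"

definition orth_proj :: "'k::complex_hilbert set \<Rightarrow> 'k \<Rightarrow> 'k"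
  where "orth_proj S k = (THE w. w \<in> S \<and> k - w \<in> orth_compl S)"

definition pseudo_inv :: "('k::complex_hilbert \<Rightarrow> 'k) \<Rightarrow> 'k \<Rightarrow> 'k"
  where "pseudo_inv A k = inv_into (orth_compl (Ker A)) A (k - orth_proj (Ker A) k)"

text \<open>Operator composition, with a priority above that of addition and subtraction.\<close>

abbreviation op_comp :: "('y \<Rightarrow> 'z) \<Rightarrow> ('x \<Rightarrow> 'y) \<Rightarrow> 'x \<Rightarrow> 'z"  (infixl "\<cdot>" 70)
  where "A \<cdot> B \<equiv> A \<circ> B"


section \<open>The graph and function spaces on it\<close>

text \<open>The finite part has vertex type \<open>'a\<close>, and the half-lines are indexed by the finite type
  \<open>'n\<close>, so that the number of half-lines is \<open>CARD('n)\<close>. The half-line vertices are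
  \<open>1, 2, \<dots>\<close>: the constructor term \<open>Ray \<alpha> k\<close> is the vertex with number \<open>Suc k\<close>.\<close>

datatype ('a, 'n) vertex = Core 'a | Ray 'n nat

type_synonym ('a, 'n) gfun = "('a, 'n) vertex \<Rightarrow> complex"
type_synonym ('a, 'n) gop = "('a, 'n) gfun \<Rightarrow> ('a, 'n) gfun"

definition simple_connected_graph :: "'a set set \<Rightarrow> bool"
  where "simple_connected_graph E0 \<longleftrightarrow>
    (\<forall>e\<in>E0. card e = 2) \<and> (\<forall>x y. (x, y) \<in> {(a, b). {a, b} \<in> E0}\<^sup>*)"

fun weight :: "real \<Rightarrow> ('a, 'n) vertex \<Rightarrow> real" where
  "weight s (Core x) = 1"
| "weight s (Ray \<alpha> k) = (1 + (real (Suc k))\<^sup>2) powr (s / 2)"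

definition lone :: "real \<Rightarrow> ('a, 'n) gfun set"
  where "lone s = {u. (\<lambda>x. weight s x * cmod (u x)) summable_on UNIV}"

definition lone_norm :: "real \<Rightarrow> ('a, 'n) gfun \<Rightarrow> real"
  where "lone_norm s u = (\<Sum>\<^sub>\<infinity>x. weight s x * cmod (u x))"

text \<open>The dual of \<open>lone s\<close> is \<open>linf (- s)\<close>.\<close>

definition linf :: "real \<Rightarrow> ('a, 'n) gfun set"
  where "linf s = {u. bdd_above (range (\<lambda>x. weight s x * cmod (u x)))}"

definition linf_norm :: "real \<Rightarrow> ('a, 'n) gfun \<Rightarrow> real"
  where "linf_norm s u = (SUP x. weight s x * cmod (u x))"

definition ltwo :: "('a, 'n) gfun set"
  where "ltwo = {u. (\<lambda>x. (cmod (u x))\<^sup>2) summable_on UNIV}"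

definition ltwo_norm :: "('a, 'n) gfun \<Rightarrow> real"
  where "ltwo_norm u = sqrt (\<Sum>\<^sub>\<infinity>x. (cmod (u x))\<^sup>2)"

definition bracket :: "('a, 'n) gfun \<Rightarrow> ('a, 'n) gfun \<Rightarrow> complex"
  where "bracket u w = (\<Sum>\<^sub>\<infinity>x. cnj (u x) * w x)"

definition ketbra :: "('a, 'n) gfun \<Rightarrow> ('a, 'n) gfun \<Rightarrow> ('a, 'n) gop"
  where "ketbra \<Psi> \<Phi> = (\<lambda>u. bracket \<Phi> u *\<^sub>C \<Psi>)"

fun nvec :: "'n \<Rightarrow> ('a, 'n) gfun" where
  "nvec \<alpha> (Core x) = 0"
| "nvec \<alpha> (Ray \<gamma> k) = (if \<gamma> = \<alpha> then of_nat (Suc k) else 0)"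

fun onevec :: "'n \<Rightarrow> ('a, 'n) gfun" where
  "onevec \<alpha> (Core x) = 0"
| "onevec \<alpha> (Ray \<gamma> k) = (if \<gamma> = \<alpha> then 1 else 0)"

text \<open>The space \<open>\<complex>1 \<oplus> lone s\<close>.\<close>

definition one_plus_lone :: "real \<Rightarrow> ('a, 'n::finite) gfun set"
  where "one_plus_lone s = {u. \<exists>c. u - (\<Sum>\<alpha>\<in>UNIV. c \<alpha> *\<^sub>C onevec \<alpha>) \<in> lone s}"


section \<open>Free operator and free expansion coefficients\<close>

text \<open>The half-line \<open>\<alpha>\<close> is attached to the finite graph at \<open>att \<alpha>\<close>. The free operator is
  decoupled (Dirichlet type), so the connecting edges contribute only the diagonal term of
  \<open>core_op\<close>; with at least one half-line and a connected core, \<open>core_op\<close> is invertible.\<close>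

definition core_op :: "'a::finite set set \<Rightarrow> ('n::finite \<Rightarrow> 'a) \<Rightarrow> ('a \<Rightarrow> complex) \<Rightarrow> 'a \<Rightarrow> complex"
  where "core_op E0 att u x =
    (\<Sum>y | {x, y} \<in> E0. u x - u y) + (\<Sum>\<alpha>\<in>UNIV. (if x = att \<alpha> then 1 else 0) * u x)"

fun free_op :: "'a::finite set set \<Rightarrow> ('n::finite \<Rightarrow> 'a) \<Rightarrow> ('a, 'n) gop" where
  "free_op E0 att u (Core x) = core_op E0 att (\<lambda>y. u (Core y)) x"
| "free_op E0 att u (Ray \<alpha> 0) = 2 * u (Ray \<alpha> 0) - u (Ray \<alpha> 1)"
| "free_op E0 att u (Ray \<alpha> (Suc k)) =
     2 * u (Ray \<alpha> (Suc k)) - u (Ray \<alpha> (Suc (Suc k))) - u (Ray \<alpha> k)"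

definition core_coeff ::
  "'a::finite set set \<Rightarrow> ('n::finite \<Rightarrow> 'a) \<Rightarrow> nat \<Rightarrow> ('a \<Rightarrow> complex) \<Rightarrow> 'a \<Rightarrow> complex"
  where "core_coeff E0 att j =
    (if even j then (- 1) ^ (j div 2) *\<^sub>C (inv (core_op E0 att) ^^ (j div 2 + 1)) else 0)"

text \<open>Kernels of the coefficients of the Dirichlet half-line resolvent at
  \<open>\<kappa>\<^sup>j\<close>; only the orders up to 3 are needed.\<close>

definition ray_kernel :: "nat \<Rightarrow> real \<Rightarrow> real \<Rightarrow> real"
  where "ray_kernel j n m =
    (if j = 0 then min n m
     else if j = 1 then - (n * m)
     else if j = 2 then - (1/6) * min n m + (1/6) * (min n m) ^ 3 + (1/2) * n * m * max n m
     else if j = 3 then (5/24) * n * m - (1/6) * n ^ 3 * m - (1/6) * n * m ^ 3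
     else undefined)"

fun free_coeff :: "'a::finite set set \<Rightarrow> ('n::finite \<Rightarrow> 'a) \<Rightarrow> nat \<Rightarrow> ('a, 'n) gop" where
  "free_coeff E0 att j u (Core x) = core_coeff E0 att j (\<lambda>y. u (Core y)) x"
| "free_coeff E0 att j u (Ray \<alpha> k) =
     (\<Sum>\<^sub>\<infinity>l. complex_of_real (ray_kernel j (real (Suc k)) (real (Suc l))) * u (Ray \<alpha> l))"


section \<open>Perturbation and resolvent\<close>

text \<open>For a bounded \<open>v\<close> from a Hilbert space to \<open>lone s\<close>, the adjoint maps the dual
  \<open>linf (- s)\<close> to the Hilbert space.\<close>

definition adj :: "('k::complex_hilbert \<Rightarrow> ('a, 'n) gfun) \<Rightarrow> ('a, 'n) gfun \<Rightarrow> 'k"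
  where "adj v f = (THE w. \<forall>k. cinner k w = bracket (v k) f)"

definition assumption_A ::
  "real \<Rightarrow> ('a, 'n) gop \<Rightarrow> ('k::complex_hilbert \<Rightarrow> ('a, 'n) gfun) \<Rightarrow> ('k \<Rightarrow> 'k) \<Rightarrow> bool"
  where "assumption_A \<beta> V v U \<longleftrightarrow>
    bounded_operator ltwo ltwo_norm ltwo ltwo_norm V \<and>
    (\<forall>u\<in>ltwo. \<forall>w\<in>ltwo. bracket (V u) w = bracket u (V w)) \<and>
    bounded_operator UNIV norm (lone \<beta>) (lone_norm \<beta>) v \<and> inj v \<and>
    self_adjoint_unitary U \<and>
    (\<forall>u\<in>linf (- \<beta>). V u = v (U (adj v u)))"

definition op_spectrum :: "('a, 'n) gop \<Rightarrow> complex set"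
  where "op_spectrum H = {z. \<not> (\<exists>S. bounded_operator ltwo ltwo_norm ltwo ltwo_norm S \<and>
    (\<forall>u\<in>ltwo. S (H u - z *\<^sub>C u) = u \<and> H (S u) - z *\<^sub>C S u = u))}"

definition resolvent :: "('a, 'n) gop \<Rightarrow> complex \<Rightarrow> ('a, 'n) gop"
  where "resolvent H \<kappa> = inv_into ltwo (\<lambda>w. H w + \<kappa>\<^sup>2 *\<^sub>C w)"

text \<open>\<open>R(\<kappa>) = (\<Sum>j = -2..\<beta>-6. \<kappa>\<^sup>j G j) + O(\<kappa>\<^bsup>\<beta>-5\<^esup>)\<close> in the operator norm from
  \<open>lone (\<beta>-2)\<close> to its dual, as \<open>\<kappa> \<rightarrow> 0\<close> with \<open>Re \<kappa> > 0\<close>.\<close>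

definition resolvent_expansion :: "nat \<Rightarrow> ('a, 'n) gop \<Rightarrow> (int \<Rightarrow> ('a, 'n) gop) \<Rightarrow> bool"
  where "resolvent_expansion \<beta> H G \<longleftrightarrow>
    (let s = real \<beta> - 2 in
      (\<forall>j\<in>{- 2..int \<beta> - 6}. bounded_operator (lone s) (lone_norm s) (linf (- s)) (linf_norm (- s)) (G j)) \<and>
      (\<exists>C. \<forall>\<^sub>F \<kappa> in at 0 within {\<kappa>. Re \<kappa> > 0}.
        - \<kappa>\<^sup>2 \<notin> op_spectrum H \<and>
        (\<forall>u\<in>lone s.
          linf_norm (- s) (resolvent H \<kappa> u - (\<Sum>j = - 2..int \<beta> - 6. \<kappa> powi j *\<^sub>C G j u))
            \<le> C * cmod \<kappa> powi (int \<beta> - 5) * lone_norm s u)))"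


section \<open>Threshold eigenspaces and bases\<close>

definition gen_eigenspace :: "nat \<Rightarrow> ('a, 'n) gop \<Rightarrow> ('a, 'n) gfun set"
  where "gen_eigenspace \<beta> H = {\<Psi> \<in> linf (- real \<beta>). H \<Psi> = 0}"

definition res_eigenspace :: "nat \<Rightarrow> ('a, 'n::finite) gop \<Rightarrow> ('a, 'n) gfun set"
  where "res_eigenspace \<beta> H = gen_eigenspace \<beta> H \<inter> one_plus_lone (real \<beta> - 2)"

definition bound_eigenspace :: "nat \<Rightarrow> ('a, 'n) gop \<Rightarrow> ('a, 'n) gfun set"
  where "bound_eigenspace \<beta> H = gen_eigenspace \<beta> H \<inter> lone (real \<beta> - 2)"

text \<open>The classes of \<open>\<Psi> i\<close>, \<open>i \<in> I\<close>, form a (finite) basis of the quotient \<open>S / T\<close>, where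
  \<open>T \<subseteq> S\<close> are linear subspaces.\<close>

definition quotient_basis ::
  "('a, 'n) gfun set \<Rightarrow> ('a, 'n) gfun set \<Rightarrow> 'i set \<Rightarrow> ('i \<Rightarrow> ('a, 'n) gfun) \<Rightarrow> bool"
  where "quotient_basis S T I \<Psi> \<longleftrightarrow>
    finite I \<and> (\<forall>i\<in>I. \<Psi> i \<in> S) \<and>
    (\<forall>a. (\<Sum>i\<in>I. a i *\<^sub>C \<Psi> i) \<in> T \<longrightarrow> (\<forall>i\<in>I. a i = 0)) \<and>
    (\<forall>\<Phi>\<in>S. \<exists>a. \<Phi> - (\<Sum>i\<in>I. a i *\<^sub>C \<Psi> i) \<in> T)"

definition orthonormal_system :: "'i set \<Rightarrow> ('i \<Rightarrow> 'n::finite \<Rightarrow> complex) \<Rightarrow> bool"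
  where "orthonormal_system I c \<longleftrightarrow>
    (\<forall>i\<in>I. \<forall>j\<in>I. (\<Sum>\<alpha>\<in>UNIV. cnj (c i \<alpha>) * c j \<alpha>) = (if i = j then 1 else 0))"

definition orthonormal_basis :: "'i set \<Rightarrow> ('i \<Rightarrow> 'n::finite \<Rightarrow> complex) \<Rightarrow> bool"
  where "orthonormal_basis I c \<longleftrightarrow>
    finite I \<and> orthonormal_system I c \<and> (\<forall>d. \<exists>a. d = (\<Sum>i\<in>I. a i *\<^sub>C c i))"

definition orthogonal_to :: "('a, 'n) gfun set \<Rightarrow> ('a, 'n) gfun \<Rightarrow> bool"
  where "orthogonal_to S \<Phi> \<longleftrightarrow>
    (\<forall>\<Psi>\<in>S. (\<lambda>x. cnj (\<Psi> x) * \<Phi> x) \<in> lone 0 \<and> bracket \<Psi> \<Phi> = 0)"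

definition bound_basis :: "nat \<Rightarrow> ('a, 'n) gop \<Rightarrow> 'i set \<Rightarrow> ('i \<Rightarrow> ('a, 'n) gfun) \<Rightarrow> bool"
  where "bound_basis \<beta> H I \<Psi> \<longleftrightarrow>
    quotient_basis (bound_eigenspace \<beta> H) {0} I \<Psi> \<and>
    (\<forall>i\<in>I. \<forall>j\<in>I. (\<lambda>x. cnj (\<Psi> i x) * \<Psi> j x) \<in> lone 0 \<and>
      bracket (\<Psi> i) (\<Psi> j) = (if i = j then 1 else 0))"

definition resonance_basis ::
  "nat \<Rightarrow> ('a, 'n::finite) gop \<Rightarrow> 'i set \<Rightarrow> ('i \<Rightarrow> ('a, 'n) gfun) \<Rightarrow> bool"
  where "resonance_basis \<beta> H I \<Psi> \<longleftrightarrow>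
    quotient_basis (res_eigenspace \<beta> H) (bound_eigenspace \<beta> H) I \<Psi> \<and>
    (\<forall>i\<in>I. orthogonal_to (bound_eigenspace \<beta> H) (\<Psi> i)) \<and>
    (\<exists>c. orthonormal_system I c \<and>
      (\<forall>i\<in>I. \<Psi> i - (\<Sum>\<alpha>\<in>UNIV. c i \<alpha> *\<^sub>C onevec \<alpha>) \<in> lone (real \<beta> - 2)))"

definition nonresonance_basis ::
  "nat \<Rightarrow> ('a, 'n::finite) gop \<Rightarrow> 'i set \<Rightarrow> ('i \<Rightarrow> ('a, 'n) gfun) \<Rightarrow> bool"
  where "nonresonance_basis \<beta> H I \<Psi> \<longleftrightarrow>
    quotient_basis (gen_eigenspace \<beta> H) (res_eigenspace \<beta> H) I \<Psi> \<and>
    (\<forall>i\<in>I. orthogonal_to (bound_eigenspace \<beta> H) (\<Psi> i)) \<and>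
    (\<exists>c. orthonormal_system I c \<and>
      (\<forall>i\<in>I. \<Psi> i - (\<Sum>\<alpha>\<in>UNIV. c i \<alpha> *\<^sub>C nvec \<alpha>) \<in> one_plus_lone (real \<beta> - 2)))"

definition basis_projection :: "'i set \<Rightarrow> ('i \<Rightarrow> ('a, 'n) gfun) \<Rightarrow> ('a, 'n) gop"
  where "basis_projection I \<Psi> = (\<Sum>i\<in>I. ketbra (\<Psi> i) (\<Psi> i))"

definition third_kind :: "nat \<Rightarrow> ('a, 'n::finite) gop \<Rightarrow> bool"
  where "third_kind \<beta> H \<longleftrightarrow>
    bound_eigenspace \<beta> H \<subset> res_eigenspace \<beta> H \<and> {0} \<subset> bound_eigenspace \<beta> H"


section \<open>Intermediate operators\<close>

definition M_zero ::
  "'a::finite set set \<Rightarrow> ('n::finite \<Rightarrow> 'a) \<Rightarrow> ('k::complex_hilbert \<Rightarrow> ('a, 'n) gfun) \<Rightarrow> ('k \<Rightarrow> 'k) \<Rightarrow> 'k \<Rightarrow> 'k"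
  where "M_zero E0 att v U = U + adj v \<cdot> free_coeff E0 att 0 \<cdot> v"

definition m_zero ::
  "'a::finite set set \<Rightarrow> ('n::finite \<Rightarrow> 'a) \<Rightarrow> ('k::complex_hilbert \<Rightarrow> ('a, 'n) gfun) \<Rightarrow> ('k \<Rightarrow> 'k) \<Rightarrow> 'k \<Rightarrow> 'k"
  where "m_zero E0 att v U k =
    (let Q = orth_proj (Ker (M_zero E0 att v U)) in
      - (\<Sum>\<alpha>\<in>UNIV. cinner (Q (adj v (nvec \<alpha>))) k *\<^sub>C Q (adj v (nvec \<alpha>))))"

end

(* Put \<kappa> = 2 sinh (\<theta>/2). The decaying solution of the free equation on a half-line is exp (- \<theta> n), and
   pairing w = R(\<kappa>) u - \<kappa>^(-2) P u with it and with the resonance functions gives identities that are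
   exact in \<theta> > 0. Comparing powers of \<kappa> in them shows that every coefficient W of w solves a threshold
   equation W + G_{0,0} V W = (data from the lower orders), satisfies a solvability condition against
   all resonance functions (inherited from the next order) and is orthogonal to the bound states.
   These three conditions determine W, because the map from a resonance function \<Psi> to the vector of
   the \<langle>n^(\<alpha>), V \<Psi>\<rangle> vanishes only on bound states. The right-hand sides of the two formulas satisfy
   the same conditions: M_0^\<dagger> solves the threshold equation, m_0^\<dagger> corrects the solution by a resonance
   function so that the solvability condition holds, and I - P restores orthogonality. *)

theory Submission
  imports Defs "HOL-Real_Asymp.Real_Asymp"
begin

text \<open>The existence of the expansion is a hypothesis, so its coefficients only have to be
  identified; this is why limits along real \<open>kap \<theta>\<close> suffice. A bound state
  \<Phi> satisfies (H + kappa^2)(kappa^(-2) \<Phi>) = \<Phi>, so subtracting kappa^(-2) P u changes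
  the datum u into (I - P) u exactly; the rightmost factor I - P comes from here. The threshold
  equation fixes a coefficient only up to resonance functions, and this freedom is settled by the
  next power of kappa; hence every order is treated together with an identity divided by one more
  kappa. The coefficients may grow at infinity, so summation by parts is possible only against
  decaying functions. Splitting G_{0,0} V \<Psi> into constants and a summable part turns the
  constants into boundary values next to the core. Closed range of M_0 comes from the weights: far
  out \<open>v k\<close> is small in a weaker norm, so finitely many of its values control the
  perturbation of the unitary \<open>U\<close>.\<close>

lemma sum_fun_apply: "(\<Sum>i\<in>I. f i) x = (\<Sum>i\<in>I. f i x)"
  by (induction I rule: infinite_finite_induct) auto

section \<open>Geometry of complex Hilbert spaces: orthogonal projections, Riesz vectors, closed
  range\<close>

section \<open>Complex Hilbert spaces\<close>

lemma scaleC_zero_left [simp]: "0 *\<^sub>C (x::'k::complex_hilbert) = 0"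
  using scaleC_of_real[of 0 x] by simp

lemma scaleC_minus_one: "(-1) *\<^sub>C (x::'k::complex_hilbert) = - x"
  using scaleC_of_real[of "-1" x] by simp

lemma scaleC_zero_right [simp]: "c *\<^sub>C (0::'k::complex_hilbert) = 0"
  by (metis add_cancel_right_right scaleC_add_right)

lemma scaleC_minus_right: "c *\<^sub>C (- x::'k::complex_hilbert) = - (c *\<^sub>C x)"
  by (metis add.right_inverse minus_unique scaleC_add_right scaleC_zero_right)

lemma scaleC_minus_left: "(- c) *\<^sub>C (x::'k::complex_hilbert) = - (c *\<^sub>C x)"
  by (metis add.right_inverse minus_unique scaleC_add_left scaleC_zero_left)

lemma scaleC_diff_right: "c *\<^sub>C (x - y::'k::complex_hilbert) = c *\<^sub>C x - c *\<^sub>C y"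
  using scaleC_add_right[of c x "-y"] by (simp add: scaleC_minus_right)

lemma cinner_add_left: "cinner (x + y) (z::'k::complex_hilbert) = cinner x z + cinner y z"
  by (metis cinner_add_right cinner_commute complex_cnj_add)

lemma cinner_scaleC_left: "cinner (c *\<^sub>C x) (z::'k::complex_hilbert) = cnj c * cinner x z"
  by (metis cinner_commute cinner_scaleC_right complex_cnj_mult)

lemma cinner_zero_right [simp]: "cinner (x::'k::complex_hilbert) 0 = 0"
  by (metis add_cancel_right_right cinner_add_right)

lemma cinner_zero_left [simp]: "cinner (0::'k::complex_hilbert) x = 0"
  by (metis add_cancel_right_right cinner_add_left)

lemma cinner_minus_right: "cinner (x::'k::complex_hilbert) (- y) = - cinner x y"
  by (metis add.right_inverse cinner_add_right cinner_zero_right minus_unique)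

lemma cinner_minus_left: "cinner (- x::'k::complex_hilbert) y = - cinner x y"
  by (metis add.right_inverse cinner_add_left cinner_zero_left minus_unique)

lemma cinner_diff_right: "cinner (x::'k::complex_hilbert) (y - z) = cinner x y - cinner x z"
  using cinner_add_right[of x y "-z"] by (simp add: cinner_minus_right)

lemma cinner_diff_left: "cinner (x - y::'k::complex_hilbert) z = cinner x z - cinner y z"
  using cinner_add_left[of x "-y" z] by (simp add: cinner_minus_left)

lemma cinner_sum_right: "cinner (x::'k::complex_hilbert) (\<Sum>i\<in>I. f i) = (\<Sum>i\<in>I. cinner x (f i))"
  by (induction I rule: infinite_finite_induct) (auto simp: cinner_add_right)

lemma cinner_sum_left: "cinner (\<Sum>i\<in>I. f i) (x::'k::complex_hilbert) = (\<Sum>i\<in>I. cinner (f i) x)"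
  by (induction I rule: infinite_finite_induct) (auto simp: cinner_add_left)

lemma cinner_eq_zero_iff [simp]: "cinner x x = 0 \<longleftrightarrow> (x::'k::complex_hilbert) = 0"
  by (simp add: cinner_norm)

lemmas cinner_simps = cinner_add_left cinner_add_right cinner_diff_left cinner_diff_right
  cinner_minus_left cinner_minus_right cinner_scaleC_left cinner_scaleC_right

lemma cinner_eqI: "(\<And>k. cinner k x = cinner k y) \<Longrightarrow> x = (y::'k::complex_hilbert)"
  by (metis cinner_diff_right cinner_eq_zero_iff eq_iff_diff_eq_0)

text \<open>Pythagoras for the component of \<open>x\<close> along \<open>y\<close>. Non-negativity
  of the left side is the Cauchy-Schwarz inequality; the strict decrease for non-orthogonal vectors
  forces orthogonality at a nearest point.\<close>

lemma norm_diff_component: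
  fixes x y :: "'k::complex_hilbert"
  assumes "y \<noteq> 0"
  shows "(norm (x - (cinner y x / complex_of_real ((norm y)\<^sup>2)) *\<^sub>C y))\<^sup>2
    = (norm x)\<^sup>2 - (cmod (cinner y x))\<^sup>2 / (norm y)\<^sup>2"
proof -
  define n where "n = complex_of_real ((norm y)\<^sup>2)"
  define t where "t = cinner y x / n"
  have n0: "n \<noteq> 0" and nc: "cnj n = n" using assms by (auto simp: n_def)
  have tn: "t * n = cinner y x" using n0 by (simp add: t_def)
  have "complex_of_real ((norm (x - t *\<^sub>C y))\<^sup>2) = cinner (x - t *\<^sub>C y) (x - t *\<^sub>C y)"
    by (simp add: cinner_norm)
  also have "\<dots> = cinner x x - t * cnj (cinner y x) - cnj t * cinner y x + cnj t * (t * cinner y y)"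
    using cinner_commute[of x y] by (simp add: cinner_simps algebra_simps)
  also have "\<dots> = cinner x x - t * cnj (cinner y x)"
    using tn by (simp add: n_def cinner_norm)
  also have "\<dots> = complex_of_real ((norm x)\<^sup>2 - (cmod (cinner y x))\<^sup>2 / (norm y)\<^sup>2)"
    unfolding cinner_norm t_def n_def of_real_diff of_real_divide complex_norm_square by simp
  finally show ?thesis unfolding t_def n_def using of_real_eq_iff by blast
qed

lemma cinner_cauchy_schwarz: "cmod (cinner (x::'k::complex_hilbert) y) \<le> norm x * norm y"
proof (cases "x = 0")
  case False
  have "0 \<le> (norm y)\<^sup>2 - (cmod (cinner x y))\<^sup>2 / (norm x)\<^sup>2"
    unfolding norm_diff_component[OF False, symmetric] by simp
  then have "(cmod (cinner x y))\<^sup>2 \<le> (norm x * norm y)\<^sup>2"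
    using False by (simp add: field_simps power_mult_distrib)
  then show ?thesis
    by (rule power2_le_imp_le) simp
qed simp

lemma bounded_linear_cinner: "bounded_linear (cinner (x::'k::complex_hilbert))"
proof (rule bounded_linear_intro)
  show "cinner x (y + z) = cinner x y + cinner x z" for y z by (rule cinner_add_right)
  show "cinner x (r *\<^sub>R y) = r *\<^sub>R cinner x y" for r y
    using cinner_scaleC_right[of x "complex_of_real r" y] by (simp add: scaleC_of_real scaleR_conv_of_real)
  show "norm (cinner x y) \<le> norm y * norm x" for y
    using cinner_cauchy_schwarz[of x y] by (simp add: mult.commute)
qed

definition closed_csubspace :: "'k::complex_hilbert set \<Rightarrow> bool"
  where "closed_csubspace S \<longleftrightarrow> closed S \<and> 0 \<in> S \<and> (\<forall>x\<in>S. \<forall>y\<in>S. x + y \<in> S) \<and> (\<forall>c. \<forall>x\<in>S. c *\<^sub>C x \<in> S)"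

lemma closed_csubspace_minus: "closed_csubspace S \<Longrightarrow> x \<in> S \<Longrightarrow> - x \<in> S"
  using scaleC_minus_one[of x] unfolding closed_csubspace_def by metis

lemma closed_csubspace_diff: "closed_csubspace S \<Longrightarrow> x \<in> S \<Longrightarrow> y \<in> S \<Longrightarrow> x - y \<in> S"
  using closed_csubspace_minus[of S y] unfolding closed_csubspace_def by (metis diff_conv_add_uminus)

lemma closed_csubspace_sum:
  "closed_csubspace S \<Longrightarrow> (\<And>i. i \<in> I \<Longrightarrow> f i \<in> S) \<Longrightarrow> (\<Sum>i\<in>I. f i) \<in> S"
  by (induction I rule: infinite_finite_induct) (auto simp: closed_csubspace_def)

lemma closed_csubspace_Int: "closed_csubspace S \<Longrightarrow> closed_csubspace T \<Longrightarrow> closed_csubspace (S \<inter> T)"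
  by (auto simp: closed_csubspace_def)

lemma closed_csubspace_orth_compl: "closed_csubspace (orth_compl S)"
proof -
  have "orth_compl S = (\<Inter>s\<in>S. cinner s -` {0})"
    by (auto simp: orth_compl_def)
  then have "closed (orth_compl S)"
    using bounded_linear_cinner
    by (auto intro!: closed_INT closed_vimage linear_continuous_on[THEN continuous_on_subset] simp: linear_continuous_on)
  then show ?thesis
    by (auto simp: closed_csubspace_def orth_compl_def cinner_simps)
qed

text \<open>A minimizing sequence for the distance is Cauchy by the parallelogram law, since the
  midpoint of two members stays in \<open>S\<close> and is no closer than the infimum. Completeness
  supplies the nearest point, and minimality makes the residue orthogonal.\<close>

theorem closed_csubspace_decomposition:
  fixes x :: "'k::complex_hilbert"
  assumes S: "closed_csubspace S"
  shows "\<exists>w\<in>S. x - w \<in> orth_compl S"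
proof -
  define d where "d = (INF s\<in>S. (norm (x - s))\<^sup>2)"
  have ne: "S \<noteq> {}" using S by (auto simp: closed_csubspace_def)
  have bb: "bdd_below ((\<lambda>s. (norm (x - s))\<^sup>2) ` S)" by (rule bdd_belowI2[where m=0]) simp
  have dle: "d \<le> (norm (x - s))\<^sup>2" if "s \<in> S" for s
    unfolding d_def by (rule cINF_lower[OF bb that])
  have "\<exists>s\<in>S. (norm (x - s))\<^sup>2 < d + 1 / (real n + 1)" for n :: nat
  proof -
    have "d < d + 1 / (real n + 1)" by simp
    then show ?thesis unfolding d_def using cINF_less_iff[OF ne bb] by (metis d_def)
  qed
  then obtain s where s: "\<And>n. s n \<in> S" "\<And>n::nat. (norm (x - s n))\<^sup>2 < d + 1 / (real n + 1)"
    by metis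
  have para: "(norm (a - b))\<^sup>2 = 2 * (norm a)\<^sup>2 + 2 * (norm b)\<^sup>2 - (norm (a + b))\<^sup>2" for a b :: 'k
  proof -
    have "complex_of_real ((norm (a - b))\<^sup>2) = complex_of_real (2 * (norm a)\<^sup>2 + 2 * (norm b)\<^sup>2 - (norm (a + b))\<^sup>2)"
      unfolding of_real_add of_real_mult of_real_diff cinner_norm[symmetric] by (simp add: cinner_simps)
    then show ?thesis using of_real_eq_iff by blast
  qed
  have est: "(norm (s m - s n))\<^sup>2 \<le> 2 / (real m + 1) + 2 / (real n + 1)" for m n
  proof -
    let ?h = "(1/2) *\<^sub>R (s m + s n)"
    have "?h = complex_of_real (1/2) *\<^sub>C (s m + s n)" by (rule scaleC_of_real[symmetric])
    then have "?h \<in> S" using S s(1) by (auto simp: closed_csubspace_def)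
    then have h: "4 * d \<le> 4 * (norm (x - ?h))\<^sup>2" using dle by simp
    have "(x - s m) + (x - s n) = 2 *\<^sub>R (x - ?h)" by (simp add: algebra_simps scaleR_2)
    then have "(norm ((x - s m) + (x - s n)))\<^sup>2 = 4 * (norm (x - ?h))\<^sup>2"
      by (simp add: power_mult_distrib)
    moreover have "(norm (s m - s n))\<^sup>2 = (norm ((x - s m) - (x - s n)))\<^sup>2"
      by (simp add: norm_minus_commute)
    ultimately have "(norm (s m - s n))\<^sup>2
        = 2 * (norm (x - s m))\<^sup>2 + 2 * (norm (x - s n))\<^sup>2 - 4 * (norm (x - ?h))\<^sup>2"
      using para[of "x - s m" "x - s n"] by simp
    then show ?thesis using s(2)[of m] s(2)[of n] h by simp
  qed
  have "Cauchy s"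
  proof (rule CauchyI)
    fix e :: real assume "0 < e"
    obtain N :: nat where N: "4 / e\<^sup>2 < real N" using reals_Archimedean2 by blast
    have "norm (s m - s n) < e" if "m \<ge> N" "n \<ge> N" for m n
    proof -
      have "2 / (real m + 1) \<le> 2 / (real N + 1)" "2 / (real n + 1) \<le> 2 / (real N + 1)"
        using that by (auto intro!: divide_left_mono)
      then have "(norm (s m - s n))\<^sup>2 \<le> 4 / (real N + 1)" using est[of m n] by simp
      also have "\<dots> < e\<^sup>2" using N \<open>0 < e\<close> by (simp add: field_simps add_strict_increasing)
      finally show ?thesis using \<open>0 < e\<close> by (simp add: power2_less_imp_less)
    qed
    then show "\<exists>M. \<forall>m\<ge>M. \<forall>n\<ge>M. norm (s m - s n) < e" by blast
  qed
  then obtain w where w: "s \<longlonglongrightarrow> w" using Cauchy_convergent convergent_def by blast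
  have wS: "w \<in> S" using w s(1) S closed_sequentially by (auto simp: closed_csubspace_def)
  have "(\<lambda>n. (norm (x - s n))\<^sup>2) \<longlonglongrightarrow> (norm (x - w))\<^sup>2" by (intro tendsto_intros w)
  moreover have "(\<lambda>n. d + 1 / (real n + 1)) \<longlonglongrightarrow> d + 0"
    by (intro tendsto_add tendsto_const)
       (use LIMSEQ_inverse_real_of_nat in \<open>simp add: inverse_eq_divide add.commute\<close>)
  ultimately have wd: "(norm (x - w))\<^sup>2 \<le> d"
    using s(2) by (intro LIMSEQ_le) (auto intro: less_imp_le)
  have "cinner y (x - w) = 0" if y: "y \<in> S" for y
  proof (cases "y = 0")
    case False
    \<comment> \<open>The best multiple of \<open>y\<close>: moving from \<open>w\<close> in this
      direction lowers the squared distance by the subtracted term of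
      \<open>norm_diff_component\<close>, which minimality of \<open>w\<close> forces to
      vanish.\<close>
    let ?t = "cinner y (x - w) / complex_of_real ((norm y)\<^sup>2)"
    have "w + ?t *\<^sub>C y \<in> S" using S wS y by (auto simp: closed_csubspace_def)
    from dle[OF this] have "d \<le> (norm (x - w - ?t *\<^sub>C y))\<^sup>2" by (simp add: algebra_simps)
    then have "(cmod (cinner y (x - w)))\<^sup>2 / (norm y)\<^sup>2 \<le> 0"
      unfolding norm_diff_component[OF False] using wd by simp
    then show ?thesis using False by (simp add: divide_le_0_iff)
  qed simp
  then show ?thesis using wS by (auto simp: orth_compl_def)
qed

lemma orth_compl_disjoint: "x \<in> S \<Longrightarrow> x \<in> orth_compl S \<Longrightarrow> (x::'k::complex_hilbert) = 0"
  by (auto simp: orth_compl_def)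

lemma orth_proj_eqI:
  assumes S: "closed_csubspace S" and "w \<in> S" "x - w \<in> orth_compl S"
  shows "orth_proj S x = w"
  unfolding orth_proj_def
proof (rule the_equality)
  fix z assume z: "z \<in> S \<and> x - z \<in> orth_compl S"
  have "z - w \<in> S" using closed_csubspace_diff[OF S] assms z by auto
  moreover have "z - w \<in> orth_compl S"
    using closed_csubspace_diff[OF closed_csubspace_orth_compl assms(3), of "x - z"] z by simp
  ultimately show "z = w" using orth_compl_disjoint by fastforce
qed (use assms in auto)

lemma
  assumes S: "closed_csubspace S"
  shows orth_proj_in: "orth_proj S x \<in> S"
    and orth_proj_compl: "x - orth_proj S x \<in> orth_compl S"
  using closed_csubspace_decomposition[OF S, of x] orth_proj_eqI[OF S] by fastforce+

text \<open>The functional is conjugate-linear, so the representing vector occupies the second slot;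
  this is the shape of \<open>k \<mapsto> bracket (v k) f\<close>, from which \<open>adj\<close> is
  built. A rescaled normal vector to the kernel represents it.\<close>

lemma riesz_representation:
  fixes \<phi> :: "'k::complex_hilbert \<Rightarrow> complex"
  assumes add: "\<And>x y. \<phi> (x + y) = \<phi> x + \<phi> y"
    and scale: "\<And>c x. \<phi> (c *\<^sub>C x) = cnj c * \<phi> x"
    and bound: "\<And>x. cmod (\<phi> x) \<le> C * norm x"
  shows "\<exists>w. \<forall>x. cinner x w = \<phi> x"
proof (cases "\<forall>x. \<phi> x = 0")
  case True
  then show ?thesis by (intro exI[of _ 0]) simp
next
  case False
  then obtain x0 where x0: "\<phi> x0 \<noteq> 0" by blast
  have "bounded_linear \<phi>"
    by (rule bounded_linear_intro[where K=C])
       (use bound in \<open>auto simp: add scale scaleR_conv_of_real mult.commute simp flip: scaleC_of_real\<close>)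
  then have "closed (\<phi> -` {0})"
    by (auto intro!: closed_vimage simp: linear_continuous_on)
  moreover have "\<phi> 0 = 0" using scale[of 0 0] by simp
  ultimately have N: "closed_csubspace (\<phi> -` {0})"
    by (auto simp: closed_csubspace_def add scale)
  have min: "\<phi> (x - y) = \<phi> x - \<phi> y" for x y
    using add[of x "-y"] scale[of "-1" y] by (simp add: scaleC_minus_one)
  from closed_csubspace_decomposition[OF N, of x0] obtain n where
    n: "\<phi> n = 0" "x0 - n \<in> orth_compl (\<phi> -` {0})" by auto
  define z where "z = x0 - n"
  have pz: "\<phi> z \<noteq> 0" using x0 n(1) by (simp add: z_def min)
  then have z0: "z \<noteq> 0" using \<open>\<phi> 0 = 0\<close> by auto
  have "cinner x ((\<phi> z / complex_of_real ((norm z)\<^sup>2)) *\<^sub>C z) = \<phi> x" for x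
  proof -
    have "\<phi> (x - cnj (\<phi> x / \<phi> z) *\<^sub>C z) = 0" using pz by (simp add: min scale)
    then have "cinner (x - cnj (\<phi> x / \<phi> z) *\<^sub>C z) z = 0" using n(2) by (auto simp: orth_compl_def z_def)
    then have "cinner x z = \<phi> x / \<phi> z * complex_of_real ((norm z)\<^sup>2)"
      by (simp add: cinner_simps cinner_norm)
    then show ?thesis using pz z0 by (simp add: cinner_scaleC_right)
  qed
  then show ?thesis by blast
qed

text \<open>Extraction is repeated for one member of the family at a time; limits obtained earlier
  survive the passage to further subsequences.\<close>

lemma bounded_families_subsequence:
  fixes f :: "'p \<Rightarrow> nat \<Rightarrow> complex"
  assumes "finite P" "\<And>p. p \<in> P \<Longrightarrow> bounded (range (f p))"
  shows "\<exists>r::nat \<Rightarrow> nat. strict_mono r \<and> (\<forall>p\<in>P. convergent (f p \<circ> r))"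
  using assms
proof (induction P)
  case empty
  then show ?case by (auto intro: strict_mono_id)
next
  case (insert p P)
  have "\<exists>r::nat \<Rightarrow> nat. strict_mono r \<and> (\<forall>p\<in>P. convergent (f p \<circ> r))"
    using insert.prems by (intro insert.IH) auto
  then obtain r :: "nat \<Rightarrow> nat" where r: "strict_mono r" "\<forall>p\<in>P. convergent (f p \<circ> r)" by blast
  have "bounded (range (f p \<circ> r))" using insert.prems[of p] by (auto intro: bounded_subset)
  then obtain l q where q: "strict_mono (q::nat\<Rightarrow>nat)" "((f p \<circ> r) \<circ> q) \<longlonglongrightarrow> l"
    using bounded_imp_convergent_subsequence by blast
  have "convergent (f p' \<circ> (r \<circ> q))" if "p' \<in> insert p P" for p'
    using that q r convergent_subseq_convergent[of "f p' \<circ> r" q]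
    by (auto simp: o_assoc convergent_def)
  then show ?case using strict_mono_o[OF r(1) q(1)] by blast
qed

text \<open>The a priori estimate says that \<open>A\<close> is bounded below on a subspace of finite codimension;
  this replaces compactness of the perturbation of a unitary operator.\<close>

lemma self_adjoint_range:
  fixes A :: "'k::complex_hilbert \<Rightarrow> 'k" and l :: "'p \<Rightarrow> 'k \<Rightarrow> complex"
  assumes lin: "bounded_linear A" and scale: "\<And>c x. A (c *\<^sub>C x) = c *\<^sub>C A x"
    and sa: "\<And>x y. cinner (A x) y = cinner x (A y)"
    and P: "finite P"
    and ladd: "\<And>p x y. p \<in> P \<Longrightarrow> l p (x - y) = l p x - l p y"
    and lbd: "\<And>p x. p \<in> P \<Longrightarrow> cmod (l p x) \<le> B * norm x"
    and est: "\<And>x. norm x \<le> C * (norm (A x) + (\<Sum>p\<in>P. cmod (l p x)))"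
    and y: "y \<in> orth_compl (Ker A)"
  shows "\<exists>x\<in>orth_compl (Ker A). A x = y"
proof -
  interpret A: bounded_linear A by (rule lin)
  have Asub: "A x - A y = A (x - y)" for x y by (simp add: A.diff)
  have cont: "(\<lambda>n. A (s n)) \<longlonglongrightarrow> A a" if "s \<longlonglongrightarrow> a" for s a
    using that by (rule A.tendsto)
  have "closed (A -` {0})" using lin by (auto intro!: closed_vimage simp: linear_continuous_on)
  moreover have "Ker A = A -` {0}" by (auto simp: Ker_def)
  ultimately have K: "closed_csubspace (Ker A)"
    by (auto simp: closed_csubspace_def Ker_def A.add scale)
  note Ko = closed_csubspace_orth_compl[of "Ker A"]
  have Kcl: "a \<in> orth_compl (Ker A)" if "s \<longlonglongrightarrow> a" "\<And>n. s n \<in> orth_compl (Ker A)" for s a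
    using that Ko closed_sequentially unfolding closed_csubspace_def by blast
  \<comment> \<open>The a priori estimate applied to differences: convergence of the images and of
    finitely many functional values controls the sequence itself.\<close>
  have cauchy: "Cauchy s" if s1: "\<And>n. norm (s n) \<le> 1" and s2: "convergent (\<lambda>n. A (s n))"
    and s3: "\<And>p. p \<in> P \<Longrightarrow> convergent (\<lambda>n. l p (s n))" for s :: "nat \<Rightarrow> 'k"
  proof (rule CauchyI)
    fix e :: real assume e: "0 < e"
    define D where "D = (\<bar>C\<bar> + 1) * (1 + real (card P))"
    have D: "D > 0" by (simp add: D_def add_pos_nonneg)
    let ?e = "e / D"
    have e': "?e > 0" using e D by simp
    from CauchyD[OF convergent_Cauchy[OF s2] e'] obtain M0 where
      M0: "\<And>m n. m \<ge> M0 \<Longrightarrow> n \<ge> M0 \<Longrightarrow> norm (A (s m) - A (s n)) < ?e" by blast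
    have "\<exists>M. \<forall>m\<ge>M. \<forall>n\<ge>M. cmod (l p (s m) - l p (s n)) < ?e" if "p \<in> P" for p
      using CauchyD[OF convergent_Cauchy[OF s3[OF that]] e'] by blast
    then obtain M where M: "\<And>p m n. p \<in> P \<Longrightarrow> m \<ge> M p \<Longrightarrow> n \<ge> M p \<Longrightarrow> cmod (l p (s m) - l p (s n)) < ?e"
      by metis
    define N where "N = Max (insert M0 (M ` P))"
    have N: "N \<ge> M0" "\<And>p. p \<in> P \<Longrightarrow> N \<ge> M p" using P by (auto simp: N_def)
    have "norm (s m - s n) < e" if mn: "m \<ge> N" "n \<ge> N" for m n
    proof -
      have a: "norm (A (s m - s n)) < ?e" unfolding A.diff using M0 N mn by auto
      have "(\<Sum>p\<in>P. cmod (l p (s m - s n))) \<le> (\<Sum>p\<in>P. ?e)"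
      proof (rule sum_mono)
        fix p assume p: "p \<in> P"
        have "m \<ge> M p" "n \<ge> M p" using N(2)[OF p] mn by auto
        then show "cmod (l p (s m - s n)) \<le> ?e" using M[OF p, of m n] by (simp add: ladd[OF p])
      qed
      then have b: "norm (A (s m - s n)) + (\<Sum>p\<in>P. cmod (l p (s m - s n))) < ?e * (1 + real (card P))"
        using a by (simp add: algebra_simps)
      let ?S = "norm (A (s m - s n)) + (\<Sum>p\<in>P. cmod (l p (s m - s n)))"
      have S0: "0 \<le> ?S" by (intro add_nonneg_nonneg sum_nonneg) auto
      have "norm (s m - s n) \<le> C * ?S" by (rule est)
      also have "\<dots> \<le> (\<bar>C\<bar> + 1) * ?S" using S0 by (intro mult_right_mono) auto
      also have "\<dots> < (\<bar>C\<bar> + 1) * (?e * (1 + real (card P)))" using b by (intro mult_strict_left_mono) auto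
      also have "\<dots> = e" using D by (simp add: D_def)
      finally show ?thesis .
    qed
    then show "\<exists>M. \<forall>m\<ge>M. \<forall>n\<ge>M. norm (s m - s n) < e" by blast
  qed
  \<comment> \<open>Otherwise unit vectors in the complement with images tending to 0 would have a
    subsequence converging to a unit vector that lies both in \<open>Ker A\<close> and in its
    complement.\<close>
  have "\<exists>c>0. \<forall>x\<in>orth_compl (Ker A). norm x \<le> c * norm (A x)"
  proof (rule ccontr)
    assume "\<not> ?thesis"
    then have H: "\<exists>x\<in>orth_compl (Ker A). norm x > c * norm (A x)" if "c > 0" for c
      using that by (auto simp: not_le)
    have "\<exists>x\<in>orth_compl (Ker A). norm x = 1 \<and> norm (A x) \<le> inverse (real (Suc n))" for n :: nat
    proof -
      obtain x where x: "x \<in> orth_compl (Ker A)" "norm x > real (Suc n) * norm (A x)"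
        using H[of "real (Suc n)"] by auto
      have nx: "norm x > 0"
      proof -
        have "0 \<le> real (Suc n) * norm (A x)" by simp
        then show ?thesis using x(2) by linarith
      qed
      define z where "z = inverse (norm x) *\<^sub>R x"
      have "z \<in> orth_compl (Ker A)"
        using Ko x(1) unfolding z_def closed_csubspace_def by (metis scaleC_of_real)
      moreover have "norm z = 1" using nx by (simp add: z_def)
      moreover have "norm (A z) = norm (A x) / norm x" by (simp add: z_def A.scaleR divide_inverse mult.commute)
      moreover have "norm (A x) / norm x \<le> inverse (real (Suc n))"
        using x(2) nx by (simp add: field_simps)
      ultimately show ?thesis by metis
    qed
    then obtain s where s: "\<And>n. s n \<in> orth_compl (Ker A)" "\<And>n. norm (s n) = 1"
      "\<And>n. norm (A (s n)) \<le> inverse (real (Suc n))" by metis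
    have A0: "(\<lambda>n. A (s n)) \<longlonglongrightarrow> 0"
      by (rule Lim_null_comparison[OF _ LIMSEQ_inverse_real_of_nat]) (use s(3) in auto)
    have bdd: "bounded (range (\<lambda>n. l p (s n)))" if "p \<in> P" for p
    proof (rule boundedI[where B=B])
      fix z assume "z \<in> range (\<lambda>n. l p (s n))"
      then obtain n where "z = l p (s n)" by blast
      then show "cmod z \<le> B" using lbd[OF that, of "s n"] s(2)[of n] by simp
    qed
    have "\<exists>r::nat \<Rightarrow> nat. strict_mono r \<and> (\<forall>p\<in>P. convergent ((\<lambda>n. l p (s n)) \<circ> r))"
      by (rule bounded_families_subsequence[OF P bdd])
    then obtain r :: "nat \<Rightarrow> nat" where
      r: "strict_mono r" "\<And>p. p \<in> P \<Longrightarrow> convergent (\<lambda>n. l p (s (r n)))" unfolding o_def by blast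
    have A0': "(\<lambda>n. A (s (r n))) \<longlonglongrightarrow> 0" using LIMSEQ_subseq_LIMSEQ[OF A0 r(1)] by (simp add: o_def)
    have "Cauchy (\<lambda>n. s (r n))"
      by (rule cauchy) (use s r A0' in \<open>auto intro: convergentI\<close>)
    then obtain a where a: "(\<lambda>n. s (r n)) \<longlonglongrightarrow> a" using Cauchy_convergent convergent_def by blast
    have "A a = 0" using cont[OF a] A0' LIMSEQ_unique by blast
    then have "a \<in> Ker A" by (simp add: Ker_def)
    moreover have "a \<in> orth_compl (Ker A)" using Kcl[OF a] s by auto
    ultimately have "a = 0" by (rule orth_compl_disjoint)
    moreover have "norm a = 1"
      using LIMSEQ_unique[OF tendsto_norm[OF a], of 1] by (simp add: s(2))
    ultimately show False by simp
  qed
  then obtain c where c: "c > 0" "\<And>x. x \<in> orth_compl (Ker A) \<Longrightarrow> norm x \<le> c * norm (A x)" by blast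
  have pre: "\<exists>x\<in>orth_compl (Ker A). A x = A z" for z
  proof (rule bexI)
    show "z - orth_proj (Ker A) z \<in> orth_compl (Ker A)" by (rule orth_proj_compl[OF K])
    have "A (orth_proj (Ker A) z) = 0" using orth_proj_in[OF K, of z] by (simp add: Ker_def)
    then show "A (z - orth_proj (Ker A) z) = A z" by (simp add: A.diff)
  qed
  have "closed (range A)"
  proof (subst closed_sequential_limits, intro allI impI)
    fix t b assume t: "(\<forall>n. t n \<in> range A) \<and> t \<longlonglongrightarrow> b"
    have "\<exists>x\<in>orth_compl (Ker A). A x = t n" for n
    proof -
      have "t n \<in> range A" using t by blast
      then obtain z where "t n = A z" by blast
      then show ?thesis using pre[of z] by simp
    qed
    then obtain x where x: "\<And>n. x n \<in> orth_compl (Ker A)" "\<And>n. A (x n) = t n" by metis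
    have "Cauchy x"
    proof (rule CauchyI)
      fix e :: real assume "0 < e"
      then obtain M where M: "\<And>m n. m \<ge> M \<Longrightarrow> n \<ge> M \<Longrightarrow> norm (t m - t n) < e / c"
        using CauchyD[OF LIMSEQ_imp_Cauchy, of t b "e / c"] t c(1) by auto
      have "norm (x m - x n) < e" if "m \<ge> M" "n \<ge> M" for m n
      proof -
        have "norm (x m - x n) \<le> c * norm (A (x m - x n))"
          by (rule c(2)) (intro closed_csubspace_diff[OF Ko] x)
        also have "\<dots> < c * (e / c)" unfolding A.diff x using M[OF that] c(1) by (intro mult_strict_left_mono)
        finally show ?thesis using c(1) by simp
      qed
      then show "\<exists>M. \<forall>m\<ge>M. \<forall>n\<ge>M. norm (x m - x n) < e" by blast
    qed
    then obtain a where a: "x \<longlonglongrightarrow> a" using Cauchy_convergent convergent_def by blast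
    have "(\<lambda>n. A (x n)) \<longlonglongrightarrow> A a" using cont[OF a] .
    then have "A a = b" using t x(2) LIMSEQ_unique by auto
    then show "b \<in> range A" by blast
  qed
  moreover have "0 \<in> range A" using rangeI[of A 0] by (simp add: A.zero)
  moreover have "A x + A z \<in> range A" for x z using rangeI[of A "x + z"] by (simp add: A.add)
  moreover have "c *\<^sub>C A x \<in> range A" for c x using rangeI[of A "c *\<^sub>C x"] by (simp add: scale)
  ultimately have R: "closed_csubspace (range A)" by (auto simp: closed_csubspace_def)
  \<comment> \<open>Closedness of the range splits \<open>y\<close> into an image and a part
    orthogonal to the range. By symmetry the latter lies in \<open>Ker A\<close>, hence is
    orthogonal to \<open>y\<close> and to the image, so it is 0.\<close>
  from closed_csubspace_decomposition[OF R, of y] obtain z where z: "y - A z \<in> orth_compl (range A)" by auto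
  have "cinner (A x) (y - A z) = 0" for x using z by (auto simp: orth_compl_def)
  then have "cinner x (A (y - A z)) = 0" for x by (simp add: sa)
  from this[of "A (y - A z)"] have "A (y - A z) = 0" by simp
  then have k: "y - A z \<in> Ker A" by (simp add: Ker_def)
  then have "cinner (y - A z) y = 0" using y by (auto simp: orth_compl_def)
  moreover have "cinner (y - A z) (A z) = 0" using k by (simp flip: sa add: Ker_def)
  ultimately have "cinner (y - A z) (y - A z) = 0" by (simp add: cinner_diff_right)
  then have "y = A z" by simp
  then show ?thesis using pre by auto
qed


section \<open>Weighted \<open>l^1\<close>, \<open>l^2\<close> and \<open>l^infinity\<close> spaces
  and their inclusions\<close>

section \<open>Weighted spaces on the graph\<close>

lemma scaleC_fun_apply [simp]: "(c *\<^sub>C (f::'x \<Rightarrow> complex)) x = c * f x"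
  by (simp add: scaleC_fun_def scaleC_complex_def)

text \<open>The common base of the weights: \<open>weight s\<close> is its power with exponent
  \<open>s\<close>, which reduces weight arithmetic to that of \<open>powr\<close>.\<close>

fun vweight :: "('a, 'n) vertex \<Rightarrow> real" where
  "vweight (Core x) = 1"
| "vweight (Ray \<alpha> k) = sqrt (1 + (real (Suc k))\<^sup>2)"

lemma weight_eq: "weight s x = vweight x powr s"
proof (cases x)
  case (Ray \<alpha> k)
  have "sqrt (1 + (real (Suc k))\<^sup>2) = (1 + (real (Suc k))\<^sup>2) powr (1/2)"
    by (subst powr_half_sqrt) auto
  then show ?thesis using Ray by (simp add: powr_powr)
qed simp

lemma vweight_ge_1: "1 \<le> vweight x"
  by (cases x) auto

lemma vweight_ge: "real (Suc k) \<le> vweight (Ray \<alpha> k)"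
  unfolding vweight.simps by (rule real_le_rsqrt) simp

lemma vweight_pos: "0 < vweight x"
  using vweight_ge_1[of x] by linarith

lemma weight_pos: "0 < weight s x"
  using vweight_ge_1[of x] by (simp add: weight_eq)

lemma weight_nonneg [simp]: "0 \<le> weight s x"
  using weight_pos[of s x] by linarith

lemma weight_add: "weight (s + t) x = weight s x * weight t x"
  by (simp add: weight_eq powr_add)

lemma weight_0 [simp]: "weight 0 x = 1"
  using vweight_ge_1[of x] by (simp add: weight_eq)

lemma weight_mono: "s \<le> t \<Longrightarrow> weight s x \<le> weight t x"
  using vweight_ge_1[of x] by (auto simp: weight_eq intro: powr_mono)

lemma weight_minus: "weight (- s) x = 1 / weight s x"
  by (simp add: weight_eq powr_minus_divide)

lemma weight_of_nat: "weight (real n) x = vweight x ^ n"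
  using vweight_ge_1[of x] by (simp add: weight_eq powr_realpow)

lemma weight_ge_power: "real (Suc k) ^ n \<le> weight (real n) (Ray \<alpha> k)"
  unfolding weight_of_nat by (rule power_mono[OF vweight_ge]) simp

text \<open>The factor \<open>weight (s - t)\<close> measures how much decay of \<open>f\<close> may
  be spent: \<open>s = t\<close> gives scaling and negation, \<open>t \<le> s\<close> the
  inclusions.\<close>

lemma lone_comparison:
  assumes "f \<in> lone s" "\<And>x. cmod (g x) \<le> C * (weight (s - t) x * cmod (f x))"
  shows "g \<in> lone t"
proof -
  have "(\<lambda>x. C * (weight s x * cmod (f x))) summable_on UNIV"
    using assms(1) by (auto simp: lone_def intro: summable_on_cmult_right)
  then have "(\<lambda>x. weight t x * cmod (g x)) summable_on UNIV"
  proof (rule summable_on_comparison_test)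
    fix x
    have "weight t x * cmod (g x) \<le> weight t x * (C * (weight (s - t) x * cmod (f x)))"
      by (intro mult_left_mono assms(2)) simp
    also have "\<dots> = C * (weight s x * cmod (f x))"
      using weight_add[of t "s - t" x] by simp
    finally show "weight t x * cmod (g x) \<le> C * (weight s x * cmod (f x))" .
  qed simp
  then show ?thesis by (simp add: lone_def)
qed

lemma lone_mono:
  fixes f :: "('a, 'n) gfun"
  shows "f \<in> lone s \<Longrightarrow> t \<le> s \<Longrightarrow> f \<in> lone t"
proof (rule lone_comparison[where C=1 and f=f and s=s])
  assume "t \<le> s"
  then have "1 \<le> weight (s - t) x" for x :: "('a, 'n) vertex" using weight_mono[of 0 "s - t" x] by simp
  then show "cmod (f x) \<le> 1 * (weight (s - t) x * cmod (f x))" for x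
    using mult_right_mono[of 1 "weight (s - t) x" "cmod (f x)"] by simp
qed

lemma lone_zero [simp]: "0 \<in> lone s"
  by (simp add: lone_def)

lemma lone_scale: "f \<in> lone s \<Longrightarrow> c *\<^sub>C f \<in> lone s"
  by (rule lone_comparison[where C="cmod c" and f=f and s=s]) (auto simp: norm_mult)

lemma lone_minus: "f \<in> lone s \<Longrightarrow> - f \<in> lone s"
  by (rule lone_comparison[where C=1 and f=f and s=s]) (auto simp: fun_Compl_def)

lemma lone_add: "f \<in> lone s \<Longrightarrow> g \<in> lone s \<Longrightarrow> f + g \<in> lone s"
proof -
  assume "f \<in> lone s" "g \<in> lone s"
  then have "(\<lambda>x. weight s x * cmod (f x) + weight s x * cmod (g x)) summable_on UNIV"
    by (auto simp: lone_def intro: summable_on_add)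
  then have "(\<lambda>x. weight s x * cmod (f x + g x)) summable_on UNIV"
    by (rule summable_on_comparison_test)
      (auto simp: norm_triangle_ineq mult_left_mono simp flip: distrib_left)
  then show ?thesis by (simp add: lone_def)
qed

lemma lone_diff: "f \<in> lone s \<Longrightarrow> g \<in> lone s \<Longrightarrow> f - g \<in> lone s"
  using lone_add[of f s "- g"] lone_minus by (auto simp: fun_diff_def fun_Compl_def plus_fun_def)

lemma lone_sum: "(\<And>i. i \<in> I \<Longrightarrow> f i \<in> lone s) \<Longrightarrow> (\<Sum>i\<in>I. f i) \<in> lone s"
  by (induction I rule: infinite_finite_induct) (auto intro: lone_add)

lemma weight_minus_le_iff: "weight (- s) x * a \<le> c \<longleftrightarrow> a \<le> c * weight s x"
  using weight_pos[of s x] by (simp add: weight_minus pos_divide_le_eq)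

lemma linfI: "(\<And>x. cmod (u x) \<le> c * weight s x) \<Longrightarrow> u \<in> linf (- s)"
  by (auto simp: linf_def weight_minus_le_iff intro!: bdd_aboveI2[where M=c])

lemma linf_norm_bound:
  assumes "u \<in> linf (- s)"
  shows "cmod (u x) \<le> linf_norm (- s) u * weight s x"
proof -
  have "weight (- s) x * cmod (u x) \<le> linf_norm (- s) u"
    using assms unfolding linf_norm_def linf_def by (intro cSUP_upper) auto
  then show ?thesis using weight_pos[of s x] by (simp add: weight_minus divide_le_eq)
qed

lemma linf_norm_nonneg: "u \<in> linf (- s) \<Longrightarrow> 0 \<le> linf_norm (- s) u"
  using linf_norm_bound[of u s undefined] weight_pos[of s undefined]
  by (meson norm_ge_zero not_le order_trans mult_neg_pos)

lemma linfE:
  assumes "u \<in> linf (- s)"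
  obtains c where "c \<ge> 0" "\<And>x. cmod (u x) \<le> c * weight s x"
  using assms linf_norm_bound linf_norm_nonneg by metis

lemma linf_mono: "f \<in> linf (- s) \<Longrightarrow> s \<le> t \<Longrightarrow> f \<in> linf (- t)"
proof -
  assume "f \<in> linf (- s)" "s \<le> t"
  then obtain c where c: "c \<ge> 0" "\<And>x. cmod (f x) \<le> c * weight s x" by (auto elim: linfE)
  show ?thesis
    by (rule linfI[of _ c]) (rule order_trans[OF c(2) mult_left_mono[OF weight_mono[OF \<open>s \<le> t\<close>] c(1)]])
qed

lemma linf_zero [simp]: "0 \<in> linf (- s)"
  by (rule linfI[of _ 0]) simp

lemma linf_scale: "f \<in> linf (- s) \<Longrightarrow> c *\<^sub>C f \<in> linf (- s)"
proof -
  assume "f \<in> linf (- s)"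
  then obtain d where d: "d \<ge> 0" "\<And>x. cmod (f x) \<le> d * weight s x" by (auto elim: linfE)
  show ?thesis
    by (rule linfI[of _ "cmod c * d"]) (auto simp: norm_mult mult.assoc intro!: mult_left_mono d)
qed

lemma linf_add: "f \<in> linf (- s) \<Longrightarrow> g \<in> linf (- s) \<Longrightarrow> f + g \<in> linf (- s)"
proof -
  assume "f \<in> linf (- s)" "g \<in> linf (- s)"
  then obtain c d where "\<And>x. cmod (f x) \<le> c * weight s x" "\<And>x. cmod (g x) \<le> d * weight s x"
    by (auto elim!: linfE)
  then show ?thesis
    by (intro linfI[of _ "c + d"]) (auto simp: distrib_right intro: norm_triangle_le add_mono)
qed

lemma linf_minus: "f \<in> linf (- s) \<Longrightarrow> - f \<in> linf (- s)"
  by (erule linfE, rule linfI) auto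

lemma linf_diff: "f \<in> linf (- s) \<Longrightarrow> g \<in> linf (- s) \<Longrightarrow> f - g \<in> linf (- s)"
  using linf_add[of f s "- g"] linf_minus by (auto simp: fun_diff_def fun_Compl_def plus_fun_def)

lemma linf_sum: "(\<And>i. i \<in> I \<Longrightarrow> f i \<in> linf (- s)) \<Longrightarrow> (\<Sum>i\<in>I. f i) \<in> linf (- s)"
  by (induction I rule: infinite_finite_induct) (auto intro: linf_add)

lemma lone_imp_linf:
  assumes "f \<in> lone s" shows "f \<in> linf s"
proof -
  have "cmod (f x) \<le> lone_norm s f * weight (- s) x" for x
  proof -
    have "(\<Sum>y\<in>{x}. weight s y * cmod (f y)) \<le> lone_norm s f"
      unfolding lone_norm_def using assms by (intro finite_sum_le_infsum) (auto simp: lone_def)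
    then show ?thesis using weight_pos[of s x] by (simp add: weight_minus field_simps)
  qed
  then have "f \<in> linf (- (- s))" by (rule linfI)
  then show ?thesis by simp
qed

lemma lone_imp_linf': "f \<in> lone s \<Longrightarrow> 0 \<le> s + t \<Longrightarrow> f \<in> linf (- t)"
  using lone_imp_linf linf_mono[of f "- s" t] by auto

lemma ltwo_imp_linf:
  assumes "f \<in> ltwo" "0 \<le> t" shows "f \<in> linf (- t)"
proof -
  have "cmod (f x) \<le> ltwo_norm f" for x
  proof -
    have "(\<Sum>y\<in>{x}. (cmod (f y))\<^sup>2) \<le> (\<Sum>\<^sub>\<infinity>x. (cmod (f x))\<^sup>2)"
      using assms by (intro finite_sum_le_infsum) (auto simp: ltwo_def)
    then show ?thesis by (auto simp: ltwo_norm_def intro: real_le_rsqrt)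
  qed
  then have "f \<in> linf (- 0)" by (intro linfI[of _ "ltwo_norm f"]) simp
  then show ?thesis using assms(2) linf_mono by blast
qed

lemma lone_imp_ltwo:
  assumes "f \<in> lone s" "0 \<le> s" shows "f \<in> ltwo"
proof -
  have f0: "f \<in> lone 0" using assms lone_mono by blast
  have "f \<in> linf (- 0)" by (rule lone_imp_linf'[OF f0]) simp
  then obtain c where c: "\<And>x. cmod (f x) \<le> c" using linfE[of f 0] by (metis mult.right_neutral weight_0)
  have "(\<lambda>x. c * cmod (f x)) summable_on UNIV"
    using f0 by (auto simp: lone_def intro: summable_on_cmult_right)
  then have "(\<lambda>x. (cmod (f x))\<^sup>2) summable_on UNIV"
    by (rule summable_on_comparison_test) (auto simp: power2_eq_square mult_right_mono c)
  then show ?thesis by (simp add: ltwo_def)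
qed

lemma ltwo_scale: "f \<in> ltwo \<Longrightarrow> c *\<^sub>C f \<in> ltwo"
  by (auto simp: ltwo_def norm_mult power_mult_distrib intro: summable_on_cmult_right)

lemma ltwo_add: "f \<in> ltwo \<Longrightarrow> g \<in> ltwo \<Longrightarrow> f + g \<in> ltwo"
proof -
  assume "f \<in> ltwo" "g \<in> ltwo"
  then have "(\<lambda>x. 2 * (cmod (f x))\<^sup>2 + 2 * (cmod (g x))\<^sup>2) summable_on UNIV"
    by (auto simp: ltwo_def intro!: summable_on_add summable_on_cmult_right)
  then have "(\<lambda>x. (cmod (f x + g x))\<^sup>2) summable_on UNIV"
  proof (rule summable_on_comparison_test)
    fix x
    have "(cmod (f x + g x))\<^sup>2 \<le> (cmod (f x) + cmod (g x))\<^sup>2"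
      by (intro power_mono norm_triangle_ineq) simp
    also have "\<dots> \<le> 2 * (cmod (f x))\<^sup>2 + 2 * (cmod (g x))\<^sup>2"
      using sum_squares_bound[of "cmod (f x)" "cmod (g x)"] by (simp add: power2_sum)
    finally show "(cmod (f x + g x))\<^sup>2 \<le> 2 * (cmod (f x))\<^sup>2 + 2 * (cmod (g x))\<^sup>2" .
  qed simp
  then show ?thesis by (simp add: ltwo_def)
qed

lemma ltwo_diff: "f \<in> ltwo \<Longrightarrow> g \<in> ltwo \<Longrightarrow> f - g \<in> ltwo"
  using ltwo_add[of f "(-1) *\<^sub>C g"] ltwo_scale[of g "-1"]
  by (auto simp: fun_diff_def plus_fun_def)


section \<open>The absolutely convergent sesquilinear pairing\<close>

section \<open>The pairing\<close>

text \<open>Absolute convergence of the sum in \<open>bracket\<close>. Since \<open>infsum\<close>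
  is 0 on divergent families, this is the condition under which \<open>bracket\<close> is
  additive.\<close>

definition pairable :: "('a, 'n) gfun \<Rightarrow> ('a, 'n) gfun \<Rightarrow> bool"
  where "pairable a b \<longleftrightarrow> (\<lambda>x. cmod (a x) * cmod (b x)) summable_on UNIV"

lemma pairable_summable: "pairable a b \<Longrightarrow> (\<lambda>x. cnj (a x) * b x) summable_on UNIV"
  unfolding pairable_def by (rule abs_summable_summable) (simp add: norm_mult)

lemma pairable_sym: "pairable a b \<Longrightarrow> pairable b a"
  by (simp add: pairable_def mult.commute)

lemma pairable_lone_linf: "a \<in> lone s \<Longrightarrow> b \<in> linf (- s) \<Longrightarrow> pairable a b"
proof -
  assume a: "a \<in> lone s" and "b \<in> linf (- s)"
  from this(2) obtain c where c: "\<And>x. cmod (b x) \<le> c * weight s x" by (rule linfE) blast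
  have "(\<lambda>x. c * (weight s x * cmod (a x))) summable_on UNIV"
    using a by (auto simp: lone_def intro: summable_on_cmult_right)
  then show ?thesis unfolding pairable_def
  proof (rule summable_on_comparison_test)
    show "cmod (a x) * cmod (b x) \<le> c * (weight s x * cmod (a x))" for x
      using mult_left_mono[OF c norm_ge_zero, of "a x" x] by (simp add: mult_ac)
  qed simp
qed

lemma pairable_linf_lone: "a \<in> linf (- s) \<Longrightarrow> b \<in> lone s \<Longrightarrow> pairable a b"
  by (rule pairable_sym[OF pairable_lone_linf])

lemma pairable_ltwo: "a \<in> ltwo \<Longrightarrow> b \<in> ltwo \<Longrightarrow> pairable a b"
proof -
  assume "a \<in> ltwo" "b \<in> ltwo"
  then have "(\<lambda>x. (cmod (a x))\<^sup>2 + (cmod (b x))\<^sup>2) summable_on UNIV"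
    by (auto simp: ltwo_def intro!: summable_on_add)
  then show ?thesis unfolding pairable_def
  proof (rule summable_on_comparison_test)
    fix x
    have "0 \<le> cmod (a x) * cmod (b x)" by simp
    then show "cmod (a x) * cmod (b x) \<le> (cmod (a x))\<^sup>2 + (cmod (b x))\<^sup>2"
      using sum_squares_bound[of "cmod (a x)" "cmod (b x)"] by linarith
  qed simp
qed

lemma pairable_add_right: "pairable a b \<Longrightarrow> pairable a c \<Longrightarrow> pairable a (b + c)"
proof -
  assume "pairable a b" "pairable a c"
  then have "(\<lambda>x. cmod (a x) * cmod (b x) + cmod (a x) * cmod (c x)) summable_on UNIV"
    by (auto simp: pairable_def intro: summable_on_add)
  then show ?thesis unfolding pairable_def
    by (rule summable_on_comparison_test)
      (auto simp: norm_triangle_ineq mult_left_mono simp flip: distrib_left)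
qed

lemma pairable_scale_right: "pairable a b \<Longrightarrow> pairable a (c *\<^sub>C b)"
  using summable_on_cmult_right[where c="cmod c" and f="\<lambda>x. cmod (a x) * cmod (b x)"]
  by (auto simp: pairable_def norm_mult mult_ac)

lemma scaleC_fun_minus_one: "(-1) *\<^sub>C (f::'x \<Rightarrow> complex) = - f"
  by (auto simp: fun_Compl_def)

lemma pairable_minus_right: "pairable a b \<Longrightarrow> pairable a (- b)"
  using pairable_scale_right[of a b "-1"] by (simp only: scaleC_fun_minus_one)

lemma pairable_diff_right: "pairable a b \<Longrightarrow> pairable a c \<Longrightarrow> pairable a (b - c)"
  using pairable_add_right[of a b "- c"] pairable_minus_right[of a c] by simp

lemma pairable_diff_left: "pairable a c \<Longrightarrow> pairable b c \<Longrightarrow> pairable (a - b) c"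
  by (rule pairable_sym[OF pairable_diff_right[OF pairable_sym pairable_sym]])

lemma pairable_zero_right [simp]: "pairable a 0"
  by (simp add: pairable_def)

lemma pairable_sum_right: "(\<And>i. i \<in> I \<Longrightarrow> pairable a (f i)) \<Longrightarrow> pairable a (\<Sum>i\<in>I. f i)"
  by (induction I rule: infinite_finite_induct) (auto intro: pairable_add_right)

lemma bracket_commute: "bracket a b = cnj (bracket b a)"
  unfolding bracket_def infsum_cnj[symmetric] by (simp add: mult.commute)

lemma bracket_zero_right [simp]: "bracket a 0 = 0"
  by (simp add: bracket_def)

lemma bracket_zero_left [simp]: "bracket 0 a = 0"
  by (simp add: bracket_def)

lemma bracket_add_right: "pairable a b \<Longrightarrow> pairable a c \<Longrightarrow> bracket a (b + c) = bracket a b + bracket a c"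
  using infsum_add[OF pairable_summable[of a b] pairable_summable[of a c]]
  by (simp add: bracket_def distrib_left)

lemma bracket_scale_right: "bracket a (c *\<^sub>C b) = c * bracket a b"
  using infsum_cmult_right'[of c "\<lambda>x. cnj (a x) * b x" UNIV] by (simp add: bracket_def mult_ac)

lemma bracket_minus_right: "bracket a (- b) = - bracket a b"
  using bracket_scale_right[of a "-1" b] by (simp only: scaleC_fun_minus_one mult_minus1)

lemma bracket_diff_right: "pairable a b \<Longrightarrow> pairable a c \<Longrightarrow> bracket a (b - c) = bracket a b - bracket a c"
  using bracket_add_right[of a b "- c"] pairable_minus_right[of a c] by (simp add: bracket_minus_right)

lemma bracket_sum_right:
  "(\<And>i. i \<in> I \<Longrightarrow> pairable a (f i)) \<Longrightarrow> bracket a (\<Sum>i\<in>I. f i) = (\<Sum>i\<in>I. bracket a (f i))"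
  by (induction I rule: infinite_finite_induct) (auto simp: bracket_add_right pairable_sum_right)

lemma bracket_add_left: "pairable a c \<Longrightarrow> pairable b c \<Longrightarrow> bracket (a + b) c = bracket a c + bracket b c"
  unfolding bracket_commute[of _ c] by (simp add: bracket_add_right pairable_sym)

lemma bracket_scale_left: "bracket (c *\<^sub>C a) b = cnj c * bracket a b"
  unfolding bracket_commute[of _ b] by (simp add: bracket_scale_right)

lemma bracket_minus_left: "bracket (- a) b = - bracket a b"
  unfolding bracket_commute[of _ b] by (simp add: bracket_minus_right)

lemma bracket_diff_left: "pairable a c \<Longrightarrow> pairable b c \<Longrightarrow> bracket (a - b) c = bracket a c - bracket b c"
  unfolding bracket_commute[of _ c] by (simp add: bracket_diff_right pairable_sym)

lemma bracket_sum_left: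
  "(\<And>i. i \<in> I \<Longrightarrow> pairable (f i) a) \<Longrightarrow> bracket (\<Sum>i\<in>I. f i) a = (\<Sum>i\<in>I. bracket (f i) a)"
  unfolding bracket_commute[of _ a] by (simp add: bracket_sum_right pairable_sym)

lemma lone_norm_nonneg: "0 \<le> lone_norm s u"
  unfolding lone_norm_def by (rule infsum_nonneg) simp

lemma lone_norm_mono: "u \<in> lone s \<Longrightarrow> t \<le> s \<Longrightarrow> lone_norm t u \<le> lone_norm s u"
  unfolding lone_norm_def using lone_mono[of u s t]
  by (intro infsum_mono mult_right_mono weight_mono) (auto simp: lone_def)

lemma bracket_bound:
  assumes a: "a \<in> lone s" and b: "\<And>x. cmod (b x) \<le> c * weight s x"
  shows "cmod (bracket a b) \<le> c * lone_norm s a"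
proof -
  have s: "(\<lambda>x. c * (weight s x * cmod (a x))) summable_on UNIV"
    using a by (auto simp: lone_def intro: summable_on_cmult_right)
  have p: "(\<lambda>x. cmod (a x) * cmod (b x)) summable_on UNIV"
    using pairable_lone_linf[OF a linfI[OF b]] by (simp add: pairable_def)
  have "cmod (bracket a b) \<le> (\<Sum>\<^sub>\<infinity>x. cmod (cnj (a x) * b x))"
    unfolding bracket_def by (rule norm_infsum_bound) (use p in \<open>simp add: norm_mult\<close>)
  also have "\<dots> \<le> (\<Sum>\<^sub>\<infinity>x. c * (weight s x * cmod (a x)))"
  proof (rule infsum_mono)
    show "cmod (cnj (a x) * b x) \<le> c * (weight s x * cmod (a x))" for x
      using mult_left_mono[OF b norm_ge_zero, of "a x" x] by (simp add: norm_mult mult_ac)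
  qed (use p s in \<open>auto simp: norm_mult\<close>)
  also have "\<dots> = c * lone_norm s a"
    unfolding lone_norm_def using a by (intro infsum_cmult_right) (auto simp: lone_def)
  finally show ?thesis .
qed

lemma bracket_bound':
  "a \<in> lone s \<Longrightarrow> (\<And>x. cmod (b x) \<le> c * weight s x) \<Longrightarrow> cmod (bracket b a) \<le> c * lone_norm s a"
  using bracket_bound[of a s b c] unfolding bracket_commute[of b] by simp

text \<open>Kernel rows, growth vectors and decaying solutions all live on a single half-line; this
  common form reduces their pairings to sums over \<open>nat\<close>.\<close>

fun rayfun :: "'n \<Rightarrow> (nat \<Rightarrow> complex) \<Rightarrow> ('a, 'n) gfun" where
  "rayfun \<alpha> p (Core x) = 0"
| "rayfun \<alpha> p (Ray \<gamma> k) = (if \<gamma> = \<alpha> then p k else 0)"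

lemma nvec_rayfun: "nvec \<alpha> = rayfun \<alpha> (\<lambda>k. of_nat (Suc k))"
proof
  show "nvec \<alpha> x = rayfun \<alpha> (\<lambda>k. of_nat (Suc k)) x" for x by (cases x) auto
qed

lemma onevec_rayfun: "onevec \<alpha> = rayfun \<alpha> (\<lambda>k. 1)"
proof
  show "onevec \<alpha> x = rayfun \<alpha> (\<lambda>k. 1) x" for x by (cases x) auto
qed

lemma bracket_rayfun: "bracket (rayfun \<alpha> p) f = (\<Sum>\<^sub>\<infinity>l. cnj (p l) * f (Ray \<alpha> l))"
proof -
  have "bracket (rayfun \<alpha> p) f = (\<Sum>\<^sub>\<infinity>x\<in>range (Ray \<alpha>). cnj (rayfun \<alpha> p x) * f x)"
    unfolding bracket_def
  proof (rule infsum_cong_neutral)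
    show "cnj (rayfun \<alpha> p x) * f x = 0" if "x \<in> UNIV - range (Ray \<alpha>)" for x
      using that by (cases x) auto
  qed auto
  also have "\<dots> = (\<Sum>\<^sub>\<infinity>l. cnj (p l) * f (Ray \<alpha> l))"
    by (subst infsum_reindex) (auto simp: o_def inj_on_def)
  finally show ?thesis .
qed

lemma bracket_rayfun_single: "bracket (rayfun \<alpha> (\<lambda>l. if l = k then c else 0)) f = cnj c * f (Ray \<alpha> k)"
proof -
  have "(\<Sum>\<^sub>\<infinity>l. cnj (if l = k then c else 0) * f (Ray \<alpha> l))
      = (\<Sum>\<^sub>\<infinity>l\<in>{k}. cnj (if l = k then c else 0) * f (Ray \<alpha> l))"
    by (rule infsum_cong_neutral) auto
  then show ?thesis by (simp add: bracket_rayfun)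
qed

lemma rayfun_bound:
  assumes "\<And>l. cmod (p l) \<le> C * real (Suc l) ^ n"
  shows "cmod (rayfun \<alpha> p x) \<le> C * weight (real n) x"
proof -
  have C: "0 \<le> C" using order_trans[OF norm_ge_zero assms[of 0]] by simp
  show ?thesis
  proof (cases x)
    case (Core y)
    then show ?thesis using C by simp
  next
    case (Ray \<gamma> l)
    have "C * real (Suc l) ^ n \<le> C * weight (real n) x"
      unfolding Ray by (intro mult_left_mono weight_ge_power C)
    then show ?thesis using assms[of l] C Ray by (auto intro: order_trans)
  qed
qed

lemma rayfun_linf:
  "(\<And>l. cmod (p l) \<le> C * real (Suc l) ^ n) \<Longrightarrow> real n \<le> s \<Longrightarrow> rayfun \<alpha> p \<in> linf (- s)"
  by (rule linf_mono[OF linfI[OF rayfun_bound]])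

lemma nvec_linf: "1 \<le> s \<Longrightarrow> nvec \<alpha> \<in> linf (- s)"
  unfolding nvec_rayfun by (rule rayfun_linf[where C=1 and n=1]) (auto simp: norm_of_nat simp del: of_nat_Suc)

lemma onevec_linf: "0 \<le> s \<Longrightarrow> onevec \<alpha> \<in> linf (- s)"
  unfolding onevec_rayfun by (rule rayfun_linf[where C=1 and n=0]) auto


section \<open>Summation by parts for the free operator\<close>

section \<open>Symmetry of the free operator\<close>

fun shift_up :: "('a, 'n) gfun \<Rightarrow> ('a, 'n) gfun" where
  "shift_up u (Core x) = 0"
| "shift_up u (Ray \<alpha> k) = u (Ray \<alpha> (Suc k))"

fun shift_down :: "('a, 'n) gfun \<Rightarrow> ('a, 'n) gfun" where
  "shift_down u (Core x) = 0"
| "shift_down u (Ray \<alpha> 0) = 0"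
| "shift_down u (Ray \<alpha> (Suc k)) = u (Ray \<alpha> k)"

fun diag_part :: "'a::finite set set \<Rightarrow> ('n::finite \<Rightarrow> 'a) \<Rightarrow> ('a, 'n) gop" where
  "diag_part E0 att u (Core x) = core_op E0 att (\<lambda>y. u (Core y)) x"
| "diag_part E0 att u (Ray \<alpha> k) = 2 * u (Ray \<alpha> k)"

text \<open>Symmetry can be proved termwise: the diagonal block is symmetric and the two shifts are
  adjoint to each other. The Dirichlet condition is the value 0 of \<open>shift_down\<close> at the
  first vertex of a half-line.\<close>

lemma free_op_eq: "free_op E0 att u = diag_part E0 att u - shift_up u - shift_down u"
proof
  fix x show "free_op E0 att u x = (diag_part E0 att u - shift_up u - shift_down u) x"
  proof (cases x)
    case (Ray \<alpha> k)
    then show ?thesis by (cases k) auto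
  qed auto
qed

lemma vweight_Suc_le: "vweight (Ray \<alpha> (Suc k)) \<le> 2 * vweight (Ray \<alpha> k)"
proof -
  have "sqrt (1 + (real (Suc (Suc k)))\<^sup>2) \<le> sqrt (4 * (1 + (real (Suc k))\<^sup>2))"
    by (intro real_sqrt_le_mono) (auto simp: power2_eq_square algebra_simps)
  also have "\<dots> = 2 * sqrt (1 + (real (Suc k))\<^sup>2)" by (simp only: real_sqrt_mult real_sqrt_four)
  finally show ?thesis unfolding vweight.simps .
qed

lemma vweight_le_Suc: "vweight (Ray \<alpha> k) \<le> vweight (Ray \<alpha> (Suc k))"
  by (simp add: power_mono)

lemma weight_Suc_le: "0 \<le> s \<Longrightarrow> weight s (Ray \<alpha> (Suc k)) \<le> 2 powr s * weight s (Ray \<alpha> k)"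
  unfolding weight_eq
  using powr_mono2[OF _ less_imp_le[OF vweight_pos] vweight_Suc_le] vweight_pos by (simp add: powr_mult less_imp_le)

lemma weight_le_Suc: "0 \<le> s \<Longrightarrow> weight s (Ray \<alpha> k) \<le> weight s (Ray \<alpha> (Suc k))"
  unfolding weight_eq by (intro powr_mono2 vweight_le_Suc less_imp_le[OF vweight_pos])

lemma shift_up_linf:
  fixes u :: "('a, 'n) gfun"
  shows "u \<in> linf (- s) \<Longrightarrow> 0 \<le> s \<Longrightarrow> shift_up u \<in> linf (- s)"
proof -
  assume "u \<in> linf (- s)" and s: "0 \<le> s"
  then obtain c where c: "c \<ge> 0" "\<And>x. cmod (u x) \<le> c * weight s x" by (auto elim: linfE)
  have "cmod (shift_up u x) \<le> (c * 2 powr s) * weight s x" for x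
  proof (cases x)
    case (Ray \<alpha> k)
    have "cmod (u (Ray \<alpha> (Suc k))) \<le> c * weight s (Ray \<alpha> (Suc k) :: ('a, 'n) vertex)" by (rule c(2))
    also have "\<dots> \<le> c * (2 powr s * weight s (Ray \<alpha> k :: ('a, 'n) vertex))" by (intro mult_left_mono weight_Suc_le s c)
    finally show ?thesis using Ray by (simp add: mult.assoc)
  qed (use c in auto)
  then show ?thesis by (rule linfI)
qed

lemma shift_down_linf:
  fixes u :: "('a, 'n) gfun"
  shows "u \<in> linf (- s) \<Longrightarrow> 0 \<le> s \<Longrightarrow> shift_down u \<in> linf (- s)"
proof -
  assume "u \<in> linf (- s)" and s: "0 \<le> s"
  then obtain c where c: "c \<ge> 0" "\<And>x. cmod (u x) \<le> c * weight s x" by (auto elim: linfE)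
  have "cmod (shift_down u x) \<le> c * weight s x" for x
  proof (cases x)
    case (Ray \<alpha> k)
    show ?thesis
    proof (cases k)
      case (Suc l)
      have "cmod (u (Ray \<alpha> l)) \<le> c * weight s (Ray \<alpha> l :: ('a, 'n) vertex)" by (rule c(2))
      also have "\<dots> \<le> c * weight s (Ray \<alpha> k)" unfolding Suc by (intro mult_left_mono weight_le_Suc s c)
      finally show ?thesis using Ray Suc by simp
    qed (use Ray c in \<open>simp del: weight.simps\<close>)
  qed (use c in auto)
  then show ?thesis by (rule linfI)
qed

text \<open>The core is finite and there are finitely many half-lines, so only the behaviour along
  each half-line matters.\<close>

lemma summable_rays_iff:
  fixes f :: "('a::finite, 'n::finite) vertex \<Rightarrow> real"
  assumes nn: "\<And>x. 0 \<le> f x"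
  shows "f summable_on UNIV \<longleftrightarrow> (\<forall>\<alpha>. (\<lambda>k. f (Ray \<alpha> k)) summable_on UNIV)"
proof
  assume "f summable_on UNIV"
  then have "f summable_on range (Ray \<alpha>)" for \<alpha> by (rule summable_on_subset_banach) simp
  then show "\<forall>\<alpha>. (\<lambda>k. f (Ray \<alpha> k)) summable_on UNIV"
    by (subst (asm) summable_on_reindex) (auto simp: inj_on_def o_def)
next
  assume *: "\<forall>\<alpha>. (\<lambda>k. f (Ray \<alpha> k)) summable_on UNIV"
  have r: "f summable_on range (Ray \<alpha>)" for \<alpha>
    by (subst summable_on_reindex) (use * in \<open>auto simp: inj_on_def o_def\<close>)
  have "f summable_on (\<Union>\<alpha>\<in>UNIV. range (Ray \<alpha>))"
    by (rule summable_on_finite_union_disjoint) (auto simp: r)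
  moreover have "f summable_on range Core" by (simp add: finite_imageI)
  ultimately have "f summable_on range Core \<union> (\<Union>\<alpha>\<in>UNIV. range (Ray \<alpha>))"
    by (intro summable_on_Un_disjoint) auto
  moreover have U: "range Core \<union> (\<Union>\<alpha>\<in>UNIV. range (Ray \<alpha>)) = (UNIV :: ('a, 'n) vertex set)"
  proof -
    have "x \<in> range Core \<union> (\<Union>\<alpha>\<in>UNIV. range (Ray \<alpha>))" for x by (cases x) auto
    then show ?thesis by blast
  qed
  ultimately show "f summable_on UNIV" by (simp only: U)
qed

lemma summable_nat_Suc: "(f :: nat \<Rightarrow> real) summable_on UNIV \<Longrightarrow> (\<lambda>k. f (Suc k)) summable_on UNIV"
  using summable_on_reindex[of Suc UNIV f] summable_on_subset_banach[of f UNIV "range Suc"]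
  by (simp add: o_def)

lemma summable_nat_pred:
  assumes "(f :: nat \<Rightarrow> real) summable_on UNIV" "\<And>k. g (Suc k) = f k"
  shows "g summable_on UNIV"
proof -
  have "g summable_on range Suc"
    using summable_on_reindex[of Suc UNIV g] assms by (simp add: o_def)
  then have "g summable_on insert 0 (range Suc)" by (simp add: summable_on_insert_iff)
  moreover have "insert 0 (range Suc) = UNIV" using not0_implies_Suc by blast
  ultimately show ?thesis by simp
qed

lemma summable_shift_up:
  fixes f g :: "('a::finite, 'n::finite) vertex \<Rightarrow> real"
  assumes "f summable_on UNIV" "\<And>x. 0 \<le> f x" "\<And>x. 0 \<le> g x" "\<And>\<alpha> k. g (Ray \<alpha> k) \<le> C * f (Ray \<alpha> (Suc k))"
  shows "g summable_on UNIV"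
proof -
  have "(\<lambda>k. g (Ray \<alpha> k)) summable_on UNIV" for \<alpha>
  proof -
  have "(\<lambda>k. f (Ray \<alpha> k)) summable_on UNIV" using assms(1) summable_rays_iff[of f] assms(2) by blast
  then have "(\<lambda>k. C * f (Ray \<alpha> (Suc k))) summable_on UNIV"
    by (intro summable_on_cmult_right summable_nat_Suc)
  then show ?thesis
    by (rule summable_on_comparison_test) (auto simp: assms)
  qed
  then show ?thesis using summable_rays_iff[of g] assms(3) by blast
qed

lemma summable_shift_down:
  fixes f g :: "('a::finite, 'n::finite) vertex \<Rightarrow> real"
  assumes "f summable_on UNIV" "\<And>x. 0 \<le> f x" "\<And>x. 0 \<le> g x" "\<And>\<alpha> k. g (Ray \<alpha> (Suc k)) \<le> C * f (Ray \<alpha> k)"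
  shows "g summable_on UNIV"
proof -
  have "(\<lambda>k. g (Ray \<alpha> k)) summable_on UNIV" for \<alpha>
  proof -
  have "(\<lambda>k. f (Ray \<alpha> k)) summable_on UNIV" using assms(1) summable_rays_iff[of f] assms(2) by blast
  then have "(\<lambda>k. C * f (Ray \<alpha> k)) summable_on UNIV" by (intro summable_on_cmult_right)
  then have "(\<lambda>k. g (Ray \<alpha> (Suc k))) summable_on UNIV"
    by (rule summable_on_comparison_test) (auto simp: assms)
  then show ?thesis by (rule summable_nat_pred) simp
  qed
  then show ?thesis using summable_rays_iff[of g] assms(3) by blast
qed

lemma shift_up_ltwo: "(u::('a::finite, 'n::finite) gfun) \<in> ltwo \<Longrightarrow> shift_up u \<in> ltwo"
  unfolding ltwo_def mem_Collect_eq by (erule summable_shift_up[where C=1]) auto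

lemma shift_down_ltwo: "(u::('a::finite, 'n::finite) gfun) \<in> ltwo \<Longrightarrow> shift_down u \<in> ltwo"
  unfolding ltwo_def mem_Collect_eq by (erule summable_shift_down[where C=1]) auto

lemma shift_up_lone: "(u::('a::finite, 'n::finite) gfun) \<in> lone s \<Longrightarrow> 0 \<le> s \<Longrightarrow> shift_up u \<in> lone s"
  unfolding lone_def mem_Collect_eq
  by (erule summable_shift_up[where C=1])
    (auto intro!: mult_right_mono weight_le_Suc simp del: weight.simps)

lemma shift_down_lone: "(u::('a::finite, 'n::finite) gfun) \<in> lone s \<Longrightarrow> 0 \<le> s \<Longrightarrow> shift_down u \<in> lone s"
  unfolding lone_def mem_Collect_eq
  by (erule summable_shift_down[where C="2 powr s"])
    (auto intro!: mult_right_mono weight_Suc_le simp del: weight.simps simp flip: mult.assoc)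

lemma diag_part_ltwo:
  fixes u :: "('a::finite, 'n::finite) gfun"
  assumes "u \<in> ltwo" shows "diag_part E0 att u \<in> ltwo"
proof -
  have "(\<lambda>k. (cmod (u (Ray \<alpha> k)))\<^sup>2) summable_on UNIV" for \<alpha>
    using assms summable_rays_iff[of "\<lambda>x. (cmod (u x))\<^sup>2"] by (simp add: ltwo_def)
  then have "(\<lambda>k. (cmod (diag_part E0 att u (Ray \<alpha> k)))\<^sup>2) summable_on UNIV" for \<alpha>
    by (simp add: norm_mult power_mult_distrib summable_on_cmult_right)
  then show ?thesis using summable_rays_iff[of "\<lambda>x. (cmod (diag_part E0 att u x))\<^sup>2"] by (simp add: ltwo_def)
qed

lemma diag_part_lone:
  fixes u :: "('a::finite, 'n::finite) gfun"
  assumes "u \<in> lone s" shows "diag_part E0 att u \<in> lone s"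
proof -
  have "(\<lambda>k. weight s (Ray \<alpha> k :: ('a, 'n) vertex) * cmod (u (Ray \<alpha> k))) summable_on UNIV" for \<alpha>
    using assms summable_rays_iff[of "\<lambda>x. weight s x * cmod (u x)"]
    unfolding lone_def mem_Collect_eq by (simp del: weight.simps)
  from summable_on_cmult_right[OF this, of 2]
  have "(\<lambda>k. weight s (Ray \<alpha> k :: ('a, 'n) vertex) * cmod (diag_part E0 att u (Ray \<alpha> k))) summable_on UNIV" for \<alpha>
    by (simp add: norm_mult mult_ac del: weight.simps)
  then show ?thesis using summable_rays_iff[of "\<lambda>x. weight s x * cmod (diag_part E0 att u x)"]
    by (simp add: lone_def del: weight.simps)
qed

lemma diag_part_linf:
  fixes u :: "('a::finite, 'n::finite) gfun"
  assumes "u \<in> linf (- s)" shows "diag_part E0 att u \<in> linf (- s)"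
proof -
  obtain c where c: "c \<ge> 0" "\<And>x. cmod (u x) \<le> c * weight s x" using assms by (auto elim: linfE)
  define D where "D = (\<Sum>x\<in>UNIV. cmod (core_op E0 att (\<lambda>y. u (Core y)) x))"
  have D: "cmod (core_op E0 att (\<lambda>y. u (Core y)) x) \<le> D" "D \<ge> 0" for x
    unfolding D_def by (auto intro!: member_le_sum sum_nonneg)
  have "cmod (diag_part E0 att u x) \<le> (2 * c + D) * weight s x" for x
  proof (cases x)
    case (Ray \<alpha> k)
    have "cmod (2 * u x) \<le> 2 * (c * weight s x)" using c(2)[of x] by (simp add: norm_mult)
    also have "\<dots> \<le> (2 * c + D) * weight s x" using D(2) weight_nonneg[of s x] by (simp add: distrib_right)
    finally show ?thesis using Ray by simp
  qed (use D(1) c(1) in \<open>auto simp: add_increasing\<close>)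
  then show ?thesis by (rule linfI)
qed

lemma bracket_split:
  fixes a b :: "('a::finite, 'n::finite) gfun"
  assumes "pairable a b"
  shows "bracket a b = (\<Sum>x\<in>UNIV. cnj (a (Core x)) * b (Core x))
    + (\<Sum>\<^sub>\<infinity>x\<in>-range Core. cnj (a x) * b x)"
proof -
  have "bracket a b = (\<Sum>\<^sub>\<infinity>x\<in>range Core \<union> - range Core. cnj (a x) * b x)"
    by (simp add: bracket_def)
  also have "\<dots> = (\<Sum>\<^sub>\<infinity>x\<in>range Core. cnj (a x) * b x) + (\<Sum>\<^sub>\<infinity>x\<in>-range Core. cnj (a x) * b x)"
    by (rule infsum_Un_disjoint)
      (auto intro: summable_on_subset_banach[OF pairable_summable[OF assms]])
  also have "(\<Sum>\<^sub>\<infinity>x\<in>range Core. cnj (a x) * b x) = (\<Sum>x\<in>UNIV. cnj (a (Core x)) * b (Core x))"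
    by (simp add: sum.reindex inj_on_def)
  finally show ?thesis .
qed

text \<open>In the double sum over ordered edges the endpoints may be exchanged, and the attachment
  term is multiplication by a real function.\<close>

lemma core_op_symmetric:
  fixes a b :: "'a::finite \<Rightarrow> complex" and att :: "'n::finite \<Rightarrow> 'a"
  shows "(\<Sum>x\<in>UNIV. cnj (core_op E0 att a x) * b x) = (\<Sum>x\<in>UNIV. cnj (a x) * core_op E0 att b x)"
proof -
  have *: "(\<Sum>x\<in>UNIV. \<Sum>y | {x, y} \<in> E0. f x y) = (\<Sum>x\<in>UNIV. \<Sum>y | {x, y} \<in> E0. f y x)" for f :: "'a \<Rightarrow> 'a \<Rightarrow> complex"
  proof -
    have "(\<Sum>x\<in>UNIV. \<Sum>y | {x, y} \<in> E0. f x y) = (\<Sum>x\<in>UNIV. \<Sum>y\<in>UNIV. if {x, y} \<in> E0 then f x y else 0)"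
      by (simp add: sum.If_cases)
    also have "\<dots> = (\<Sum>y\<in>UNIV. \<Sum>x\<in>UNIV. if {x, y} \<in> E0 then f x y else 0)" by (rule sum.swap)
    also have "\<dots> = (\<Sum>x\<in>UNIV. \<Sum>y | {x, y} \<in> E0. f y x)"
      by (simp add: sum.If_cases insert_commute)
    finally show ?thesis .
  qed
  define m :: "'a \<Rightarrow> complex" where "m x = (\<Sum>\<alpha>\<in>UNIV. if x = att \<alpha> then 1 else 0)" for x
  have core: "core_op E0 att u x = (\<Sum>y | {x, y} \<in> E0. u x - u y) + m x * u x" for u x
    by (simp add: core_op_def m_def sum_distrib_right)
  have m: "cnj (m x) = m x" for x
    by (simp add: m_def if_distrib cong: if_cong)
  have l: "cnj (core_op E0 att a x) * b x = (\<Sum>y | {x, y} \<in> E0. cnj (a x) * b x)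
      - (\<Sum>y | {x, y} \<in> E0. cnj (a y) * b x) + m x * (cnj (a x) * b x)" for x
    by (simp add: core m sum_subtractf left_diff_distrib distrib_right sum_distrib_right)
  have r: "cnj (a x) * core_op E0 att b x = (\<Sum>y | {x, y} \<in> E0. cnj (a x) * b x)
      - (\<Sum>y | {x, y} \<in> E0. cnj (a x) * b y) + m x * (cnj (a x) * b x)" for x
    by (simp add: core m sum_subtractf right_diff_distrib distrib_left sum_distrib_left)
  have "(\<Sum>x\<in>UNIV. cnj (core_op E0 att a x) * b x)
      = (\<Sum>x\<in>UNIV. \<Sum>y | {x, y} \<in> E0. cnj (a x) * b x) - (\<Sum>x\<in>UNIV. \<Sum>y | {x, y} \<in> E0. cnj (a y) * b x)
      + (\<Sum>x\<in>UNIV. m x * (cnj (a x) * b x))"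
    by (simp add: l sum.distrib sum_subtractf)
  also have "(\<Sum>x\<in>UNIV. \<Sum>y | {x, y} \<in> E0. cnj (a y) * b x) = (\<Sum>x\<in>UNIV. \<Sum>y | {x, y} \<in> E0. cnj (a x) * b y)"
    by (rule *)
  also have "(\<Sum>x\<in>UNIV. \<Sum>y | {x, y} \<in> E0. cnj (a x) * b x) - \<dots>
      + (\<Sum>x\<in>UNIV. m x * (cnj (a x) * b x))
      = (\<Sum>x\<in>UNIV. cnj (a x) * core_op E0 att b x)"
    by (simp add: r sum.distrib sum_subtractf)
  finally show ?thesis .
qed

lemma diag_part_symmetric:
  assumes "pairable (diag_part E0 att a) b" "pairable a (diag_part E0 att b)"
  shows "bracket (diag_part E0 att a) b = bracket a (diag_part E0 att b)"
proof -
  have "(\<Sum>\<^sub>\<infinity>x\<in>-range Core. cnj (diag_part E0 att a x) * b x)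
      = (\<Sum>\<^sub>\<infinity>x\<in>-range Core. cnj (a x) * diag_part E0 att b x)"
  proof (rule infsum_cong)
    show "cnj (diag_part E0 att a x) * b x = cnj (a x) * diag_part E0 att b x" if "x \<in> -range Core" for x
      using that by (cases x) auto
  qed
  then show ?thesis unfolding bracket_split[OF assms(1)] bracket_split[OF assms(2)]
    by (simp add: core_op_symmetric)
qed

text \<open>A shift of the summation index; there is no boundary term because
  \<open>shift_down\<close> is 0 at the first vertex.\<close>

lemma bracket_shift_up:
  fixes a b :: "('a, 'n) gfun"
  shows "bracket (shift_up a) b = bracket a (shift_down b)"
proof -
  define \<sigma> :: "('a, 'n) vertex \<Rightarrow> ('a, 'n) vertex"
    where "\<sigma> x = (case x of Core y \<Rightarrow> Core y | Ray \<alpha> k \<Rightarrow> Ray \<alpha> (Suc k))" for x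
  have inj: "inj_on \<sigma> A" for A by (auto simp: inj_on_def \<sigma>_def split: vertex.splits)
  have "bracket a (shift_down b) = (\<Sum>\<^sub>\<infinity>x\<in>\<sigma> ` (-range Core). cnj (a x) * shift_down b x)"
    unfolding bracket_def
  proof (rule infsum_cong_neutral)
    fix x assume x: "x \<in> UNIV - \<sigma> ` (- range Core)"
    show "cnj (a x) * shift_down b x = 0"
    proof (cases x)
      case (Ray \<alpha> k)
      show ?thesis
      proof (cases k)
        case (Suc l)
        then have "x = \<sigma> (Ray \<alpha> l)" using Ray by (simp add: \<sigma>_def)
        then have "x \<in> \<sigma> ` (- range Core)" by (rule image_eqI) auto
        then show ?thesis using x by blast
      qed (use Ray in simp)
    qed simp
  qed auto
  also have "\<dots> = (\<Sum>\<^sub>\<infinity>x\<in>-range Core. cnj (a (\<sigma> x)) * shift_down b (\<sigma> x))"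
    by (subst infsum_reindex[OF inj]) (simp add: o_def)
  also have "\<dots> = bracket (shift_up a) b"
    unfolding bracket_def
  proof (rule infsum_cong_neutral)
    show "cnj (a (\<sigma> x)) * shift_down b (\<sigma> x) = cnj (shift_up a x) * b x" if "x \<in> -range Core \<inter> UNIV" for x
      using that by (cases x) (auto simp: \<sigma>_def)
    show "cnj (shift_up a x) * b x = 0" if "x \<in> UNIV - -range Core" for x using that by auto
  qed auto
  finally show ?thesis by simp
qed

lemma bracket_shift_down: "bracket (shift_down a) b = bracket a (shift_up b)"
  unfolding bracket_commute[of _ b] bracket_commute[of a] bracket_shift_up ..

lemma free_op_symmetric_aux:
  assumes "pairable (diag_part E0 att a) b" "pairable a (diag_part E0 att b)"
    "pairable (shift_up a) b" "pairable (shift_down a) b"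
    "pairable a (shift_up b)" "pairable a (shift_down b)"
  shows "bracket (free_op E0 att a) b = bracket a (free_op E0 att b)"
  unfolding free_op_eq using assms
  by (simp add: bracket_diff_left bracket_diff_right pairable_diff_right pairable_diff_left
      bracket_shift_up bracket_shift_down diag_part_symmetric)

lemma free_op_symmetric_ltwo:
  "a \<in> ltwo \<Longrightarrow> b \<in> ltwo \<Longrightarrow> bracket (free_op E0 att a) b = bracket a (free_op E0 att b)"
  by (intro free_op_symmetric_aux pairable_ltwo shift_up_ltwo shift_down_ltwo diag_part_ltwo)

text \<open>Shifts preserve both a weighted \<open>l^1\<close> space and its dual, so decay of one
  factor pays for polynomial growth of the other.\<close>

lemma free_op_symmetric_lone:
  "a \<in> lone s \<Longrightarrow> b \<in> linf (- s) \<Longrightarrow> 0 \<le> s \<Longrightarrow> bracket (free_op E0 att a) b = bracket a (free_op E0 att b)"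
  by (intro free_op_symmetric_aux pairable_lone_linf[of _ s] shift_up_lone shift_down_lone diag_part_lone
      shift_up_linf shift_down_linf diag_part_linf)

lemma free_op_lone: "a \<in> lone s \<Longrightarrow> 0 \<le> s \<Longrightarrow> free_op E0 att a \<in> lone s"
  unfolding free_op_eq by (intro lone_diff shift_up_lone shift_down_lone diag_part_lone)

lemma free_op_ltwo: "a \<in> ltwo \<Longrightarrow> free_op E0 att a \<in> ltwo"
  unfolding free_op_eq by (intro ltwo_diff shift_up_ltwo shift_down_ltwo diag_part_ltwo)


lemma scaleC_fun_zero_right [simp]: "c *\<^sub>C (0::'x \<Rightarrow> complex) = 0"
  by (rule ext) simp

lemma scaleC_fun_zero_left [simp]: "0 *\<^sub>C (f::'x \<Rightarrow> complex) = 0"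
  by (rule ext) simp

section \<open>Dirichlet energy and invertibility on the finite graph\<close>

section \<open>The finite part of the free operator\<close>

lemma core_op_add: "core_op E0 att (u + w) x = core_op E0 att u x + core_op E0 att w x"
  by (simp add: core_op_def algebra_simps sum.distrib sum_subtractf)

lemma core_op_scale: "core_op E0 att (c *\<^sub>C u) x = c * core_op E0 att u x"
  by (simp add: core_op_def algebra_simps sum_distrib_left)

text \<open>Ordered pairs count every edge twice, whence the factors 2. The right side is the
  Dirichlet form: squared differences along edges and squared values at the attachment
  points.\<close>

lemma core_op_energy:
  fixes u :: "'a::finite \<Rightarrow> complex" and att :: "'n::finite \<Rightarrow> 'a"
  shows "2 * (\<Sum>x\<in>UNIV. cnj (u x) * core_op E0 att u x)
    = complex_of_real ((\<Sum>x\<in>UNIV. \<Sum>y | {x, y} \<in> E0. (cmod (u x - u y))\<^sup>2)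
      + 2 * (\<Sum>\<alpha>\<in>UNIV. (cmod (u (att \<alpha>)))\<^sup>2))"
proof -
  let ?S = "\<lambda>f. \<Sum>x\<in>UNIV. \<Sum>y | {x, y} \<in> E0. f x y :: complex"
  have swap: "?S (\<lambda>x y. f x y) = ?S (\<lambda>x y. f y x)" for f
  proof -
    have "?S (\<lambda>x y. f x y) = (\<Sum>x\<in>UNIV. \<Sum>y\<in>UNIV. if {x, y} \<in> E0 then f x y else 0)"
      by (simp add: sum.If_cases)
    also have "\<dots> = (\<Sum>y\<in>UNIV. \<Sum>x\<in>UNIV. if {x, y} \<in> E0 then f x y else 0)" by (rule sum.swap)
    also have "\<dots> = ?S (\<lambda>x y. f y x)"
      by (simp add: sum.If_cases insert_commute)
    finally show ?thesis .
  qed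
  have att: "(\<Sum>x\<in>UNIV. cnj (u x) * (\<Sum>\<alpha>\<in>UNIV. (if x = att \<alpha> then 1 else 0) * u x))
      = (\<Sum>\<alpha>\<in>UNIV. complex_of_real ((cmod (u (att \<alpha>)))\<^sup>2))"
  proof -
    have "(\<Sum>x\<in>UNIV. cnj (u x) * (\<Sum>\<alpha>\<in>UNIV. (if x = att \<alpha> then 1 else 0) * u x))
        = (\<Sum>x\<in>UNIV. \<Sum>\<alpha>\<in>UNIV. if x = att \<alpha> then cnj (u x) * u x else 0)"
      by (auto simp: sum_distrib_left intro!: sum.cong)
    also have "\<dots> = (\<Sum>\<alpha>\<in>UNIV. \<Sum>x\<in>UNIV. if x = att \<alpha> then cnj (u x) * u x else 0)"
      by (rule sum.swap)
    finally show ?thesis by (simp only: complex_norm_square) (simp add: mult.commute)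
  qed
  have half: "?S (\<lambda>x y. complex_of_real ((cmod (u x - u y))\<^sup>2))
      = 2 * ?S (\<lambda>x y. cnj (u x) * (u x - u y))"
  proof -
    have "?S (\<lambda>x y. complex_of_real ((cmod (u x - u y))\<^sup>2))
      = ?S (\<lambda>x y. cnj (u x) * (u x - u y) + cnj (u y) * (u y - u x))"
      by (simp only: complex_norm_square) (simp add: algebra_simps)
    also have "\<dots> = ?S (\<lambda>x y. cnj (u x) * (u x - u y)) + ?S (\<lambda>x y. cnj (u y) * (u y - u x))"
      by (simp only: sum.distrib)
    also have "?S (\<lambda>x y. cnj (u y) * (u y - u x)) = ?S (\<lambda>x y. cnj (u x) * (u x - u y))"
      by (rule swap)
    finally show ?thesis by simp
  qed
  have "(\<Sum>x\<in>UNIV. cnj (u x) * core_op E0 att u x)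
      = ?S (\<lambda>x y. cnj (u x) * (u x - u y))
        + (\<Sum>x\<in>UNIV. cnj (u x) * (\<Sum>\<alpha>\<in>UNIV. (if x = att \<alpha> then 1 else 0) * u x))"
    by (simp only: core_op_def distrib_left sum.distrib sum_distrib_left)
  then show ?thesis unfolding att
    using half by (simp add: distrib_left)
qed

text \<open>Zero energy makes \<open>u\<close> constant along edges and 0 at the attachment points;
  connectedness carries the value 0 to every vertex.\<close>

lemma core_op_injective:
  fixes u :: "'a::finite \<Rightarrow> complex" and att :: "'n::finite \<Rightarrow> 'a"
  assumes graph: "simple_connected_graph E0" and zero: "\<And>x. core_op E0 att u x = 0"
  shows "u x = 0"
proof -
  let ?A = "\<Sum>x\<in>UNIV. \<Sum>y | {x, y} \<in> E0. (cmod (u x - u y))\<^sup>2"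
  let ?B = "\<Sum>\<alpha>\<in>UNIV. (cmod (u (att \<alpha>)))\<^sup>2"
  have "complex_of_real (?A + 2 * ?B) = 0" unfolding core_op_energy[symmetric] by (simp add: zero)
  then have "?A + 2 * ?B = 0" using of_real_eq_0_iff by blast
  moreover have "?A \<ge> 0" "?B \<ge> 0" by (auto intro!: sum_nonneg)
  ultimately have A: "?A = 0" and B: "?B = 0" by linarith+
  have edge: "u a = u b" if "{a, b} \<in> E0" for a b
  proof -
    have "(\<Sum>y | {a, y} \<in> E0. (cmod (u a - u y))\<^sup>2) = 0"
      using A by (subst (asm) sum_nonneg_eq_0_iff) (auto intro!: sum_nonneg)
    then have "(cmod (u a - u b))\<^sup>2 = 0"
      using that by (subst (asm) sum_nonneg_eq_0_iff) auto
    then show ?thesis by simp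
  qed
  have att: "u (att \<alpha>) = 0" for \<alpha>
    using B by (subst (asm) sum_nonneg_eq_0_iff) auto
  \<comment> \<open>\<open>undefined\<close> serves as the name of some half-line: the index type is
    inhabited, so an attachment point exists.\<close>
  have "(att undefined, x) \<in> {(a, b). {a, b} \<in> E0}\<^sup>*"
    using graph unfolding simple_connected_graph_def by blast
  then have "u (att undefined) = u x"
    by (induction rule: rtrancl_induct) (auto dest: edge)
  then show ?thesis using att by simp
qed

text \<open>Functions on a finite vertex set form a finite-dimensional space; the passage to
  \<open>complex ^ 'a\<close> makes available that an injective endomorphism is surjective.\<close>

lemma bij_core_op:
  fixes att :: "'n::finite \<Rightarrow> 'a::finite"
  assumes graph: "simple_connected_graph E0"
  shows "bij (core_op E0 att)"
proof -
  define T :: "complex ^ 'a \<Rightarrow> complex ^ 'a" where "T v = (\<chi> x. core_op E0 att (\<lambda>y. v $ y) x)" for v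
  have add: "T (v + w) = T v + T w" for v w
    using core_op_add[of E0 att "($) v" "($) w"] by (simp add: T_def vec_eq_iff plus_fun_def)
  moreover have "T (r *\<^sub>R v) = r *\<^sub>R T v" for r v
    using core_op_scale[of E0 att "complex_of_real r" "($) v"]
    by (simp add: T_def vec_eq_iff scaleC_fun_def scaleC_complex_def scaleR_conv_of_real[where 'a=complex])
  ultimately have lin: "linear T" by (rule linearI)
  moreover have "inj T"
  proof (subst linear_injective_0[OF lin], intro allI impI)
    fix v assume "T v = 0"
    then have "core_op E0 att (\<lambda>y. v $ y) x = 0" for x by (simp add: T_def vec_eq_iff)
    from core_op_injective[OF graph this] show "v = 0" by (simp add: vec_eq_iff)
  qed
  ultimately have surj: "surj T" using linear_injective_imp_surjective[of T] by simp
  show ?thesis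
  proof (rule bijI)
    show "inj (core_op E0 att)"
    proof (rule injI)
      fix u w :: "'a \<Rightarrow> complex" assume uw: "core_op E0 att u = core_op E0 att w"
      have "core_op E0 att (u + (-1) *\<^sub>C w) x = 0" for x
        unfolding core_op_add core_op_scale uw by simp
      then have "(u + (-1) *\<^sub>C w) x = 0" for x by (rule core_op_injective[OF graph])
      then show "u = w" by (intro ext) simp
    qed
    show "surj (core_op E0 att)"
    proof (unfold surj_def, rule allI)
      fix u :: "'a \<Rightarrow> complex"
      obtain v where "T v = (\<chi> x. u x)" using surj by (metis surjD)
      then have "core_op E0 att (\<lambda>y. v $ y) = u" by (auto simp: T_def vec_eq_iff)
      then show "\<exists>w. u = core_op E0 att w" by blast
    qed
  qed
qed


section \<open>Recursions, bounds and asymptotics of the free coefficients\<close>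

section \<open>The free expansion coefficients\<close>

lemma free_op_add: "free_op E0 att (u + w) = free_op E0 att u + free_op E0 att w"
proof
  fix x show "free_op E0 att (u + w) x = (free_op E0 att u + free_op E0 att w) x"
  proof (cases x)
    case (Core y)
    then show ?thesis using core_op_add[of E0 att "\<lambda>y. u (Core y)" "\<lambda>y. w (Core y)"] by (simp add: plus_fun_def)
  next
    case (Ray \<alpha> k)
    then show ?thesis by (cases k) auto
  qed
qed

lemma free_op_scale: "free_op E0 att (c *\<^sub>C u) = c *\<^sub>C free_op E0 att u"
proof
  fix x show "free_op E0 att (c *\<^sub>C u) x = (c *\<^sub>C free_op E0 att u) x"
  proof (cases x)
    case (Core y)
    then show ?thesis using core_op_scale[of E0 att c "\<lambda>y. u (Core y)"] by (simp add: scaleC_fun_def scaleC_complex_def)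
  next
    case (Ray \<alpha> k)
    then show ?thesis by (cases k) (auto simp: algebra_simps)
  qed
qed

lemma free_op_minus: "free_op E0 att (- u) = - free_op E0 att u"
  using free_op_scale[of E0 att "-1" u] by (simp only: scaleC_fun_minus_one)

lemma free_op_diff: "free_op E0 att (u - w) = free_op E0 att u - free_op E0 att w"
  using free_op_add[of E0 att u "- w"] by (simp add: free_op_minus)

lemma free_op_zero [simp]: "free_op E0 att 0 = 0"
  using free_op_diff[of E0 att 0 0] by simp

lemma free_op_sum: "free_op E0 att (\<Sum>i\<in>I. f i) = (\<Sum>i\<in>I. free_op E0 att (f i))"
  by (induction I rule: infinite_finite_induct)
    (simp_all only: sum.infinite sum.empty sum.insert free_op_add free_op_zero not_False_eq_True simp_thms)

lemma free_op_nvec [simp]: "free_op E0 att (nvec \<alpha>) = 0"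
proof
  fix x show "free_op E0 att (nvec \<alpha>) x = 0 x"
  proof (cases x)
    case (Ray \<gamma> k)
    then show ?thesis by (cases k) auto
  qed (simp add: core_op_def)
qed

lemma free_op_onevec: "free_op E0 att (onevec \<alpha>) = rayfun \<alpha> (\<lambda>l. if l = 0 then 1 else 0)"
proof
  fix x show "free_op E0 att (onevec \<alpha>) x = rayfun \<alpha> (\<lambda>l. if l = 0 then 1 else 0) x"
  proof (cases x)
    case (Ray \<gamma> k)
    then show ?thesis by (cases k) auto
  qed (simp add: core_op_def)
qed

text \<open>The free equation is a second order recursion on the half-lines, so that a solution is
  determined by its values at the vertices adjacent to the core.\<close>

lemma free_op_unique:
  fixes u w :: "('a::finite, 'n::finite) gfun"
  assumes graph: "simple_connected_graph E0"
    and eq: "free_op E0 att u = free_op E0 att w" and init: "\<And>\<alpha>. u (Ray \<alpha> 0) = w (Ray \<alpha> 0)"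
  shows "u = w"
proof -
  define z where "z = u - w"
  have z: "free_op E0 att z = 0" by (simp add: z_def free_op_diff eq)
  have z0: "z (Ray \<alpha> 0) = 0" for \<alpha> by (simp add: z_def init)
  have "z x = 0" for x
  proof (cases x)
    case (Core y)
    have "core_op E0 att (\<lambda>y. z (Core y)) y = 0" for y using fun_cong[OF z, of "Core y"] by simp
    from core_op_injective[OF graph this] show ?thesis using Core by simp
  next
    case (Ray \<alpha> k)
    have "z (Ray \<alpha> k) = 0 \<and> z (Ray \<alpha> (Suc k)) = 0"
    proof (induction k)
      case 0
      then show ?case using z0 fun_cong[OF z, of "Ray \<alpha> 0"] by simp
    next
      case (Suc k)
      then show ?case using fun_cong[OF z, of "Ray \<alpha> (Suc k)"] by simp
    qed
    then show ?thesis using Ray by simp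
  qed
  then show ?thesis by (intro ext) (simp add: z_def)
qed

text \<open>\<open>k\<close> is the vertex number, so the row at \<open>Ray \<alpha> k\<close>
  carries the index \<open>Suc k\<close>. Index 0 stands for the Dirichlet point before the
  half-line, where the kernels with \<open>j \<le> 3\<close> vanish; it spares a separate recursion
  at the first vertex.\<close>

definition ray_kernel_fun :: "nat \<Rightarrow> 'n \<Rightarrow> nat \<Rightarrow> ('a, 'n) gfun"
  where "ray_kernel_fun j \<alpha> k = rayfun \<alpha> (\<lambda>l. complex_of_real (ray_kernel j (real k) (real (Suc l))))"

lemma free_coeff_Ray: "free_coeff E0 att j u (Ray \<alpha> k) = bracket (ray_kernel_fun j \<alpha> (Suc k)) u"
  by (simp add: ray_kernel_fun_def bracket_rayfun)

lemma ray_kernel_zero: "j \<le> 3 \<Longrightarrow> 0 \<le> m \<Longrightarrow> ray_kernel j 0 m = 0"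
proof -
  assume "j \<le> 3" "0 \<le> m"
  moreover have "j = 0 \<or> j = 1 \<or> j = 2 \<or> j = 3" using \<open>j \<le> 3\<close> by linarith
  ultimately show ?thesis by (auto simp: ray_kernel_def)
qed

lemma ray_kernel_fun_zero: "j \<le> 3 \<Longrightarrow> ray_kernel_fun j \<alpha> 0 = 0"
proof
  fix x assume "j \<le> 3"
  then show "ray_kernel_fun j \<alpha> 0 x = 0 x" by (cases x) (auto simp: ray_kernel_fun_def ray_kernel_zero)
qed

text \<open>The exponent of \<open>n\<close> is at least 1 because already the minimum of
  \<open>n\<close> and \<open>m\<close> may grow like \<open>n\<close>;
  \<open>ray_kernel_0_bound\<close> trades this growth for a power of \<open>m\<close>.\<close>

lemma ray_kernel_bound:
  fixes n m :: real
  assumes j: "j \<le> 3" and n: "1 \<le> n" and m: "1 \<le> m"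
  shows "\<bar>ray_kernel j n m\<bar> \<le> n ^ max 1 j * m ^ j"
proof -
  have nm: "1 \<le> n * m" using mult_mono[of 1 n 1 m] n m by simp
  have mx: "max n m \<le> n * m" "min n m \<le> n * m" "0 < max n m" "0 < min n m"
    using n m mult_mono[of 1 n m m] mult_mono[of n n 1 m] by (auto simp: max_def min_def)
  have sq: "n * m \<le> (n * m)\<^sup>2" "n * m \<le> (n * m) ^ 3" using nm power_increasing[of 1 2 "n * m"] power_increasing[of 1 3 "n * m"] by auto
  have "j = 0 \<or> j = 1 \<or> j = 2 \<or> j = 3" using j by linarith
  then show ?thesis
  proof (elim disjE)
    assume j: "j = 2"
    have prod: "min n m * max n m = n * m" by (simp add: min_def max_def)
    have c: "(min n m) ^ 3 \<le> (n * m)\<^sup>2"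
    proof -
      have "(min n m) ^ 3 = min n m * (min n m * min n m)" by (simp add: power3_eq_cube)
      also have "\<dots> \<le> (n * m) * (n * m)" using n m by (intro mult_mono mx) auto
      finally show ?thesis by (simp add: power2_eq_square)
    qed
    have d: "n * m * max n m \<le> (n * m)\<^sup>2"
      using mult_left_mono[OF mx(1), of "n * m"] nm by (simp add: power2_eq_square)
    have nn: "0 \<le> (min n m) ^ 3" "0 \<le> n * m * max n m" "0 \<le> min n m" using n m by auto
    have "ray_kernel 2 n m = - (1/6) * min n m + (1/6) * (min n m) ^ 3 + (1/2) * (n * m * max n m)"
      by (simp add: ray_kernel_def)
    then have "\<bar>ray_kernel 2 n m\<bar> \<le> (n * m)\<^sup>2"
      using nn c d mx(2) sq(1) unfolding abs_le_iff by linarith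
    then show ?thesis using j by (simp add: power2_eq_square mult_ac)
  next
    assume j: "j = 3"
    have n3: "n \<le> n ^ 3" "m \<le> m ^ 3" using n m power_increasing[of 1 3 n] power_increasing[of 1 3 m] by auto
    have "n ^ 3 * m \<le> n ^ 3 * m ^ 3" "n * m ^ 3 \<le> n ^ 3 * m ^ 3" "0 \<le> n ^ 3 * m" "0 \<le> n * m ^ 3" "0 \<le> n * m"
      using n m n3 by (auto intro: mult_mono)
    then show ?thesis using j sq(2) by (simp add: ray_kernel_def power_mult_distrib abs_le_iff)
  qed (use n m in \<open>auto simp: ray_kernel_def\<close>)
qed

lemma ray_kernel_0_bound: "1 \<le> n \<Longrightarrow> 1 \<le> m \<Longrightarrow> \<bar>ray_kernel 0 n m\<bar> \<le> m"
  by (auto simp: ray_kernel_def)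

lemma ray_kernel_fun_bound:
  assumes j: "j \<le> 3"
  shows "cmod (ray_kernel_fun j \<alpha> (Suc k) x) \<le> real (Suc k) ^ max 1 j * weight (real j) x"
  unfolding ray_kernel_fun_def
  by (rule rayfun_bound) (use ray_kernel_bound[OF j] in \<open>simp add: norm_of_real\<close>)

lemma ray_kernel_fun_0_bound: "cmod (ray_kernel_fun 0 \<alpha> (Suc k) x) \<le> 1 * weight (real 1) x"
  unfolding ray_kernel_fun_def
  by (rule rayfun_bound) (use ray_kernel_0_bound in \<open>simp add: norm_of_real\<close>)

lemma ray_kernel_fun_pairable:
  assumes "j \<le> 3" "u \<in> lone (real j)" shows "pairable (ray_kernel_fun j \<alpha> k) u"
proof (cases k)
  case 0
  then show ?thesis by (simp add: ray_kernel_fun_zero[OF assms(1)] pairable_def)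
next
  case (Suc l)
  then show ?thesis
    using pairable_linf_lone[OF linfI[OF ray_kernel_fun_bound[OF assms(1)]] assms(2)] by simp
qed

lemma finite_core_bound: "\<exists>D\<ge>0. \<forall>x::'a::finite. cmod (f x) \<le> D"
  by (rule exI[of _ "\<Sum>x\<in>UNIV. cmod (f x)"]) (auto intro!: member_le_sum sum_nonneg)

lemma free_coeff_linf:
  fixes u :: "('a::finite, 'n::finite) gfun"
  assumes j: "j \<le> 3" and u: "u \<in> lone (real j)"
  shows "free_coeff E0 att j u \<in> linf (- real (max 1 j))"
proof -
  obtain D where D: "D \<ge> 0" "\<And>x. cmod (free_coeff E0 att j u (Core x)) \<le> D"
    using finite_core_bound[of "\<lambda>x. free_coeff E0 att j u (Core x)"] by auto
  have "cmod (free_coeff E0 att j u x) \<le> (D + lone_norm (real j) u) * weight (real (max 1 j)) x" for x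
  proof (cases x)
    case (Core y)
    then show ?thesis using D(2)[of y] lone_norm_nonneg[of "real j" u] by simp
  next
    case (Ray \<alpha> k)
    have "cmod (free_coeff E0 att j u x) \<le> real (Suc k) ^ max 1 j * lone_norm (real j) u"
      unfolding Ray free_coeff_Ray by (rule bracket_bound'[OF u ray_kernel_fun_bound[OF j]])
    also have "\<dots> \<le> weight (real (max 1 j)) x * lone_norm (real j) u"
      unfolding Ray by (intro mult_right_mono weight_ge_power lone_norm_nonneg)
    also have "\<dots> \<le> (D + lone_norm (real j) u) * weight (real (max 1 j)) x"
      using D(1) by (simp add: algebra_simps del: weight.simps)
    finally show ?thesis .
  qed
  then show ?thesis by (rule linfI)
qed

lemma free_coeff_0_Ray_bound:
  "u \<in> lone 1 \<Longrightarrow> cmod (free_coeff E0 att 0 u (Ray \<alpha> k)) \<le> lone_norm 1 u"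
  using bracket_bound'[of u "real 1", OF _ ray_kernel_fun_0_bound[of \<alpha> k]]
  unfolding free_coeff_Ray by simp

text \<open>One power of decay of \<open>u\<close> is spent on \<open>min n m \<le> m\<close>, which
  bounds the kernel row uniformly in the vertex \<open>n\<close>.\<close>

lemma free_coeff_0_bounded:
  fixes u :: "('a::finite, 'n::finite) gfun"
  assumes u: "u \<in> lone 1"
  shows "free_coeff E0 att 0 u \<in> linf (- 0)"
proof -
  obtain D where D: "D \<ge> 0" "\<And>x. cmod (free_coeff E0 att 0 u (Core x)) \<le> D"
    using finite_core_bound[of "\<lambda>x. free_coeff E0 att 0 u (Core x)"] by auto
  have "cmod (free_coeff E0 att 0 u x) \<le> (D + lone_norm 1 u) * weight 0 x" for x
  proof (cases x)
    case (Core y)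
    then show ?thesis using D(2)[of y] lone_norm_nonneg[of 1 u] by simp
  next
    case (Ray \<alpha> k)
    then show ?thesis using free_coeff_0_Ray_bound[OF u, of E0 att \<alpha> k] D(1)
      by (simp del: free_coeff.simps weight.simps)
  qed
  then show ?thesis by (rule linfI)
qed

text \<open>The kernel \<open>- n m\<close> factorizes and the core contributes nothing at odd
  order, so the operator has finite rank.\<close>

lemma free_coeff_1: "free_coeff E0 att 1 u = - (\<Sum>\<alpha>\<in>UNIV. bracket (nvec \<alpha>) u *\<^sub>C nvec \<alpha>)"
proof
  fix x
  show "free_coeff E0 att 1 u x = (- (\<Sum>\<alpha>\<in>UNIV. bracket (nvec \<alpha>) u *\<^sub>C nvec \<alpha>)) x"
  proof (cases x)
    case (Core y)
    then show ?thesis by (simp add: core_coeff_def sum_fun_apply fun_Compl_def)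
  next
    case (Ray \<alpha> k)
    have eq: "ray_kernel_fun 1 \<alpha> (Suc k) = (- of_nat (Suc k)) *\<^sub>C (nvec \<alpha> :: ('a, 'b) gfun)"
    proof
      show "ray_kernel_fun 1 \<alpha> (Suc k) x = ((- of_nat (Suc k)) *\<^sub>C (nvec \<alpha> :: ('a, 'b) gfun)) x" for x
        by (cases x) (auto simp: ray_kernel_fun_def ray_kernel_def algebra_simps)
    qed
    have "(\<Sum>\<gamma>\<in>UNIV. bracket (nvec \<gamma>) u * nvec \<gamma> (Ray \<alpha> k :: ('a, 'b) vertex)) = bracket (nvec \<alpha>) u * of_nat (Suc k)"
    proof -
      have "(\<Sum>\<gamma>\<in>UNIV. bracket (nvec \<gamma>) u * nvec \<gamma> (Ray \<alpha> k :: ('a, 'b) vertex))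
          = (\<Sum>\<gamma>\<in>UNIV. if \<gamma> = \<alpha> then bracket (nvec \<alpha>) u * of_nat (Suc k) else 0)"
        by (intro sum.cong) auto
      then show ?thesis by (simp only: sum.delta[OF finite] UNIV_I if_True)
    qed
    moreover have "free_coeff E0 att 1 u (Ray \<alpha> k) = - (of_nat (Suc k) * bracket (nvec \<alpha>) u)"
      by (simp only: free_coeff_Ray eq bracket_scale_left) (simp add: algebra_simps)
    ultimately show ?thesis unfolding Ray by (simp add: sum_fun_apply fun_Compl_def mult.commute)
  qed
qed

text \<open>The two polynomial branches of the kernel agree at \<open>n = m + 1\<close>, so a second
  difference centred at \<open>n \<le> m\<close> can be computed from this branch alone.\<close>

lemma ray_kernel_2_low:
  assumes "n \<le> Suc m"
  shows "ray_kernel 2 (real n) (real m) = - (1/6) * real n + (1/6) * real n ^ 3 + (1/2) * real n * (real m)\<^sup>2"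
proof (cases "n \<le> m")
  case True
  then show ?thesis by (simp add: ray_kernel_def max_def min_def power2_eq_square)
next
  case False
  then have "n = Suc m" using assms by simp
  then show ?thesis
    by (simp add: ray_kernel_def max_def min_def power2_eq_square power3_eq_cube field_simps)
qed

lemma ray_kernel_2_high:
  assumes "m \<le> Suc n"
  shows "ray_kernel 2 (real n) (real m) = - (1/6) * real m + (1/6) * real m ^ 3 + (1/2) * (real n)\<^sup>2 * real m"
proof (cases "m \<le> n")
  case True
  then show ?thesis by (simp add: ray_kernel_def max_def min_def power2_eq_square)
next
  case False
  then have "m = Suc n" using assms by simp
  then show ?thesis
    by (simp add: ray_kernel_def max_def min_def power2_eq_square power3_eq_cube field_simps)
qed

text \<open>Comparison of powers of kappa in (h + kappa^2) g(kappa) = I for the Dirichlet half-line: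
  the second difference in the first variable sends order 0 to the identity, order 1 to 0, and
  orders 2 and 3 to minus the orders 0 and 1.\<close>

lemma ray_kernel_recursion:
  fixes k m :: nat
  defines "D \<equiv> \<lambda>j. 2 * ray_kernel j (real (Suc k)) (real m) - ray_kernel j (real (Suc (Suc k))) (real m)
    - ray_kernel j (real k) (real m)"
  shows "D 0 = (if m = Suc k then 1 else 0)" "D 1 = 0"
    "D 2 = - ray_kernel 0 (real (Suc k)) (real m)" "D 3 = - ray_kernel 1 (real (Suc k)) (real m)"
proof -
  show "D 0 = (if m = Suc k then 1 else 0)" unfolding D_def ray_kernel_def
    by (cases m "Suc k" rule: linorder_cases) (auto simp: min_def)
  show "D 1 = 0" unfolding D_def ray_kernel_def by (simp add: algebra_simps)
  show "D 3 = - ray_kernel 1 (real (Suc k)) (real m)" unfolding D_def ray_kernel_def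
    by (simp add: field_simps power3_eq_cube)
  show "D 2 = - ray_kernel 0 (real (Suc k)) (real m)"
  proof (cases "Suc k \<le> m")
    case True
    then show ?thesis unfolding D_def
      by (subst (1 2 3) ray_kernel_2_low)
        (auto simp: ray_kernel_def[of 0] field_simps power2_eq_square power3_eq_cube)
  next
    case False
    then show ?thesis unfolding D_def
      by (subst (1 2 3) ray_kernel_2_high)
        (auto simp: ray_kernel_def[of 0] field_simps power2_eq_square power3_eq_cube)
  qed
qed

lemma ray_kernel_fun_recursion:
  fixes \<alpha> :: 'm and k :: nat
  defines "D \<equiv> \<lambda>j. 2 *\<^sub>C ray_kernel_fun j \<alpha> (Suc k) - ray_kernel_fun j \<alpha> (Suc (Suc k)) - (ray_kernel_fun j \<alpha> k :: ('b, 'm) gfun)"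
  shows "D 0 = rayfun \<alpha> (\<lambda>l. if l = k then 1 else 0)" "D 1 = 0"
    "D 2 = - ray_kernel_fun 0 \<alpha> (Suc k)" "D 3 = - ray_kernel_fun 1 \<alpha> (Suc k)"
proof -
  have *: "D j = rayfun \<alpha> (\<lambda>l. complex_of_real (2 * ray_kernel j (real (Suc k)) (real (Suc l))
      - ray_kernel j (real (Suc (Suc k))) (real (Suc l)) - ray_kernel j (real k) (real (Suc l))))" for j
  proof
    fix x show "D j x = rayfun \<alpha> (\<lambda>l. complex_of_real (2 * ray_kernel j (real (Suc k)) (real (Suc l))
      - ray_kernel j (real (Suc (Suc k))) (real (Suc l)) - ray_kernel j (real k) (real (Suc l)))) x"
      unfolding D_def by (cases x) (simp_all add: ray_kernel_fun_def del: of_nat_Suc)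
  qed
  show "D 0 = rayfun \<alpha> (\<lambda>l. if l = k then 1 else 0)"
    unfolding * ray_kernel_recursion by (rule arg_cong[where f="rayfun \<alpha>"]) auto
  have neg: "rayfun \<alpha> (\<lambda>l. complex_of_real (- f l)) = - rayfun \<alpha> (\<lambda>l. complex_of_real (f l))" for f
  proof
    show "rayfun \<alpha> (\<lambda>l. complex_of_real (- f l)) x = (- rayfun \<alpha> (\<lambda>l. complex_of_real (f l))) x" for x
      by (cases x) auto
  qed
  show "D 1 = 0"
  proof
    show "D 1 x = 0 x" for x unfolding * ray_kernel_recursion by (cases x) auto
  qed
  show "D 2 = - ray_kernel_fun 0 \<alpha> (Suc k)" "D 3 = - ray_kernel_fun 1 \<alpha> (Suc k)"
    unfolding * ray_kernel_recursion neg ray_kernel_fun_def by simp_all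
qed

text \<open>The first row of the kernel. Pairing with it gives the value of
  \<open>free_coeff\<close> at the vertex next to the core, which is the datum that
  \<open>free_op_unique\<close> asks for.\<close>

definition init_fun :: "nat \<Rightarrow> 'm \<Rightarrow> ('b, 'm) gfun"
  where "init_fun j \<alpha> = ray_kernel_fun j \<alpha> 1"

lemma free_coeff_init: "free_coeff E0 att j u (Ray \<alpha> 0) = bracket (init_fun j \<alpha>) u"
  by (simp add: free_coeff_Ray init_fun_def del: free_coeff.simps)

lemma init_fun_0: "init_fun 0 \<alpha> = onevec \<alpha>"
  unfolding init_fun_def ray_kernel_fun_def onevec_rayfun
  by (rule arg_cong[where f="rayfun \<alpha>"]) (auto simp: ray_kernel_def)

lemma init_fun_1: "init_fun 1 \<alpha> = - nvec \<alpha>"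
proof
  show "init_fun 1 \<alpha> x = (- nvec \<alpha>) x" for x
    by (cases x) (auto simp: init_fun_def ray_kernel_fun_def ray_kernel_def)
qed

lemma infsum_finite_sum:
  fixes f :: "'i \<Rightarrow> 'x \<Rightarrow> real"
  assumes "finite I" "\<And>i. i \<in> I \<Longrightarrow> f i summable_on A"
  shows "(\<lambda>x. \<Sum>i\<in>I. f i x) summable_on A \<and> infsum (\<lambda>x. \<Sum>i\<in>I. f i x) A = (\<Sum>i\<in>I. infsum (f i) A)"
  using assms
proof (induction I)
  case (insert i I)
  then have "f i summable_on A" "(\<lambda>x. \<Sum>i\<in>I. f i x) summable_on A" by auto
  then show ?case using insert by (simp add: infsum_add summable_on_add)
qed simp

text \<open>At most \<open>l\<close> vertices contribute, each with a factor at most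
  \<open>l\<close> and a weight at most that of \<open>l\<close>, so two powers of the weight are
  spent. This is the loss from \<open>\<beta>\<close> to \<open>\<beta> - 2\<close> in the function
  spaces.\<close>

lemma weighted_tail_sum_bound:
  assumes s: "2 \<le> s" and X: "finite X"
  shows "(\<Sum>k\<in>X. weight (s - 2) (Ray \<alpha> k :: ('b, 'm) vertex) * (if k < l then real (l - k) else 0))
    \<le> weight s (Ray \<alpha> l :: ('b, 'm) vertex)"
proof -
  let ?w = "\<lambda>t k. weight t (Ray \<alpha> k :: ('b, 'm) vertex)"
  have mono: "?w (s - 2) k \<le> ?w (s - 2) l" if "k \<le> l" for k
  proof -
    have "vweight (Ray \<alpha> k :: ('b, 'm) vertex) \<le> vweight (Ray \<alpha> l :: ('b, 'm) vertex)"
      using that by (simp add: power_mono)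
    then show ?thesis
      unfolding weight_eq using s less_imp_le[OF vweight_pos] by (intro powr_mono2) auto
  qed
  have "(\<Sum>k\<in>X. ?w (s - 2) k * (if k < l then real (l - k) else 0))
      = (\<Sum>k\<in>X. if k \<in> {..<l} then ?w (s - 2) k * real (l - k) else 0)"
    by (intro sum.cong) (auto simp del: weight.simps)
  also have "\<dots> = (\<Sum>k\<in>X \<inter> {..<l}. ?w (s - 2) k * real (l - k))"
    by (rule sum.inter_restrict[OF X, symmetric])
  also have "\<dots> \<le> (\<Sum>k\<in>X \<inter> {..<l}. ?w (s - 2) l * real l)"
    by (intro sum_mono mult_mono mono) auto
  also have "\<dots> \<le> (\<Sum>k\<in>{..<l}. ?w (s - 2) l * real l)"
    by (intro sum_mono2) auto
  also have "\<dots> = ?w (s - 2) l * (real l) ^ 2" by (simp add: power2_eq_square)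
  also have "\<dots> \<le> ?w (s - 2) l * ?w 2 l"
  proof (intro mult_left_mono)
    have "(real l)\<^sup>2 \<le> (real (Suc l))\<^sup>2" by (intro power_mono) auto
    also have "\<dots> \<le> ?w (real 2) l" by (rule weight_ge_power)
    finally show "(real l)\<^sup>2 \<le> ?w 2 l" by simp
  qed simp
  also have "\<dots> = ?w s l" using weight_add[of "s - 2" 2 "Ray \<alpha> l :: ('b, 'm) vertex"] by (simp del: weight.simps)
  finally show ?thesis .
qed

text \<open>On a half-line \<open>min n m = m - max 0 (m - n)\<close>. The first summand gives the
  constant limit; the second sees only the part of \<open>u\<close> beyond \<open>n\<close>, and
  exchanging the order of summation costs two powers of the weight.\<close>

theorem free_coeff_0_asymptotics:
  fixes u :: "('a::finite, 'n::finite) gfun"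
  assumes s: "2 \<le> s" and u: "u \<in> lone s"
  shows "free_coeff E0 att 0 u - (\<Sum>\<alpha>\<in>UNIV. bracket (nvec \<alpha>) u *\<^sub>C onevec \<alpha>) \<in> lone (s - 2)"
proof -
  let ?w = "\<lambda>\<alpha> t k. weight t (Ray \<alpha> k :: ('a, 'n) vertex)"
  define z where "z = free_coeff E0 att 0 u - (\<Sum>\<alpha>\<in>UNIV. bracket (nvec \<alpha>) u *\<^sub>C onevec \<alpha>)"
  \<comment> \<open>The vertex numbers are \<open>Suc k\<close> and \<open>Suc l\<close>, whose
    difference is \<open>l - k\<close>; for \<open>l \<le> k\<close> the kernel row already equals
    its limit.\<close>
  define t where "t k l = (if k < l then real (l - k) else 0)" for k l :: nat
  have usum: "(\<lambda>l. ?w \<alpha> s l * cmod (u (Ray \<alpha> l))) summable_on UNIV" for \<alpha>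
    using u summable_rays_iff[of "\<lambda>x. weight s x * cmod (u x)"] by (simp add: lone_def del: weight.simps)
  have zeq: "z (Ray \<alpha> k) = bracket (rayfun \<alpha> (\<lambda>l. complex_of_real (- t k l))) u" for \<alpha> k
  proof -
    have "(\<Sum>\<gamma>\<in>UNIV. bracket (nvec \<gamma>) u * onevec \<gamma> (Ray \<alpha> k :: ('a, 'n) vertex)) = bracket (nvec \<alpha>) u"
    proof -
      have "(\<Sum>\<gamma>\<in>UNIV. bracket (nvec \<gamma>) u * onevec \<gamma> (Ray \<alpha> k :: ('a, 'n) vertex))
          = (\<Sum>\<gamma>\<in>UNIV. if \<gamma> = \<alpha> then bracket (nvec \<alpha>) u else 0)"
        by (intro sum.cong) auto
      then show ?thesis by (simp only: sum.delta[OF finite] UNIV_I if_True)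
    qed
    then have "z (Ray \<alpha> k) = bracket (ray_kernel_fun 0 \<alpha> (Suc k)) u - bracket (nvec \<alpha>) u"
      by (simp add: z_def free_coeff_Ray sum_fun_apply del: free_coeff.simps)
    also have "\<dots> = bracket (ray_kernel_fun 0 \<alpha> (Suc k) - nvec \<alpha>) u"
    proof (rule bracket_diff_left[symmetric])
      show "pairable (ray_kernel_fun 0 \<alpha> (Suc k)) u"
        using u s by (intro ray_kernel_fun_pairable) (auto intro: lone_mono)
      show "pairable (nvec \<alpha>) u"
        by (rule pairable_linf_lone[OF nvec_linf u]) (use s in simp)
    qed
    also have "ray_kernel_fun 0 \<alpha> (Suc k) - nvec \<alpha> = rayfun \<alpha> (\<lambda>l. complex_of_real (- t k l))"
    proof
      show "(ray_kernel_fun 0 \<alpha> (Suc k) - nvec \<alpha>) x = rayfun \<alpha> (\<lambda>l. complex_of_real (- t k l)) x" for x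
        by (cases x) (auto simp: ray_kernel_fun_def ray_kernel_def t_def of_nat_diff min_def)
    qed
    finally show ?thesis .
  qed
  have tle: "t k l \<le> ?w \<alpha> s l" for k l \<alpha>
  proof -
    have "t k l \<le> real (Suc l) ^ 2"
    proof -
      have "t k l \<le> real (Suc l)" by (auto simp: t_def)
      also have "\<dots> \<le> real (Suc l) ^ 2" by (simp add: power2_eq_square)
      finally show ?thesis .
    qed
    also have "\<dots> \<le> ?w \<alpha> (real 2) l" by (rule weight_ge_power)
    also have "\<dots> \<le> ?w \<alpha> s l" using s by (intro weight_mono) simp
    finally show ?thesis .
  qed
  have t0: "0 \<le> t k l" for k l by (simp add: t_def)
  have tsum: "(\<lambda>l. t k l * cmod (u (Ray \<alpha> l))) summable_on UNIV" for k \<alpha>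
    by (rule summable_on_comparison_test[OF usum[of \<alpha>]]) (use t0 tle in \<open>auto intro: mult_right_mono simp del: weight.simps\<close>)
  have zb: "cmod (z (Ray \<alpha> k)) \<le> (\<Sum>\<^sub>\<infinity>l. t k l * cmod (u (Ray \<alpha> l)))" for \<alpha> k
  proof -
    have "cmod (\<Sum>\<^sub>\<infinity>l. cnj (complex_of_real (- t k l)) * u (Ray \<alpha> l))
        \<le> (\<Sum>\<^sub>\<infinity>l. cmod (cnj (complex_of_real (- t k l)) * u (Ray \<alpha> l)))"
      by (rule norm_infsum_bound) (use tsum[of k \<alpha>] t0 in \<open>simp add: norm_mult\<close>)
    then show ?thesis unfolding zeq bracket_rayfun using t0 by (simp add: norm_mult)
  qed
  have "(\<lambda>k. ?w \<alpha> (s - 2) k * cmod (z (Ray \<alpha> k))) summable_on UNIV" for \<alpha>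
  proof (rule nonneg_bdd_above_summable_on)
    show "bdd_above (sum (\<lambda>k. ?w \<alpha> (s - 2) k * cmod (z (Ray \<alpha> k))) ` {F. F \<subseteq> UNIV \<and> finite F})"
    proof (rule bdd_aboveI2[where M="\<Sum>\<^sub>\<infinity>l. ?w \<alpha> s l * cmod (u (Ray \<alpha> l))"])
      fix X :: "nat set" assume "X \<in> {F. F \<subseteq> UNIV \<and> finite F}"
      then have X: "finite X" by simp
      let ?f = "\<lambda>k l. ?w \<alpha> (s - 2) k * (t k l * cmod (u (Ray \<alpha> l)))"
      have fs: "?f k summable_on UNIV" for k by (rule summable_on_cmult_right[OF tsum])
      have "(\<Sum>k\<in>X. ?w \<alpha> (s - 2) k * cmod (z (Ray \<alpha> k)))
          \<le> (\<Sum>k\<in>X. ?w \<alpha> (s - 2) k * (\<Sum>\<^sub>\<infinity>l. t k l * cmod (u (Ray \<alpha> l))))"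
        by (intro sum_mono mult_left_mono zb) simp
      also have "\<dots> = (\<Sum>k\<in>X. infsum (?f k) UNIV)"
        by (intro sum.cong refl infsum_cmult_right[symmetric] tsum)
      also have "\<dots> = (\<Sum>\<^sub>\<infinity>l. \<Sum>k\<in>X. ?f k l)"
        using infsum_finite_sum[OF X fs] by simp
      also have "\<dots> \<le> (\<Sum>\<^sub>\<infinity>l. ?w \<alpha> s l * cmod (u (Ray \<alpha> l)))"
      proof (rule infsum_mono)
        show "(\<lambda>l. \<Sum>k\<in>X. ?f k l) summable_on UNIV" using infsum_finite_sum[OF X fs] by simp
        fix l
        have "(\<Sum>k\<in>X. ?f k l) = (\<Sum>k\<in>X. ?w \<alpha> (s - 2) k * t k l) * cmod (u (Ray \<alpha> l))"
          by (simp add: sum_distrib_right mult.assoc del: weight.simps)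
        also have "\<dots> \<le> ?w \<alpha> s l * cmod (u (Ray \<alpha> l))"
          using weighted_tail_sum_bound[OF s X, of \<alpha> l] unfolding t_def by (intro mult_right_mono) auto
        finally show "(\<Sum>k\<in>X. ?f k l) \<le> ?w \<alpha> s l * cmod (u (Ray \<alpha> l))" .
      qed (rule usum)
      finally show "(\<Sum>k\<in>X. ?w \<alpha> (s - 2) k * cmod (z (Ray \<alpha> k))) \<le> (\<Sum>\<^sub>\<infinity>l. ?w \<alpha> s l * cmod (u (Ray \<alpha> l)))" .
    qed
  qed simp
  then show ?thesis using summable_rays_iff[of "\<lambda>x. weight (s - 2) x * cmod (z x)"]
    unfolding z_def[symmetric] lone_def mem_Collect_eq by (simp del: weight.simps)
qed

context
  fixes E0 :: "'a::finite set set" and att :: "'n::finite \<Rightarrow> 'a"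
  assumes graph: "simple_connected_graph E0"
begin

lemma core_op_inv: "core_op E0 att (inv (core_op E0 att) u) = u"
  using bij_core_op[OF graph, of att] by (simp add: bij_is_surj surj_f_inv_f)

lemma inv_core_op: "inv (core_op E0 att) (core_op E0 att u) = u"
  using bij_core_op[OF graph, of att] by (simp add: bij_is_inj)

lemma inv_core_op_add: "inv (core_op E0 att) (u + w) = inv (core_op E0 att) u + inv (core_op E0 att) w"
proof -
  have "core_op E0 att (inv (core_op E0 att) u + inv (core_op E0 att) w) = u + w"
    by (rule ext) (simp add: core_op_add core_op_inv)
  then show ?thesis by (metis inv_core_op)
qed

lemma inv_core_op_scale: "inv (core_op E0 att) (c *\<^sub>C u) = c *\<^sub>C inv (core_op E0 att) u"
proof -
  have "core_op E0 att (c *\<^sub>C inv (core_op E0 att) u) = c *\<^sub>C u"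
    by (rule ext) (simp add: core_op_scale core_op_inv)
  then show ?thesis by (metis inv_core_op)
qed

lemma core_coeff_simps:
  "core_coeff E0 att 0 u = inv (core_op E0 att) u"
  "core_coeff E0 att 1 u = 0"
  "core_coeff E0 att 2 u = - inv (core_op E0 att) (inv (core_op E0 att) u)"
  "core_coeff E0 att 3 u = 0"
  "core_coeff E0 att (Suc 0) u = 0"
proof -
  have "f ^^ 2 = f \<circ> f" for f :: "('a \<Rightarrow> complex) \<Rightarrow> ('a \<Rightarrow> complex)" by (simp add: numeral_2_eq_2)
  then show "core_coeff E0 att 2 u = - inv (core_op E0 att) (inv (core_op E0 att) u)"
    by (auto simp: core_coeff_def scaleC_fun_def scaleC_complex_def)
qed (auto simp: core_coeff_def scaleC_fun_def scaleC_complex_def)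

lemma core_coeff_add: "j \<le> 3 \<Longrightarrow> core_coeff E0 att j (u + w) = core_coeff E0 att j u + core_coeff E0 att j w"
proof -
  assume "j \<le> 3"
  then have "j = 0 \<or> j = 1 \<or> j = 2 \<or> j = 3" by linarith
  then show ?thesis by (elim disjE) (simp_all only: core_coeff_simps inv_core_op_add, simp_all)
qed

lemma core_coeff_scale: "j \<le> 3 \<Longrightarrow> core_coeff E0 att j (c *\<^sub>C u) = c *\<^sub>C core_coeff E0 att j u"
proof -
  assume "j \<le> 3"
  then have "j = 0 \<or> j = 1 \<or> j = 2 \<or> j = 3" by linarith
  then show ?thesis
    by (elim disjE) (simp_all only: core_coeff_simps inv_core_op_scale,
      auto simp: scaleC_fun_def scaleC_complex_def fun_Compl_def zero_fun_def)
qed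

lemma free_coeff_add:
  assumes "j \<le> 3" "u \<in> lone (real j)" "w \<in> lone (real j)"
  shows "free_coeff E0 att j (u + w) = free_coeff E0 att j u + free_coeff E0 att j w"
proof
  fix x
  show "free_coeff E0 att j (u + w) x = (free_coeff E0 att j u + free_coeff E0 att j w) x"
  proof (cases x)
    case (Core y)
    then show ?thesis using fun_cong[OF core_coeff_add[OF assms(1), of "\<lambda>y. u (Core y)" "\<lambda>y. w (Core y)"], of y]
      by (simp add: plus_fun_def)
  next
    case (Ray \<alpha> k)
    then show ?thesis
      by (simp only: free_coeff_Ray plus_fun_apply bracket_add_right ray_kernel_fun_pairable assms)
  qed
qed

lemma free_coeff_scale: "j \<le> 3 \<Longrightarrow> free_coeff E0 att j (c *\<^sub>C u) = c *\<^sub>C free_coeff E0 att j u"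
proof
  fix x assume j: "j \<le> 3"
  show "free_coeff E0 att j (c *\<^sub>C u) x = (c *\<^sub>C free_coeff E0 att j u) x"
  proof (cases x)
    case (Core y)
    then show ?thesis using fun_cong[OF core_coeff_scale[OF j, of c "\<lambda>y. u (Core y)"], of y]
      by (simp add: scaleC_fun_def scaleC_complex_def)
  next
    case (Ray \<alpha> k)
    then show ?thesis by (simp only: free_coeff_Ray scaleC_fun_apply bracket_scale_right)
  qed
qed

lemma free_coeff_minus: "j \<le> 3 \<Longrightarrow> free_coeff E0 att j (- u) = - free_coeff E0 att j u"
  using free_coeff_scale[of j "-1" u] by (simp only: scaleC_fun_minus_one)

lemma free_coeff_diff:
  assumes "j \<le> 3" "u \<in> lone (real j)" "w \<in> lone (real j)"
  shows "free_coeff E0 att j (u - w) = free_coeff E0 att j u - free_coeff E0 att j w"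
  using free_coeff_add[of j u "- w"] assms lone_minus[of w "real j"] by (simp add: free_coeff_minus)

text \<open>Kernel rows with index 0 vanish, so the same three-term combination is valid at the
  first vertex of the half-line.\<close>

lemma free_op_free_coeff_Ray:
  assumes j: "j \<le> 3" and u: "u \<in> lone (real j)"
  shows "free_op E0 att (free_coeff E0 att j u) (Ray \<alpha> k)
    = bracket (2 *\<^sub>C ray_kernel_fun j \<alpha> (Suc k) - ray_kernel_fun j \<alpha> (Suc (Suc k)) - ray_kernel_fun j \<alpha> k) u"
proof -
  note p = ray_kernel_fun_pairable[OF j u]
  have "free_op E0 att (free_coeff E0 att j u) (Ray \<alpha> k)
    = 2 * bracket (ray_kernel_fun j \<alpha> (Suc k)) u - bracket (ray_kernel_fun j \<alpha> (Suc (Suc k))) u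
      - bracket (ray_kernel_fun j \<alpha> k) u"
    by (cases k) (simp_all add: free_coeff_Ray ray_kernel_fun_zero[OF j] del: free_coeff.simps)
  moreover have "pairable (2 *\<^sub>C ray_kernel_fun j \<alpha> (Suc k)) u"
    by (rule pairable_sym[OF pairable_scale_right[OF pairable_sym[OF p]]])
  ultimately show ?thesis
    using p by (simp add: bracket_diff_left bracket_scale_left pairable_diff_left)
qed

text \<open>The four lemmas from here on are the orders 0 to 3 of the identity (H0 + kappa^2)
  R0(kappa) = I for the free resolvent R0.\<close>

lemma free_op_free_coeff_0:
  assumes u: "u \<in> lone 0"
  shows "free_op E0 att (free_coeff E0 att 0 u) = u"
proof
  fix x show "free_op E0 att (free_coeff E0 att 0 u) x = u x"
  proof (cases x)
    case (Core y)
    then show ?thesis by (simp add: core_coeff_simps core_op_inv)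
  next
    case (Ray \<alpha> k)
    then show ?thesis using free_op_free_coeff_Ray[of 0 u \<alpha> k] u
      by (simp add: ray_kernel_fun_recursion bracket_rayfun_single)
  qed
qed

lemma free_op_free_coeff_1:
  assumes u: "u \<in> lone 1"
  shows "free_op E0 att (free_coeff E0 att 1 u) = 0"
  unfolding free_coeff_1 by (simp add: free_op_minus free_op_sum free_op_scale)

lemma free_op_free_coeff_2:
  assumes u: "u \<in> lone 2"
  shows "free_op E0 att (free_coeff E0 att 2 u) = - free_coeff E0 att 0 u"
proof
  fix x show "free_op E0 att (free_coeff E0 att 2 u) x = (- free_coeff E0 att 0 u) x"
  proof (cases x)
    case (Core y)
    have "core_op E0 att (\<lambda>z. - w z) y = - core_op E0 att w y" for w
      using core_op_scale[of E0 att "-1" w y] by (simp add: scaleC_fun_minus_one fun_Compl_def)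
    then show ?thesis using Core by (simp add: core_coeff_simps core_op_inv)
  next
    case (Ray \<alpha> k)
    then show ?thesis using free_op_free_coeff_Ray[of 2 u \<alpha> k] u
      by (simp add: ray_kernel_fun_recursion bracket_minus_left free_coeff_Ray del: free_coeff.simps)
  qed
qed

lemma free_op_free_coeff_3:
  assumes u: "u \<in> lone 3"
  shows "free_op E0 att (free_coeff E0 att 3 u) = - free_coeff E0 att 1 u"
proof
  fix x show "free_op E0 att (free_coeff E0 att 3 u) x = (- free_coeff E0 att 1 u) x"
  proof (cases x)
    case (Core y)
    then show ?thesis by (simp add: core_coeff_simps core_op_def)
  next
    case (Ray \<alpha> k)
    then show ?thesis using free_op_free_coeff_Ray[of 3 u \<alpha> k] u
      by (simp add: ray_kernel_fun_recursion(4) bracket_minus_left free_coeff_Ray del: free_coeff.simps)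
  qed
qed

end


lemma bdd_op:
  assumes "bounded_operator S nS T nT A"
  shows bdd_op_mem: "u \<in> S \<Longrightarrow> A u \<in> T"
    and bdd_op_add: "u \<in> S \<Longrightarrow> w \<in> S \<Longrightarrow> A (u + w) = A u + A w"
    and bdd_op_scale: "u \<in> S \<Longrightarrow> A (c *\<^sub>C u) = c *\<^sub>C A u"
    and bdd_op_bound: "\<exists>C. \<forall>u\<in>S. nT (A u) \<le> C * nS u"
  using assms by (auto simp: bounded_operator_def)

section \<open>Boundedness and symmetry of the factorized perturbation\<close>

section \<open>Factorized potentials\<close>

locale factorized_potential =
  fixes E0 :: "'a::finite set set" and att :: "'n::finite \<Rightarrow> 'a"
    and V :: "('a, 'n) gop"
    and v :: "'k::complex_hilbert \<Rightarrow> ('a, 'n) gfun" and U :: "'k \<Rightarrow> 'k"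
    and \<beta> :: nat
  assumes graph: "simple_connected_graph E0"
    and beta: "4 \<le> \<beta>"
    and A: "assumption_A (real \<beta>) V v U"
begin

abbreviation "va \<equiv> adj v"
abbreviation "H0 \<equiv> free_op E0 att"
abbreviation "H \<equiv> free_op E0 att + V"
abbreviation "G0 \<equiv> free_coeff E0 att 0"
abbreviation "G1 \<equiv> free_coeff E0 att 1"
abbreviation "G2 \<equiv> free_coeff E0 att 2"
abbreviation "G3 \<equiv> free_coeff E0 att 3"
abbreviation "M \<equiv> M_zero E0 att v U"

lemma v_op: "bounded_operator UNIV norm (lone (real \<beta>)) (lone_norm (real \<beta>)) v"
  and U_sau: "self_adjoint_unitary U"
  and V_linf: "u \<in> linf (- real \<beta>) \<Longrightarrow> V u = v (U (va u))"
  using A by (auto simp: assumption_A_def)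

lemma v_lone: "v k \<in> lone (real \<beta>)"
  and v_add: "v (k + l) = v k + v l"
  and v_scale: "v (c *\<^sub>C k) = c *\<^sub>C v k"
  using bdd_op_mem[OF v_op] bdd_op_add[OF v_op] bdd_op_scale[OF v_op] by auto

lemma v_lone': "s \<le> real \<beta> \<Longrightarrow> v k \<in> lone s"
  using lone_mono[OF v_lone] .

lemma v_minus: "v (- k) = - v k"
  using v_scale[of "-1" k] by (simp add: scaleC_minus_one scaleC_fun_minus_one)

lemma v_diff: "v (k - l) = v k - v l"
  using v_add[of k "- l"] by (simp add: v_minus)

lemma v_zero [simp]: "v 0 = 0"
  using v_diff[of 0 0] by simp

lemma v_sum: "v (\<Sum>i\<in>I. f i) = (\<Sum>i\<in>I. v (f i))"
  by (induction I rule: infinite_finite_induct) (simp_all only: sum.infinite sum.empty sum.insert v_add v_zero not_False_eq_True simp_thms)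

lemma v_bound: "\<exists>C\<ge>0. \<forall>k. lone_norm (real \<beta>) (v k) \<le> C * norm k"
proof -
  obtain C where C: "\<And>k. lone_norm (real \<beta>) (v k) \<le> C * norm k" using bdd_op_bound[OF v_op] by auto
  have "lone_norm (real \<beta>) (v k) \<le> max C 0 * norm k" for k
    using C[of k] mult_right_mono[of C "max C 0" "norm k"] by simp
  then show ?thesis by (intro exI[of _ "max C 0"]) simp
qed

lemma U_add: "U (k + l) = U k + U l"
  and U_scale: "U (c *\<^sub>C k) = c *\<^sub>C U k"
  and U_sym: "cinner (U k) l = cinner k (U l)"
  and U_iso: "cinner (U k) (U l) = cinner k l"
  using U_sau bdd_op_add[of UNIV norm UNIV norm U] bdd_op_scale[of UNIV norm UNIV norm U]
  by (auto simp: self_adjoint_unitary_def)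

lemma U_U [simp]: "U (U k) = k"
  by (rule cinner_eqI) (metis U_iso U_sym)

lemma U_norm: "norm (U k) = norm k"
proof -
  have "complex_of_real ((norm (U k))\<^sup>2) = complex_of_real ((norm k)\<^sup>2)"
    unfolding cinner_norm[symmetric] by (rule U_iso)
  then have "(norm (U k))\<^sup>2 = (norm k)\<^sup>2" using of_real_eq_iff by blast
  then show ?thesis by simp
qed

text \<open>Boundedness of \<open>v\<close> into \<open>lone (real \<beta>)\<close> makes
  \<open>k \<mapsto> bracket (v k) f\<close> a bounded conjugate-linear functional; its Riesz vector
  is what the definite description in \<open>adj\<close> picks out.\<close>

lemma adj_cinner:
  assumes f: "f \<in> linf (- real \<beta>)"
  shows "cinner k (va f) = bracket (v k) f"
proof -
  obtain C where C: "C \<ge> 0" "\<And>k. lone_norm (real \<beta>) (v k) \<le> C * norm k" using v_bound by blast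
  obtain c where c: "c \<ge> 0" "\<And>x. cmod (f x) \<le> c * weight (real \<beta>) x" using f by (auto elim: linfE)
  have p: "pairable (v k) f" for k by (rule pairable_lone_linf[OF v_lone f])
  have "\<exists>w. \<forall>k. cinner k w = bracket (v k) f"
  proof (rule riesz_representation)
    show "cmod (bracket (v k) f) \<le> (c * C) * norm k" for k
    proof -
      have "cmod (bracket (v k) f) \<le> c * lone_norm (real \<beta>) (v k)" by (rule bracket_bound[OF v_lone c(2)])
      also have "\<dots> \<le> c * (C * norm k)" by (intro mult_left_mono C c)
      finally show ?thesis by (simp add: mult.assoc)
    qed
  qed (auto simp: v_add v_scale bracket_add_left p bracket_scale_left)
  then obtain w where w: "\<And>k. cinner k w = bracket (v k) f" by blast
  have "va f = w" unfolding adj_def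
    by (rule the_equality) (use w in \<open>auto intro: cinner_eqI\<close>)
  then show ?thesis using w by simp
qed

lemma adj_cinner': "f \<in> linf (- real \<beta>) \<Longrightarrow> cinner (va f) k = bracket f (v k)"
  using adj_cinner[of f k] by (metis bracket_commute cinner_commute)

lemma adj_add: "f \<in> linf (- real \<beta>) \<Longrightarrow> g \<in> linf (- real \<beta>) \<Longrightarrow> va (f + g) = va f + va g"
  by (rule cinner_eqI)
    (simp add: adj_cinner linf_add cinner_add_right bracket_add_right pairable_lone_linf[OF v_lone])

lemma adj_scale: "f \<in> linf (- real \<beta>) \<Longrightarrow> va (c *\<^sub>C f) = c *\<^sub>C va f"
  by (rule cinner_eqI) (simp add: adj_cinner linf_scale cinner_scaleC_right bracket_scale_right)

lemma adj_minus: "f \<in> linf (- real \<beta>) \<Longrightarrow> va (- f) = - va f"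
  using adj_scale[of f "-1"] by (simp add: scaleC_minus_one scaleC_fun_minus_one)

lemma adj_diff: "f \<in> linf (- real \<beta>) \<Longrightarrow> g \<in> linf (- real \<beta>) \<Longrightarrow> va (f - g) = va f - va g"
  using adj_add[of f "- g"] linf_minus[of g] by (simp add: adj_minus)

lemma adj_bound: "\<exists>C\<ge>0. \<forall>f c. (\<forall>x. cmod (f x) \<le> c * weight (real \<beta>) x) \<longrightarrow> norm (va f) \<le> C * c"
proof -
  obtain C where C: "C \<ge> 0" "\<And>k. lone_norm (real \<beta>) (v k) \<le> C * norm k" using v_bound by blast
  have "norm (va f) \<le> C * c" if f: "\<And>x. cmod (f x) \<le> c * weight (real \<beta>) x" for f c
  proof (cases "va f = 0")
    case True
    have "0 \<le> c * weight (real \<beta>) (undefined :: ('a, 'n) vertex)" by (rule order_trans[OF norm_ge_zero f])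
    then have "0 \<le> c" using weight_pos[of "real \<beta>" "undefined :: ('a, 'n) vertex"] by (simp add: zero_le_mult_iff)
    then show ?thesis using True C(1) by simp
  next
    case False
    have "0 \<le> c * weight (real \<beta>) (undefined :: ('a, 'n) vertex)" by (rule order_trans[OF norm_ge_zero f])
    then have c: "0 \<le> c" using weight_pos[of "real \<beta>" "undefined :: ('a, 'n) vertex"] by (simp add: zero_le_mult_iff)
    have "(norm (va f))\<^sup>2 = cmod (cinner (va f) (va f))" by (simp add: cinner_norm norm_power)
    also have "\<dots> = cmod (bracket (v (va f)) f)" by (simp add: adj_cinner[OF linfI[OF f]])
    also have "\<dots> \<le> c * lone_norm (real \<beta>) (v (va f))" by (rule bracket_bound[OF v_lone f])
    also have "\<dots> \<le> c * (C * norm (va f))" by (intro mult_left_mono C c)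
    finally have "norm (va f) * norm (va f) \<le> (C * c) * norm (va f)" by (simp add: power2_eq_square mult_ac)
    then show ?thesis using False by simp
  qed
  then show ?thesis using C(1) by blast
qed

lemma V_lone: "u \<in> linf (- real \<beta>) \<Longrightarrow> V u \<in> lone (real \<beta>)"
  by (simp add: V_linf v_lone)

lemma V_lone': "u \<in> linf (- real \<beta>) \<Longrightarrow> s \<le> real \<beta> \<Longrightarrow> V u \<in> lone s"
  using lone_mono[OF V_lone] .

lemma V_add: "u \<in> linf (- real \<beta>) \<Longrightarrow> w \<in> linf (- real \<beta>) \<Longrightarrow> V (u + w) = V u + V w"
  by (simp add: V_linf linf_add adj_add U_add v_add)

lemma V_scale: "u \<in> linf (- real \<beta>) \<Longrightarrow> V (c *\<^sub>C u) = c *\<^sub>C V u"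
  by (simp add: V_linf linf_scale adj_scale U_scale v_scale)

lemma V_minus: "u \<in> linf (- real \<beta>) \<Longrightarrow> V (- u) = - V u"
  using V_scale[of u "-1"] by (simp add: scaleC_fun_minus_one)

lemma V_diff: "u \<in> linf (- real \<beta>) \<Longrightarrow> w \<in> linf (- real \<beta>) \<Longrightarrow> V (u - w) = V u - V w"
  using V_add[of u "- w"] linf_minus[of w] by (simp add: V_minus)

lemma V_sum: "(\<And>i. i \<in> I \<Longrightarrow> f i \<in> linf (- real \<beta>)) \<Longrightarrow> V (\<Sum>i\<in>I. f i) = (\<Sum>i\<in>I. V (f i))"
proof (induction I rule: infinite_finite_induct)
  case (insert i I)
  then have "V (f i + (\<Sum>i\<in>I. f i)) = V (f i) + V (\<Sum>i\<in>I. f i)"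
    by (intro V_add linf_sum) auto
  then show ?case using insert by (simp only: sum.insert not_False_eq_True simp_thms) simp
qed (use V_diff[of 0 0] in simp_all)

lemma V_symmetric:
  assumes "u \<in> linf (- real \<beta>)" "w \<in> linf (- real \<beta>)"
  shows "bracket (V u) w = bracket u (V w)"
  unfolding V_linf[OF assms(1)] V_linf[OF assms(2)] adj_cinner[OF assms(2), symmetric]
    adj_cinner'[OF assms(1), symmetric] by (rule U_sym)

lemma V_bound: "\<exists>C\<ge>0. \<forall>f c. (\<forall>x. cmod (f x) \<le> c * weight (real \<beta>) x) \<longrightarrow> lone_norm (real \<beta>) (V f) \<le> C * c"
proof -
  obtain C where C: "C \<ge> 0" "\<And>k. lone_norm (real \<beta>) (v k) \<le> C * norm k" using v_bound by blast
  obtain D where D: "D \<ge> 0" "\<And>f c. (\<forall>x. cmod (f x) \<le> c * weight (real \<beta>) x) \<Longrightarrow> norm (va f) \<le> D * c"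
    using adj_bound by blast
  have "lone_norm (real \<beta>) (V f) \<le> (C * D) * c" if f: "\<forall>x. cmod (f x) \<le> c * weight (real \<beta>) x" for f c
  proof -
    have "f \<in> linf (- real \<beta>)" using f by (intro linfI) blast
    then have "lone_norm (real \<beta>) (V f) \<le> C * norm (va f)" using C(2)[of "U (va f)"] by (simp add: V_linf U_norm)
    also have "\<dots> \<le> C * (D * c)" by (intro mult_left_mono D f C)
    finally show ?thesis by (simp add: mult.assoc)
  qed
  then show ?thesis using C(1) D(1) by (intro exI[of _ "C * D"]) auto
qed


section \<open>Summation by parts against growing functions\<close>

subsection \<open>Green's identity\<close>

text \<open>For \<open>a = V \<Psi>\<close> with a resonance function \<Psi>, these numbers are
  minus the limits of \<Psi> along the half-lines; see \<open>res_coeff_unique\<close>.\<close>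

definition res_coeff :: "('a, 'n) gfun \<Rightarrow> 'n \<Rightarrow> complex"
  where "res_coeff a \<alpha> = bracket (nvec \<alpha>) a"

text \<open>\<open>G0 a\<close> itself is only bounded. Without its limits along the half-lines it
  belongs to \<open>lone (real \<beta> - 2)\<close> and may be paired with growing
  functions.\<close>

definition decaying_part :: "('a, 'n) gfun \<Rightarrow> ('a, 'n) gfun"
  where "decaying_part a = G0 a - (\<Sum>\<alpha>\<in>UNIV. res_coeff a \<alpha> *\<^sub>C onevec \<alpha>)"

lemma decaying_part_lone: "a \<in> lone (real \<beta>) \<Longrightarrow> decaying_part a \<in> lone (real \<beta> - 2)"
  unfolding decaying_part_def res_coeff_def using beta by (intro free_coeff_0_asymptotics) auto

text \<open>Since \<open>a = H0 (G0 a)\<close>, the operator is moved to \<open>Z\<close> on the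
  decaying part. The constants are kept apart: \<open>H0\<close> sends each \<open>onevec\<close> to
  the unit mass at the first vertex, which produces the boundary values of \<open>Z\<close>.\<close>

lemma green_identity:
  assumes a: "a \<in> lone (real \<beta>)" and Z: "Z \<in> linf (- (real \<beta> - 2))"
  shows "bracket a Z = bracket (decaying_part a) (H0 Z) + (\<Sum>\<alpha>\<in>UNIV. cnj (res_coeff a \<alpha>) * Z (Ray \<alpha> 0))"
proof -
  have s: "0 \<le> real \<beta> - 2" using beta by simp
  define z where "z = decaying_part a"
  have z: "z \<in> lone (real \<beta> - 2)" unfolding z_def by (rule decaying_part_lone[OF a])
  have a0: "a \<in> lone 0" using a by (rule lone_mono) simp
  have "a = H0 (G0 a)" by (rule free_op_free_coeff_0[OF graph a0, symmetric])
  also have "G0 a = z + (\<Sum>\<alpha>\<in>UNIV. res_coeff a \<alpha> *\<^sub>C onevec \<alpha>)" by (simp add: z_def decaying_part_def)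
  also have "H0 (z + (\<Sum>\<alpha>\<in>UNIV. res_coeff a \<alpha> *\<^sub>C onevec \<alpha>))
      = H0 z + (\<Sum>\<alpha>\<in>UNIV. res_coeff a \<alpha> *\<^sub>C rayfun \<alpha> (\<lambda>l. if l = 0 then 1 else 0))"
    by (simp only: free_op_add free_op_sum free_op_scale free_op_onevec)
  finally have eq: "a = H0 z + (\<Sum>\<alpha>\<in>UNIV. res_coeff a \<alpha> *\<^sub>C rayfun \<alpha> (\<lambda>l. if l = 0 then 1 else 0))" .
  have p1: "pairable (H0 z) Z" by (rule pairable_lone_linf[OF free_op_lone[OF z s] Z])
  have d: "rayfun \<alpha> (\<lambda>l. if l = 0 then 1 else 0) \<in> lone s" for \<alpha> :: 'n and s :: real
    unfolding lone_def mem_Collect_eq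
  proof (rule finite_nonzero_values_imp_summable_on)
    have "{x \<in> UNIV. weight s x * cmod (rayfun \<alpha> (\<lambda>l. if l = 0 then 1 else 0) x) \<noteq> 0} \<subseteq> {Ray \<alpha> 0}"
      (is "?S \<subseteq> _")
    proof
      fix x assume "x \<in> ?S"
      then show "x \<in> {Ray \<alpha> 0}" by (cases x) (auto split: if_splits)
    qed
    then show "finite ?S" using finite_subset by blast
  qed
  have p2: "pairable (res_coeff a \<alpha> *\<^sub>C rayfun \<alpha> (\<lambda>l. if l = 0 then 1 else 0)) Z" for \<alpha>
    by (rule pairable_lone_linf[OF lone_scale[OF d] Z])
  have "bracket a Z = bracket (H0 z) Z
      + bracket (\<Sum>\<alpha>\<in>UNIV. res_coeff a \<alpha> *\<^sub>C rayfun \<alpha> (\<lambda>l. if l = 0 then 1 else 0)) Z"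
    by (subst eq, rule bracket_add_left[OF p1])
      (rule pairable_sym[OF pairable_sum_right[OF pairable_sym[OF p2]]])
  also have "bracket (\<Sum>\<alpha>\<in>UNIV. res_coeff a \<alpha> *\<^sub>C rayfun \<alpha> (\<lambda>l. if l = 0 then 1 else 0)) Z
      = (\<Sum>\<alpha>\<in>UNIV. cnj (res_coeff a \<alpha>) * Z (Ray \<alpha> 0))"
    by (simp add: bracket_sum_left[OF p2] bracket_scale_left bracket_rayfun_single)
  also have "bracket (H0 z) Z = bracket z (H0 Z)" by (rule free_op_symmetric_lone[OF z Z s])
  finally show ?thesis by (simp add: z_def)
qed

lemma G0_linf1: "u \<in> lone 0 \<Longrightarrow> G0 u \<in> linf (- 1)"
  using free_coeff_linf[of 0 u E0 att] by simp

text \<open>Green's identity with \<open>Z = G0 u\<close>: then \<open>H0 Z = u\<close>, and the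
  boundary values of \<open>Z\<close> are pairings with \<open>onevec\<close>, which restore exactly
  the constants removed in \<open>decaying_part\<close>.\<close>

lemma bracket_G0:
  assumes a: "a \<in> lone (real \<beta>)" and u: "u \<in> lone 1"
  shows "bracket a (G0 u) = bracket (G0 a) u"
proof -
  have u0: "u \<in> lone 0" using u by (rule lone_mono) simp
  have Z: "G0 u \<in> linf (- (real \<beta> - 2))" using beta by (intro linf_mono[OF G0_linf1[OF u0]]) simp
  have p1: "pairable (decaying_part a) u"
    by (rule pairable_linf_lone[OF lone_imp_linf'[OF decaying_part_lone[OF a]] u0]) (use beta in simp)
  have p2: "pairable (res_coeff a \<alpha> *\<^sub>C onevec \<alpha>) u" for \<alpha>
    by (rule pairable_linf_lone[OF linf_scale[OF onevec_linf] u0]) simp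
  have "bracket a (G0 u) = bracket (decaying_part a) u + (\<Sum>\<alpha>\<in>UNIV. cnj (res_coeff a \<alpha>) * bracket (onevec \<alpha>) u)"
    unfolding green_identity[OF a Z] free_op_free_coeff_0[OF graph u0] free_coeff_init init_fun_0 ..
  also have "(\<Sum>\<alpha>\<in>UNIV. cnj (res_coeff a \<alpha>) * bracket (onevec \<alpha>) u)
      = bracket (\<Sum>\<alpha>\<in>UNIV. res_coeff a \<alpha> *\<^sub>C onevec \<alpha>) u"
    by (simp add: bracket_sum_left[OF p2] bracket_scale_left)
  also have "bracket (decaying_part a) u + \<dots> = bracket (decaying_part a + (\<Sum>\<alpha>\<in>UNIV. res_coeff a \<alpha> *\<^sub>C onevec \<alpha>)) u"
    by (rule bracket_add_left[symmetric, OF p1]) (rule pairable_sym[OF pairable_sum_right[OF pairable_sym[OF p2]]])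
  finally show ?thesis by (simp add: decaying_part_def)
qed


section \<open>Lippmann-Schwinger equations and behaviour at infinity of threshold functions\<close>

subsection \<open>Threshold eigenspaces\<close>

abbreviation "Egen \<equiv> gen_eigenspace \<beta> H"
abbreviation "Eres \<equiv> res_eigenspace \<beta> H"
abbreviation "Ebd \<equiv> bound_eigenspace \<beta> H"

lemma G0_bounded: "u \<in> lone 1 \<Longrightarrow> G0 u \<in> linf (- 0)"
  by (rule free_coeff_0_bounded)

lemma linf0_beta: "u \<in> linf (- 0) \<Longrightarrow> u \<in> linf (- real \<beta>)"
  by (rule linf_mono[of u 0]) simp_all

lemma nsum_linf: "1 \<le> s \<Longrightarrow> (\<Sum>\<alpha>\<in>UNIV. d \<alpha> *\<^sub>C nvec \<alpha>) \<in> linf (- s)"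
  by (intro linf_sum linf_scale nvec_linf)

lemma nsum_bounded_zero:
  assumes "(\<Sum>\<alpha>\<in>UNIV. d \<alpha> *\<^sub>C nvec \<alpha> :: ('a, 'n) gfun) \<in> linf (- 0)"
  shows "d \<alpha> = 0"
proof -
  let ?f = "\<Sum>\<alpha>\<in>UNIV. d \<alpha> *\<^sub>C nvec \<alpha> :: ('a, 'n) gfun"
  obtain c where c: "\<And>x. cmod (?f x) \<le> c * weight 0 x" using assms by (rule linfE) blast
  have val: "?f (Ray \<alpha> k) = d \<alpha> * of_nat (Suc k)" for k
  proof -
    have "?f (Ray \<alpha> k) = (\<Sum>\<gamma>\<in>UNIV. if \<gamma> = \<alpha> then d \<alpha> * of_nat (Suc k) else 0)"
      unfolding sum_fun_apply by (intro sum.cong) auto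
    then show ?thesis by (simp only: sum.delta[OF finite] UNIV_I if_True)
  qed
  have b: "real (Suc k) * cmod (d \<alpha>) \<le> c" for k
    using c[of "Ray \<alpha> k"] unfolding val by (simp add: norm_mult mult.commute norm_of_nat del: of_nat_Suc weight.simps)
  show ?thesis
  proof (rule ccontr)
    assume "d \<alpha> \<noteq> 0"
    then have "0 < cmod (d \<alpha>)" by simp
    then obtain k :: nat where "c < real k * cmod (d \<alpha>)" using reals_Archimedean3 by blast
    also have "\<dots> \<le> real (Suc k) * cmod (d \<alpha>)" by (intro mult_right_mono) auto
    finally show False using b[of k] by simp
  qed
qed

lemma onesum_lone_zero:
  assumes "(\<Sum>\<alpha>\<in>UNIV. d \<alpha> *\<^sub>C onevec \<alpha> :: ('a, 'n) gfun) \<in> lone 0"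
  shows "d \<alpha> = 0"
proof -
  let ?f = "\<Sum>\<alpha>\<in>UNIV. d \<alpha> *\<^sub>C onevec \<alpha> :: ('a, 'n) gfun"
  have val: "?f (Ray \<alpha> k) = d \<alpha>" for k
  proof -
    have "?f (Ray \<alpha> k) = (\<Sum>\<gamma>\<in>UNIV. if \<gamma> = \<alpha> then d \<alpha> else 0)"
      unfolding sum_fun_apply by (intro sum.cong) auto
    then show ?thesis by (simp only: sum.delta[OF finite] UNIV_I if_True)
  qed
  have "(\<lambda>k. cmod (?f (Ray \<alpha> k))) summable_on UNIV"
    using assms summable_rays_iff[of "\<lambda>x. cmod (?f x)"] by (simp add: lone_def)
  then have "(\<lambda>k::nat. cmod (d \<alpha>)) summable_on UNIV" by (simp only: val)
  then have "summable (\<lambda>k::nat. cmod (d \<alpha>))" by (rule summable_on_imp_summable)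
  then show ?thesis by (simp add: summable_const_iff)
qed

text \<open>\<open>\<Psi> + G0 (V \<Psi>)\<close> is annihilated by \<open>H0\<close>, and such
  functions are combinations of the \<open>nvec\<close>; the coefficients are read off at the first
  vertices.\<close>

lemma gen_eigenspaceE:
  assumes "\<Psi> \<in> Egen"
  obtains d where "\<Psi> = (\<Sum>\<alpha>\<in>UNIV. d \<alpha> *\<^sub>C nvec \<alpha>) - G0 (V \<Psi>)"
proof -
  have \<Psi>: "\<Psi> \<in> linf (- real \<beta>)" "H0 \<Psi> + V \<Psi> = 0" using assms by (auto simp: gen_eigenspace_def)
  have V0: "V \<Psi> \<in> lone 0" by (rule V_lone'[OF \<Psi>(1)]) simp
  define d where "d \<alpha> = \<Psi> (Ray \<alpha> 0) + G0 (V \<Psi>) (Ray \<alpha> 0)" for \<alpha>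
  have "\<Psi> = (\<Sum>\<alpha>\<in>UNIV. d \<alpha> *\<^sub>C nvec \<alpha>) - G0 (V \<Psi>)"
  proof (rule free_op_unique[OF graph])
    have "H0 \<Psi> = - V \<Psi>" using \<Psi>(2) by (simp add: eq_neg_iff_add_eq_0)
    then show "H0 \<Psi> = H0 ((\<Sum>\<alpha>\<in>UNIV. d \<alpha> *\<^sub>C nvec \<alpha>) - G0 (V \<Psi>))"
      by (simp add: free_op_diff free_op_sum free_op_scale free_op_free_coeff_0[OF graph V0])
    fix \<alpha>
    have "(\<Sum>\<gamma>\<in>UNIV. d \<gamma> * nvec \<gamma> (Ray \<alpha> 0 :: ('a, 'n) vertex)) = (\<Sum>\<gamma>\<in>UNIV. if \<gamma> = \<alpha> then d \<alpha> else 0)"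
      by (intro sum.cong) auto
    then have "(\<Sum>\<gamma>\<in>UNIV. d \<gamma> * nvec \<gamma> (Ray \<alpha> 0 :: ('a, 'n) vertex)) = d \<alpha>"
      by (simp only: sum.delta[OF finite] UNIV_I if_True)
    then show "\<Psi> (Ray \<alpha> 0) = ((\<Sum>\<alpha>\<in>UNIV. d \<alpha> *\<^sub>C nvec \<alpha>) - G0 (V \<Psi>)) (Ray \<alpha> 0)"
      by (simp add: sum_fun_apply d_def del: free_coeff.simps)
  qed
  then show thesis by (rule that)
qed

lemma gen_eigenspaceI:
  assumes "\<Psi> \<in> linf (- real \<beta>)" and eq: "\<Psi> = (\<Sum>\<alpha>\<in>UNIV. d \<alpha> *\<^sub>C nvec \<alpha>) - G0 (V \<Psi>)"
  shows "\<Psi> \<in> Egen"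
proof -
  have V0: "V \<Psi> \<in> lone 0" by (rule V_lone'[OF assms(1)]) simp
  have "H0 \<Psi> = - V \<Psi>"
    by (subst eq) (simp add: free_op_diff free_op_sum free_op_scale free_op_free_coeff_0[OF graph V0])
  then show ?thesis using assms(1) by (simp add: gen_eigenspace_def)
qed

lemma one_plus_lone_bounded:
  assumes "u \<in> one_plus_lone (real \<beta> - 2)" shows "u \<in> linf (- 0)"
proof -
  obtain c where c: "u - (\<Sum>\<alpha>\<in>UNIV. c \<alpha> *\<^sub>C onevec \<alpha>) \<in> lone (real \<beta> - 2)"
    using assms by (auto simp: one_plus_lone_def)
  have "u - (\<Sum>\<alpha>\<in>UNIV. c \<alpha> *\<^sub>C onevec \<alpha>) \<in> linf (- 0)" by (rule lone_imp_linf'[OF c]) (use beta in simp)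
  moreover have "(\<Sum>\<alpha>\<in>UNIV. c \<alpha> *\<^sub>C onevec \<alpha>) \<in> linf (- 0)" by (intro linf_sum linf_scale onevec_linf) simp
  ultimately have "u - (\<Sum>\<alpha>\<in>UNIV. c \<alpha> *\<^sub>C onevec \<alpha>) + (\<Sum>\<alpha>\<in>UNIV. c \<alpha> *\<^sub>C onevec \<alpha>) \<in> linf (- 0)" by (rule linf_add)
  then show ?thesis by simp
qed

lemma G0_one_plus_lone: "a \<in> lone (real \<beta>) \<Longrightarrow> - G0 a \<in> one_plus_lone (real \<beta> - 2)"
proof -
  assume a: "a \<in> lone (real \<beta>)"
  have "- decaying_part a \<in> lone (real \<beta> - 2)" by (rule lone_minus[OF decaying_part_lone[OF a]])
  moreover have "- decaying_part a = - G0 a - (\<Sum>\<alpha>\<in>UNIV. (- res_coeff a \<alpha>) *\<^sub>C onevec \<alpha>)"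
  proof
    show "(- decaying_part a) x = (- G0 a - (\<Sum>\<alpha>\<in>UNIV. (- res_coeff a \<alpha>) *\<^sub>C onevec \<alpha>)) x" for x
      by (simp add: decaying_part_def sum_fun_apply sum_negf del: free_coeff.simps)
  qed
  ultimately show ?thesis by (auto simp: one_plus_lone_def)
qed

lemma gen_linf: "\<Psi> \<in> Egen \<Longrightarrow> \<Psi> \<in> linf (- real \<beta>)"
  by (simp add: gen_eigenspace_def)

lemma V_lone1: "u \<in> linf (- real \<beta>) \<Longrightarrow> V u \<in> lone 1"
  by (rule V_lone') (use beta in auto)

text \<open>Functions in \<open>Eres\<close> are bounded, and so is \<open>G0 (V \<Psi>)\<close>;
  hence the linearly growing part in \<open>gen_eigenspaceE\<close> vanishes and a homogeneous
  Lippmann-Schwinger equation remains.\<close>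

lemma res_eigenspace_iff: "\<Psi> \<in> Eres \<longleftrightarrow> \<Psi> \<in> linf (- real \<beta>) \<and> \<Psi> = - G0 (V \<Psi>)"
proof
  assume \<Psi>: "\<Psi> \<in> Eres"
  then have g: "\<Psi> \<in> Egen" "\<Psi> \<in> linf (- 0)" using one_plus_lone_bounded by (auto simp: res_eigenspace_def)
  note l = gen_linf[OF g(1)]
  from g(1) obtain d where d: "\<Psi> = (\<Sum>\<alpha>\<in>UNIV. d \<alpha> *\<^sub>C nvec \<alpha>) - G0 (V \<Psi>)" by (rule gen_eigenspaceE)
  then have "(\<Sum>\<alpha>\<in>UNIV. d \<alpha> *\<^sub>C nvec \<alpha>) = \<Psi> + G0 (V \<Psi>)" by (metis diff_add_cancel)
  moreover have "\<Psi> + G0 (V \<Psi>) \<in> linf (- 0)" by (intro linf_add g(2) G0_bounded V_lone1[OF l])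
  ultimately have "d \<alpha> = 0" for \<alpha> using nsum_bounded_zero[of d] by simp
  then have "(\<Sum>\<alpha>\<in>UNIV. d \<alpha> *\<^sub>C nvec \<alpha> :: ('a, 'n) gfun) = 0" by simp
  then show "\<Psi> \<in> linf (- real \<beta>) \<and> \<Psi> = - G0 (V \<Psi>)" using d l by (metis diff_0)
next
  assume \<Psi>: "\<Psi> \<in> linf (- real \<beta>) \<and> \<Psi> = - G0 (V \<Psi>)"
  then have "\<Psi> = (\<Sum>\<alpha>\<in>UNIV. 0 *\<^sub>C nvec \<alpha>) - G0 (V \<Psi>)" by simp
  then have "\<Psi> \<in> Egen" using \<Psi> gen_eigenspaceI[of \<Psi> "\<lambda>_. 0"] by blast
  moreover have "- G0 (V \<Psi>) \<in> one_plus_lone (real \<beta> - 2)" by (rule G0_one_plus_lone[OF V_lone]) (use \<Psi> in blast)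
  ultimately show "\<Psi> \<in> Eres" using \<Psi> by (simp add: res_eigenspace_def)
qed

lemma res_bounded: "\<Psi> \<in> Eres \<Longrightarrow> \<Psi> \<in> linf (- 0)"
  using one_plus_lone_bounded by (auto simp: res_eigenspace_def)

lemma res_linf: "\<Psi> \<in> Eres \<Longrightarrow> \<Psi> \<in> linf (- real \<beta>)"
  by (simp add: res_eigenspace_iff)

lemma res_eq: "\<Psi> \<in> Eres \<Longrightarrow> G0 (V \<Psi>) = - \<Psi>"
  using res_eigenspace_iff[of \<Psi>] by (metis minus_minus)

lemma res_decomp:
  assumes "\<Psi> \<in> Eres"
  shows "\<Psi> = - decaying_part (V \<Psi>) - (\<Sum>\<alpha>\<in>UNIV. res_coeff (V \<Psi>) \<alpha> *\<^sub>C onevec \<alpha>)"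
  using res_eq[OF assms] by (simp add: decaying_part_def)

text \<open>Two choices of the constants differ by a summable combination of the
  \<open>onevec\<close>, hence agree. This ties the constants of a resonance basis to the pairings
  with \<open>V \<Psi>\<close>.\<close>

lemma res_coeff_unique:
  assumes \<Psi>: "\<Psi> \<in> Eres" and c: "\<Psi> - (\<Sum>\<alpha>\<in>UNIV. c \<alpha> *\<^sub>C onevec \<alpha>) \<in> lone s" and s: "0 \<le> s"
  shows "c \<alpha> = - res_coeff (V \<Psi>) \<alpha>"
proof -
  have "\<Psi> - (\<Sum>\<alpha>\<in>UNIV. c \<alpha> *\<^sub>C onevec \<alpha>) + decaying_part (V \<Psi>)
      = (\<Sum>\<alpha>\<in>UNIV. (- res_coeff (V \<Psi>) \<alpha> - c \<alpha>) *\<^sub>C onevec \<alpha>)" (is "?l = ?r")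
  proof
    show "?l x = ?r x" for x
      using fun_cong[OF res_decomp[OF \<Psi>], of x]
      by (simp add: sum_fun_apply left_diff_distrib sum_subtractf sum_negf)
  qed
  moreover have "?l \<in> lone 0"
    using lone_mono[OF c s] lone_mono[OF decaying_part_lone[OF V_lone[OF res_linf[OF \<Psi>]]], of 0] beta
    by (intro lone_add) auto
  ultimately have "- res_coeff (V \<Psi>) \<alpha> - c \<alpha> = 0" using onesum_lone_zero by metis
  then show ?thesis by simp
qed

text \<open>By \<open>res_decomp\<close> a resonance function is a combination of the
  \<open>onevec\<close> plus a function in \<open>lone (real \<beta> - 2)\<close>; summability and a
  nonzero constant exclude each other.\<close>

lemma bound_eigenspace_iff: "\<Psi> \<in> Ebd \<longleftrightarrow> \<Psi> \<in> Eres \<and> (\<forall>\<alpha>. res_coeff (V \<Psi>) \<alpha> = 0)"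
proof
  assume \<Psi>: "\<Psi> \<in> Ebd"
  have 0: "\<Psi> - (\<Sum>\<alpha>\<in>UNIV. 0 *\<^sub>C onevec \<alpha>) \<in> lone (real \<beta> - 2)"
    using \<Psi> by (simp add: bound_eigenspace_def)
  then have "\<Psi> \<in> one_plus_lone (real \<beta> - 2)" unfolding one_plus_lone_def mem_Collect_eq by (rule exI[of _ "\<lambda>_. 0"])
  then have "\<Psi> \<in> Eres" using \<Psi> by (auto simp: res_eigenspace_def bound_eigenspace_def)
  moreover from res_coeff_unique[OF this 0] beta have "res_coeff (V \<Psi>) \<alpha> = 0" for \<alpha> by simp
  ultimately show "\<Psi> \<in> Eres \<and> (\<forall>\<alpha>. res_coeff (V \<Psi>) \<alpha> = 0)" by blast
next
  assume \<Psi>: "\<Psi> \<in> Eres \<and> (\<forall>\<alpha>. res_coeff (V \<Psi>) \<alpha> = 0)"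
  then have "\<Psi> = - decaying_part (V \<Psi>)" using res_decomp[of \<Psi>] by simp
  moreover have "- decaying_part (V \<Psi>) \<in> lone (real \<beta> - 2)"
    using \<Psi> by (intro lone_minus decaying_part_lone V_lone res_linf) simp
  ultimately have "\<Psi> \<in> lone (real \<beta> - 2)" by simp
  then show "\<Psi> \<in> Ebd" using \<Psi> by (simp add: bound_eigenspace_def res_eigenspace_def)
qed

lemma res_zero [simp]: "0 \<in> Eres"
proof -
  have "V 0 = 0" using V_diff[of 0 0] by simp
  moreover have "G0 0 = 0" using free_coeff_scale[OF graph, where j=0 and c=0 and u=0] by simp
  ultimately show ?thesis by (simp add: res_eigenspace_iff)
qed

lemma V_zero [simp]: "V 0 = 0"
  using V_diff[of 0 0] by simp

lemma res_add: "\<Psi> \<in> Eres \<Longrightarrow> \<Phi> \<in> Eres \<Longrightarrow> \<Psi> + \<Phi> \<in> Eres"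
proof -
  assume a: "\<Psi> \<in> Eres" "\<Phi> \<in> Eres"
  have "G0 (V \<Psi> + V \<Phi>) = G0 (V \<Psi>) + G0 (V \<Phi>)"
    by (intro free_coeff_add[OF graph]) (auto intro!: V_lone' res_linf a)
  then have "G0 (V (\<Psi> + \<Phi>)) = - (\<Psi> + \<Phi>)"
    using a by (simp add: V_add res_linf res_eq)
  then show ?thesis using a by (simp add: res_eigenspace_iff[of "\<Psi> + \<Phi>"] linf_add res_linf)
qed

lemma res_scale: "\<Psi> \<in> Eres \<Longrightarrow> c *\<^sub>C \<Psi> \<in> Eres"
proof -
  assume a: "\<Psi> \<in> Eres"
  have "G0 (V (c *\<^sub>C \<Psi>)) = c *\<^sub>C (- \<Psi>)"
    using a by (simp add: V_scale res_linf res_eq free_coeff_scale[OF graph])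
  also have "\<dots> = - (c *\<^sub>C \<Psi>)" by (rule ext) simp
  finally show ?thesis using a by (simp add: res_eigenspace_iff[of "c *\<^sub>C \<Psi>"] linf_scale res_linf)
qed

lemma res_diff: "\<Psi> \<in> Eres \<Longrightarrow> \<Phi> \<in> Eres \<Longrightarrow> \<Psi> - \<Phi> \<in> Eres"
  using res_add[of \<Psi> "(-1) *\<^sub>C \<Phi>"] res_scale[of \<Phi> "-1"] by (simp add: scaleC_fun_minus_one)

lemma res_sum: "(\<And>i. i \<in> I \<Longrightarrow> f i \<in> Eres) \<Longrightarrow> (\<Sum>i\<in>I. f i) \<in> Eres"
  by (induction I rule: infinite_finite_induct) (auto intro: res_add)

lemma V_lone_n: "u \<in> linf (- real \<beta>) \<Longrightarrow> pairable (nvec \<alpha>) (V u)"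
  by (rule pairable_linf_lone[OF nvec_linf V_lone]) (use beta in auto)

text \<open>\<open>V \<Psi>2\<close> is paired with the inhomogeneous Lippmann-Schwinger equation of
  \<Psi>1. Symmetry of \<open>G0\<close> and \<open>V\<close> cancels everything except the
  contribution of the growing part.\<close>

lemma gen_res_orthogonal:
  assumes \<Psi>1: "\<Psi>1 \<in> Egen" and \<Psi>2: "\<Psi>2 \<in> Eres"
    and c1: "\<Psi>1 - (\<Sum>\<alpha>\<in>UNIV. c1 \<alpha> *\<^sub>C nvec \<alpha>) \<in> one_plus_lone (real \<beta> - 2)"
  shows "(\<Sum>\<alpha>\<in>UNIV. cnj (res_coeff (V \<Psi>2) \<alpha>) * c1 \<alpha>) = 0"
proof -
  note l1 = gen_linf[OF \<Psi>1] and l2 = res_linf[OF \<Psi>2]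
  from \<Psi>1 obtain d where d: "\<Psi>1 = (\<Sum>\<alpha>\<in>UNIV. d \<alpha> *\<^sub>C nvec \<alpha>) - G0 (V \<Psi>1)" by (rule gen_eigenspaceE)
  \<comment> \<open>The growth coefficients are unique, because the difference of two choices is
    bounded.\<close>
  have "(\<Sum>\<alpha>\<in>UNIV. (c1 \<alpha> - d \<alpha>) *\<^sub>C nvec \<alpha>)
      = - G0 (V \<Psi>1) - (\<Psi>1 - (\<Sum>\<alpha>\<in>UNIV. c1 \<alpha> *\<^sub>C nvec \<alpha>))" (is "?l = ?r")
  proof
    show "?l x = ?r x" for x
      using fun_cong[OF d, of x] by (simp add: sum_fun_apply left_diff_distrib sum_subtractf del: free_coeff.simps)
  qed
  moreover have "?r \<in> linf (- 0)"
    by (intro linf_diff linf_minus G0_bounded V_lone1 l1 one_plus_lone_bounded c1)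
  ultimately have "c1 \<alpha> - d \<alpha> = 0" for \<alpha> using nsum_bounded_zero[of "\<lambda>\<alpha>. c1 \<alpha> - d \<alpha>"] by simp
  then have cd: "c1 \<alpha> = d \<alpha>" for \<alpha> by simp
  have V1: "V \<Psi>1 \<in> lone 1" "V \<Psi>2 \<in> lone (real \<beta>)" by (rule V_lone1[OF l1], rule V_lone[OF l2])
  have pn: "pairable (V \<Psi>2) (d \<alpha> *\<^sub>C nvec \<alpha>)" for \<alpha>
    by (rule pairable_scale_right[OF pairable_sym[OF V_lone_n[OF l2]]])
  have "bracket (V \<Psi>2) \<Psi>1 = bracket (V \<Psi>2) (\<Sum>\<alpha>\<in>UNIV. d \<alpha> *\<^sub>C nvec \<alpha>) - bracket (V \<Psi>2) (G0 (V \<Psi>1))"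
    by (subst d, rule bracket_diff_right)
      (auto intro: pairable_sum_right pn pairable_lone_linf[OF V1(2)] linf0_beta G0_bounded V1)
  also have "bracket (V \<Psi>2) (\<Sum>\<alpha>\<in>UNIV. d \<alpha> *\<^sub>C nvec \<alpha>) = (\<Sum>\<alpha>\<in>UNIV. cnj (res_coeff (V \<Psi>2) \<alpha>) * d \<alpha>)"
    by (simp add: bracket_sum_right[OF pn] bracket_scale_right res_coeff_def mult.commute bracket_commute[of "V \<Psi>2" "nvec _"])
  also have "bracket (V \<Psi>2) (G0 (V \<Psi>1)) = - bracket \<Psi>2 (V \<Psi>1)"
    by (simp add: bracket_G0[OF V1(2,1)] res_eq[OF \<Psi>2] bracket_minus_left)
  finally show ?thesis using V_symmetric[OF l2 l1] cd by simp
qed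


section \<open>A priori estimate and closed range of \<open>M\<close>\<close>

subsection \<open>Closed range and pseudo-inverse of the threshold operator\<close>

lemma G0_v_linf: "G0 (v k) \<in> linf (- 0)" "G0 (v k) \<in> linf (- real \<beta>)"
  using G0_bounded[OF v_lone'[of 1 k]] beta linf0_beta by auto

lemma M_eq: "M k = U k + va (G0 (v k))"
  by (simp add: M_zero_def)

lemma M_add: "M (k + l) = M k + M l"
proof -
  have "G0 (v (k + l)) = G0 (v k) + G0 (v l)"
    unfolding v_add by (rule free_coeff_add[OF graph]) (auto intro: v_lone')
  then show ?thesis by (simp add: M_eq U_add adj_add[OF G0_v_linf(2) G0_v_linf(2)])
qed

lemma M_scale: "M (c *\<^sub>C k) = c *\<^sub>C M k"
  by (simp add: M_eq v_scale free_coeff_scale[OF graph] U_scale adj_scale[OF G0_v_linf(2)] scaleC_add_right)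

lemma M_symmetric: "cinner (M k) l = cinner k (M l)"
proof -
  have "v k \<in> lone 1" "v l \<in> lone 1" using beta by (auto intro: v_lone')
  then show ?thesis
    by (simp add: M_eq cinner_simps U_sym adj_cinner adj_cinner' G0_v_linf bracket_G0 v_lone)
qed

lemma G0_sum: "(\<And>i. i \<in> I \<Longrightarrow> f i \<in> lone 0) \<Longrightarrow> G0 (\<Sum>i\<in>I. f i) = (\<Sum>i\<in>I. G0 (f i))"
proof (induction I rule: infinite_finite_induct)
  case (insert i I)
  then have "G0 (f i + (\<Sum>i\<in>I. f i)) = G0 (f i) + G0 (\<Sum>i\<in>I. f i)"
    by (intro free_coeff_add[OF graph] lone_sum) auto
  then show ?case using insert by (simp only: sum.insert not_False_eq_True simp_thms) simp
qed (use free_coeff_scale[OF graph, where j=0 and c=0 and u=0] in simp_all)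

lemma lone_delta: "(\<lambda>x. if x = p then 1 else 0 :: complex) \<in> lone s"
  unfolding lone_def mem_Collect_eq by (rule finite_nonzero_values_imp_summable_on) (auto intro: finite_subset[of _ "{p}"])

text \<open>\<open>M\<close> is the unitary \<open>U\<close> plus
  \<open>va \<circ> G0 \<circ> v\<close>. Outside a large finite set \<open>P\<close> of vertices
  \<open>v k\<close> contributes at most half of \<open>norm k\<close>, by the spare weight
  \<open>\<beta> - 1\<close>; the rest depends only on the values of \<open>v k\<close> on
  \<open>P\<close>. The second estimate serves boundedness of \<open>M\<close>.\<close>

lemma M_estimate:
  "\<exists>P C. finite P \<and> (\<forall>k. norm k \<le> C * (norm (M k) + (\<Sum>p\<in>P. cmod (v k p))))
    \<and> (\<forall>k. norm (M k) \<le> C * (norm k + (\<Sum>p\<in>P. cmod (v k p))))"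
proof -
  obtain Cv where Cv: "Cv \<ge> 0" "\<And>k. lone_norm (real \<beta>) (v k) \<le> Cv * norm k" using v_bound by blast
  obtain Ca where Ca: "Ca \<ge> 0" "\<And>f c. (\<forall>x. cmod (f x) \<le> c * weight (real \<beta>) x) \<Longrightarrow> norm (va f) \<le> Ca * c"
    using adj_bound by blast
  \<comment> \<open>\<open>Ca * Cv / (N + 1)\<close> has to be at most 1/2, so that the contribution
    of the tail can be absorbed into \<open>norm k\<close>.\<close>
  obtain N :: nat where N: "2 * (Ca * Cv) < real N" using reals_Archimedean2 by blast
  define P :: "('a, 'n) vertex set" where "P = range Core \<union> (\<lambda>(\<alpha>, k). Ray \<alpha> k) ` (UNIV \<times> {..<N})"
  have P: "finite P" by (simp add: P_def)
  define e where "e p = (\<lambda>x. if x = p then 1 else 0 :: complex)" for p :: "('a, 'n) vertex"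
  have e: "e p \<in> lone s" for p s unfolding e_def by (rule lone_delta)
  have "\<exists>c\<ge>0. \<forall>x. cmod (G0 (e p) x) \<le> c" for p
  proof -
    have "G0 (e p) \<in> linf (- 0)" by (rule G0_bounded[OF e])
    then obtain c where "c \<ge> 0" "\<And>x. cmod (G0 (e p) x) \<le> c * weight 0 x" by (rule linfE) blast
    then show ?thesis by auto
  qed
  then obtain D where D: "\<And>p. D p \<ge> 0" "\<And>p x. cmod (G0 (e p) x) \<le> D p" by metis
  define Dm where "Dm = (\<Sum>p\<in>P. D p)"
  have Dm: "D p \<le> Dm" if "p \<in> P" for p unfolding Dm_def using P that D(1) by (intro member_le_sum) auto
  have Dm0: "0 \<le> Dm" unfolding Dm_def by (intro sum_nonneg D)
  have w1: "1 * 1 \<le> weight (real \<beta>) x" for x :: "('a, 'n) vertex" using weight_mono[of 0 "real \<beta>" x] by simp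
  have bd: "norm (va f) \<le> Ca * c" if f: "\<And>x. cmod (f x) \<le> c" for f :: "('a, 'n) gfun" and c
  proof (rule Ca(2), intro allI)
    fix x :: "('a, 'n) vertex"
    have "0 \<le> c" by (rule order_trans[OF norm_ge_zero f])
    then have "c * 1 \<le> c * weight (real \<beta>) x" using w1[of x] by (intro mult_left_mono) auto
    then show "cmod (f x) \<le> c * weight (real \<beta>) x" using f[of x] by linarith
  qed
  \<comment> \<open>The factor 2 results from absorbing \<open>norm k / 2\<close>;
    \<open>Ca * Dm\<close> bounds the contribution of the values on \<open>P\<close>.\<close>
  let ?C = "2 + 2 * Ca * Dm"
  have est: "norm k \<le> ?C * (norm (M k) + (\<Sum>p\<in>P. cmod (v k p)))
      \<and> norm (M k) \<le> ?C * (norm k + (\<Sum>p\<in>P. cmod (v k p)))" for k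
  proof -
    define a1 where "a1 = (\<Sum>p\<in>P. v k p *\<^sub>C e p)"
    define a2 where "a2 = v k - a1"
    have a1x: "a1 x = (if x \<in> P then v k x else 0)" for x
    proof -
      have "a1 x = (\<Sum>p\<in>P. if x = p then v k x else 0)"
        unfolding a1_def sum_fun_apply by (intro sum.cong) (auto simp: e_def)
      then show ?thesis using P by simp
    qed
    have a1: "a1 \<in> lone s" for s unfolding a1_def by (intro lone_sum lone_scale e)
    have a2: "a2 \<in> lone s" if "s \<le> real \<beta>" for s unfolding a2_def by (intro lone_diff v_lone' that a1)
    have a2x: "a2 x = (if x \<in> P then 0 else v k x)" for x by (simp add: a2_def a1x)
    have vk: "v k = a1 + a2" by (simp add: a2_def)
    have G0a1: "G0 a1 = (\<Sum>p\<in>P. v k p *\<^sub>C G0 (e p))"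
      unfolding a1_def by (subst G0_sum) (auto intro: lone_scale e simp: free_coeff_scale[OF graph])
    have G1b: "cmod (G0 a1 x) \<le> Dm * (\<Sum>p\<in>P. cmod (v k p))" for x
    proof -
      have "cmod (G0 a1 x) \<le> (\<Sum>p\<in>P. cmod (v k p * G0 (e p) x))"
        unfolding G0a1 sum_fun_apply by (rule order_trans[OF norm_sum]) simp
      also have "\<dots> \<le> (\<Sum>p\<in>P. Dm * cmod (v k p))"
      proof (rule sum_mono)
        fix p assume "p \<in> P"
        then have "cmod (G0 (e p) x) \<le> Dm" using D(2) Dm order_trans by blast
        then show "cmod (v k p * G0 (e p) x) \<le> Dm * cmod (v k p)"
          using mult_left_mono[of "cmod (G0 (e p) x)" Dm "cmod (v k p)"]
          by (simp add: norm_mult mult.commute[of Dm] del: free_coeff.simps)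
      qed
      finally show ?thesis by (simp add: sum_distrib_left)
    qed
    have a2n: "lone_norm 1 a2 \<le> lone_norm (real \<beta>) (v k) / real (Suc N)"
    proof -
      have "lone_norm 1 a2 \<le> (\<Sum>\<^sub>\<infinity>x. (1 / real (Suc N)) * (weight (real \<beta>) x * cmod (v k x)))"
        unfolding lone_norm_def
      proof (rule infsum_mono)
        show "(\<lambda>x. weight 1 x * cmod (a2 x)) summable_on UNIV" using a2[of 1] beta by (simp add: lone_def)
        show "(\<lambda>x. (1 / real (Suc N)) * (weight (real \<beta>) x * cmod (v k x))) summable_on UNIV"
          using v_lone[of k] by (intro summable_on_cmult_right) (simp add: lone_def)
        fix x :: "('a, 'n) vertex"
        show "weight 1 x * cmod (a2 x) \<le> (1 / real (Suc N)) * (weight (real \<beta>) x * cmod (v k x))"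
        proof (cases "x \<in> P")
          case True
          then show ?thesis by (simp add: a2x)
        next
          case False
          \<comment> \<open>Off \<open>P\<close> the vertex number is at least \<open>Suc N\<close>,
            and exchanging weight 1 for weight \<open>\<beta>\<close> gains at least this
            factor.\<close>
          then obtain \<alpha> l where x: "x = Ray \<alpha> l" "N \<le> l" by (cases x) (auto simp: P_def image_iff not_less)
          have "real (Suc N) \<le> vweight x" using vweight_ge[of l \<alpha>] x by (metis Suc_le_mono of_nat_le_iff order_trans)
          also have "vweight x \<le> weight (real \<beta> - 1) x"
            using weight_mono[of 1 "real \<beta> - 1" x] beta vweight_pos[of x] by (simp add: weight_eq[of 1])
          finally have "real (Suc N) * weight 1 x \<le> weight (real \<beta> - 1) x * weight 1 x"
            by (intro mult_right_mono) auto
          then have "weight 1 x \<le> (1 / real (Suc N)) * weight (real \<beta>) x"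
            using weight_add[of "real \<beta> - 1" 1 x] by (simp add: field_simps del: of_nat_Suc weight.simps)
          then have "weight 1 x * cmod (v k x) \<le> (1 / real (Suc N)) * weight (real \<beta>) x * cmod (v k x)"
            by (rule mult_right_mono) simp
          then show ?thesis using False by (simp add: a2x mult.assoc del: of_nat_Suc weight.simps)
        qed
      qed
      also have "\<dots> = lone_norm (real \<beta>) (v k) / real (Suc N)"
        unfolding lone_norm_def using v_lone[of k]
        by (subst infsum_cmult_right) (auto simp: lone_def)
      finally show ?thesis .
    qed
    have G2b: "cmod (G0 a2 x) \<le> lone_norm 1 a2" for x
    proof (cases x)
      case (Core y)
      have z: "(\<lambda>y. a2 (Core y)) = 0" by (rule ext) (simp add: a2x P_def)
      have "core_coeff E0 att 0 0 = 0" using core_coeff_scale[OF graph, where j=0 and c=0 and u=0] by simp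
      then show ?thesis using Core lone_norm_nonneg[of 1 a2] by (simp add: z)
    next
      case (Ray \<alpha> l)
      show ?thesis unfolding Ray by (rule free_coeff_0_Ray_bound) (use a2[of 1] beta in simp)
    qed
    have b1: "norm (va (G0 a1)) \<le> Ca * (Dm * (\<Sum>p\<in>P. cmod (v k p)))" by (rule bd[OF G1b])
    have b2: "norm (va (G0 a2)) \<le> norm k / 2"
    proof -
      have "norm (va (G0 a2)) \<le> Ca * lone_norm 1 a2" by (rule bd[OF G2b])
      also have "\<dots> \<le> Ca * ((Cv * norm k) / real (Suc N))"
        by (intro mult_left_mono Ca order_trans[OF a2n] divide_right_mono Cv) simp
      also have "\<dots> = (Ca * Cv / real (Suc N)) * norm k" by simp
      also have "\<dots> \<le> (1 / 2) * norm k"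
        using N by (intro mult_right_mono) (auto simp: field_simps)
      finally show ?thesis by simp
    qed
    have "G0 (v k) = G0 a1 + G0 a2"
      unfolding vk by (rule free_coeff_add[OF graph]) (auto intro: a1 a2)
    moreover have "G0 a1 \<in> linf (- real \<beta>)" "G0 a2 \<in> linf (- real \<beta>)"
      using a2[of 1] beta by (auto intro!: linf0_beta G0_bounded a1)
    ultimately have "U k = M k - (va (G0 a1) + va (G0 a2))" by (simp add: M_eq adj_add)
    then have U: "U k = M k - (va (G0 a1) + va (G0 a2))" "M k = U k + (va (G0 a1) + va (G0 a2))" by simp_all
    have S0: "0 \<le> (\<Sum>p\<in>P. cmod (v k p))" by (intro sum_nonneg) simp
    have tri: "norm (va (G0 a1) + va (G0 a2)) \<le> Ca * Dm * (\<Sum>p\<in>P. cmod (v k p)) + norm k / 2"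
      using norm_triangle_ineq[of "va (G0 a1)" "va (G0 a2)"] b1 b2 by simp
    have "norm k \<le> norm (M k) + norm (va (G0 a1) + va (G0 a2))"
      using U_norm[of k] norm_triangle_ineq4[of "M k" "va (G0 a1) + va (G0 a2)"] by (simp add: U(1))
    then have "norm k \<le> 2 * norm (M k) + 2 * Ca * Dm * (\<Sum>p\<in>P. cmod (v k p))" using tri by simp
    also have "\<dots> \<le> ?C * (norm (M k) + (\<Sum>p\<in>P. cmod (v k p)))"
      using Ca(1) Dm0 S0 by (simp add: algebra_simps)
    finally have "norm k \<le> ?C * (norm (M k) + (\<Sum>p\<in>P. cmod (v k p)))" .
    moreover have "norm (M k) \<le> ?C * (norm k + (\<Sum>p\<in>P. cmod (v k p)))"
    proof -
      have "norm (M k) \<le> norm k + norm (va (G0 a1) + va (G0 a2))"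
        using U_norm[of k] norm_triangle_ineq[of "U k" "va (G0 a1) + va (G0 a2)"] by (subst U(2)) simp
      also have "\<dots> \<le> 2 * norm k + 2 * Ca * Dm * (\<Sum>p\<in>P. cmod (v k p))"
      proof -
        have "0 \<le> Ca * Dm * (\<Sum>p\<in>P. cmod (v k p))" by (intro mult_nonneg_nonneg Ca Dm0 S0)
        then show ?thesis using tri norm_ge_zero[of k] unfolding mult.assoc by linarith
      qed
      also have "\<dots> \<le> ?C * (norm k + (\<Sum>p\<in>P. cmod (v k p)))"
        using Ca(1) Dm0 S0 by (simp add: algebra_simps)
      finally show ?thesis .
    qed
    ultimately show ?thesis by blast
  qed
  then show ?thesis using P by blast
qed

lemma v_pointwise_bound: "\<exists>B. \<forall>k p. cmod (v k p) \<le> B * norm k"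
proof -
  obtain Cv where Cv: "Cv \<ge> 0" "\<And>k. lone_norm (real \<beta>) (v k) \<le> Cv * norm k" using v_bound by blast
  have "cmod (v k p) \<le> Cv * norm k" for k p
  proof -
    have "1 * cmod (v k p) \<le> weight (real \<beta>) p * cmod (v k p)"
      using weight_mono[of 0 "real \<beta>" p] by (intro mult_right_mono) auto
    also have "\<dots> = (\<Sum>x\<in>{p}. weight (real \<beta>) x * cmod (v k x))" by simp
    also have "\<dots> \<le> lone_norm (real \<beta>) (v k)"
      unfolding lone_norm_def using v_lone[of k] by (intro finite_sum_le_infsum) (auto simp: lone_def)
    finally show ?thesis using Cv(2)[of k] by simp
  qed
  then show ?thesis by blast
qed

lemma M_bounded_linear: "bounded_linear M"
proof -
  obtain P C where P: "finite P" "\<And>k. norm (M k) \<le> C * (norm k + (\<Sum>p\<in>P. cmod (v k p)))"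
    using M_estimate by blast
  obtain B where B: "\<And>k p. cmod (v k p) \<le> B * norm k" using v_pointwise_bound by blast
  show ?thesis
  proof (rule bounded_linear_intro)
    show "M (k + l) = M k + M l" for k l by (rule M_add)
    show "M (r *\<^sub>R k) = r *\<^sub>R M k" for r k using M_scale[of "complex_of_real r" k] by (simp add: scaleC_of_real)
    show "norm (M k) \<le> norm k * (\<bar>C\<bar> * (1 + real (card P) * B))" for k
    proof -
      have S0: "0 \<le> (\<Sum>p\<in>P. cmod (v k p))" by (intro sum_nonneg) simp
      have "norm (M k) \<le> C * (norm k + (\<Sum>p\<in>P. cmod (v k p)))" by (rule P)
      also have "\<dots> \<le> \<bar>C\<bar> * (norm k + (\<Sum>p\<in>P. cmod (v k p)))" using S0 by (intro mult_right_mono) auto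
      also have "\<dots> \<le> \<bar>C\<bar> * (norm k + (\<Sum>p\<in>P. B * norm k))"
        by (intro mult_left_mono add_left_mono sum_mono B) simp
      finally show ?thesis by (simp add: algebra_simps)
    qed
  qed
qed

lemma M_range:
  assumes "y \<in> orth_compl (Ker M)"
  shows "\<exists>k\<in>orth_compl (Ker M). M k = y"
proof -
  obtain P C where P: "finite P" "\<And>k. norm k \<le> C * (norm (M k) + (\<Sum>p\<in>P. cmod (v k p)))"
    using M_estimate by blast
  obtain B where B: "\<And>k p. cmod (v k p) \<le> B * norm k" using v_pointwise_bound by blast
  show ?thesis
    by (rule self_adjoint_range[where l="\<lambda>p k. v k p", OF M_bounded_linear M_scale M_symmetric P(1) _ B P(2) assms])
      (simp add: v_diff)
qed

lemma closed_csubspace_Ker_M: "closed_csubspace (Ker M)"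
proof -
  interpret M: bounded_linear M by (rule M_bounded_linear)
  have "closed (M -` {0})" using M_bounded_linear by (auto intro!: closed_vimage simp: linear_continuous_on)
  moreover have "Ker M = M -` {0}" by (auto simp: Ker_def)
  ultimately show ?thesis by (auto simp: closed_csubspace_def Ker_def M.add M.zero M_scale)
qed

lemma pseudo_inv_orth:
  fixes T :: "'k \<Rightarrow> 'k"
  assumes K: "closed_csubspace (Ker T)" and y: "y \<in> orth_compl (Ker T)"
    and ex: "\<exists>k\<in>orth_compl (Ker T). T k = y"
  shows "pseudo_inv T y \<in> orth_compl (Ker T)" "T (pseudo_inv T y) = y"
proof -
  have "0 \<in> Ker T" using K by (simp add: closed_csubspace_def)
  then have "orth_proj (Ker T) y = 0" using y by (intro orth_proj_eqI[OF K]) auto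
  moreover have "y \<in> T ` orth_compl (Ker T)" using ex by blast
  ultimately show "pseudo_inv T y \<in> orth_compl (Ker T)" "T (pseudo_inv T y) = y"
    unfolding pseudo_inv_def by (auto intro: inv_into_into f_inv_into_f)
qed

abbreviation "Md \<equiv> pseudo_inv M"

lemma Md_spec:
  assumes "y \<in> orth_compl (Ker M)"
  shows "M (Md y) = y"
  by (rule pseudo_inv_orth[OF closed_csubspace_Ker_M assms M_range[OF assms]])


section \<open>Resonance functions as kernel vectors, and inversion of \<open>mz\<close>\<close>

subsection \<open>The kernel of the threshold operator\<close>

definition res_of :: "'k \<Rightarrow> ('a, 'n) gfun"
  where "res_of k = - G0 (v k)"

definition ker_of :: "('a, 'n) gfun \<Rightarrow> 'k"
  where "ker_of \<Psi> = U (va \<Psi>)"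

text \<open>Kernel vectors satisfy \<open>va (G0 (v k)) = - U k\<close>, so
  \<open>va (res_of k) = U k\<close>; because \<open>U\<close> is an involution,
  \<open>V (res_of k) = v k\<close>. This is the homogeneous Lippmann-Schwinger equation for
  \<open>res_of k\<close>.\<close>

lemma
  assumes "k \<in> Ker M"
  shows res_of_res: "res_of k \<in> Eres" and V_res_of: "V (res_of k) = v k"
proof -
  have l: "res_of k \<in> linf (- real \<beta>)" unfolding res_of_def by (intro linf_minus G0_v_linf)
  have "va (G0 (v k)) = - U k" using assms by (simp add: Ker_def M_eq eq_neg_iff_add_eq_0 add.commute)
  then have "va (res_of k) = U k" by (simp add: res_of_def adj_minus[OF G0_v_linf(2)])
  then show V: "V (res_of k) = v k" using l by (simp add: V_linf)
  show "res_of k \<in> Eres" unfolding res_eigenspace_iff V using l by (simp add: res_of_def)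
qed

lemma v_ker_of: "\<Psi> \<in> linf (- real \<beta>) \<Longrightarrow> v (ker_of \<Psi>) = V \<Psi>"
  by (simp add: ker_of_def V_linf)

lemma ker_of_Ker: "\<Psi> \<in> Eres \<Longrightarrow> ker_of \<Psi> \<in> Ker M"
proof -
  assume \<Psi>: "\<Psi> \<in> Eres"
  have "va (G0 (V \<Psi>)) = - va \<Psi>" by (simp add: res_eq[OF \<Psi>] adj_minus res_linf[OF \<Psi>])
  then show ?thesis by (simp add: Ker_def M_eq v_ker_of res_linf[OF \<Psi>]) (simp add: ker_of_def)
qed

text \<open>Under \<open>res_of\<close>, the kernel of \<open>M\<^sub>0\<close> corresponds to the resonance space and \<open>KB\<close> to the bound
  states.\<close>

definition KB :: "'k set"
  where "KB = {k \<in> Ker M. \<forall>\<alpha>. res_coeff (v k) \<alpha> = 0}"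

text \<open>On this complement a vector is determined by the numbers \<open>res_coeff (v k)\<close>,
  since a vector of \<open>Ker M\<close> without them lies in \<open>KB\<close>. It is the subspace
  on which \<open>mz\<close> is invertible.\<close>

definition KF :: "'k set"
  where "KF = Ker M \<inter> orth_compl KB"

lemma nvec_linf_beta: "nvec \<alpha> \<in> linf (- real \<beta>)"
  using beta by (intro nvec_linf) simp

lemma res_coeff_v: "res_coeff (v k) \<alpha> = cinner (va (nvec \<alpha>)) k"
  by (simp add: res_coeff_def adj_cinner'[OF nvec_linf_beta])

lemma closed_csubspace_KB: "closed_csubspace KB"
proof -
  have "KB = Ker M \<inter> orth_compl (range (\<lambda>\<alpha>. va (nvec \<alpha>)))"
    by (auto simp: KB_def orth_compl_def res_coeff_v)
  then show ?thesis using closed_csubspace_Int[OF closed_csubspace_Ker_M closed_csubspace_orth_compl] by simp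
qed

lemma closed_csubspace_KF: "closed_csubspace KF"
  unfolding KF_def by (rule closed_csubspace_Int[OF closed_csubspace_Ker_M closed_csubspace_orth_compl])

lemma KF_Ker: "k \<in> KF \<Longrightarrow> k \<in> Ker M"
  by (simp add: KF_def)

lemma KB_Ker: "k \<in> KB \<Longrightarrow> k \<in> Ker M"
  by (simp add: KB_def)

lemma KB_KF_zero: "k \<in> KB \<Longrightarrow> k \<in> KF \<Longrightarrow> k = 0"
  by (auto simp: KF_def intro: orth_compl_disjoint)

lemma Ker_M_decomp:
  assumes "k \<in> Ker M" obtains b f where "b \<in> KB" "f \<in> KF" "k = b + f"
proof
  let ?b = "orth_proj KB k"
  show b: "?b \<in> KB" by (rule orth_proj_in[OF closed_csubspace_KB])
  show "k - ?b \<in> KF" unfolding KF_def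
    using orth_proj_compl[OF closed_csubspace_KB, of k] KB_Ker[OF b]
      closed_csubspace_diff[OF closed_csubspace_Ker_M assms] by blast
  show "k = ?b + (k - ?b)" by simp
qed

lemma res_coeff_v_add: "res_coeff (v (k + l)) \<alpha> = res_coeff (v k) \<alpha> + res_coeff (v l) \<alpha>"
  by (simp add: res_coeff_v cinner_add_right)

lemma res_coeff_v_diff: "res_coeff (v (k - l)) \<alpha> = res_coeff (v k) \<alpha> - res_coeff (v l) \<alpha>"
  by (simp add: res_coeff_v cinner_diff_right)

lemma res_coeff_v_scale: "res_coeff (v (c *\<^sub>C k)) \<alpha> = c * res_coeff (v k) \<alpha>"
  by (simp add: res_coeff_v cinner_scaleC_right)

lemma res_coeff_v_sum: "res_coeff (v (\<Sum>i\<in>I. f i)) \<alpha> = (\<Sum>i\<in>I. res_coeff (v (f i)) \<alpha>)"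
  by (simp add: res_coeff_v cinner_sum_right)

abbreviation "mz \<equiv> m_zero E0 att v U"
abbreviation "md \<equiv> pseudo_inv mz"

definition qvec :: "'n \<Rightarrow> 'k"
  where "qvec \<alpha> = orth_proj (Ker M) (va (nvec \<alpha>))"

lemma mz_eq: "mz k = - (\<Sum>\<alpha>\<in>UNIV. cinner (qvec \<alpha>) k *\<^sub>C qvec \<alpha>)"
  by (simp add: m_zero_def Let_def qvec_def)

lemma qvec_Ker: "qvec \<alpha> \<in> Ker M"
  unfolding qvec_def by (rule orth_proj_in[OF closed_csubspace_Ker_M])

text \<open>Vectors of \<open>Ker M\<close> do not see the difference between
  \<open>va (nvec \<alpha>)\<close> and its projection onto \<open>Ker M\<close>.\<close>

lemma cinner_qvec: "k \<in> Ker M \<Longrightarrow> cinner (qvec \<alpha>) k = res_coeff (v k) \<alpha>"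
proof -
  assume "k \<in> Ker M"
  then have "cinner k (va (nvec \<alpha>) - qvec \<alpha>) = 0"
    using orth_proj_compl[OF closed_csubspace_Ker_M, of "va (nvec \<alpha>)"] by (auto simp: orth_compl_def qvec_def)
  then have "cinner k (qvec \<alpha>) = cinner k (va (nvec \<alpha>))" by (simp add: cinner_diff_right)
  then show ?thesis unfolding res_coeff_v using cinner_commute by metis
qed

lemma cinner_qvec': "k \<in> Ker M \<Longrightarrow> cinner k (qvec \<alpha>) = cnj (res_coeff (v k) \<alpha>)"
  using cinner_qvec[of k \<alpha>] cinner_commute[of k "qvec \<alpha>"] by simp

lemma qvec_KF: "qvec \<alpha> \<in> KF"
  unfolding KF_def using qvec_Ker[of \<alpha>] by (auto simp: orth_compl_def KB_def cinner_qvec')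

text \<open>On \<open>Ker M\<close> the form of \<open>mz\<close> is thus the pairing of
  \<open>v k\<close> with \<open>G1 (v x)\<close>, as \<open>bracket_G1\<close> shows:
  \<open>mz\<close> is the compression of \<open>va \<circ> G1 \<circ> v\<close>.\<close>

lemma cinner_mz: "k \<in> Ker M \<Longrightarrow> x \<in> Ker M \<Longrightarrow>
  cinner k (mz x) = - (\<Sum>\<alpha>\<in>UNIV. cnj (res_coeff (v k) \<alpha>) * res_coeff (v x) \<alpha>)"
  by (simp add: mz_eq cinner_minus_right cinner_sum_right cinner_scaleC_right cinner_qvec cinner_qvec' mult.commute)

text \<open>\<open>mz\<close> is minus a sum of rank-one squares, so its kernel is the complement of
  all \<open>qvec\<close>. These lie in \<open>KF\<close>, and a vector of \<open>KF\<close>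
  orthogonal to all of them has no \<open>res_coeff\<close>, hence is 0.\<close>

lemma Ker_mz: "Ker mz = orth_compl KF"
proof
  show "orth_compl KF \<subseteq> Ker mz"
    using qvec_KF by (auto simp: Ker_def orth_compl_def mz_eq)
  show "Ker mz \<subseteq> orth_compl KF"
  proof
    fix k assume "k \<in> Ker mz"
    then have "mz k = 0" by (simp add: Ker_def)
    then have "cinner k (mz k) = 0" by simp
    then have "(\<Sum>\<alpha>\<in>UNIV. cinner (qvec \<alpha>) k * cinner k (qvec \<alpha>)) = 0"
      by (simp add: mz_eq cinner_minus_right cinner_sum_right cinner_scaleC_right)
    moreover have "cinner (qvec \<alpha>) k * cinner k (qvec \<alpha>) = complex_of_real ((cmod (cinner (qvec \<alpha>) k))\<^sup>2)" for \<alpha>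
      using cinner_commute[of k "qvec \<alpha>"] by (simp only: complex_norm_square)
    ultimately have "complex_of_real (\<Sum>\<alpha>\<in>UNIV. (cmod (cinner (qvec \<alpha>) k))\<^sup>2) = 0" by simp
    then have "(\<Sum>\<alpha>\<in>UNIV. (cmod (cinner (qvec \<alpha>) k))\<^sup>2) = 0" using of_real_eq_0_iff by blast
    then have q0: "cinner (qvec \<alpha>) k = 0" for \<alpha> by (subst (asm) sum_nonneg_eq_0_iff) auto
    define h where "h = orth_proj KF k"
    have h: "h \<in> KF" "k - h \<in> orth_compl KF" unfolding h_def
      by (rule orth_proj_in[OF closed_csubspace_KF], rule orth_proj_compl[OF closed_csubspace_KF])
    have "cinner (qvec \<alpha>) (k - h) = 0" for \<alpha> using h(2) qvec_KF by (auto simp: orth_compl_def)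
    then have "res_coeff (v h) \<alpha> = 0" for \<alpha> using q0[of \<alpha>] cinner_qvec[OF KF_Ker[OF h(1)], of \<alpha>] by (simp add: cinner_diff_right)
    then have "h \<in> KB" using KF_Ker[OF h(1)] by (simp add: KB_def)
    then have "h = 0" using KB_KF_zero h(1) by blast
    then show "k \<in> orth_compl KF" using h(2) by simp
  qed
qed

text \<open>Carried over to \<open>KF\<close>, the resonance functions form a basis in which the
  form of \<open>mz\<close> is minus the identity, because their constants are orthonormal; the
  solution is then explicit. Only the component of \<open>y\<close> in \<open>KF\<close> can be
  reached, whence the weak form of the equation.\<close>

lemma md_spec:
  fixes \<Psi> :: "'i \<Rightarrow> ('a, 'n) gfun"
  assumes I: "finite I" and \<Psi>: "\<And>i. i \<in> I \<Longrightarrow> \<Psi> i \<in> Eres"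
    and span: "\<And>\<Phi>. \<Phi> \<in> Eres \<Longrightarrow> \<exists>a. \<Phi> - (\<Sum>i\<in>I. a i *\<^sub>C \<Psi> i) \<in> Ebd"
    and on: "\<And>i j. i \<in> I \<Longrightarrow> j \<in> I \<Longrightarrow>
      (\<Sum>\<alpha>\<in>UNIV. cnj (res_coeff (V (\<Psi> i)) \<alpha>) * res_coeff (V (\<Psi> j)) \<alpha>) = (if i = j then 1 else 0)"
  shows "md y \<in> KF" and "\<And>k. k \<in> KF \<Longrightarrow> cinner k (mz (md y)) = cinner k y"
proof -
  \<comment> \<open>Subtracting the \<open>KB\<close> component moves the vector into
    \<open>KF\<close> and leaves its \<open>res_coeff\<close> unchanged.\<close>
  define w where "w i = ker_of (\<Psi> i) - orth_proj KB (ker_of (\<Psi> i))" for i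
  have bKB: "orth_proj KB k \<in> KB" for k by (rule orth_proj_in[OF closed_csubspace_KB])
  have wF: "w i \<in> KF" if "i \<in> I" for i
    unfolding w_def KF_def using orth_proj_compl[OF closed_csubspace_KB]
      closed_csubspace_diff[OF closed_csubspace_Ker_M ker_of_Ker[OF \<Psi>[OF that]] KB_Ker[OF bKB]] by blast
  have wc: "res_coeff (v (w i)) \<alpha> = res_coeff (V (\<Psi> i)) \<alpha>" if "i \<in> I" for i \<alpha>
    using bKB[of "ker_of (\<Psi> i)"]
    by (simp add: w_def res_coeff_v_diff v_ker_of res_linf[OF \<Psi>[OF that]] KB_def)
  define a where "a k i = (\<Sum>\<alpha>\<in>UNIV. cnj (res_coeff (v (w i)) \<alpha>) * res_coeff (v k) \<alpha>)" for k i
  have rep: "k = (\<Sum>i\<in>I. a k i *\<^sub>C w i)" if k: "k \<in> KF" for k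
  proof -
    have r: "res_of k \<in> Eres" by (rule res_of_res[OF KF_Ker[OF k]])
    from span[OF r] obtain b where b: "res_of k - (\<Sum>i\<in>I. b i *\<^sub>C \<Psi> i) \<in> Ebd" by blast
    have l: "b i *\<^sub>C \<Psi> i \<in> linf (- real \<beta>)" if "i \<in> I" for i by (intro linf_scale res_linf \<Psi> that)
    have "V (res_of k - (\<Sum>i\<in>I. b i *\<^sub>C \<Psi> i)) = v k - (\<Sum>i\<in>I. b i *\<^sub>C V (\<Psi> i))"
      by (subst V_diff) (auto intro!: res_linf r linf_sum l sum.cong
          simp: V_res_of[OF KF_Ker[OF k]] V_sum[OF l] V_scale[OF res_linf[OF \<Psi>]])
    also have "\<dots> = v (k - (\<Sum>i\<in>I. b i *\<^sub>C w i) - (\<Sum>i\<in>I. b i *\<^sub>C orth_proj KB (ker_of (\<Psi> i))))"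
      using v_ker_of[OF res_linf[OF \<Psi>]]
      by (simp add: v_diff v_sum v_scale w_def scaleC_diff_right sum_subtractf)
    finally have "res_coeff (v (k - (\<Sum>i\<in>I. b i *\<^sub>C w i) - (\<Sum>i\<in>I. b i *\<^sub>C orth_proj KB (ker_of (\<Psi> i))))) \<alpha> = 0" for \<alpha>
      using b unfolding bound_eigenspace_iff by metis
    then have c: "res_coeff (v (k - (\<Sum>i\<in>I. b i *\<^sub>C w i))) \<alpha> = 0" for \<alpha>
      using bKB by (simp add: res_coeff_v_diff res_coeff_v_sum res_coeff_v_scale KB_def)
    have F: "k - (\<Sum>i\<in>I. b i *\<^sub>C w i) \<in> KF"
      using closed_csubspace_KF wF k
      by (intro closed_csubspace_diff closed_csubspace_sum) (auto simp: closed_csubspace_def)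
    then have "k - (\<Sum>i\<in>I. b i *\<^sub>C w i) \<in> KB" using c KF_Ker by (auto simp: KB_def)
    then have eq: "k = (\<Sum>i\<in>I. b i *\<^sub>C w i)" using KB_KF_zero F by fastforce
    have "a k j = b j" if j: "j \<in> I" for j
    proof -
      have "a k j = (\<Sum>\<alpha>\<in>UNIV. cnj (res_coeff (v (w j)) \<alpha>) * (\<Sum>i\<in>I. b i * res_coeff (v (w i)) \<alpha>))"
        unfolding a_def using arg_cong[OF eq, of "\<lambda>k. res_coeff (v k)"]
        by (simp only: fun_eq_iff res_coeff_v_sum res_coeff_v_scale)
      also have "\<dots> = (\<Sum>i\<in>I. b i * (\<Sum>\<alpha>\<in>UNIV. cnj (res_coeff (v (w j)) \<alpha>) * res_coeff (v (w i)) \<alpha>))"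
        unfolding sum_distrib_left by (subst sum.swap) (simp add: mult_ac)
      also have "\<dots> = (\<Sum>i\<in>I. if i = j then b j else 0)"
        using j by (intro sum.cong) (auto simp: wc on)
      finally show ?thesis using I j by simp
    qed
    then show ?thesis by (subst eq) (auto intro: sum.cong)
  qed
  \<comment> \<open>The sign compensates that of \<open>mz\<close>, which acts as minus the identity
    in the coordinates \<open>a\<close>.\<close>
  define x where "x = - (\<Sum>i\<in>I. cinner (w i) y *\<^sub>C w i)"
  have xF: "x \<in> KF" unfolding x_def using closed_csubspace_KF wF
    by (intro closed_csubspace_minus closed_csubspace_sum) (auto simp: closed_csubspace_def)
  have sol: "cinner k (mz x) = cinner k y" if k: "k \<in> KF" for k
  proof -
    have "res_coeff (v x) \<alpha> = - (\<Sum>i\<in>I. cinner (w i) y * res_coeff (v (w i)) \<alpha>)" for \<alpha>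
      by (simp add: x_def res_coeff_v cinner_minus_right cinner_sum_right cinner_scaleC_right)
    then have "cinner k (mz x) = (\<Sum>\<alpha>\<in>UNIV. cnj (res_coeff (v k) \<alpha>) * (\<Sum>i\<in>I. cinner (w i) y * res_coeff (v (w i)) \<alpha>))"
      by (simp add: cinner_mz[OF KF_Ker[OF k] KF_Ker[OF xF]] sum_negf)
    also have "\<dots> = (\<Sum>i\<in>I. cinner (w i) y * (\<Sum>\<alpha>\<in>UNIV. cnj (res_coeff (v k) \<alpha>) * res_coeff (v (w i)) \<alpha>))"
      unfolding sum_distrib_left by (subst sum.swap) (simp add: mult_ac)
    also have "\<dots> = (\<Sum>i\<in>I. cnj (a k i) * cinner (w i) y)"
      by (simp add: a_def mult_ac)
    also have "\<dots> = cinner (\<Sum>i\<in>I. a k i *\<^sub>C w i) y"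
      by (simp add: cinner_sum_left cinner_scaleC_left)
    finally show ?thesis using rep[OF k] by simp
  qed
  have mF: "mz x \<in> KF" unfolding mz_eq using closed_csubspace_KF qvec_KF
    by (intro closed_csubspace_minus closed_csubspace_sum) (auto simp: closed_csubspace_def)
  have FF: "KF \<subseteq> orth_compl (Ker mz)"
  proof
    fix k assume k: "k \<in> KF"
    have "cinner s k = 0" if "s \<in> orth_compl KF" for s
      using that k cinner_commute[of s k] by (auto simp: orth_compl_def)
    then show "k \<in> orth_compl (Ker mz)" by (auto simp: Ker_mz orth_compl_def[of "orth_compl KF"])
  qed
  have Kc: "closed_csubspace (Ker mz)" unfolding Ker_mz by (rule closed_csubspace_orth_compl)
  have "orth_proj (Ker mz) y = y - mz x"
  proof (rule orth_proj_eqI[OF Kc])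
    show "y - mz x \<in> Ker mz" unfolding Ker_mz using sol by (simp add: orth_compl_def cinner_diff_right)
    show "y - (y - mz x) \<in> orth_compl (Ker mz)" using FF mF by auto
  qed
  then have md: "md y = inv_into (orth_compl (Ker mz)) mz (mz x)" by (simp add: pseudo_inv_def)
  have im: "mz x \<in> mz ` orth_compl (Ker mz)" using FF xF by blast
  let ?z = "md y"
  have z: "?z \<in> orth_compl (Ker mz)" "mz ?z = mz x"
    unfolding md by (rule inv_into_into[OF im], rule f_inv_into_f[OF im])
  have "mz (?z - x) = mz ?z - mz x"
  proof -
    have "cinner q (a - b) *\<^sub>C q = cinner q a *\<^sub>C q - cinner q b *\<^sub>C q" for q a b :: 'k
      using scaleC_add_left[of "cinner q a" "- cinner q b" q] by (simp add: cinner_diff_right scaleC_minus_left)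
    then show ?thesis by (simp add: mz_eq sum_subtractf)
  qed
  then have "?z - x \<in> Ker mz" using z(2) by (simp add: Ker_def)
  moreover have "?z - x \<in> orth_compl (Ker mz)"
    by (rule closed_csubspace_diff[OF closed_csubspace_orth_compl z(1)]) (use FF xF in blast)
  ultimately have "?z - x = 0" by (rule orth_compl_disjoint)
  then have "?z = x" by simp
  then show "md y \<in> KF" "\<And>k. k \<in> KF \<Longrightarrow> cinner k (mz (md y)) = cinner k y" using xF sol by auto
qed

end


section \<open>Uniform Taylor remainders of exp (- \<theta> n) in powers of kappa\<close>

section \<open>Low energy expansion of the resolvent\<close>

text \<open>The free half-line resolvent is governed by \<open>exp (- \<theta> n)\<close>, where \<open>\<kappa> = 2 sinh (\<theta>/2)\<close>
  solves \<open>\<kappa>\<^sup>2 = exp \<theta> + exp (- \<theta>) - 2\<close>. Only the limit along real \<open>\<theta> \<rightarrow> 0+\<close> is needed to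
  identify coefficients.\<close>

definition kap :: "real \<Rightarrow> real"
  where "kap \<theta> = 2 * sinh (\<theta> / 2)"

lemma kap_pos: "0 < \<theta> \<Longrightarrow> 0 < kap \<theta>"
  by (simp add: kap_def)

lemma kap_sq: "(kap \<theta>)\<^sup>2 = exp \<theta> + exp (- \<theta>) - 2"
proof -
  have "exp (\<theta> / 2) * exp (\<theta> / 2) = exp \<theta>" "exp (- \<theta> / 2) * exp (- \<theta> / 2) = exp (- \<theta>)"
    "exp (\<theta> / 2) * exp (- \<theta> / 2) = 1"
    by (simp_all flip: exp_add)
  then show ?thesis
    by (simp add: kap_def sinh_def power2_eq_square algebra_simps)
qed

lemma kap_tendsto: "filterlim kap (at_right 0) (at_right 0)"
  unfolding kap_def by real_asymp

lemma kap_tendsto_0: "(kap \<longlongrightarrow> 0) (at_right 0)"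
  using kap_tendsto by (simp add: filterlim_at)

lemma kap_small: "\<forall>\<^sub>F \<theta> in at_right 0. 0 < kap \<theta> \<and> kap \<theta> \<le> 1 \<and> 0 < \<theta> \<and> \<theta> \<le> kap \<theta>"
proof -
  have "\<forall>\<^sub>F \<theta> in at_right 0. 0 < kap \<theta>" "\<forall>\<^sub>F \<theta> in at_right 0. kap \<theta> \<le> 1"
    "\<forall>\<^sub>F \<theta> in at_right 0. 0 < (\<theta>::real)" "\<forall>\<^sub>F \<theta> in at_right 0. \<theta> \<le> kap \<theta>"
    unfolding kap_def by real_asymp+
  then show ?thesis by eventually_elim auto
qed

text \<open>The argument will be \<theta> n with unbounded n, so the bound has to hold on the whole
  half-axis; \<open>exp t \<le> 1\<close> at the intermediate point makes the Lagrange remainder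
  uniform.\<close>

lemma exp_minus_Taylor:
  assumes "0 \<le> (x::real)" "0 < n"
  shows "\<bar>exp (- x) - (\<Sum>m<n. (- x) ^ m / fact m)\<bar> \<le> x ^ n"
proof (cases "x = 0")
  case True
  then show ?thesis using assms(2)
    by (cases n) (simp_all add: sum.lessThan_Suc_shift del: sum.lessThan_Suc)
next
  case False
  then have "- x < 0" using assms(1) by simp
  have "\<exists>t. - x < t \<and> t < 0 \<and> exp (- x) = (\<Sum>m<n. exp 0 / fact m * (- x) ^ m) + exp t / fact n * (- x) ^ n"
    by (rule Maclaurin_minus[where diff="\<lambda>_. exp"]) (use \<open>- x < 0\<close> assms in \<open>auto intro!: derivative_eq_intros\<close>)
  then obtain t where t: "t < 0" "exp (- x) = (\<Sum>m<n. exp 0 / fact m * (- x) ^ m) + exp t / fact n * (- x) ^ n"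
    by blast
  have "exp (- x) - (\<Sum>m<n. (- x) ^ m / fact m) = exp t / fact n * (- x) ^ n"
    using t(2) by simp
  then have "\<bar>exp (- x) - (\<Sum>m<n. (- x) ^ m / fact m)\<bar> = exp t / fact n * x ^ n"
    using assms(1) by (simp add: abs_mult power_abs)
  also have "\<dots> \<le> 1 * x ^ n"
  proof (rule mult_right_mono)
    have "exp t / fact n \<le> 1 / 1"
      using t(1) fact_ge_1[of n, where 'a=real] by (intro frac_le) auto
    then show "exp t / fact n \<le> 1" by simp
  qed (use assms in simp)
  finally show ?thesis by simp
qed

text \<open>\<open>ray_rem j \<theta> n\<close> is the \<open>j\<close>-th rescaled Taylor remainder in \<open>\<kappa>\<close> of \<open>exp (- \<theta> n)\<close>; its Taylor
  coefficients are \<open>ray_kernel j 1 n\<close>.\<close>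

fun ray_rem :: "nat \<Rightarrow> real \<Rightarrow> nat \<Rightarrow> real" where
  "ray_rem 0 \<theta> l = exp (- (\<theta> * real (Suc l)))"
| "ray_rem (Suc j) \<theta> l = (ray_rem j \<theta> l - ray_kernel j 1 (real (Suc l))) / kap \<theta>"

lemma ray_kernel_init:
  assumes "1 \<le> m"
  shows "ray_kernel 0 1 m = 1" "ray_kernel (Suc 0) 1 m = - m" "ray_kernel 2 1 m = m\<^sup>2 / 2" "ray_kernel 3 1 m = m / 24 - m ^ 3 / 6"
  using assms by (auto simp: ray_kernel_def power2_eq_square max_def min_def)

text \<open>Up to a power of kappa the remainder is exp (- (\<theta> n)) minus a polynomial in kappa
  and n. It is compared with the Taylor polynomial in \<theta> n, and the discrepancies between
  powers of kappa and of \<theta> are of the required order. Polynomial growth in n is the price of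
  uniformity over the half-line.\<close>

lemma ray_rem_bound:
  assumes "j \<le> 3"
  shows "\<exists>D\<ge>0. \<forall>\<^sub>F \<theta> in at_right 0. \<forall>l. \<bar>ray_rem (Suc j) \<theta> l\<bar> \<le> D * real (Suc l) ^ (Suc j)"
proof -
  \<comment> \<open>From kappa = 2 sinh (\<theta>/2) = \<theta> + \<theta>^3/24 + O(\<theta>^5).
    This is the origin of the 1/24 in the linear term of \<open>ray_kernel 3 1 m\<close>.\<close>
  have O: "kap \<in> O[at_right 0](kap)" 
    "(\<lambda>\<theta>. kap \<theta> - \<theta>) \<in> O[at_right 0](\<lambda>\<theta>. kap \<theta> ^ 3)"
    "(\<lambda>\<theta>. kap \<theta> - \<theta> - kap \<theta> ^ 3 / 24) \<in> O[at_right 0](\<lambda>\<theta>. kap \<theta> ^ 4)"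
    "(\<lambda>\<theta>. (kap \<theta>)\<^sup>2 - \<theta>\<^sup>2) \<in> O[at_right 0](\<lambda>\<theta>. kap \<theta> ^ 4)"
    "(\<lambda>\<theta>. (kap \<theta>) ^ 3 - \<theta> ^ 3) \<in> O[at_right 0](\<lambda>\<theta>. kap \<theta> ^ 4)"
    unfolding kap_def by real_asymp+
  obtain c1 where c1: "c1 > 0" "\<forall>\<^sub>F \<theta> in at_right 0. norm (kap \<theta> - \<theta>) \<le> c1 * norm (kap \<theta> ^ 3)"
    using O(2) by (rule landau_o.bigE)
  obtain c2 where c2: "c2 > 0" "\<forall>\<^sub>F \<theta> in at_right 0. norm (kap \<theta> - \<theta> - kap \<theta> ^ 3 / 24) \<le> c2 * norm (kap \<theta> ^ 4)"
    using O(3) by (rule landau_o.bigE)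
  obtain c3 where c3: "c3 > 0" "\<forall>\<^sub>F \<theta> in at_right 0. norm ((kap \<theta>)\<^sup>2 - \<theta>\<^sup>2) \<le> c3 * norm (kap \<theta> ^ 4)"
    using O(4) by (rule landau_o.bigE)
  obtain c4 where c4: "c4 > 0" "\<forall>\<^sub>F \<theta> in at_right 0. norm (kap \<theta> ^ 3 - \<theta> ^ 3) \<le> c4 * norm (kap \<theta> ^ 4)"
    using O(5) by (rule landau_o.bigE)
  \<comment> \<open>One summand for each error source; the 1 belongs to the Taylor remainder of the
    exponential.\<close>
  define D where "D = 1 + c1 + c2 + c3 + c4"
  have "\<forall>\<^sub>F \<theta> in at_right 0. \<forall>l. \<bar>ray_rem (Suc j) \<theta> l\<bar> \<le> D * real (Suc l) ^ (Suc j)"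
    using kap_small c1(2) c2(2) c3(2) c4(2)
  proof eventually_elim
    case (elim \<theta>)
    define k where "k = kap \<theta>"
    have k: "0 < k" "k \<le> 1" "0 < \<theta>" "\<theta> \<le> k" using elim by (auto simp: k_def)
    have kp: "k ^ 3 \<le> k\<^sup>2" "k ^ 4 \<le> k ^ 3" using k by (auto intro!: power_decreasing)
    have e1: "\<bar>k - \<theta>\<bar> \<le> c1 * k ^ 3" and e2: "\<bar>k - \<theta> - k ^ 3 / 24\<bar> \<le> c2 * k ^ 4"
      and e3: "\<bar>k\<^sup>2 - \<theta>\<^sup>2\<bar> \<le> c3 * k ^ 4" and e4: "\<bar>k ^ 3 - \<theta> ^ 3\<bar> \<le> c4 * k ^ 4"
      using elim k by (auto simp: k_def)
    have e1': "\<bar>k - \<theta>\<bar> \<le> c1 * k\<^sup>2" and e3': "\<bar>k\<^sup>2 - \<theta>\<^sup>2\<bar> \<le> c3 * k ^ 3"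
      using e1 e3 mult_left_mono[OF kp(1), of c1] mult_left_mono[OF kp(2), of c3] c1(1) c3(1) by linarith+
    show ?case
    proof
      fix l
      define n where "n = real (Suc l)"
      have n1: "1 \<le> n" by (simp add: n_def)
      define E where "E = exp (- (\<theta> * n))"
      have x: "0 \<le> \<theta> * n" using k n1 by simp
      have xk: "(\<theta> * n) ^ i \<le> k ^ i * n ^ i" for i
        unfolding power_mult_distrib using k n1 by (intro mult_right_mono power_mono) auto
      have T: "\<bar>E - (\<Sum>m<i. (- (\<theta> * n)) ^ m / fact m)\<bar> \<le> k ^ i * n ^ i" if "0 < i" for i
        unfolding E_def using exp_minus_Taylor[OF x that] xk[of i] by linarith
      have npow: "n ^ i \<le> n ^ m" if "i \<le> m" for i m using n1 that by (rule power_increasing[rotated])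
      have B: "\<bar>a * n ^ i\<bar> \<le> c * (k ^ p * n ^ m)" if "\<bar>a\<bar> \<le> c * k ^ p" "0 \<le> c" "i \<le> m" for a c i p m
      proof -
        have "\<bar>a * n ^ i\<bar> = \<bar>a\<bar> * n ^ i" using n1 by (simp add: abs_mult)
        also have "\<dots> \<le> (c * k ^ p) * n ^ m" using that n1 k npow by (intro mult_mono) auto
        finally show ?thesis by simp
      qed
      consider "j = 0" | "j = 1" | "j = 2" | "j = 3" using assms by linarith
      \<comment> \<open>The divisions by kappa in \<open>ray_rem\<close> are cleared before
        estimating.\<close>
      then have "\<bar>ray_rem (Suc j) \<theta> l * k ^ Suc j\<bar> \<le> D * (k ^ Suc j * n ^ Suc j)"
      proof cases
        case 1
        have "ray_rem (Suc j) \<theta> l * k ^ Suc j = E - 1"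
          using k 1 by (simp add: E_def n_def k_def[symmetric] ray_kernel_init)
        moreover have "\<bar>E - 1\<bar> \<le> 1 * (k ^ 1 * n ^ 1)" using T[of 1] by simp
        moreover have "1 * (k ^ 1 * n ^ 1) \<le> D * (k ^ 1 * n ^ 1)"
          using c1 c2 c3 c4 k n1 by (intro mult_right_mono) (auto simp: D_def)
        ultimately show ?thesis using 1 by simp
      next
        case 2
        have "ray_rem (Suc j) \<theta> l * k ^ Suc j = E - 1 + k * n"
          using k 2 by (simp add: E_def n_def k_def[symmetric] ray_kernel_init field_simps power2_eq_square)
        also have "\<dots> = (E - (\<Sum>m<2. (- (\<theta> * n)) ^ m / fact m)) + (k - \<theta>) * n ^ 1"
          by (simp add: numeral_2_eq_2 algebra_simps)
        finally have "\<bar>ray_rem (Suc j) \<theta> l * k ^ Suc j\<bar> \<le> k\<^sup>2 * n\<^sup>2 + c1 * (k\<^sup>2 * n\<^sup>2)"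
          using T[of 2] B[OF e1', of 1 2] c1(1) by linarith
        also have "\<dots> \<le> D * (k\<^sup>2 * n\<^sup>2)"
          using c1 c2 c3 c4 k n1 mult_right_mono[of "1 + c1" D "k\<^sup>2 * n\<^sup>2"] by (simp add: D_def algebra_simps)
        finally show ?thesis using 2 by (simp add: numeral_2_eq_2)
      next
        case 3
        have "ray_rem (Suc j) \<theta> l * k ^ Suc j = E - 1 + k * n - k\<^sup>2 * n\<^sup>2 / 2"
          using k 3 by (simp add: E_def n_def k_def[symmetric] ray_kernel_init(1) ray_kernel_init(2,3) field_simps power2_eq_square power3_eq_cube numeral_2_eq_2 ray_kernel_init(3)[unfolded numeral_2_eq_2])
        also have "\<dots> = (E - (\<Sum>m<3. (- (\<theta> * n)) ^ m / fact m)) + (k - \<theta>) * n ^ 1 + (- 1/2 * (k\<^sup>2 - \<theta>\<^sup>2)) * n ^ 2"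
          by (simp add: numeral_3_eq_3 algebra_simps power2_eq_square)
        finally have eq: "ray_rem (Suc j) \<theta> l * k ^ Suc j = \<dots>" .
        have "\<bar>ray_rem (Suc j) \<theta> l * k ^ Suc j\<bar> \<le> k ^ 3 * n ^ 3 + c1 * (k ^ 3 * n ^ 3) + c3 * (k ^ 3 * n ^ 3)"
        proof -
          have "\<bar>- 1/2 * (k\<^sup>2 - \<theta>\<^sup>2)\<bar> \<le> c3 * k ^ 3" using e3' abs_ge_zero[of "k\<^sup>2 - \<theta>\<^sup>2"] unfolding abs_mult by simp
          from B[OF this, of 2 3] c3(1) have "\<bar>- 1/2 * (k\<^sup>2 - \<theta>\<^sup>2) * n\<^sup>2\<bar> \<le> c3 * (k ^ 3 * n ^ 3)" by simp
          moreover have "\<bar>(k - \<theta>) * n ^ 1\<bar> \<le> c1 * (k ^ 3 * n ^ 3)" using B[OF e1, of 1 3] c1(1) by simp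
          moreover have "\<bar>E - (\<Sum>m<3. (- (\<theta> * n)) ^ m / fact m)\<bar> \<le> k ^ 3 * n ^ 3" by (rule T) simp
          ultimately show ?thesis unfolding eq by linarith
        qed
        also have "\<dots> \<le> D * (k ^ 3 * n ^ 3)"
          using c1 c2 c3 c4 k n1 mult_right_mono[of "1 + c1 + c3" D "k ^ 3 * n ^ 3"] by (simp add: D_def algebra_simps)
        finally show ?thesis using 3 by (simp add: numeral_3_eq_3)
      next
        case 4
        have "ray_rem (Suc j) \<theta> l * k ^ Suc j = E - 1 + k * n - k\<^sup>2 * n\<^sup>2 / 2 - k ^ 3 * (n / 24 - n ^ 3 / 6)"
        proof -
          have S: "2 = Suc (Suc 0)" "3 = Suc (Suc (Suc 0))" by simp_all
          have rk: "ray_kernel 0 1 n = 1" "ray_kernel (Suc 0) 1 n = - n" "ray_kernel (Suc (Suc 0)) 1 n = n\<^sup>2 / 2"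
            "ray_kernel (Suc (Suc (Suc 0))) 1 n = n / 24 - n ^ 3 / 6"
            using ray_kernel_init[OF n1] unfolding S by - assumption+
          have "ray_rem (Suc (Suc (Suc (Suc 0)))) \<theta> l = (((((E - 1) / k) - (- n)) / k - n\<^sup>2 / 2) / k - (n / 24 - n ^ 3 / 6)) / k"
            by (simp only: ray_rem.simps n_def[symmetric] k_def[symmetric] E_def[symmetric] rk)
          moreover have "Suc j = Suc (Suc (Suc (Suc 0)))" "Suc j = 4" using 4 by simp_all
          moreover have "k ^ Suc j = k ^ 4" using 4 by simp
          ultimately have "ray_rem (Suc j) \<theta> l * k ^ Suc j
              = (((((E - 1) / k) - (- n)) / k - n\<^sup>2 / 2) / k - (n / 24 - n ^ 3 / 6)) / k * k ^ 4" by metis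
          also have "\<dots> = E - 1 + k * n - k\<^sup>2 * n\<^sup>2 / 2 - k ^ 3 * (n / 24 - n ^ 3 / 6)"
            using k by (simp add: field_simps eval_nat_numeral(2,3))
          finally show ?thesis .
        qed
        also have "\<dots> = (E - (\<Sum>m<4. (- (\<theta> * n)) ^ m / fact m)) + (k - \<theta> - k ^ 3 / 24) * n ^ 1
            + (- 1/2 * (k\<^sup>2 - \<theta>\<^sup>2)) * n ^ 2 + (1/6 * (k ^ 3 - \<theta> ^ 3)) * n ^ 3"
          by (simp add: eval_nat_numeral(2,3) algebra_simps fact_numeral)
        finally have eq: "ray_rem (Suc j) \<theta> l * k ^ Suc j = \<dots>" .
        have "\<bar>ray_rem (Suc j) \<theta> l * k ^ Suc j\<bar>
            \<le> k ^ 4 * n ^ 4 + c2 * (k ^ 4 * n ^ 4) + c3 * (k ^ 4 * n ^ 4) + c4 * (k ^ 4 * n ^ 4)"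
        proof -
          have "\<bar>- 1/2 * (k\<^sup>2 - \<theta>\<^sup>2)\<bar> \<le> c3 * k ^ 4" using e3 abs_ge_zero[of "k\<^sup>2 - \<theta>\<^sup>2"] unfolding abs_mult by simp
          from B[OF this, of 2 4] c3(1) have "\<bar>- 1/2 * (k\<^sup>2 - \<theta>\<^sup>2) * n\<^sup>2\<bar> \<le> c3 * (k ^ 4 * n ^ 4)" by simp
          moreover have "\<bar>1/6 * (k ^ 3 - \<theta> ^ 3)\<bar> \<le> c4 * k ^ 4" using e4 abs_ge_zero[of "k ^ 3 - \<theta> ^ 3"] unfolding abs_mult by simp
          from B[OF this, of 3 4] c4(1) have "\<bar>1/6 * (k ^ 3 - \<theta> ^ 3) * n ^ 3\<bar> \<le> c4 * (k ^ 4 * n ^ 4)" by simp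
          moreover have "\<bar>(k - \<theta> - k ^ 3 / 24) * n ^ 1\<bar> \<le> c2 * (k ^ 4 * n ^ 4)" using B[OF e2, of 1 4] c2(1) by simp
          moreover have "\<bar>E - (\<Sum>m<4. (- (\<theta> * n)) ^ m / fact m)\<bar> \<le> k ^ 4 * n ^ 4" by (rule T) simp
          ultimately show ?thesis unfolding eq by linarith
        qed
        also have "\<dots> \<le> D * (k ^ 4 * n ^ 4)"
          using c1 c2 c3 c4 k n1 mult_right_mono[of "1 + c2 + c3 + c4" D "k ^ 4 * n ^ 4"] by (simp add: D_def algebra_simps)
        finally show ?thesis using 4 by simp
      qed
      then have "\<bar>ray_rem (Suc j) \<theta> l\<bar> * k ^ Suc j \<le> (D * n ^ Suc j) * k ^ Suc j"
        using k by (simp add: abs_mult mult_ac)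
      then show "\<bar>ray_rem (Suc j) \<theta> l\<bar> \<le> D * real (Suc l) ^ Suc j"
        unfolding n_def using k by (simp only: mult_le_cancel_right_pos zero_less_power)
    qed
  qed
  moreover have "0 \<le> D" using c1 c2 c3 c4 by (simp add: D_def)
  ultimately show ?thesis by blast
qed


definition ray_rem_fun :: "nat \<Rightarrow> real \<Rightarrow> 'm \<Rightarrow> ('b, 'm) gfun"
  where "ray_rem_fun j \<theta> \<alpha> = rayfun \<alpha> (\<lambda>l. complex_of_real (ray_rem j \<theta> l))"

lemma ray_rem_fun_Suc:
  "kap \<theta> \<noteq> 0 \<Longrightarrow> complex_of_real (kap \<theta>) *\<^sub>C ray_rem_fun (Suc j) \<theta> \<alpha> = ray_rem_fun j \<theta> \<alpha> - init_fun j \<alpha>"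
proof
  fix x assume "kap \<theta> \<noteq> 0"
  then show "(complex_of_real (kap \<theta>) *\<^sub>C ray_rem_fun (Suc j) \<theta> \<alpha>) x = (ray_rem_fun j \<theta> \<alpha> - init_fun j \<alpha>) x"
    by (cases x) (simp_all add: ray_rem_fun_def init_fun_def ray_kernel_fun_def)
qed

lemma ray_rem_fun_bound:
  assumes "j \<le> 3"
  shows "\<exists>D\<ge>0. \<forall>\<^sub>F \<theta> in at_right 0. \<forall>\<alpha> x. cmod (ray_rem_fun (Suc j) \<theta> \<alpha> x) \<le> D * weight (real (Suc j)) x"
proof -
  obtain D where D: "D \<ge> 0" "\<forall>\<^sub>F \<theta> in at_right 0. \<forall>l. \<bar>ray_rem (Suc j) \<theta> l\<bar> \<le> D * real (Suc l) ^ (Suc j)"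
    using ray_rem_bound[OF assms] by blast
  have "\<forall>\<^sub>F \<theta> in at_right 0. \<forall>\<alpha> x. cmod (ray_rem_fun (Suc j) \<theta> \<alpha> x) \<le> D * weight (real (Suc j)) x"
    using D(2)
  proof eventually_elim
    case (elim \<theta>)
    show ?case unfolding ray_rem_fun_def
      by (intro allI rayfun_bound) (use elim in \<open>simp only: norm_of_real\<close>)
  qed
  then show ?thesis using D(1) by blast
qed

lemma ray_rem_0_bound: "0 < \<theta> \<Longrightarrow> cmod (ray_rem_fun 0 \<theta> \<alpha> x) \<le> 1 * weight (real 0) x"
  unfolding ray_rem_fun_def by (rule rayfun_bound) simp

lemma ray_rem_0_ltwo:
  assumes "0 < \<theta>"
  shows "(ray_rem_fun 0 \<theta> \<alpha> :: ('a::finite, 'n::finite) gfun) \<in> ltwo"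
proof -
  have "(\<lambda>k. (cmod (ray_rem_fun 0 \<theta> \<alpha> (Ray \<gamma> k :: ('a, 'n) vertex)))\<^sup>2) summable_on UNIV" for \<gamma>
  proof (cases "\<gamma> = \<alpha>")
    case True
    have "summable (\<lambda>k. exp (- 2 * \<theta>) * exp (- 2 * \<theta>) ^ k)"
      using assms by (intro summable_mult summable_geometric) simp
    then have "(\<lambda>k. exp (- 2 * \<theta>) * exp (- 2 * \<theta>) ^ k) summable_on UNIV"
      by (simp add: summable_on_UNIV_nonneg_real_iff)
    moreover have "(exp (- (\<theta> * real (Suc k))))\<^sup>2 = exp (- 2 * \<theta>) * exp (- 2 * \<theta>) ^ k" for k
      by (simp add: power2_eq_square algebra_simps flip: exp_add exp_of_nat_mult)
    ultimately show ?thesis using True by (simp add: ray_rem_fun_def)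
  qed (simp add: ray_rem_fun_def)
  then show ?thesis
    using summable_rays_iff[of "\<lambda>x :: ('a, 'n) vertex. (cmod (ray_rem_fun 0 \<theta> \<alpha> x))\<^sup>2"]
    by (simp add: ltwo_def)
qed

text \<open>The sequence exp (- (\<theta> n)) solves the recursion for all n, but the Dirichlet
  operator omits its value 1 at n = 0; this omission is the unit mass at the first vertex.\<close>

lemma free_op_ray_rem_0:
  assumes "0 < \<theta>"
  shows "free_op E0 att (ray_rem_fun 0 \<theta> \<alpha>)
    = rayfun \<alpha> (\<lambda>l. if l = 0 then 1 else 0) - complex_of_real ((kap \<theta>)\<^sup>2) *\<^sub>C ray_rem_fun 0 \<theta> \<alpha>"
proof
  have *: "2 * exp (- (\<theta> * n)) - exp (- (\<theta> * (n + 1))) - exp (- (\<theta> * (n - 1))) = - (kap \<theta>)\<^sup>2 * exp (- (\<theta> * n))" for n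
    unfolding kap_sq by (simp add: algebra_simps flip: exp_add)
  fix x show "free_op E0 att (ray_rem_fun 0 \<theta> \<alpha>) x
    = (rayfun \<alpha> (\<lambda>l. if l = 0 then 1 else 0) - complex_of_real ((kap \<theta>)\<^sup>2) *\<^sub>C ray_rem_fun 0 \<theta> \<alpha>) x"
  proof (cases x)
    case (Core y)
    then show ?thesis by (simp add: ray_rem_fun_def core_op_def)
  next
    case (Ray \<gamma> k)
    show ?thesis
    proof (cases "\<gamma> = \<alpha>")
      case True
      have "2 * complex_of_real (exp (- (\<theta> * real (Suc k)))) - complex_of_real (exp (- (\<theta> * real (Suc (Suc k)))))
          - complex_of_real (exp (- (\<theta> * real k))) = - complex_of_real ((kap \<theta>)\<^sup>2) * complex_of_real (exp (- (\<theta> * real (Suc k))))"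
        using arg_cong[OF *[of "real (Suc k)"], of complex_of_real] by (simp add: algebra_simps)
      then show ?thesis using True Ray
        by (cases k) (simp_all add: ray_rem_fun_def algebra_simps del: of_nat_Suc)
    next
      case False
      then show ?thesis using Ray by (cases k) (simp_all add: ray_rem_fun_def)
    qed
  qed
qed

section \<open>Convergence in weighted norms and exact identities for the resolvent\<close>

context factorized_potential
begin

abbreviation "sb \<equiv> real \<beta> - 2"

text \<open>Convergence at rate kappa in the norm of \<open>linf (- sb)\<close>. \<open>V\<close>
  turns it into convergence in \<open>lone (real \<beta>)\<close>, and it is compatible with
  pairings against the decaying parts, which lie in \<open>lone sb\<close>.\<close>

definition conv :: "(real \<Rightarrow> ('a, 'n) gfun) \<Rightarrow> ('a, 'n) gfun \<Rightarrow> bool"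
  where "conv y Y \<longleftrightarrow> Y \<in> linf (- sb) \<and>
    (\<exists>C\<ge>0. \<forall>\<^sub>F \<theta> in at_right 0. \<forall>x. cmod (y \<theta> x - Y x) \<le> C * kap \<theta> * weight sb x)"

lemma linf_sb: "u \<in> linf (- sb) \<Longrightarrow> u \<in> linf (- real \<beta>)"
  by (rule linf_mono[of u sb]) simp_all

lemma kap_Lim: "((\<lambda>\<theta>. C * kap \<theta>) \<longlongrightarrow> 0) (at_right 0)"
  using tendsto_mult_right_zero[OF kap_tendsto_0] by blast

lemma conv_pointwise: assumes "conv y Y" shows "((\<lambda>\<theta>. y \<theta> x) \<longlongrightarrow> Y x) (at_right 0)"
proof -
  obtain C where C: "\<forall>\<^sub>F \<theta> in at_right 0. \<forall>x. cmod (y \<theta> x - Y x) \<le> C * kap \<theta> * weight sb x"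
    using assms by (auto simp: conv_def)
  have "((\<lambda>\<theta>. y \<theta> x - Y x) \<longlongrightarrow> 0) (at_right 0)"
  proof (rule Lim_null_comparison)
    show "\<forall>\<^sub>F \<theta> in at_right 0. norm (y \<theta> x - Y x) \<le> (C * weight sb x) * kap \<theta>"
      using C by eventually_elim (simp add: mult_ac del: weight.simps)
  qed (rule kap_Lim)
  then show ?thesis by (simp add: LIM_zero_cancel)
qed

lemma conv_H0: assumes "conv y Y" shows "((\<lambda>\<theta>. H0 (y \<theta>) x) \<longlongrightarrow> H0 Y x) (at_right 0)"
proof (cases x)
  case (Core z)
  show ?thesis unfolding Core free_op.simps core_op_def
    by (intro tendsto_intros conv_pointwise[OF assms])
next
  case (Ray \<alpha> k)
  show ?thesis unfolding Ray
    by (cases k) (simp_all only: free_op.simps, (intro tendsto_intros conv_pointwise[OF assms])+)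
qed

lemma conv_linf: "conv y Y \<Longrightarrow> \<forall>\<^sub>F \<theta> in at_right 0. y \<theta> \<in> linf (- sb)"
proof -
  assume c: "conv y Y"
  then obtain C where C: "\<forall>\<^sub>F \<theta> in at_right 0. \<forall>x. cmod (y \<theta> x - Y x) \<le> C * kap \<theta> * weight sb x"
    and Y: "Y \<in> linf (- sb)" by (auto simp: conv_def)
  from C show ?thesis
  proof eventually_elim
    case (elim \<theta>)
    have "y \<theta> - Y \<in> linf (- sb)" by (rule linfI[of _ "C * kap \<theta>"]) (use elim in simp)
    from linf_add[OF this Y] show ?case by simp
  qed
qed

lemma conv_bracket:
  assumes c: "conv y Y" and z: "z \<in> lone sb"
  shows "((\<lambda>\<theta>. bracket z (y \<theta>)) \<longlongrightarrow> bracket z Y) (at_right 0)"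
proof -
  obtain C where C: "\<forall>\<^sub>F \<theta> in at_right 0. \<forall>x. cmod (y \<theta> x - Y x) \<le> C * kap \<theta> * weight sb x"
    and Y: "Y \<in> linf (- sb)" using c by (auto simp: conv_def)
  have "((\<lambda>\<theta>. bracket z (y \<theta>) - bracket z Y) \<longlongrightarrow> 0) (at_right 0)"
  proof (rule Lim_null_comparison)
    show "\<forall>\<^sub>F \<theta> in at_right 0. norm (bracket z (y \<theta>) - bracket z Y) \<le> (C * lone_norm sb z) * kap \<theta>"
      using C conv_linf[OF c]
    proof eventually_elim
      case (elim \<theta>)
      have "bracket z (y \<theta>) - bracket z Y = bracket z (y \<theta> - Y)"
        by (rule bracket_diff_right[symmetric]) (use elim Y in \<open>auto intro: pairable_lone_linf[OF z]\<close>)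
      then show ?case using bracket_bound[OF z, of "y \<theta> - Y" "C * kap \<theta>"] elim(1) by (simp add: mult_ac)
    qed
  qed (rule kap_Lim)
  then show ?thesis by (simp add: LIM_zero_cancel)
qed

lemma init_fun_pairable: "j \<le> 3 \<Longrightarrow> f \<in> lone (real j) \<Longrightarrow> pairable (init_fun j \<alpha>) f"
  unfolding init_fun_def by (rule ray_kernel_fun_pairable)

text \<open>The difference is \<open>kap \<theta>\<close> times the pairing with the next remainder,
  which is uniformly bounded by \<open>ray_rem_fun_bound\<close>; this costs one more power of decay
  of \<open>f\<close>.\<close>

lemma ray_rem_tendsto:
  fixes f :: "('a, 'n) gfun"
  assumes j: "j \<le> 3" and f: "f \<in> lone (real (Suc j))"
  shows "((\<lambda>\<theta>. bracket (ray_rem_fun j \<theta> \<alpha>) f) \<longlongrightarrow> bracket (init_fun j \<alpha>) f) (at_right 0)"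
proof -
  obtain D where D: "D \<ge> 0"
    "\<forall>\<^sub>F \<theta> in at_right 0. \<forall>\<alpha> x. cmod (ray_rem_fun (Suc j) \<theta> \<alpha> (x :: ('a, 'n) vertex)) \<le> D * weight (real (Suc j)) x"
    using ray_rem_fun_bound[OF j] by blast
  have "((\<lambda>\<theta>. bracket (ray_rem_fun j \<theta> \<alpha>) f - bracket (init_fun j \<alpha>) f) \<longlongrightarrow> 0) (at_right 0)"
  proof (rule Lim_null_comparison)
    show "\<forall>\<^sub>F \<theta> in at_right 0. norm (bracket (ray_rem_fun j \<theta> \<alpha>) f - bracket (init_fun j \<alpha>) f) \<le> (D * lone_norm (real (Suc j)) f) * kap \<theta>"
      using D(2) kap_small
    proof eventually_elim
      case (elim \<theta>)
      let ?E = "ray_rem_fun (Suc j) \<theta> \<alpha> :: ('a, 'n) gfun"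
      have eq: "ray_rem_fun j \<theta> \<alpha> = complex_of_real (kap \<theta>) *\<^sub>C ?E + init_fun j \<alpha>"
      proof -
        have "kap \<theta> \<noteq> 0" using elim by simp
        from ray_rem_fun_Suc[OF this, of j \<alpha>, symmetric] show ?thesis by (simp only: diff_eq_eq)
      qed
      have "pairable ?E f" by (rule pairable_linf_lone[OF linfI f]) (use elim in blast)
      then have "pairable (complex_of_real (kap \<theta>) *\<^sub>C ?E) f" by (metis pairable_sym pairable_scale_right)
      moreover have "pairable (init_fun j \<alpha>) f" by (rule init_fun_pairable[OF j lone_mono[OF f]]) simp
      ultimately have "bracket (ray_rem_fun j \<theta> \<alpha>) f - bracket (init_fun j \<alpha>) f = kap \<theta> * bracket ?E f"
        unfolding eq by (simp add: bracket_add_left bracket_scale_left)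
      moreover have "cmod (bracket ?E f) \<le> D * lone_norm (real (Suc j)) f"
        by (rule bracket_bound'[OF f]) (use elim in blast)
      ultimately show ?case using elim by (simp add: norm_mult mult.commute mult_left_mono)
    qed
  qed (rule kap_Lim)
  then show ?thesis by (simp add: LIM_zero_cancel)
qed

lemma ray_rem_fun_bound':
  assumes j: "j \<le> 3"
  shows "\<exists>D\<ge>0. \<forall>\<^sub>F \<theta> in at_right 0. \<forall>\<alpha> x. cmod (ray_rem_fun j \<theta> \<alpha> (x :: ('a, 'n) vertex)) \<le> D * weight (real j) x"
proof (cases j)
  case 0
  have "\<forall>\<^sub>F \<theta> in at_right 0. \<forall>\<alpha> x. cmod (ray_rem_fun j \<theta> \<alpha> (x :: ('a, 'n) vertex)) \<le> 1 * weight (real j) x"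
    using kap_small
  proof eventually_elim
    case (elim \<theta>)
    show ?case unfolding 0 by (intro allI ray_rem_0_bound) (use elim in simp)
  qed
  then show ?thesis by (intro exI[of _ 1]) simp
next
  case (Suc i)
  then show ?thesis using ray_rem_fun_bound[of i] j by simp
qed

lemma conv_V_norm:
  assumes c: "conv y Y"
  shows "\<exists>C\<ge>0. \<forall>\<^sub>F \<theta> in at_right 0. lone_norm (real \<beta>) (V (y \<theta>) - V Y) \<le> C * kap \<theta>"
proof -
  obtain C where C: "C \<ge> 0" "\<forall>\<^sub>F \<theta> in at_right 0. \<forall>x. cmod (y \<theta> x - Y x) \<le> C * kap \<theta> * weight sb x"
    and Y: "Y \<in> linf (- sb)" using c by (auto simp: conv_def)
  obtain B where B: "B \<ge> 0" "\<And>f c. (\<forall>x. cmod (f x) \<le> c * weight (real \<beta>) x) \<Longrightarrow> lone_norm (real \<beta>) (V f) \<le> B * c"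
    using V_bound by blast
  have "\<forall>\<^sub>F \<theta> in at_right 0. lone_norm (real \<beta>) (V (y \<theta>) - V Y) \<le> (B * C) * kap \<theta>"
    using C(2) conv_linf[OF c] kap_small
  proof eventually_elim
    case (elim \<theta>)
    have "V (y \<theta>) - V Y = V (y \<theta> - Y)" using elim Y linf_sb by (intro V_diff[symmetric]) auto
    moreover have "lone_norm (real \<beta>) (V (y \<theta> - Y)) \<le> B * (C * kap \<theta>)"
    proof (rule B(2), intro allI)
      fix x
      have "cmod ((y \<theta> - Y) x) \<le> C * kap \<theta> * weight sb x" using elim by simp
      also have "\<dots> \<le> C * kap \<theta> * weight (real \<beta>) x"
        using C(1) elim by (intro mult_left_mono weight_mono) auto
      finally show "cmod ((y \<theta> - Y) x) \<le> C * kap \<theta> * weight (real \<beta>) x" .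
    qed
    ultimately show ?case by (simp add: mult.assoc)
  qed
  then show ?thesis using B(1) C(1) by (intro exI[of _ "B * C"]) auto
qed

lemma conv_V_pointwise:
  assumes c: "conv y Y"
  shows "((\<lambda>\<theta>. V (y \<theta>) x) \<longlongrightarrow> V Y x) (at_right 0)"
proof -
  obtain C where C: "C \<ge> 0" "\<forall>\<^sub>F \<theta> in at_right 0. lone_norm (real \<beta>) (V (y \<theta>) - V Y) \<le> C * kap \<theta>"
    using conv_V_norm[OF c] by blast
  have Y: "Y \<in> linf (- sb)" using c by (simp add: conv_def)
  have "((\<lambda>\<theta>. V (y \<theta>) x - V Y x) \<longlongrightarrow> 0) (at_right 0)"
  proof (rule Lim_null_comparison)
    show "\<forall>\<^sub>F \<theta> in at_right 0. norm (V (y \<theta>) x - V Y x) \<le> C * kap \<theta>"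
      using C(2) conv_linf[OF c]
    proof eventually_elim
      case (elim \<theta>)
      have l: "V (y \<theta>) - V Y \<in> lone (real \<beta>)" using elim Y linf_sb by (intro lone_diff V_lone) auto
      have "1 * cmod ((V (y \<theta>) - V Y) x) \<le> weight (real \<beta>) x * cmod ((V (y \<theta>) - V Y) x)"
        using weight_mono[of 0 "real \<beta>" x] by (intro mult_right_mono) auto
      also have "\<dots> = (\<Sum>x\<in>{x}. weight (real \<beta>) x * cmod ((V (y \<theta>) - V Y) x))" by simp
      also have "\<dots> \<le> lone_norm (real \<beta>) (V (y \<theta>) - V Y)"
        unfolding lone_norm_def using l by (intro finite_sum_le_infsum) (auto simp: lone_def)
      finally show ?case using elim by simp
    qed
  qed (rule kap_Lim)
  then show ?thesis by (simp add: LIM_zero_cancel)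
qed

text \<open>Both factors vary with \<theta>. Replacing \<open>V (y \<theta>)\<close> by
  \<open>V Y\<close> costs an error of order kappa, because the remainder functions are uniformly
  bounded with weight \<open>j\<close>; \<open>ray_rem_tendsto\<close> covers the fixed function
  \<open>V Y\<close>.\<close>

lemma ray_rem_V_tendsto:
  assumes j: "j \<le> 3" and c: "conv y Y"
  shows "((\<lambda>\<theta>. bracket (ray_rem_fun j \<theta> \<alpha>) (V (y \<theta>))) \<longlongrightarrow> bracket (init_fun j \<alpha>) (V Y)) (at_right 0)"
proof -
  have Y: "Y \<in> linf (- real \<beta>)" using c linf_sb unfolding conv_def by blast
  obtain C where C: "C \<ge> 0" "\<forall>\<^sub>F \<theta> in at_right 0. lone_norm (real \<beta>) (V (y \<theta>) - V Y) \<le> C * kap \<theta>"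
    using conv_V_norm[OF c] by blast
  obtain D where D: "D \<ge> 0"
    "\<forall>\<^sub>F \<theta> in at_right 0. \<forall>\<alpha> x. cmod (ray_rem_fun j \<theta> \<alpha> (x :: ('a, 'n) vertex)) \<le> D * weight (real j) x"
    using ray_rem_fun_bound'[OF j] by blast
  have "((\<lambda>\<theta>. bracket (ray_rem_fun j \<theta> \<alpha>) (V (y \<theta>)) - bracket (ray_rem_fun j \<theta> \<alpha>) (V Y)) \<longlongrightarrow> 0) (at_right 0)"
  proof (rule Lim_null_comparison)
    show "\<forall>\<^sub>F \<theta> in at_right 0. norm (bracket (ray_rem_fun j \<theta> \<alpha>) (V (y \<theta>)) - bracket (ray_rem_fun j \<theta> \<alpha>) (V Y)) \<le> (D * C) * kap \<theta>"
      using C(2) D(2) conv_linf[OF c]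
    proof eventually_elim
      case (elim \<theta>)
      have yl: "V (y \<theta>) \<in> lone (real j)" "V Y \<in> lone (real j)"
        using elim Y linf_sb j beta by (auto intro!: V_lone')
      have E: "(ray_rem_fun j \<theta> \<alpha> :: ('a, 'n) gfun) \<in> linf (- real j)" by (rule linfI[where c=D]) (use elim in blast)
      have "bracket (ray_rem_fun j \<theta> \<alpha>) (V (y \<theta>)) - bracket (ray_rem_fun j \<theta> \<alpha>) (V Y)
          = bracket (ray_rem_fun j \<theta> \<alpha>) (V (y \<theta>) - V Y)"
        by (intro bracket_diff_right[symmetric] pairable_linf_lone[OF E] yl)
      also have "cmod \<dots> \<le> D * lone_norm (real j) (V (y \<theta>) - V Y)"
        by (rule bracket_bound'[OF lone_diff[OF yl]]) (use elim in blast)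
      also have "\<dots> \<le> D * lone_norm (real \<beta>) (V (y \<theta>) - V Y)"
        using elim Y linf_sb j beta by (intro mult_left_mono lone_norm_mono lone_diff V_lone D) auto
      also have "\<dots> \<le> D * (C * kap \<theta>)" using elim D by (intro mult_left_mono) auto
      finally show ?case by (simp add: mult_ac)
    qed
  qed (rule kap_Lim)
  moreover have "((\<lambda>\<theta>. bracket (ray_rem_fun j \<theta> \<alpha>) (V Y)) \<longlongrightarrow> bracket (init_fun j \<alpha>) (V Y)) (at_right 0)"
    using j beta by (intro ray_rem_tendsto V_lone' Y) auto
  ultimately show ?thesis using tendsto_add by fastforce
qed

text \<open>Pairing the resolvent equation with the decaying solution \<open>exp (- \<theta> n)\<close> of the free equation
  yields the value next to the core, and Green's identity then gives the exact solvability
  condition for every resonance function.\<close>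

lemma resolvent_init:
  assumes \<theta>: "0 < \<theta>" and w: "w \<in> ltwo" and f: "f \<in> lone 0"
    and eq: "H0 w + complex_of_real ((kap \<theta>)\<^sup>2) *\<^sub>C w = f"
  shows "w (Ray \<alpha> 0) = bracket (ray_rem_fun 0 \<theta> \<alpha>) f"
proof -
  let ?e = "ray_rem_fun 0 \<theta> \<alpha> :: ('a, 'n) gfun" and ?d = "rayfun \<alpha> (\<lambda>l. if l = 0 then 1 else 0) :: ('a, 'n) gfun"
  let ?k = "complex_of_real ((kap \<theta>)\<^sup>2)"
  have e: "?e \<in> ltwo" by (rule ray_rem_0_ltwo[OF \<theta>])
  have p: "pairable ?e w" "pairable ?e (H0 w)" by (intro pairable_ltwo e w free_op_ltwo)+
  have d: "?d = H0 ?e + ?k *\<^sub>C ?e" using free_op_ray_rem_0[OF \<theta>, of E0 att \<alpha>] by simp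
  have "w (Ray \<alpha> 0) = bracket ?d w" by (simp add: bracket_rayfun_single)
  also have "\<dots> = bracket (H0 ?e) w + ?k * bracket ?e w"
    unfolding d by (subst bracket_add_left) (auto intro!: pairable_ltwo free_op_ltwo ltwo_scale e w simp: bracket_scale_left)
  also have "bracket (H0 ?e) w = bracket ?e (H0 w)" by (rule free_op_symmetric_ltwo[OF e w])
  also have "bracket ?e (H0 w) + ?k * bracket ?e w = bracket ?e (H0 w + ?k *\<^sub>C w)"
    by (simp add: bracket_add_right p pairable_scale_right bracket_scale_right)
  finally show ?thesis unfolding eq .
qed

lemma resolvent_solvability:
  assumes \<theta>: "0 < \<theta>" and w: "w \<in> ltwo" and u: "u \<in> lone 1"
    and eq: "H w + complex_of_real ((kap \<theta>)\<^sup>2) *\<^sub>C w = u" and \<Psi>: "\<Psi> \<in> Eres"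
  shows "complex_of_real ((kap \<theta>)\<^sup>2) * bracket (decaying_part (V \<Psi>)) w + bracket \<Psi> u
    = complex_of_real (kap \<theta>) * (\<Sum>\<alpha>\<in>UNIV. cnj (res_coeff (V \<Psi>) \<alpha>) * bracket (ray_rem_fun 1 \<theta> \<alpha>) (u - V w))"
proof -
  let ?k = "complex_of_real ((kap \<theta>)\<^sup>2)" and ?c = "res_coeff (V \<Psi>)" and ?d = "decaying_part (V \<Psi>)"
  let ?f = "u - V w"
  have wl: "w \<in> linf (- real \<beta>)" "w \<in> linf (- sb)"
    using beta by (auto intro!: ltwo_imp_linf[OF w] simp del: minus_diff_eq)
  note \<Psi>l = res_linf[OF \<Psi>]
  have s1: "1 \<le> sb" using beta by simp
  have d: "?d \<in> lone sb" by (rule decaying_part_lone[OF V_lone[OF \<Psi>l]])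
  have d0: "?d \<in> linf (- 0)" by (rule lone_imp_linf'[OF d]) (use beta in simp)
  have d2: "?d \<in> ltwo" by (rule lone_imp_ltwo[OF d]) (use beta in simp)
  have f1: "?f \<in> lone 1" using beta by (intro lone_diff u V_lone' wl) auto
  have f0: "?f \<in> lone 0" using f1 by (rule lone_mono) simp
  have u0: "u \<in> lone 0" using u by (rule lone_mono) simp
  have "H0 w + V w + ?k *\<^sub>C w = u" using eq by simp
  then have H0w: "H0 w + ?k *\<^sub>C w = ?f" by (simp only: eq_diff_eq add_ac)
  have "bracket \<Psi> (V w) = bracket (V \<Psi>) w" by (rule V_symmetric[OF \<Psi>l wl(1), symmetric])
  also have "\<dots> = bracket ?d (H0 w) + (\<Sum>\<alpha>\<in>UNIV. cnj (?c \<alpha>) * w (Ray \<alpha> 0))"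
    by (rule green_identity[OF V_lone[OF \<Psi>l] wl(2)])
  also have "H0 w = ?f - ?k *\<^sub>C w" using H0w by (metis add_diff_cancel_right')
  also have "bracket ?d (?f - ?k *\<^sub>C w) = bracket ?d ?f - ?k * bracket ?d w"
    by (subst bracket_diff_right)
      (auto intro!: pairable_linf_lone[OF d0 f0] pairable_scale_right pairable_ltwo d2 w simp: bracket_scale_right)
  finally have 1: "bracket \<Psi> (V w) = bracket ?d ?f - ?k * bracket ?d w + (\<Sum>\<alpha>\<in>UNIV. cnj (?c \<alpha>) * bracket (ray_rem_fun 0 \<theta> \<alpha>) ?f)"
    by (simp add: resolvent_init[OF \<theta> w f0 H0w])
  \<comment> \<open>The constant 1 in exp (- (\<theta> n)) cancels against the constant part of
    \<Psi>, so that only terms with a factor kappa remain on the right.\<close>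
  have E1: "bracket (ray_rem_fun 0 \<theta> \<alpha>) ?f = bracket (onevec \<alpha>) ?f + kap \<theta> * bracket (ray_rem_fun 1 \<theta> \<alpha>) ?f" for \<alpha>
  proof -
    have k0: "kap \<theta> \<noteq> 0" using kap_pos[OF \<theta>] by simp
    have "complex_of_real (kap \<theta>) *\<^sub>C (ray_rem_fun 1 \<theta> \<alpha> :: ('a, 'n) gfun) = ray_rem_fun 0 \<theta> \<alpha> - onevec \<alpha>"
      using ray_rem_fun_Suc[OF k0, of 0 \<alpha>] by (simp add: init_fun_0)
    from arg_cong[OF this, of "\<lambda>z. bracket z ?f"]
    have "kap \<theta> * bracket (ray_rem_fun 1 \<theta> \<alpha>) ?f = bracket (ray_rem_fun 0 \<theta> \<alpha> - onevec \<alpha>) ?f"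
      by (simp add: bracket_scale_left)
    also have "\<dots> = bracket (ray_rem_fun 0 \<theta> \<alpha>) ?f - bracket (onevec \<alpha>) ?f"
      by (intro bracket_diff_left pairable_linf_lone[OF _ f0] linfI[where c=1] onevec_linf)
        (use ray_rem_0_bound[OF \<theta>] in auto)
    finally show ?thesis by simp
  qed
  have "\<Psi> = - ?d - (\<Sum>\<alpha>\<in>UNIV. ?c \<alpha> *\<^sub>C onevec \<alpha>)" by (rule res_decomp[OF \<Psi>])
  moreover have "bracket (- ?d - (\<Sum>\<alpha>\<in>UNIV. ?c \<alpha> *\<^sub>C onevec \<alpha>)) ?f = - bracket ?d ?f - (\<Sum>\<alpha>\<in>UNIV. cnj (?c \<alpha>) * bracket (onevec \<alpha>) ?f)"
  proof -
    have p: "pairable (?c \<alpha> *\<^sub>C onevec \<alpha>) ?f" for \<alpha>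
      by (intro pairable_linf_lone[OF _ f0] linf_scale onevec_linf) simp
    have "pairable (\<Sum>\<alpha>\<in>UNIV. ?c \<alpha> *\<^sub>C onevec \<alpha>) ?f"
      by (intro pairable_linf_lone[OF _ f0] linf_sum linf_scale onevec_linf) simp
    moreover have "pairable (- ?d) ?f"
      by (rule pairable_linf_lone[OF linf_minus[OF lone_imp_linf'[OF d]] f0]) (use beta in simp)
    ultimately show ?thesis by (simp add: bracket_diff_left bracket_minus_left bracket_sum_left[OF p] bracket_scale_left)
  qed
  ultimately have 2: "bracket \<Psi> ?f = - bracket ?d ?f - (\<Sum>\<alpha>\<in>UNIV. cnj (?c \<alpha>) * bracket (onevec \<alpha>) ?f)" by simp
  have 3: "bracket \<Psi> ?f = bracket \<Psi> u - bracket \<Psi> (V w)"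
    by (intro bracket_diff_right pairable_linf_lone[OF res_bounded[OF \<Psi>]] u0 V_lone' wl) simp
  have 4: "(\<Sum>\<alpha>\<in>UNIV. cnj (?c \<alpha>) * bracket (ray_rem_fun 0 \<theta> \<alpha>) ?f) = (\<Sum>\<alpha>\<in>UNIV. cnj (?c \<alpha>) * bracket (onevec \<alpha>) ?f)
      + kap \<theta> * (\<Sum>\<alpha>\<in>UNIV. cnj (?c \<alpha>) * bracket (ray_rem_fun 1 \<theta> \<alpha>) ?f)"
    by (simp only: E1 distrib_left sum.distrib sum_distrib_left mult_ac)
  show ?thesis using 1 2 3 unfolding 4 by algebra
qed


lemma Ebd_lone: "\<Phi> \<in> Ebd \<Longrightarrow> \<Phi> \<in> lone sb"
  by (simp add: bound_eigenspace_def)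

lemma bound_zero:
  assumes "X \<in> Ebd" "bracket X X = 0" shows "X = 0"
proof
  fix x
  have "X \<in> ltwo" by (rule lone_imp_ltwo[OF Ebd_lone[OF assms(1)]]) (use beta in simp)
  then have s: "(\<lambda>x. (cmod (X x))\<^sup>2) summable_on UNIV" by (simp add: ltwo_def)
  have "bracket X X = (\<Sum>\<^sub>\<infinity>x. complex_of_real ((cmod (X x))\<^sup>2))"
    unfolding bracket_def by (intro infsum_cong) (simp only: complex_norm_square mult.commute)
  also have "\<dots> = complex_of_real (\<Sum>\<^sub>\<infinity>x. (cmod (X x))\<^sup>2)"
    by (rule infsumI[OF has_sum_of_real[OF has_sum_infsum[OF s]]])
  finally have "(\<Sum>\<^sub>\<infinity>x. (cmod (X x))\<^sup>2) = 0" using assms(2) by (simp del: of_real_power)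
  then have "(cmod (X x))\<^sup>2 = 0" using nonneg_infsum_le_0D[OF _ s, of x] by simp
  then show "X x = 0 x" by simp
qed

lemma res_coeff_sq_zero:
  assumes "(\<Sum>\<alpha>\<in>UNIV. cnj (c \<alpha>) * c \<alpha>) = (0 :: complex)" shows "c (\<alpha> :: 'n) = 0"
proof -
  have "complex_of_real (\<Sum>\<alpha>\<in>UNIV. (cmod (c \<alpha>))\<^sup>2) = 0"
    using assms unfolding of_real_sum complex_norm_square by (simp add: mult.commute)
  then have "(\<Sum>\<alpha>\<in>UNIV. (cmod (c \<alpha>))\<^sup>2) = 0" using of_real_eq_0_iff by blast
  then show ?thesis by (subst (asm) sum_nonneg_eq_0_iff) auto
qed

lemma decaying_part_V_lone: "\<Psi> \<in> Eres \<Longrightarrow> decaying_part (V \<Psi>) \<in> lone sb"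
  by (rule decaying_part_lone[OF V_lone[OF res_linf]])

lemma free_coeff_linf_sb: "6 \<le> \<beta> \<Longrightarrow> j \<le> 3 \<Longrightarrow> f \<in> lone (real j) \<Longrightarrow> free_coeff E0 att j f \<in> linf (- sb)"
  by (rule linf_mono[OF free_coeff_linf]) auto

text \<open>Here and for \<open>G2\<close> and \<open>G3\<close> the boundary values in Green's
  identity are evaluated by \<open>free_coeff_init\<close>. The three lemmas translate conditions on
  \<open>init_fun\<close>, as they arise from limits, into pairings of \<open>V \<Psi>\<close> with
  free coefficients.\<close>

lemma green_G1:
  assumes b6: "6 \<le> \<beta>" and "\<Psi> \<in> Eres" "f \<in> lone 1"
  shows "bracket (V \<Psi>) (G1 f) = (\<Sum>\<alpha>\<in>UNIV. cnj (res_coeff (V \<Psi>) \<alpha>) * bracket (init_fun 1 \<alpha>) f)"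
  using green_identity[OF V_lone[OF res_linf[OF assms(2)]] free_coeff_linf_sb[of 1 f]] assms(3) b6
  by (simp add: free_op_free_coeff_1[OF graph] free_coeff_init del: free_coeff.simps One_nat_def)

lemma green_G2:
  assumes b6: "6 \<le> \<beta>" and "\<Psi> \<in> Eres" "f \<in> lone 2"
  shows "bracket (V \<Psi>) (G2 f) = - bracket (decaying_part (V \<Psi>)) (G0 f)
    + (\<Sum>\<alpha>\<in>UNIV. cnj (res_coeff (V \<Psi>) \<alpha>) * bracket (init_fun 2 \<alpha>) f)"
  using green_identity[OF V_lone[OF res_linf[OF assms(2)]] free_coeff_linf_sb[of 2 f]] assms(3) b6
  by (simp add: free_op_free_coeff_2[OF graph] free_coeff_init bracket_minus_right del: free_coeff.simps)

lemma green_G3: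
  assumes b6: "6 \<le> \<beta>" and "\<Psi> \<in> Eres" "f \<in> lone 3"
  shows "bracket (V \<Psi>) (G3 f) = - bracket (decaying_part (V \<Psi>)) (G1 f)
    + (\<Sum>\<alpha>\<in>UNIV. cnj (res_coeff (V \<Psi>) \<alpha>) * bracket (init_fun 3 \<alpha>) f)"
  using green_identity[OF V_lone[OF res_linf[OF assms(2)]] free_coeff_linf_sb[of 3 f]] assms(3) b6
  by (simp add: free_op_free_coeff_3[OF graph] free_coeff_init bracket_minus_right del: free_coeff.simps One_nat_def)

end

text \<open>\<open>u\<close> is a datum without bound component and \<open>w\<close> the
  corresponding solution of the resolvent equation; \<open>W2\<close>, \<open>Wm\<close>,
  \<open>W0\<close> are the coefficients of its orders -2, -1, 0. The condition
  \<open>6 \<le> \<beta>\<close> says that order 0 occurs in the expansion.\<close>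

locale resolvent_family = factorized_potential E0 att V v U \<beta>
  for E0 :: "'a::finite set set" and att :: "'n::finite \<Rightarrow> 'a"
    and V :: "('a, 'n) gop" and v :: "'k::complex_hilbert \<Rightarrow> ('a, 'n) gfun" and U \<beta> +
  fixes w :: "real \<Rightarrow> ('a, 'n) gfun" and u W2 Wm W0 :: "('a, 'n) gfun"
  assumes beta6: "6 \<le> \<beta>"
    and u: "u \<in> lone (real \<beta> - 2)"
    and u_orth: "\<And>\<Phi>. \<Phi> \<in> Ebd \<Longrightarrow> bracket \<Phi> u = 0"
    and w_ev: "\<forall>\<^sub>F \<theta> in at_right 0. w \<theta> \<in> ltwo \<and> H (w \<theta>) + complex_of_real ((kap \<theta>)\<^sup>2) *\<^sub>C w \<theta> = u"
    and W2: "W2 \<in> linf (- (real \<beta> - 2))" and Wm: "Wm \<in> linf (- (real \<beta> - 2))" and W0: "W0 \<in> linf (- (real \<beta> - 2))"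
    and expansion: "\<exists>C\<ge>0. \<forall>\<^sub>F \<theta> in at_right 0. \<forall>x.
      cmod (w \<theta> x - (W2 x / complex_of_real ((kap \<theta>)\<^sup>2) + Wm x / complex_of_real (kap \<theta>) + W0 x))
        \<le> C * kap \<theta> * weight (real \<beta> - 2) x"
begin

lemma u_lone: "s \<le> real \<beta> - 2 \<Longrightarrow> u \<in> lone s"
  using lone_mono[OF u] .

lemma u_lone_nat: "j \<le> 4 \<Longrightarrow> u \<in> lone (real j)"
  by (rule u_lone) (use beta6 in simp)

lemma W_linf: "W2 \<in> linf (- real \<beta>)" "Wm \<in> linf (- real \<beta>)" "W0 \<in> linf (- real \<beta>)"
  by (rule linf_sb, rule W2 Wm W0)+

lemma V_W_lone: "s \<le> real \<beta> \<Longrightarrow> V W2 \<in> lone s" "s \<le> real \<beta> \<Longrightarrow> V Wm \<in> lone s" "s \<le> real \<beta> \<Longrightarrow> V W0 \<in> lone s"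
  using V_lone' W_linf by auto

definition "g \<equiv> \<lambda>\<theta>. complex_of_real (kap \<theta>)"

lemma g_tendsto: "(g \<longlongrightarrow> 0) (at_right 0)"
  unfolding g_def using tendsto_of_real[OF kap_tendsto_0, where ?'a = complex] by simp

section \<open>Threshold equations and solvability conditions for the orders -2, -1 and 0\<close>

lemma conv_W2: "conv (\<lambda>\<theta>. (g \<theta>)\<^sup>2 *\<^sub>C w \<theta>) W2"
proof -
  obtain C where C: "C \<ge> 0" "\<forall>\<^sub>F \<theta> in at_right 0. \<forall>x.
      cmod (w \<theta> x - (W2 x / complex_of_real ((kap \<theta>)\<^sup>2) + Wm x / complex_of_real (kap \<theta>) + W0 x)) \<le> C * kap \<theta> * weight sb x"
    using expansion by blast
  obtain cm where cm: "cm \<ge> 0" "\<And>x. cmod (Wm x) \<le> cm * weight sb x" using Wm by (rule linfE) blast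
  obtain c0 where c0: "c0 \<ge> 0" "\<And>x. cmod (W0 x) \<le> c0 * weight sb x" using W0 by (rule linfE) blast
  have "\<forall>\<^sub>F \<theta> in at_right 0. \<forall>x. cmod (((g \<theta>)\<^sup>2 *\<^sub>C w \<theta>) x - W2 x) \<le> (C + cm + c0) * kap \<theta> * weight sb x"
    using C(2) kap_small
  proof eventually_elim
    case (elim \<theta>)
    let ?k = "kap \<theta>"
    have k: "0 < ?k" "?k \<le> 1" using elim by auto
    show ?case
    proof
      fix x
      define r where "r = w \<theta> x - (W2 x / complex_of_real (?k\<^sup>2) + Wm x / complex_of_real ?k + W0 x)"
      have r: "cmod r \<le> C * ?k * weight sb x" using elim by (simp add: r_def)
      have eq: "((g \<theta>)\<^sup>2 *\<^sub>C w \<theta>) x - W2 x = complex_of_real ?k * Wm x + complex_of_real (?k\<^sup>2) * (W0 x + r)"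
        using k by (simp add: r_def g_def field_simps power2_eq_square)
      have k2: "?k\<^sup>2 \<le> ?k" "?k\<^sup>2 * ?k \<le> ?k" using k by (auto simp: power2_eq_square mult_le_one)
      have "cmod (((g \<theta>)\<^sup>2 *\<^sub>C w \<theta>) x - W2 x) \<le> ?k * cmod (Wm x) + ?k\<^sup>2 * (cmod (W0 x) + cmod r)"
        unfolding eq using k
        by (intro order_trans[OF norm_triangle_ineq] add_mono)
          (auto simp: norm_mult norm_power intro!: mult_left_mono norm_triangle_ineq)
      also have "\<dots> \<le> ?k * (cm * weight sb x) + ?k\<^sup>2 * (c0 * weight sb x + C * ?k * weight sb x)"
        using k by (intro add_mono mult_left_mono cm c0 r) auto
      also have "\<dots> = cm * (?k * weight sb x) + c0 * (?k\<^sup>2 * weight sb x) + C * ((?k\<^sup>2 * ?k) * weight sb x)"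
        by (simp add: algebra_simps)
      also have "\<dots> \<le> cm * (?k * weight sb x) + c0 * (?k * weight sb x) + C * (?k * weight sb x)"
        using k2 C cm c0 by (intro add_mono mult_left_mono mult_right_mono) auto
      finally show "cmod (((g \<theta>)\<^sup>2 *\<^sub>C w \<theta>) x - W2 x) \<le> (C + cm + c0) * kap \<theta> * weight sb x"
        by (simp add: algebra_simps)
    qed
  qed
  then show ?thesis using C(1) cm(1) c0(1) W2 unfolding conv_def by (intro conjI exI[of _ "C + cm + c0"]) auto
qed

lemma bracket_V_scale: "y \<in> ltwo \<Longrightarrow> bracket a (V (c *\<^sub>C y)) = c * bracket a (V y)"
  using V_scale[OF ltwo_imp_linf[of y "real \<beta>"]] by (simp add: bracket_scale_right)

lemma bracket_linear_V:
  assumes "y \<in> ltwo" "a \<in> linf (- 1)"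
  shows "bracket a (V (c *\<^sub>C y)) = c * bracket a (V y)" "bracket a (u - V y) = bracket a u - bracket a (V y)"
proof -
  have l: "y \<in> linf (- real \<beta>)" by (rule ltwo_imp_linf[OF assms(1)]) simp
  show "bracket a (V (c *\<^sub>C y)) = c * bracket a (V y)" by (simp add: V_scale[OF l] bracket_scale_right)
  show "bracket a (u - V y) = bracket a u - bracket a (V y)"
    using beta6 by (intro bracket_diff_right pairable_linf_lone[OF assms(2)] u_lone V_lone'[OF l]) auto
qed

lemma ray_rem_linf: "\<forall>\<^sub>F \<theta> in at_right 0. \<forall>\<alpha>. (ray_rem_fun 0 \<theta> \<alpha> :: ('a, 'n) gfun) \<in> linf (- 1) \<and> (ray_rem_fun 1 \<theta> \<alpha> :: ('a, 'n) gfun) \<in> linf (- 1)"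
proof -
  obtain D where D: "\<forall>\<^sub>F \<theta> in at_right 0. \<forall>\<alpha> x. cmod (ray_rem_fun (Suc 0) \<theta> \<alpha> (x :: ('a, 'n) vertex)) \<le> D * weight (real (Suc 0)) x"
    using ray_rem_fun_bound[of 0] by blast
  show ?thesis using D kap_small
  proof eventually_elim
    case (elim \<theta>)
    have "(ray_rem_fun 0 \<theta> \<alpha> :: ('a, 'n) gfun) \<in> linf (- real 0)" for \<alpha>
      by (rule linfI[where c=1], rule ray_rem_0_bound) (use elim in simp)
    then have "(ray_rem_fun 0 \<theta> \<alpha> :: ('a, 'n) gfun) \<in> linf (- 1)" for \<alpha>
      by (rule linf_mono) simp
    moreover have "(ray_rem_fun (Suc 0) \<theta> \<alpha> :: ('a, 'n) gfun) \<in> linf (- real (Suc 0))" for \<alpha>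
      by (rule linfI[where c=D]) (use elim in blast)
    ultimately show ?case by simp
  qed
qed

text \<open>The pairings with \<open>u\<close> and with \<open>V (w \<theta>)\<close> are separated
  because \<open>u\<close> is fixed, while \<open>w \<theta>\<close> may be singular and has to be
  rescaled before a limit is taken.\<close>

lemma w_identities:
  "\<forall>\<^sub>F \<theta> in at_right 0. (\<forall>\<alpha>. w \<theta> (Ray \<alpha> 0) = bracket (ray_rem_fun 0 \<theta> \<alpha>) u - bracket (ray_rem_fun 0 \<theta> \<alpha>) (V (w \<theta>)))
    \<and> (\<forall>\<Psi>\<in>Eres. (g \<theta>)\<^sup>2 * bracket (decaying_part (V \<Psi>)) (w \<theta>) + bracket \<Psi> u
        = g \<theta> * (\<Sum>\<alpha>\<in>UNIV. cnj (res_coeff (V \<Psi>) \<alpha>) * (bracket (ray_rem_fun 1 \<theta> \<alpha>) u - bracket (ray_rem_fun 1 \<theta> \<alpha>) (V (w \<theta>)))))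
    \<and> w \<theta> \<in> ltwo \<and> H0 (w \<theta>) + (g \<theta>)\<^sup>2 *\<^sub>C w \<theta> = u - V (w \<theta>) \<and> g \<theta> \<noteq> 0"
  using w_ev ray_rem_linf kap_small
proof eventually_elim
  case (elim \<theta>)
  have t: "0 < \<theta>" and w: "w \<theta> \<in> ltwo" and eq: "H (w \<theta>) + complex_of_real ((kap \<theta>)\<^sup>2) *\<^sub>C w \<theta> = u"
    and k: "0 < kap \<theta>" using elim by auto
  have l: "w \<theta> \<in> linf (- real \<beta>)" by (rule ltwo_imp_linf[OF w]) simp
  have g2: "(g \<theta>)\<^sup>2 = complex_of_real ((kap \<theta>)\<^sup>2)" by (simp add: g_def)
  have "H0 (w \<theta>) + V (w \<theta>) + complex_of_real ((kap \<theta>)\<^sup>2) *\<^sub>C w \<theta> = u" using eq by simp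
  then have H0w: "H0 (w \<theta>) + complex_of_real ((kap \<theta>)\<^sup>2) *\<^sub>C w \<theta> = u - V (w \<theta>)" by (simp only: eq_diff_eq add_ac)
  have f: "u - V (w \<theta>) \<in> lone 0" using beta6 by (intro lone_diff u_lone V_lone'[OF l]) auto
  have a: "w \<theta> (Ray \<alpha> 0) = bracket (ray_rem_fun 0 \<theta> \<alpha>) u - bracket (ray_rem_fun 0 \<theta> \<alpha>) (V (w \<theta>))" for \<alpha>
    using resolvent_init[OF t w f H0w, of \<alpha>] bracket_linear_V(2)[OF w, of "ray_rem_fun 0 \<theta> \<alpha>"] elim(2) by simp
  have b: "(g \<theta>)\<^sup>2 * bracket (decaying_part (V \<Psi>)) (w \<theta>) + bracket \<Psi> u
        = g \<theta> * (\<Sum>\<alpha>\<in>UNIV. cnj (res_coeff (V \<Psi>) \<alpha>) * (bracket (ray_rem_fun 1 \<theta> \<alpha>) u - bracket (ray_rem_fun 1 \<theta> \<alpha>) (V (w \<theta>))))"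
    if "\<Psi> \<in> Eres" for \<Psi>
    using resolvent_solvability[OF t w _ eq that] u_lone[of 1] beta6 elim(2)
    unfolding g2 g_def by (simp add: bracket_linear_V(2)[OF w])
  show ?case unfolding g2 using a b[unfolded g2] w H0w k by (auto simp: g_def)
qed

text \<open>For a bound state the right side of the solvability identity vanishes and the decaying
  part is \<open>- \<Phi>\<close>; orthogonality of \<open>u\<close> then yields orthogonality of
  \<open>w \<theta>\<close> itself, not only of its limits.\<close>

lemma w_orth: "\<Phi> \<in> Ebd \<Longrightarrow> \<forall>\<^sub>F \<theta> in at_right 0. bracket \<Phi> (w \<theta>) = 0"
proof -
  assume \<Phi>: "\<Phi> \<in> Ebd"
  then have r: "\<Phi> \<in> Eres" "\<And>\<alpha>. res_coeff (V \<Phi>) \<alpha> = 0" by (auto simp: bound_eigenspace_iff)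
  have "\<Phi> = - decaying_part (V \<Phi>)" using res_decomp[OF r(1)] r(2) by simp
  then have d: "decaying_part (V \<Phi>) = - \<Phi>" by (metis minus_minus)
  show ?thesis using w_identities
  proof eventually_elim
    case (elim \<theta>)
    then have "(g \<theta>)\<^sup>2 * bracket (decaying_part (V \<Phi>)) (w \<theta>) + bracket \<Phi> u = 0"
      using r by simp
    then show ?case using elim by (simp add: d u_orth[OF \<Phi>] bracket_minus_left)
  qed
qed

lemma conv_orth:
  assumes c: "conv y Y" and y: "\<forall>\<^sub>F \<theta> in at_right 0. bracket \<Phi> (y \<theta>) = 0" and \<Phi>: "\<Phi> \<in> Ebd"
  shows "bracket \<Phi> Y = 0"
proof -
  have "((\<lambda>\<theta>. bracket \<Phi> (y \<theta>)) \<longlongrightarrow> bracket \<Phi> Y) (at_right 0)" by (rule conv_bracket[OF c Ebd_lone[OF \<Phi>]])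
  moreover have "((\<lambda>\<theta>. bracket \<Phi> (y \<theta>)) \<longlongrightarrow> 0) (at_right 0)"
    using y by (rule tendsto_eventually)
  ultimately show ?thesis using tendsto_unique trivial_limit_at_right_real by blast
qed

lemma lim_unique: "(f \<longlongrightarrow> a) (at_right (0::real)) \<Longrightarrow> (f' \<longlongrightarrow> b) (at_right 0) \<Longrightarrow> \<forall>\<^sub>F \<theta> in at_right 0. f \<theta> = f' \<theta> \<Longrightarrow> a = (b::complex)"
  using tendsto_unique[of "at_right (0::real)" f a b] tendsto_cong[of f f' "at_right 0" b] trivial_limit_at_right_real by auto

lemma gmult_lim: "(f \<longlongrightarrow> a) (at_right (0::real)) \<Longrightarrow> ((\<lambda>\<theta>. g \<theta> * f \<theta>) \<longlongrightarrow> 0) (at_right 0)"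
  using tendsto_mult[OF g_tendsto] by fastforce

lemma u_rem: "j \<le> 3 \<Longrightarrow> ((\<lambda>\<theta>. bracket (ray_rem_fun j \<theta> \<alpha>) u) \<longlongrightarrow> bracket (init_fun j \<alpha>) u) (at_right 0)"
  by (rule ray_rem_tendsto) (use beta6 in \<open>auto intro!: u_lone_nat simp del: of_nat_Suc\<close>)

lemma bracket_init_1: "bracket (init_fun 1 \<alpha>) f = - res_coeff f \<alpha>"
  unfolding init_fun_1 res_coeff_def by (rule bracket_minus_left)

lemma res_from_init:
  assumes X: "X \<in> linf (- real \<beta>)" and eq: "H0 X = - V X" and init: "\<And>\<alpha>. X (Ray \<alpha> 0) = - bracket (init_fun 0 \<alpha>) (V X)"
  shows "X \<in> Eres"
proof -
  have V0: "V X \<in> lone 0" by (rule V_lone'[OF X]) simp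
  have "X = - G0 (V X)"
  proof (rule free_op_unique[OF graph])
    show "H0 X = H0 (- G0 (V X))" by (simp add: free_op_minus free_op_free_coeff_0[OF graph V0] eq)
    show "X (Ray \<alpha> 0) = (- G0 (V X)) (Ray \<alpha> 0)" for \<alpha> using init[of \<alpha>] by (simp add: free_coeff_init[symmetric] del: free_coeff.simps)
  qed
  then show ?thesis using X by (simp add: res_eigenspace_iff[of X])
qed

text \<open>The limiting equation makes \<open>W2\<close> a resonance function. The solvability
  identity tested with \<open>W2\<close> itself shows that its constants vanish, so it is a bound
  state, and orthogonality to bound states leaves 0.\<close>

lemma W2_zero: "W2 = 0"
proof -
  let ?y = "\<lambda>\<theta>. (g \<theta>)\<^sup>2 *\<^sub>C w \<theta>"
  note c = conv_W2
  have eqH: "H0 W2 = - V W2"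
  proof
    fix x
    have "H0 W2 x + 0 = 0 - V W2 x"
    proof (rule lim_unique)
      show "((\<lambda>\<theta>. H0 (?y \<theta>) x + g \<theta> * (g \<theta> * ?y \<theta> x)) \<longlongrightarrow> H0 W2 x + 0) (at_right 0)"
        by (intro tendsto_add conv_H0[OF c] gmult_lim[OF gmult_lim[OF conv_pointwise[OF c]]])
      show "((\<lambda>\<theta>. g \<theta> * (g \<theta> * u x) - V (?y \<theta>) x) \<longlongrightarrow> 0 - V W2 x) (at_right 0)"
        by (intro tendsto_diff conv_V_pointwise[OF c] gmult_lim[OF gmult_lim[OF tendsto_const]])
      show "\<forall>\<^sub>F \<theta> in at_right 0. H0 (?y \<theta>) x + g \<theta> * (g \<theta> * ?y \<theta> x) = g \<theta> * (g \<theta> * u x) - V (?y \<theta>) x"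
        using w_identities
      proof eventually_elim
        case (elim \<theta>)
        have l: "w \<theta> \<in> linf (- real \<beta>)" using elim by (intro ltwo_imp_linf) auto
        have "H0 (w \<theta>) x + (g \<theta>)\<^sup>2 * w \<theta> x = u x - V (w \<theta>) x" using elim by (metis minus_apply plus_fun_apply scaleC_fun_apply)
        then show ?case by (simp add: free_op_scale V_scale[OF l]) algebra
      qed
    qed
    then show "H0 W2 x = (- V W2) x" by simp
  qed
  have init: "W2 (Ray \<alpha> 0) = - bracket (init_fun 0 \<alpha>) (V W2)" for \<alpha>
  proof (rule lim_unique)
    show "((\<lambda>\<theta>. ?y \<theta> (Ray \<alpha> 0)) \<longlongrightarrow> W2 (Ray \<alpha> 0)) (at_right 0)" by (rule conv_pointwise[OF c])
    show "((\<lambda>\<theta>. g \<theta> * (g \<theta> * bracket (ray_rem_fun 0 \<theta> \<alpha>) u) - bracket (ray_rem_fun 0 \<theta> \<alpha>) (V (?y \<theta>)))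
        \<longlongrightarrow> - bracket (init_fun 0 \<alpha>) (V W2)) (at_right 0)"
      using tendsto_diff[OF gmult_lim[OF gmult_lim[OF u_rem[of 0 \<alpha>]]] ray_rem_V_tendsto[OF _ c, of 0 \<alpha>]] by simp
    show "\<forall>\<^sub>F \<theta> in at_right 0. ?y \<theta> (Ray \<alpha> 0)
        = g \<theta> * (g \<theta> * bracket (ray_rem_fun 0 \<theta> \<alpha>) u) - bracket (ray_rem_fun 0 \<theta> \<alpha>) (V (?y \<theta>))"
      using w_identities
    proof eventually_elim
      case (elim \<theta>)
      then have w: "w \<theta> \<in> ltwo"
        and e: "w \<theta> (Ray \<alpha> 0) = bracket (ray_rem_fun 0 \<theta> \<alpha>) u - bracket (ray_rem_fun 0 \<theta> \<alpha>) (V (w \<theta>))" by blast+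
      show ?case by (simp add: e bracket_V_scale[OF w] power2_eq_square algebra_simps)
    qed
  qed
  have res: "W2 \<in> Eres" by (rule res_from_init[OF W_linf(1) eqH init])
  let ?d = "decaying_part (V W2)" and ?c = "res_coeff (V W2)"
  have d: "?d \<in> lone sb" by (rule decaying_part_lone[OF V_lone[OF W_linf(1)]])
  \<comment> \<open>The identity is multiplied by kappa; in the limit only the pairing with
    \<open>V W2\<close> survives, which is a sum of squares of constants.\<close>
  have "0 = (\<Sum>\<alpha>\<in>UNIV. cnj (?c \<alpha>) * (0 - bracket (init_fun 1 \<alpha>) (V W2)))"
  proof (rule lim_unique)
    show "((\<lambda>\<theta>. g \<theta> * bracket ?d (?y \<theta>) + g \<theta> * bracket W2 u) \<longlongrightarrow> 0) (at_right 0)"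
      using tendsto_add[OF gmult_lim[OF conv_bracket[OF c d]] gmult_lim[OF tendsto_const[of "bracket W2 u"]]] by simp
    show "((\<lambda>\<theta>. \<Sum>\<alpha>\<in>UNIV. cnj (?c \<alpha>) * (g \<theta> * (g \<theta> * bracket (ray_rem_fun 1 \<theta> \<alpha>) u)
        - bracket (ray_rem_fun 1 \<theta> \<alpha>) (V (?y \<theta>))))
        \<longlongrightarrow> (\<Sum>\<alpha>\<in>UNIV. cnj (?c \<alpha>) * (0 - bracket (init_fun 1 \<alpha>) (V W2)))) (at_right 0)"
      by (intro tendsto_sum tendsto_mult tendsto_const tendsto_diff gmult_lim[OF gmult_lim[OF u_rem]]
          ray_rem_V_tendsto[OF _ c]) simp_all
    show "\<forall>\<^sub>F \<theta> in at_right 0. g \<theta> * bracket ?d (?y \<theta>) + g \<theta> * bracket W2 u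
        = (\<Sum>\<alpha>\<in>UNIV. cnj (?c \<alpha>) * (g \<theta> * (g \<theta> * bracket (ray_rem_fun 1 \<theta> \<alpha>) u)
          - bracket (ray_rem_fun 1 \<theta> \<alpha>) (V (?y \<theta>))))"
      using w_identities
    proof eventually_elim
      case (elim \<theta>)
      then have w: "w \<theta> \<in> ltwo" by blast
      have "(g \<theta>)\<^sup>2 * bracket ?d (w \<theta>) + bracket W2 u
        = g \<theta> * (\<Sum>\<alpha>\<in>UNIV. cnj (?c \<alpha>) * (bracket (ray_rem_fun 1 \<theta> \<alpha>) u - bracket (ray_rem_fun 1 \<theta> \<alpha>) (V (w \<theta>))))"
        using elim res by blast
      from arg_cong[OF this, of "\<lambda>z. g \<theta> * z"] show ?case
        by (simp add: bracket_V_scale[OF w] bracket_scale_right sum_distrib_left algebra_simps power2_eq_square)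
    qed
  qed
  then have "(\<Sum>\<alpha>\<in>UNIV. cnj (?c \<alpha>) * ?c \<alpha>) = 0" by (simp only: bracket_init_1) simp
  then have "?c \<alpha> = 0" for \<alpha> by (rule res_coeff_sq_zero)
  then have b: "W2 \<in> Ebd" using res by (simp add: bound_eigenspace_iff)
  have "\<forall>\<^sub>F \<theta> in at_right 0. bracket W2 (?y \<theta>) = 0"
    using w_orth[OF b] by eventually_elim (simp add: bracket_scale_right)
  from conv_orth[OF c this b] show ?thesis by (rule bound_zero[OF b])
qed

lemma expansion': "\<exists>C\<ge>0. \<forall>\<^sub>F \<theta> in at_right 0. \<forall>x.
  cmod (w \<theta> x - (Wm x / g \<theta> + W0 x)) \<le> C * kap \<theta> * weight sb x"
  using expansion by (simp add: W2_zero g_def)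

lemma conv_W0: "conv (\<lambda>\<theta>. w \<theta> - (1 / g \<theta>) *\<^sub>C Wm) W0"
  using expansion' W0 by (simp add: conv_def algebra_simps)

lemma conv_Wm: "conv (\<lambda>\<theta>. g \<theta> *\<^sub>C w \<theta>) Wm"
proof -
  obtain C where C: "C \<ge> 0" "\<forall>\<^sub>F \<theta> in at_right 0. \<forall>x. cmod (w \<theta> x - (Wm x / g \<theta> + W0 x)) \<le> C * kap \<theta> * weight sb x"
    using expansion' by blast
  obtain c0 where c0: "c0 \<ge> 0" "\<And>x. cmod (W0 x) \<le> c0 * weight sb x" using W0 by (rule linfE) blast
  have "\<forall>\<^sub>F \<theta> in at_right 0. \<forall>x. cmod ((g \<theta> *\<^sub>C w \<theta>) x - Wm x) \<le> (C + c0) * kap \<theta> * weight sb x"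
    using C(2) kap_small
  proof eventually_elim
    case (elim \<theta>)
    let ?k = "kap \<theta>"
    have k: "0 < ?k" "?k \<le> 1" using elim by auto
    show ?case
    proof
      fix x
      define r where "r = w \<theta> x - (Wm x / g \<theta> + W0 x)"
      have r: "cmod r \<le> C * ?k * weight sb x" using elim by (simp add: r_def)
      have eq: "(g \<theta> *\<^sub>C w \<theta>) x - Wm x = complex_of_real ?k * (W0 x + r)"
        using k by (simp add: r_def g_def field_simps)
      have "cmod ((g \<theta> *\<^sub>C w \<theta>) x - Wm x) \<le> ?k * (cmod (W0 x) + cmod r)"
        unfolding eq using k by (auto simp: norm_mult intro!: mult_left_mono norm_triangle_ineq)
      also have "\<dots> \<le> ?k * (c0 * weight sb x + C * 1 * weight sb x)"
        using k C(1) by (intro mult_left_mono add_mono c0 order_trans[OF r] mult_right_mono) auto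
      finally show "cmod ((g \<theta> *\<^sub>C w \<theta>) x - Wm x) \<le> (C + c0) * kap \<theta> * weight sb x"
        by (simp add: algebra_simps)
    qed
  qed
  then show ?thesis using C(1) c0(1) Wm unfolding conv_def by (intro conjI exI[of _ "C + c0"]) auto
qed

text \<open>One Taylor step in kappa, for all half-lines at once; it exposes the term that cancels
  against the equation of the preceding order.\<close>

lemma rem_step:
  assumes j: "j \<le> 3" and f: "f \<in> lone (real (Suc j))"
  shows "\<forall>\<^sub>F \<theta> in at_right 0. \<forall>\<alpha>. bracket (ray_rem_fun j \<theta> \<alpha>) (f :: ('a, 'n) gfun)
    = bracket (init_fun j \<alpha>) f + g \<theta> * bracket (ray_rem_fun (Suc j) \<theta> \<alpha>) f"
proof -
  obtain D where D: "D \<ge> 0"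
    "\<forall>\<^sub>F \<theta> in at_right 0. \<forall>\<alpha> x. cmod (ray_rem_fun (Suc j) \<theta> \<alpha> (x :: ('a, 'n) vertex)) \<le> D * weight (real (Suc j)) x"
    using ray_rem_fun_bound[OF j] by blast
  show ?thesis using D(2) kap_small
  proof eventually_elim
    case (elim \<theta>)
    show ?case
    proof
      fix \<alpha>
      let ?E = "ray_rem_fun (Suc j) \<theta> \<alpha> :: ('a, 'n) gfun"
      have "kap \<theta> \<noteq> 0" using elim by simp
      from ray_rem_fun_Suc[OF this, of j \<alpha>, symmetric]
      have eq: "ray_rem_fun j \<theta> \<alpha> = complex_of_real (kap \<theta>) *\<^sub>C ?E + init_fun j \<alpha>" by (simp only: diff_eq_eq)
      have "pairable ?E f" by (rule pairable_linf_lone[OF linfI f]) (use elim in blast)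
      then have "pairable (complex_of_real (kap \<theta>) *\<^sub>C ?E) f" by (metis pairable_sym pairable_scale_right)
      moreover have "pairable (init_fun j \<alpha>) f" by (rule init_fun_pairable[OF j lone_mono[OF f]]) simp
      ultimately show "bracket (ray_rem_fun j \<theta> \<alpha>) f = bracket (init_fun j \<alpha>) f + g \<theta> * bracket ?E f"
        unfolding eq by (simp add: bracket_add_left bracket_scale_left g_def)
    qed
  qed
qed

lemma Wm_eqs: "H0 Wm = - V Wm" "\<And>\<alpha>. Wm (Ray \<alpha> 0) = - bracket (init_fun 0 \<alpha>) (V Wm)"
proof -
  let ?y = "\<lambda>\<theta>. g \<theta> *\<^sub>C w \<theta>"
  note c = conv_Wm
  show "H0 Wm = - V Wm"
  proof
    fix x
    have "H0 Wm x + 0 = 0 - V Wm x"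
    proof (rule lim_unique)
      show "((\<lambda>\<theta>. H0 (?y \<theta>) x + g \<theta> * (g \<theta> * ?y \<theta> x)) \<longlongrightarrow> H0 Wm x + 0) (at_right 0)"
        by (intro tendsto_add conv_H0[OF c] gmult_lim[OF gmult_lim[OF conv_pointwise[OF c]]])
      show "((\<lambda>\<theta>. g \<theta> * u x - V (?y \<theta>) x) \<longlongrightarrow> 0 - V Wm x) (at_right 0)"
        by (intro tendsto_diff conv_V_pointwise[OF c] gmult_lim[OF tendsto_const])
      show "\<forall>\<^sub>F \<theta> in at_right 0. H0 (?y \<theta>) x + g \<theta> * (g \<theta> * ?y \<theta> x) = g \<theta> * u x - V (?y \<theta>) x"
        using w_identities
      proof eventually_elim
        case (elim \<theta>)
        have l: "w \<theta> \<in> linf (- real \<beta>)" using elim by (intro ltwo_imp_linf) auto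
        have "H0 (w \<theta>) x + (g \<theta>)\<^sup>2 * w \<theta> x = u x - V (w \<theta>) x" using elim by (metis minus_apply plus_fun_apply scaleC_fun_apply)
        then show ?case by (simp add: free_op_scale V_scale[OF l]) algebra
      qed
    qed
    then show "H0 Wm x = (- V Wm) x" by simp
  qed
  show "Wm (Ray \<alpha> 0) = - bracket (init_fun 0 \<alpha>) (V Wm)" for \<alpha>
  proof (rule lim_unique)
    show "((\<lambda>\<theta>. ?y \<theta> (Ray \<alpha> 0)) \<longlongrightarrow> Wm (Ray \<alpha> 0)) (at_right 0)" by (rule conv_pointwise[OF c])
    show "((\<lambda>\<theta>. g \<theta> * bracket (ray_rem_fun 0 \<theta> \<alpha>) u - bracket (ray_rem_fun 0 \<theta> \<alpha>) (V (?y \<theta>)))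
        \<longlongrightarrow> - bracket (init_fun 0 \<alpha>) (V Wm)) (at_right 0)"
      using tendsto_diff[OF gmult_lim[OF u_rem[of 0 \<alpha>]] ray_rem_V_tendsto[OF _ c, of 0 \<alpha>]] by simp
    show "\<forall>\<^sub>F \<theta> in at_right 0. ?y \<theta> (Ray \<alpha> 0)
        = g \<theta> * bracket (ray_rem_fun 0 \<theta> \<alpha>) u - bracket (ray_rem_fun 0 \<theta> \<alpha>) (V (?y \<theta>))"
      using w_identities
    proof eventually_elim
      case (elim \<theta>)
      then have w: "w \<theta> \<in> ltwo"
        and e: "w \<theta> (Ray \<alpha> 0) = bracket (ray_rem_fun 0 \<theta> \<alpha>) u - bracket (ray_rem_fun 0 \<theta> \<alpha>) (V (w \<theta>))" by blast+
      show ?case by (simp add: e bracket_V_scale[OF w] algebra_simps)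
    qed
  qed
qed

lemma Wm_res: "Wm \<in> Eres"
  by (rule res_from_init[OF W_linf(2) Wm_eqs])

lemma Wm_orth: "\<Phi> \<in> Ebd \<Longrightarrow> bracket \<Phi> Wm = 0"
proof -
  assume \<Phi>: "\<Phi> \<in> Ebd"
  have "\<forall>\<^sub>F \<theta> in at_right 0. bracket \<Phi> (g \<theta> *\<^sub>C w \<theta>) = 0"
    using w_orth[OF \<Phi>] by eventually_elim (simp add: bracket_scale_right)
  from conv_orth[OF conv_Wm this \<Phi>] show ?thesis .
qed

text \<open>In the limit of the solvability identity the pairing of kappa^2 w with the decaying part
  disappears and kappa w becomes \<open>Wm\<close>. This fixes the constants of \<open>Wm\<close>,
  which its own equation leaves free.\<close>

lemma Wm_pair:
  assumes \<Psi>: "\<Psi> \<in> Eres"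
  shows "bracket \<Psi> u = (\<Sum>\<alpha>\<in>UNIV. cnj (res_coeff (V \<Psi>) \<alpha>) * res_coeff (V Wm) \<alpha>)"
proof -
  let ?y = "\<lambda>\<theta>. g \<theta> *\<^sub>C w \<theta>"
  note c = conv_Wm
  let ?d = "decaying_part (V \<Psi>)" and ?c = "res_coeff (V \<Psi>)"
  have "bracket \<Psi> u = (\<Sum>\<alpha>\<in>UNIV. cnj (?c \<alpha>) * (0 - bracket (init_fun 1 \<alpha>) (V Wm)))"
  proof (rule lim_unique)
    show "((\<lambda>\<theta>. g \<theta> * bracket ?d (?y \<theta>) + bracket \<Psi> u) \<longlongrightarrow> bracket \<Psi> u) (at_right 0)"
      using tendsto_add[OF gmult_lim[OF conv_bracket[OF c decaying_part_V_lone[OF \<Psi>]]] tendsto_const[of "bracket \<Psi> u"]] by simp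
    show "((\<lambda>\<theta>. \<Sum>\<alpha>\<in>UNIV. cnj (?c \<alpha>) * (g \<theta> * bracket (ray_rem_fun 1 \<theta> \<alpha>) u
        - bracket (ray_rem_fun 1 \<theta> \<alpha>) (V (?y \<theta>))))
        \<longlongrightarrow> (\<Sum>\<alpha>\<in>UNIV. cnj (?c \<alpha>) * (0 - bracket (init_fun 1 \<alpha>) (V Wm)))) (at_right 0)"
      by (intro tendsto_sum tendsto_mult tendsto_const tendsto_diff gmult_lim[OF u_rem]
          ray_rem_V_tendsto[OF _ c]) simp_all
    show "\<forall>\<^sub>F \<theta> in at_right 0. g \<theta> * bracket ?d (?y \<theta>) + bracket \<Psi> u
        = (\<Sum>\<alpha>\<in>UNIV. cnj (?c \<alpha>) * (g \<theta> * bracket (ray_rem_fun 1 \<theta> \<alpha>) u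
          - bracket (ray_rem_fun 1 \<theta> \<alpha>) (V (?y \<theta>))))"
      using w_identities
    proof eventually_elim
      case (elim \<theta>)
      then have w: "w \<theta> \<in> ltwo" by blast
      have "(g \<theta>)\<^sup>2 * bracket ?d (w \<theta>) + bracket \<Psi> u
        = g \<theta> * (\<Sum>\<alpha>\<in>UNIV. cnj (?c \<alpha>) * (bracket (ray_rem_fun 1 \<theta> \<alpha>) u - bracket (ray_rem_fun 1 \<theta> \<alpha>) (V (w \<theta>))))"
        using elim \<Psi> by blast
      then show ?case
        by (simp add: bracket_V_scale[OF w] bracket_scale_right sum_distrib_left algebra_simps power2_eq_square)
    qed
  qed
  then show ?thesis by (simp only: bracket_init_1) simp
qed

lemma W0_orth: "\<Phi> \<in> Ebd \<Longrightarrow> bracket \<Phi> W0 = 0"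
proof -
  assume \<Phi>: "\<Phi> \<in> Ebd"
  have "\<forall>\<^sub>F \<theta> in at_right 0. bracket \<Phi> (w \<theta> - (1 / g \<theta>) *\<^sub>C Wm) = 0"
    using w_orth[OF \<Phi>] w_identities
  proof eventually_elim
    case (elim \<theta>)
    have "pairable \<Phi> (w \<theta>)" using elim lone_imp_ltwo[OF Ebd_lone[OF \<Phi>]] beta6 by (intro pairable_ltwo) auto
    moreover have "pairable \<Phi> ((1 / g \<theta>) *\<^sub>C Wm)" by (rule pairable_lone_linf[OF Ebd_lone[OF \<Phi>] linf_scale[OF Wm]])
    ultimately show ?case using elim(1) by (simp add: bracket_diff_right bracket_scale_right Wm_orth[OF \<Phi>])
  qed
  from conv_orth[OF conv_W0 this \<Phi>] show ?thesis .
qed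

text \<open>The singular term \<open>Wm / kappa\<close> is removed. Its boundary values cancel by
  \<open>Wm_eqs\<close> and its part of the solvability identity by \<open>Wm_pair\<close>, so that
  the remaining identity can be divided by kappa.\<close>

lemma w_identities_0:
  "\<forall>\<^sub>F \<theta> in at_right 0. let y = w \<theta> - (1 / g \<theta>) *\<^sub>C Wm in
    (\<forall>\<alpha>. y (Ray \<alpha> 0) = bracket (ray_rem_fun 0 \<theta> \<alpha>) u - bracket (ray_rem_fun 0 \<theta> \<alpha>) (V y) - bracket (ray_rem_fun 1 \<theta> \<alpha>) (V Wm))
    \<and> (\<forall>\<Psi>\<in>Eres. bracket (decaying_part (V \<Psi>)) (g \<theta> *\<^sub>C w \<theta>)
        = (\<Sum>\<alpha>\<in>UNIV. cnj (res_coeff (V \<Psi>) \<alpha>) * (bracket (ray_rem_fun 1 \<theta> \<alpha>) u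
          - bracket (ray_rem_fun 1 \<theta> \<alpha>) (V y) - bracket (ray_rem_fun 2 \<theta> \<alpha>) (V Wm))))
    \<and> H0 y + g \<theta> *\<^sub>C (g \<theta> *\<^sub>C w \<theta>) = u - V y"
proof -
  have s: "V Wm \<in> lone (real (Suc 0))" "V Wm \<in> lone (real (Suc 1))" using beta6 by (auto intro!: V_W_lone)
  have j: "(0::nat) \<le> 3" "(1::nat) \<le> 3" by simp_all
  show ?thesis using w_identities ray_rem_linf rem_step[OF j(1) s(1)] rem_step[OF j(2) s(2)]
  proof eventually_elim
    case (elim \<theta>)
    define y where "y = w \<theta> - (1 / g \<theta>) *\<^sub>C Wm"
    have w: "w \<theta> \<in> ltwo" and g0: "g \<theta> \<noteq> 0" using elim by blast+
    have l: "w \<theta> \<in> linf (- real \<beta>)" by (rule ltwo_imp_linf[OF w]) simp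
    have Vw: "V (w \<theta>) = V y + (1 / g \<theta>) *\<^sub>C V Wm"
      unfolding y_def by (simp add: V_diff l linf_scale W_linf V_scale)
    have yl: "y \<in> linf (- real \<beta>)" unfolding y_def by (intro linf_diff l linf_scale W_linf)
    have E: "bracket a (V (w \<theta>)) = bracket a (V y) + (1 / g \<theta>) * bracket a (V Wm)" if "a \<in> linf (- 1)" for a
      unfolding Vw using beta6
      by (subst bracket_add_right)
        (auto intro!: pairable_linf_lone[OF that] lone_scale V_lone' yl W_linf simp: bracket_scale_right)
    have a: "y (Ray \<alpha> 0) = bracket (ray_rem_fun 0 \<theta> \<alpha>) u - bracket (ray_rem_fun 0 \<theta> \<alpha>) (V y) - bracket (ray_rem_fun 1 \<theta> \<alpha>) (V Wm)" for \<alpha>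
    proof -
      have "w \<theta> (Ray \<alpha> 0) = bracket (ray_rem_fun 0 \<theta> \<alpha>) u - bracket (ray_rem_fun 0 \<theta> \<alpha>) (V (w \<theta>))"
        using elim(1) by blast
      moreover have "bracket (ray_rem_fun 0 \<theta> \<alpha>) (V (w \<theta>))
          = bracket (ray_rem_fun 0 \<theta> \<alpha>) (V y) + (1 / g \<theta>) * bracket (ray_rem_fun 0 \<theta> \<alpha>) (V Wm)"
        by (rule E) (use elim(2) in blast)
      moreover have "bracket (ray_rem_fun 0 \<theta> \<alpha>) (V Wm)
          = bracket (init_fun 0 \<alpha>) (V Wm) + g \<theta> * bracket (ray_rem_fun 1 \<theta> \<alpha>) (V Wm)"
        using elim(3) by simp
      ultimately show ?thesis using g0 Wm_eqs(2)[of \<alpha>] by (simp add: y_def field_simps)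
    qed
    have b: "bracket (decaying_part (V \<Psi>)) (g \<theta> *\<^sub>C w \<theta>)
        = (\<Sum>\<alpha>\<in>UNIV. cnj (res_coeff (V \<Psi>) \<alpha>) * (bracket (ray_rem_fun 1 \<theta> \<alpha>) u
          - bracket (ray_rem_fun 1 \<theta> \<alpha>) (V y) - bracket (ray_rem_fun 2 \<theta> \<alpha>) (V Wm)))" if \<Psi>: "\<Psi> \<in> Eres" for \<Psi>
    proof -
      let ?c = "res_coeff (V \<Psi>)"
      let ?S = "\<Sum>\<alpha>\<in>UNIV. cnj (?c \<alpha>) * (bracket (ray_rem_fun 1 \<theta> \<alpha>) u
          - bracket (ray_rem_fun 1 \<theta> \<alpha>) (V y) - bracket (ray_rem_fun 2 \<theta> \<alpha>) (V Wm))"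
      have "g \<theta> * (bracket (ray_rem_fun 1 \<theta> \<alpha>) u - bracket (ray_rem_fun 1 \<theta> \<alpha>) (V (w \<theta>)))
          = g \<theta> * (bracket (ray_rem_fun 1 \<theta> \<alpha>) u - bracket (ray_rem_fun 1 \<theta> \<alpha>) (V y) - bracket (ray_rem_fun 2 \<theta> \<alpha>) (V Wm))
            + res_coeff (V Wm) \<alpha>" for \<alpha>
      proof -
        have "bracket (ray_rem_fun 1 \<theta> \<alpha>) (V (w \<theta>))
            = bracket (ray_rem_fun 1 \<theta> \<alpha>) (V y) + (1 / g \<theta>) * bracket (ray_rem_fun 1 \<theta> \<alpha>) (V Wm)"
          by (rule E) (use elim(2) in blast)
        moreover have "bracket (ray_rem_fun 1 \<theta> \<alpha>) (V Wm)
            = - res_coeff (V Wm) \<alpha> + g \<theta> * bracket (ray_rem_fun 2 \<theta> \<alpha>) (V Wm)"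
          using elim(4) bracket_init_1[of \<alpha> "V Wm"] by (simp add: numeral_2_eq_2)
        ultimately show ?thesis using g0 by (simp add: field_simps)
      qed
      then have "g \<theta> * (\<Sum>\<alpha>\<in>UNIV. cnj (?c \<alpha>) * (bracket (ray_rem_fun 1 \<theta> \<alpha>) u - bracket (ray_rem_fun 1 \<theta> \<alpha>) (V (w \<theta>))))
          = g \<theta> * ?S + (\<Sum>\<alpha>\<in>UNIV. cnj (?c \<alpha>) * res_coeff (V Wm) \<alpha>)"
        unfolding sum_distrib_left mult.left_commute[of "g \<theta>"] by (simp only: distrib_left sum.distrib)
      moreover have "(g \<theta>)\<^sup>2 * bracket (decaying_part (V \<Psi>)) (w \<theta>) + bracket \<Psi> u
        = g \<theta> * (\<Sum>\<alpha>\<in>UNIV. cnj (?c \<alpha>) * (bracket (ray_rem_fun 1 \<theta> \<alpha>) u - bracket (ray_rem_fun 1 \<theta> \<alpha>) (V (w \<theta>))))"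
        using elim(1) \<Psi> by blast
      ultimately have "g \<theta> * (g \<theta> * bracket (decaying_part (V \<Psi>)) (w \<theta>)) = g \<theta> * ?S"
        using Wm_pair[OF \<Psi>] by (simp add: power2_eq_square mult.assoc)
      then show ?thesis using g0 by (simp add: bracket_scale_right)
    qed
    have e: "H0 y + g \<theta> *\<^sub>C (g \<theta> *\<^sub>C w \<theta>) = u - V y"
    proof
      fix x
      have "H0 (w \<theta>) + (g \<theta>)\<^sup>2 *\<^sub>C w \<theta> = u - V (w \<theta>)" using elim(1) by blast
      from fun_cong[OF this, of x] fun_cong[OF Vw, of x]
      show "(H0 y + g \<theta> *\<^sub>C (g \<theta> *\<^sub>C w \<theta>)) x = (u - V y) x"
        by (simp add: y_def free_op_diff free_op_scale Wm_eqs(1) power2_eq_square algebra_simps)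
    qed
    show ?case unfolding Let_def y_def[symmetric] using a b e by blast
  qed
qed

lemma W0_eqs: "H0 W0 = u - V W0"
  "\<And>\<alpha>. W0 (Ray \<alpha> 0) = bracket (init_fun 0 \<alpha>) u - bracket (init_fun 0 \<alpha>) (V W0) - bracket (init_fun 1 \<alpha>) (V Wm)"
proof -
  let ?y = "\<lambda>\<theta>. w \<theta> - (1 / g \<theta>) *\<^sub>C Wm"
  note c = conv_W0
  have s: "V Wm \<in> lone (real (Suc 1))" using beta6 by (auto intro!: V_W_lone)
  show "H0 W0 = u - V W0"
  proof
    fix x
    have "H0 W0 x + 0 = u x - V W0 x"
    proof (rule lim_unique)
      show "((\<lambda>\<theta>. H0 (?y \<theta>) x + g \<theta> * ((g \<theta> *\<^sub>C w \<theta>) x)) \<longlongrightarrow> H0 W0 x + 0) (at_right 0)"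
        by (intro tendsto_add conv_H0[OF c] gmult_lim[OF conv_pointwise[OF conv_Wm]])
      show "((\<lambda>\<theta>. u x - V (?y \<theta>) x) \<longlongrightarrow> u x - V W0 x) (at_right 0)"
        by (intro tendsto_diff conv_V_pointwise[OF c] tendsto_const)
      show "\<forall>\<^sub>F \<theta> in at_right 0. H0 (?y \<theta>) x + g \<theta> * ((g \<theta> *\<^sub>C w \<theta>) x) = u x - V (?y \<theta>) x"
        using w_identities_0
      proof eventually_elim
        case (elim \<theta>)
        then have "H0 (?y \<theta>) + g \<theta> *\<^sub>C (g \<theta> *\<^sub>C w \<theta>) = u - V (?y \<theta>)" by (simp only: Let_def)
        from fun_cong[OF this, of x] show ?case by (simp only: plus_fun_apply minus_apply scaleC_fun_apply)
      qed
    qed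
    then show "H0 W0 x = (u - V W0) x" by simp
  qed
  show "W0 (Ray \<alpha> 0) = bracket (init_fun 0 \<alpha>) u - bracket (init_fun 0 \<alpha>) (V W0) - bracket (init_fun 1 \<alpha>) (V Wm)" for \<alpha>
  proof (rule lim_unique)
    show "((\<lambda>\<theta>. ?y \<theta> (Ray \<alpha> 0)) \<longlongrightarrow> W0 (Ray \<alpha> 0)) (at_right 0)" by (rule conv_pointwise[OF c])
    show "((\<lambda>\<theta>. bracket (ray_rem_fun 0 \<theta> \<alpha>) u - bracket (ray_rem_fun 0 \<theta> \<alpha>) (V (?y \<theta>)) - bracket (ray_rem_fun 1 \<theta> \<alpha>) (V Wm))
        \<longlongrightarrow> bracket (init_fun 0 \<alpha>) u - bracket (init_fun 0 \<alpha>) (V W0) - bracket (init_fun 1 \<alpha>) (V Wm)) (at_right 0)"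
      by (intro tendsto_diff u_rem ray_rem_V_tendsto[OF _ c] ray_rem_tendsto s) simp_all
    show "\<forall>\<^sub>F \<theta> in at_right 0. ?y \<theta> (Ray \<alpha> 0)
        = bracket (ray_rem_fun 0 \<theta> \<alpha>) u - bracket (ray_rem_fun 0 \<theta> \<alpha>) (V (?y \<theta>)) - bracket (ray_rem_fun 1 \<theta> \<alpha>) (V Wm)"
      using w_identities_0 by eventually_elim (unfold Let_def, blast)
  qed
qed

lemma init_bracket_diff: "j \<le> 4 \<Longrightarrow> j \<le> 3 \<Longrightarrow> bracket (init_fun j \<alpha>) (u - V W0) = bracket (init_fun j \<alpha>) u - bracket (init_fun j \<alpha>) (V W0)"
  using beta6 by (intro bracket_diff_right init_fun_pairable u_lone_nat V_W_lone) auto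

text \<open>The limits in \<open>W0_eqs\<close> are the image under \<open>H0\<close> and the values
  next to the core of the right side, and these determine a function.\<close>

lemma W0_eq: "W0 = G0 (u - V W0) - G1 (V Wm)"
proof (rule free_op_unique[OF graph])
  have l: "u - V W0 \<in> lone 0" "V Wm \<in> lone 1" using beta6 by (auto intro!: lone_diff u_lone V_W_lone)
  show "H0 W0 = H0 (G0 (u - V W0) - G1 (V Wm))"
    by (simp add: free_op_diff free_op_free_coeff_0[OF graph l(1)] free_op_free_coeff_1[OF graph l(2)] W0_eqs(1) del: One_nat_def)
  show "W0 (Ray \<alpha> 0) = (G0 (u - V W0) - G1 (V Wm)) (Ray \<alpha> 0)" for \<alpha>
    unfolding W0_eqs(2) by (simp add: free_coeff_init init_bracket_diff del: free_coeff.simps One_nat_def)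
qed

text \<open>Stated with \<open>init_fun\<close>, because in this form it also cancels the leading
  order of the identity on which order 1 rests.\<close>

lemma W0_solvability_raw:
  assumes \<Psi>: "\<Psi> \<in> Eres"
  shows "bracket (decaying_part (V \<Psi>)) Wm = (\<Sum>\<alpha>\<in>UNIV. cnj (res_coeff (V \<Psi>) \<alpha>)
    * (bracket (init_fun 1 \<alpha>) u - bracket (init_fun 1 \<alpha>) (V W0) - bracket (init_fun 2 \<alpha>) (V Wm)))"
proof -
  let ?y = "\<lambda>\<theta>. w \<theta> - (1 / g \<theta>) *\<^sub>C Wm"
  let ?d = "decaying_part (V \<Psi>)" and ?c = "res_coeff (V \<Psi>)"
  note c = conv_W0
  have s: "V Wm \<in> lone (real (Suc 2))" "V Wm \<in> lone 2" "u - V W0 \<in> lone 1"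
    using beta6 by (auto intro!: V_W_lone lone_diff u_lone)
  show "bracket ?d Wm = (\<Sum>\<alpha>\<in>UNIV. cnj (?c \<alpha>) * (bracket (init_fun 1 \<alpha>) u - bracket (init_fun 1 \<alpha>) (V W0) - bracket (init_fun 2 \<alpha>) (V Wm)))"
  proof (rule lim_unique)
    show "((\<lambda>\<theta>. bracket ?d (g \<theta> *\<^sub>C w \<theta>)) \<longlongrightarrow> bracket ?d Wm) (at_right 0)"
      by (rule conv_bracket[OF conv_Wm decaying_part_V_lone[OF \<Psi>]])
    show "((\<lambda>\<theta>. \<Sum>\<alpha>\<in>UNIV. cnj (?c \<alpha>) * (bracket (ray_rem_fun 1 \<theta> \<alpha>) u
          - bracket (ray_rem_fun 1 \<theta> \<alpha>) (V (?y \<theta>)) - bracket (ray_rem_fun 2 \<theta> \<alpha>) (V Wm)))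
        \<longlongrightarrow> (\<Sum>\<alpha>\<in>UNIV. cnj (?c \<alpha>) * (bracket (init_fun 1 \<alpha>) u - bracket (init_fun 1 \<alpha>) (V W0) - bracket (init_fun 2 \<alpha>) (V Wm)))) (at_right 0)"
      by (intro tendsto_sum tendsto_mult tendsto_const tendsto_diff u_rem ray_rem_V_tendsto[OF _ c] ray_rem_tendsto s) simp_all
    show "\<forall>\<^sub>F \<theta> in at_right 0. bracket ?d (g \<theta> *\<^sub>C w \<theta>) = (\<Sum>\<alpha>\<in>UNIV. cnj (?c \<alpha>) * (bracket (ray_rem_fun 1 \<theta> \<alpha>) u
          - bracket (ray_rem_fun 1 \<theta> \<alpha>) (V (?y \<theta>)) - bracket (ray_rem_fun 2 \<theta> \<alpha>) (V Wm)))"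
      using w_identities_0 by eventually_elim (use \<Psi> in \<open>unfold Let_def, blast\<close>)
  qed
qed

text \<open>Green's identity absorbs the pairing of the decaying part with \<open>Wm\<close> into
  \<open>G2 (V Wm)\<close>, because \<open>G0 (V Wm) = - Wm\<close>.\<close>

lemma W0_solvability:
  assumes \<Psi>: "\<Psi> \<in> Eres"
  shows "bracket (V \<Psi>) (G1 (u - V W0)) = bracket (V \<Psi>) (G2 (V Wm))"
proof -
  let ?d = "decaying_part (V \<Psi>)" and ?c = "res_coeff (V \<Psi>)"
  have s: "V Wm \<in> lone (real (Suc 2))" "V Wm \<in> lone 2" "u - V W0 \<in> lone 1"
    using beta6 by (auto intro!: V_W_lone lone_diff u_lone)
  note W0_solvability_raw[OF \<Psi>]
  moreover have "bracket (V \<Psi>) (G2 (V Wm)) = bracket ?d Wm + (\<Sum>\<alpha>\<in>UNIV. cnj (?c \<alpha>) * bracket (init_fun 2 \<alpha>) (V Wm))"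
    by (simp add: green_G2[OF beta6 \<Psi> s(2)] res_eq[OF Wm_res] bracket_minus_right)
  moreover have "bracket (V \<Psi>) (G1 (u - V W0)) = (\<Sum>\<alpha>\<in>UNIV. cnj (?c \<alpha>) * (bracket (init_fun 1 \<alpha>) u - bracket (init_fun 1 \<alpha>) (V W0)))"
    unfolding green_G1[OF beta6 \<Psi> s(3)] by (simp add: init_bracket_diff del: One_nat_def)
  ultimately show ?thesis by (simp add: right_diff_distrib sum_subtractf del: One_nat_def)
qed

end


section \<open>Threshold equation and solvability condition for order 1\<close>

locale resolvent_family_1 = resolvent_family E0 att V v U \<beta> w u W2 Wm W0
  for E0 :: "'a::finite set set" and att :: "'n::finite \<Rightarrow> 'a"
    and V :: "('a, 'n) gop" and v :: "'k::complex_hilbert \<Rightarrow> ('a, 'n) gfun" and U \<beta> w u W2 Wm W0 +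
  fixes W1 :: "('a, 'n) gfun"
  assumes beta7: "7 \<le> \<beta>"
    and W1: "W1 \<in> linf (- (real \<beta> - 2))"
    and expansion_1: "\<exists>C\<ge>0. \<forall>\<^sub>F \<theta> in at_right 0. \<forall>x.
      cmod (w \<theta> x - (W2 x / complex_of_real ((kap \<theta>)\<^sup>2) + Wm x / complex_of_real (kap \<theta>) + W0 x
        + complex_of_real (kap \<theta>) * W1 x)) \<le> C * (kap \<theta>)\<^sup>2 * weight (real \<beta> - 2) x"
begin

lemma W1_linf: "W1 \<in> linf (- real \<beta>)"
  by (rule linf_sb[OF W1])

abbreviation "y0 \<theta> \<equiv> w \<theta> - (1 / g \<theta>) *\<^sub>C Wm"
abbreviation "y1 \<theta> \<equiv> (1 / g \<theta>) *\<^sub>C (y0 \<theta> - W0)"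

lemma conv_W1: "conv y1 W1"
proof -
  obtain C where C: "C \<ge> 0" "\<forall>\<^sub>F \<theta> in at_right 0. \<forall>x.
      cmod (w \<theta> x - (W2 x / complex_of_real ((kap \<theta>)\<^sup>2) + Wm x / complex_of_real (kap \<theta>) + W0 x
        + complex_of_real (kap \<theta>) * W1 x)) \<le> C * (kap \<theta>)\<^sup>2 * weight sb x"
    using expansion_1 by blast
  have "\<forall>\<^sub>F \<theta> in at_right 0. \<forall>x. cmod (y1 \<theta> x - W1 x) \<le> C * kap \<theta> * weight sb x"
    using C(2) kap_small
  proof eventually_elim
    case (elim \<theta>)
    let ?k = "kap \<theta>"
    have k: "0 < ?k" using elim by auto
    show ?case
    proof
      fix x
      define r where "r = w \<theta> x - (W2 x / complex_of_real (?k\<^sup>2) + Wm x / complex_of_real ?k + W0 x + complex_of_real ?k * W1 x)"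
      have r: "cmod r \<le> C * ?k\<^sup>2 * weight sb x" using elim by (simp add: r_def)
      have eq: "y1 \<theta> x - W1 x = r / complex_of_real ?k"
        using k by (simp add: r_def g_def W2_zero field_simps)
      have "cmod (y1 \<theta> x - W1 x) = cmod r / ?k" unfolding eq using k by (simp add: norm_divide)
      also have "\<dots> \<le> (C * ?k\<^sup>2 * weight sb x) / ?k" using k by (intro divide_right_mono r) auto
      finally show "cmod (y1 \<theta> x - W1 x) \<le> C * kap \<theta> * weight sb x"
        using k by (simp add: power2_eq_square)
    qed
  qed
  then show ?thesis using C(1) W1 unfolding conv_def by blast
qed

text \<open>The pattern of \<open>w_identities_0\<close> once more: the equations of
  \<open>W0\<close> and \<open>W0_solvability_raw\<close> remove the leading order, and one more
  factor kappa is divided out.\<close>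

lemma w_identities_1:
  "\<forall>\<^sub>F \<theta> in at_right 0.
    (\<forall>\<alpha>. y1 \<theta> (Ray \<alpha> 0) = bracket (ray_rem_fun 1 \<theta> \<alpha>) u - bracket (ray_rem_fun 1 \<theta> \<alpha>) (V W0)
        - bracket (ray_rem_fun 0 \<theta> \<alpha>) (V (y1 \<theta>)) - bracket (ray_rem_fun 2 \<theta> \<alpha>) (V Wm))
    \<and> (\<forall>\<Psi>\<in>Eres. bracket (decaying_part (V \<Psi>)) (y0 \<theta>)
        = (\<Sum>\<alpha>\<in>UNIV. cnj (res_coeff (V \<Psi>) \<alpha>) * (bracket (ray_rem_fun 2 \<theta> \<alpha>) u - bracket (ray_rem_fun 2 \<theta> \<alpha>) (V W0)
          - bracket (ray_rem_fun 1 \<theta> \<alpha>) (V (y1 \<theta>)) - bracket (ray_rem_fun 3 \<theta> \<alpha>) (V Wm))))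
    \<and> H0 (y1 \<theta>) + g \<theta> *\<^sub>C w \<theta> = - V (y1 \<theta>)"
proof -
  have s: "V Wm \<in> lone (real (Suc 1))" "V Wm \<in> lone (real (Suc 2))" "u \<in> lone (real (Suc 0))" "u \<in> lone (real (Suc 1))"
    "V W0 \<in> lone (real (Suc 0))" "V W0 \<in> lone (real (Suc 1))"
    using beta6 by (auto intro!: V_W_lone u_lone)
  have j: "(0::nat) \<le> 3" "(1::nat) \<le> 3" "(2::nat) \<le> 3" by simp_all
  show ?thesis using w_identities w_identities_0 ray_rem_linf rem_step[OF j(2) s(1)] rem_step[OF j(3) s(2)]
    rem_step[OF j(1) s(3)] rem_step[OF j(2) s(4)] rem_step[OF j(1) s(5)] rem_step[OF j(2) s(6)]
  proof eventually_elim
    case (elim \<theta>)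
    let ?R = "\<lambda>j \<alpha>. ray_rem_fun j \<theta> \<alpha> :: ('a, 'n) gfun"
    have w: "w \<theta> \<in> ltwo" and g0: "g \<theta> \<noteq> 0" using elim(1) by blast+
    have l: "w \<theta> \<in> linf (- real \<beta>)" by (rule ltwo_imp_linf[OF w]) simp
    have y0l: "y0 \<theta> \<in> linf (- real \<beta>)" by (intro linf_diff l linf_scale W_linf)
    have y1l: "y1 \<theta> \<in> linf (- real \<beta>)" by (intro linf_scale linf_diff[OF y0l] W_linf)
    have y0: "y0 \<theta> = W0 + g \<theta> *\<^sub>C y1 \<theta>" using g0 by (intro ext) simp
    have Vy: "V (y0 \<theta>) = V W0 + g \<theta> *\<^sub>C V (y1 \<theta>)"
      using arg_cong[OF y0, of V] by (simp add: V_add[OF W_linf(3) linf_scale[OF y1l]] V_scale[OF y1l])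
    have E: "bracket a (V (y0 \<theta>)) = bracket a (V W0) + g \<theta> * bracket a (V (y1 \<theta>))" if "a \<in> linf (- 1)" for a
      unfolding Vy using beta6
      by (subst bracket_add_right)
        (auto intro!: pairable_linf_lone[OF that] lone_scale V_lone' y1l W_linf simp: bracket_scale_right)
    have st: "bracket (?R 1 \<alpha>) (V Wm) = bracket (init_fun 1 \<alpha>) (V Wm) + g \<theta> * bracket (?R 2 \<alpha>) (V Wm)"
      "bracket (?R 2 \<alpha>) (V Wm) = bracket (init_fun 2 \<alpha>) (V Wm) + g \<theta> * bracket (?R 3 \<alpha>) (V Wm)"
      "bracket (?R 0 \<alpha>) u = bracket (init_fun 0 \<alpha>) u + g \<theta> * bracket (?R 1 \<alpha>) u"
      "bracket (?R 1 \<alpha>) u = bracket (init_fun 1 \<alpha>) u + g \<theta> * bracket (?R 2 \<alpha>) u"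
      "bracket (?R 0 \<alpha>) (V W0) = bracket (init_fun 0 \<alpha>) (V W0) + g \<theta> * bracket (?R 1 \<alpha>) (V W0)"
      "bracket (?R 1 \<alpha>) (V W0) = bracket (init_fun 1 \<alpha>) (V W0) + g \<theta> * bracket (?R 2 \<alpha>) (V W0)" for \<alpha>
      using elim(4-9) by (simp_all add: numeral_2_eq_2 numeral_3_eq_3)
    have Ra: "?R 0 \<alpha> \<in> linf (- 1)" "?R 1 \<alpha> \<in> linf (- 1)" for \<alpha> using elim(3) by blast+
    have i0: "y0 \<theta> (Ray \<alpha> 0) = bracket (?R 0 \<alpha>) u - bracket (?R 0 \<alpha>) (V (y0 \<theta>)) - bracket (?R 1 \<alpha>) (V Wm)" for \<alpha>
      using elim(2) unfolding Let_def by blast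
    have b0: "bracket (decaying_part (V \<Psi>)) (g \<theta> *\<^sub>C w \<theta>)
        = (\<Sum>\<alpha>\<in>UNIV. cnj (res_coeff (V \<Psi>) \<alpha>) * (bracket (?R 1 \<alpha>) u
          - bracket (?R 1 \<alpha>) (V (y0 \<theta>)) - bracket (?R 2 \<alpha>) (V Wm)))" if "\<Psi> \<in> Eres" for \<Psi>
      using elim(2) that unfolding Let_def by blast
    have e0: "H0 (y0 \<theta>) + g \<theta> *\<^sub>C (g \<theta> *\<^sub>C w \<theta>) = u - V (y0 \<theta>)"
      using elim(2) unfolding Let_def by blast
    have a: "y1 \<theta> (Ray \<alpha> 0) = bracket (?R 1 \<alpha>) u - bracket (?R 1 \<alpha>) (V W0)
        - bracket (?R 0 \<alpha>) (V (y1 \<theta>)) - bracket (?R 2 \<alpha>) (V Wm)" for \<alpha>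
    proof -
      have "g \<theta> * y1 \<theta> (Ray \<alpha> 0) = y0 \<theta> (Ray \<alpha> 0) - W0 (Ray \<alpha> 0)" using g0 by simp
      also have "\<dots> = g \<theta> * (bracket (?R 1 \<alpha>) u - bracket (?R 1 \<alpha>) (V W0)
        - bracket (?R 0 \<alpha>) (V (y1 \<theta>)) - bracket (?R 2 \<alpha>) (V Wm))"
        unfolding i0 E[OF Ra(1)] W0_eqs(2) st(1)[of \<alpha>] st(3)[of \<alpha>] st(5)[of \<alpha>] by (simp only: algebra_simps)
      finally show ?thesis using g0 by (simp only: mult_cancel_left simp_thms)
    qed
    have b: "bracket (decaying_part (V \<Psi>)) (y0 \<theta>)
        = (\<Sum>\<alpha>\<in>UNIV. cnj (res_coeff (V \<Psi>) \<alpha>) * (bracket (?R 2 \<alpha>) u - bracket (?R 2 \<alpha>) (V W0)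
          - bracket (?R 1 \<alpha>) (V (y1 \<theta>)) - bracket (?R 3 \<alpha>) (V Wm)))" if \<Psi>: "\<Psi> \<in> Eres" for \<Psi>
    proof -
      let ?d = "decaying_part (V \<Psi>)" and ?c = "res_coeff (V \<Psi>)"
      note d = decaying_part_V_lone[OF \<Psi>]
      let ?S = "\<Sum>\<alpha>\<in>UNIV. cnj (?c \<alpha>) * (bracket (?R 2 \<alpha>) u - bracket (?R 2 \<alpha>) (V W0)
          - bracket (?R 1 \<alpha>) (V (y1 \<theta>)) - bracket (?R 3 \<alpha>) (V Wm))"
      have eq: "g \<theta> *\<^sub>C w \<theta> = Wm + g \<theta> *\<^sub>C y0 \<theta>" using g0 by (intro ext) (simp add: field_simps)
      have ws: "w \<theta> \<in> linf (- sb)" using beta6 by (intro ltwo_imp_linf[OF w]) simp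
      have y0s: "y0 \<theta> \<in> linf (- sb)" by (intro linf_diff ws linf_scale Wm)
      have "bracket ?d (g \<theta> *\<^sub>C w \<theta>) = bracket ?d Wm + g \<theta> * bracket ?d (y0 \<theta>)"
        unfolding eq by (subst bracket_add_right) (auto intro!: pairable_lone_linf[OF d] linf_scale[OF y0s] Wm simp only: bracket_scale_right)
      moreover have "(\<Sum>\<alpha>\<in>UNIV. cnj (?c \<alpha>) * (bracket (?R 1 \<alpha>) u - bracket (?R 1 \<alpha>) (V (y0 \<theta>)) - bracket (?R 2 \<alpha>) (V Wm)))
          = (\<Sum>\<alpha>\<in>UNIV. cnj (?c \<alpha>) * (bracket (init_fun 1 \<alpha>) u - bracket (init_fun 1 \<alpha>) (V W0) - bracket (init_fun 2 \<alpha>) (V Wm)))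
            + g \<theta> * ?S"
      proof -
        have "bracket (?R 1 \<alpha>) u - bracket (?R 1 \<alpha>) (V (y0 \<theta>)) - bracket (?R 2 \<alpha>) (V Wm)
          = (bracket (init_fun 1 \<alpha>) u - bracket (init_fun 1 \<alpha>) (V W0) - bracket (init_fun 2 \<alpha>) (V Wm))
            + g \<theta> * (bracket (?R 2 \<alpha>) u - bracket (?R 2 \<alpha>) (V W0) - bracket (?R 1 \<alpha>) (V (y1 \<theta>)) - bracket (?R 3 \<alpha>) (V Wm))" for \<alpha>
          unfolding E[OF Ra(2)] st(2)[of \<alpha>] st(4)[of \<alpha>] st(6)[of \<alpha>] by (simp only: algebra_simps)
        then show ?thesis
          by (simp only: distrib_left sum.distrib) (simp only: sum_distrib_left mult.left_commute[of "g \<theta>"])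
      qed
      ultimately have "g \<theta> * bracket ?d (y0 \<theta>) = g \<theta> * ?S"
        using b0[OF \<Psi>] W0_solvability_raw[OF \<Psi>] by simp
      then show ?thesis using g0 by (simp only: mult_cancel_left simp_thms)
    qed
    have e: "H0 (y1 \<theta>) + g \<theta> *\<^sub>C w \<theta> = - V (y1 \<theta>)"
    proof
      fix x
      have "H0 (y0 \<theta>) x + g \<theta> * (g \<theta> * w \<theta> x) = u x - V (y0 \<theta>) x" using fun_cong[OF e0, of x] by simp
      moreover have "H0 (y0 \<theta>) x = H0 W0 x + g \<theta> * H0 (y1 \<theta>) x"
        using fun_cong[OF arg_cong[OF y0, of H0], of x] by (simp only: free_op_add free_op_scale plus_fun_apply scaleC_fun_apply)
      moreover have "H0 W0 x = u x - V W0 x" by (simp add: W0_eqs(1))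
      ultimately have "g \<theta> * (H0 (y1 \<theta>) x + g \<theta> * w \<theta> x) = g \<theta> * (- V (y1 \<theta>) x)"
        using fun_cong[OF Vy, of x] by (simp only: plus_fun_apply scaleC_fun_apply) algebra
      then show "(H0 (y1 \<theta>) + g \<theta> *\<^sub>C w \<theta>) x = (- V (y1 \<theta>)) x"
        using g0 by (simp only: mult_cancel_left simp_thms plus_fun_apply scaleC_fun_apply uminus_apply)
    qed
    show ?case using a b e by blast
  qed
qed

lemma W1_eqs: "H0 W1 = - V W1 - Wm"
  "\<And>\<alpha>. W1 (Ray \<alpha> 0) = bracket (init_fun 1 \<alpha>) u - bracket (init_fun 1 \<alpha>) (V W0)
    - bracket (init_fun 0 \<alpha>) (V W1) - bracket (init_fun 2 \<alpha>) (V Wm)"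
proof -
  note c = conv_W1
  have s: "V Wm \<in> lone (real (Suc 2))" "V W0 \<in> lone (real (Suc 1))"
    using beta6 by (auto intro!: V_W_lone)
  show "H0 W1 = - V W1 - Wm"
  proof
    fix x
    have "H0 W1 x + Wm x = - V W1 x"
    proof (rule lim_unique)
      show "((\<lambda>\<theta>. H0 (y1 \<theta>) x + (g \<theta> *\<^sub>C w \<theta>) x) \<longlongrightarrow> H0 W1 x + Wm x) (at_right 0)"
        by (intro tendsto_add conv_H0[OF c] conv_pointwise[OF conv_Wm])
      show "((\<lambda>\<theta>. - V (y1 \<theta>) x) \<longlongrightarrow> - V W1 x) (at_right 0)"
        by (intro tendsto_minus conv_V_pointwise[OF c])
      show "\<forall>\<^sub>F \<theta> in at_right 0. H0 (y1 \<theta>) x + (g \<theta> *\<^sub>C w \<theta>) x = - V (y1 \<theta>) x"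
        using w_identities_1
      proof eventually_elim
        case (elim \<theta>)
        then have "H0 (y1 \<theta>) + g \<theta> *\<^sub>C w \<theta> = - V (y1 \<theta>)" by blast
        from fun_cong[OF this, of x] show ?case by (simp only: plus_fun_apply uminus_apply)
      qed
    qed
    then show "H0 W1 x = (- V W1 - Wm) x" by (simp add: eq_diff_eq)
  qed
  show "W1 (Ray \<alpha> 0) = bracket (init_fun 1 \<alpha>) u - bracket (init_fun 1 \<alpha>) (V W0)
    - bracket (init_fun 0 \<alpha>) (V W1) - bracket (init_fun 2 \<alpha>) (V Wm)" for \<alpha>
  proof (rule lim_unique)
    show "((\<lambda>\<theta>. y1 \<theta> (Ray \<alpha> 0)) \<longlongrightarrow> W1 (Ray \<alpha> 0)) (at_right 0)" by (rule conv_pointwise[OF c])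
    show "((\<lambda>\<theta>. bracket (ray_rem_fun 1 \<theta> \<alpha>) u - bracket (ray_rem_fun 1 \<theta> \<alpha>) (V W0)
        - bracket (ray_rem_fun 0 \<theta> \<alpha>) (V (y1 \<theta>)) - bracket (ray_rem_fun 2 \<theta> \<alpha>) (V Wm))
        \<longlongrightarrow> bracket (init_fun 1 \<alpha>) u - bracket (init_fun 1 \<alpha>) (V W0)
          - bracket (init_fun 0 \<alpha>) (V W1) - bracket (init_fun 2 \<alpha>) (V Wm)) (at_right 0)"
      by (intro tendsto_diff u_rem ray_rem_V_tendsto[OF _ c] ray_rem_tendsto s) simp_all
    show "\<forall>\<^sub>F \<theta> in at_right 0. y1 \<theta> (Ray \<alpha> 0) = bracket (ray_rem_fun 1 \<theta> \<alpha>) u - bracket (ray_rem_fun 1 \<theta> \<alpha>) (V W0)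
        - bracket (ray_rem_fun 0 \<theta> \<alpha>) (V (y1 \<theta>)) - bracket (ray_rem_fun 2 \<theta> \<alpha>) (V Wm)"
      using w_identities_1 by eventually_elim blast
  qed
qed

lemma W1_orth: "\<Phi> \<in> Ebd \<Longrightarrow> bracket \<Phi> W1 = 0"
proof -
  assume \<Phi>: "\<Phi> \<in> Ebd"
  have "\<forall>\<^sub>F \<theta> in at_right 0. bracket \<Phi> (y1 \<theta>) = 0"
    using w_orth[OF \<Phi>] w_identities
  proof eventually_elim
    case (elim \<theta>)
    have p: "pairable \<Phi> (w \<theta>)" using elim lone_imp_ltwo[OF Ebd_lone[OF \<Phi>]] beta6 by (intro pairable_ltwo) auto
    have p': "pairable \<Phi> ((1 / g \<theta>) *\<^sub>C Wm)" "pairable \<Phi> W0"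
      by (intro pairable_lone_linf[OF Ebd_lone[OF \<Phi>]] linf_scale Wm W0)+
    show ?case using elim(1) p p'
      by (simp add: bracket_diff_right pairable_diff_right bracket_scale_right Wm_orth[OF \<Phi>] W0_orth[OF \<Phi>])
  qed
  from conv_orth[OF conv_W1 this \<Phi>] show ?thesis .
qed

lemma W1_eq: "W1 = G1 (u - V W0) - G2 (V Wm) - G0 (V W1)"
proof (rule free_op_unique[OF graph])
  have l: "u - V W0 \<in> lone 1" "V Wm \<in> lone 2" "V W1 \<in> lone 0"
    using beta6 by (auto intro!: lone_diff u_lone V_W_lone V_lone' W1_linf)
  show "H0 W1 = H0 (G1 (u - V W0) - G2 (V Wm) - G0 (V W1))"
    by (simp add: free_op_diff free_op_free_coeff_0[OF graph l(3)] free_op_free_coeff_1[OF graph l(1)]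
        free_op_free_coeff_2[OF graph l(2)] W1_eqs(1) res_eq[OF Wm_res] del: One_nat_def)
  show "W1 (Ray \<alpha> 0) = (G1 (u - V W0) - G2 (V Wm) - G0 (V W1)) (Ray \<alpha> 0)" for \<alpha>
    unfolding W1_eqs(2) by (simp add: free_coeff_init init_bracket_diff del: free_coeff.simps One_nat_def)
qed

text \<open>The limit involves the pairing of the decaying part with \<open>W0\<close>, which is
  replaced by its equation \<open>W0_eq\<close>; Green's identities for \<open>G1\<close>,
  \<open>G2\<close> and \<open>G3\<close> then eliminate the decaying part.\<close>

lemma W1_solvability:
  assumes \<Psi>: "\<Psi> \<in> Eres"
  shows "bracket (V \<Psi>) (G2 (u - V W0)) = bracket (V \<Psi>) (G1 (V W1)) + bracket (V \<Psi>) (G3 (V Wm))"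
proof -
  let ?d = "decaying_part (V \<Psi>)" and ?c = "res_coeff (V \<Psi>)"
  note c = conv_W1
  have s: "V Wm \<in> lone (real (Suc 3))" "V Wm \<in> lone 3" "u - V W0 \<in> lone 2" "V W0 \<in> lone (real (Suc 2))" "V W1 \<in> lone 1"
    "u - V W0 \<in> lone 0" "V Wm \<in> lone 1"
    using beta7 by (auto intro!: V_W_lone lone_diff u_lone V_lone' W1_linf)
  have "bracket ?d W0 = (\<Sum>\<alpha>\<in>UNIV. cnj (?c \<alpha>) * (bracket (init_fun 2 \<alpha>) u - bracket (init_fun 2 \<alpha>) (V W0)
      - bracket (init_fun 1 \<alpha>) (V W1) - bracket (init_fun 3 \<alpha>) (V Wm)))"
  proof (rule lim_unique)
    show "((\<lambda>\<theta>. bracket ?d (y0 \<theta>)) \<longlongrightarrow> bracket ?d W0) (at_right 0)"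
      by (rule conv_bracket[OF conv_W0 decaying_part_V_lone[OF \<Psi>]])
    show "((\<lambda>\<theta>. \<Sum>\<alpha>\<in>UNIV. cnj (?c \<alpha>) * (bracket (ray_rem_fun 2 \<theta> \<alpha>) u - bracket (ray_rem_fun 2 \<theta> \<alpha>) (V W0)
          - bracket (ray_rem_fun 1 \<theta> \<alpha>) (V (y1 \<theta>)) - bracket (ray_rem_fun 3 \<theta> \<alpha>) (V Wm)))
        \<longlongrightarrow> (\<Sum>\<alpha>\<in>UNIV. cnj (?c \<alpha>) * (bracket (init_fun 2 \<alpha>) u - bracket (init_fun 2 \<alpha>) (V W0)
          - bracket (init_fun 1 \<alpha>) (V W1) - bracket (init_fun 3 \<alpha>) (V Wm)))) (at_right 0)"
      by (intro tendsto_sum tendsto_mult tendsto_const tendsto_diff u_rem ray_rem_V_tendsto[OF _ c] ray_rem_tendsto s) simp_all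
    show "\<forall>\<^sub>F \<theta> in at_right 0. bracket ?d (y0 \<theta>) = (\<Sum>\<alpha>\<in>UNIV. cnj (?c \<alpha>) * (bracket (ray_rem_fun 2 \<theta> \<alpha>) u - bracket (ray_rem_fun 2 \<theta> \<alpha>) (V W0)
          - bracket (ray_rem_fun 1 \<theta> \<alpha>) (V (y1 \<theta>)) - bracket (ray_rem_fun 3 \<theta> \<alpha>) (V Wm)))"
      using w_identities_1 by eventually_elim (use \<Psi> in blast)
  qed
  moreover have "bracket ?d W0 = bracket ?d (G0 (u - V W0)) - bracket ?d (G1 (V Wm))"
    by (subst W0_eq, rule bracket_diff_right)
      (intro pairable_lone_linf[OF decaying_part_V_lone[OF \<Psi>]] free_coeff_linf_sb beta6; use s in simp)+
  ultimately show ?thesis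
    unfolding green_G2[OF beta6 \<Psi> s(3)] green_G3[OF beta6 \<Psi> s(2)] green_G1[OF beta6 \<Psi> s(5)]
    by (simp add: init_bracket_diff right_diff_distrib sum_subtractf del: One_nat_def) algebra
qed

end


declare One_nat_def [simp del]

context factorized_potential
begin

section \<open>Existence and uniqueness for the threshold equation\<close>

subsection \<open>Solutions of the threshold equation\<close>

lemma res_coeff_add: "pairable (nvec \<alpha>) a \<Longrightarrow> pairable (nvec \<alpha>) b \<Longrightarrow> res_coeff (a + b) \<alpha> = res_coeff a \<alpha> + res_coeff b \<alpha>"
  by (simp add: res_coeff_def bracket_add_right)

lemma nvec_pairable: "a \<in> lone 1 \<Longrightarrow> pairable (nvec \<alpha>) a"
  by (rule pairable_linf_lone[OF nvec_linf]) simp_all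

lemma bracket_nvec: "bracket a (nvec \<alpha>) = cnj (res_coeff a \<alpha>)"
  unfolding res_coeff_def by (rule bracket_commute)

lemma bracket_nsum:
  assumes "a \<in> lone 1"
  shows "bracket a (\<Sum>\<alpha>\<in>UNIV. d \<alpha> *\<^sub>C nvec \<alpha>) = (\<Sum>\<alpha>\<in>UNIV. cnj (res_coeff a \<alpha>) * d \<alpha>)"
  using pairable_scale_right[OF pairable_sym[OF nvec_pairable[OF assms]]]
  by (simp add: bracket_sum_right bracket_scale_right bracket_nvec mult.commute)

lemma G1_eq: "G1 f = - (\<Sum>\<alpha>\<in>UNIV. res_coeff f \<alpha> *\<^sub>C nvec \<alpha>)"
  unfolding res_coeff_def by (rule free_coeff_1)

text \<open>By finite rank the pairing is minus the hermitian product of the vectors of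
  \<open>res_coeff\<close>. With \<open>f = a\<close> it vanishes only if all
  \<open>res_coeff\<close> of \<open>a\<close> do, which is the definiteness behind the uniqueness
  arguments.\<close>

lemma bracket_G1:
  assumes "a \<in> lone 1"
  shows "bracket a (G1 f) = - (\<Sum>\<alpha>\<in>UNIV. cnj (res_coeff a \<alpha>) * res_coeff f \<alpha>)"
  by (simp add: G1_eq bracket_minus_right bracket_nsum[OF assms])

lemma G1_linf: "1 \<le> s \<Longrightarrow> G1 f \<in> linf (- s)"
  unfolding G1_eq by (intro linf_minus nsum_linf)

lemma v_lone1: "v k \<in> lone 1"
  using beta by (intro v_lone') simp

lemma v_pairable: "a \<in> linf (- real \<beta>) \<Longrightarrow> pairable (v k) a"
  by (rule pairable_lone_linf[OF v_lone])

lemma KB_G1: "k \<in> KB \<Longrightarrow> bracket (v k) (G1 f) = 0"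
  by (simp add: bracket_G1[OF v_lone1] KB_def)

lemma KB_bound: "k \<in> KB \<Longrightarrow> res_of k \<in> Ebd"
  unfolding bound_eigenspace_iff using res_of_res[of k] V_res_of[of k] by (simp add: KB_def)

lemma bracket_V_G0: "\<Psi> \<in> Eres \<Longrightarrow> f \<in> lone 1 \<Longrightarrow> bracket (V \<Psi>) (G0 f) = - bracket \<Psi> f"
  by (simp add: bracket_G0[OF V_lone[OF res_linf]] res_eq bracket_minus_left)

lemma bracket_v_G0: "k \<in> Ker M \<Longrightarrow> f \<in> lone 1 \<Longrightarrow> bracket (v k) (G0 f) = - bracket (res_of k) f"
  using bracket_V_G0[OF res_of_res] by (simp add: V_res_of)

lemma bound_res: "\<Phi> \<in> Ebd \<Longrightarrow> \<Phi> \<in> Eres"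
  by (simp add: bound_eigenspace_iff)

lemma bound_res_coeff: "\<Phi> \<in> Ebd \<Longrightarrow> res_coeff (V \<Phi>) \<alpha> = 0"
  by (simp add: bound_eigenspace_iff)

lemma bound_linf: "\<Phi> \<in> Ebd \<Longrightarrow> \<Phi> \<in> linf (- real \<beta>)"
  by (rule res_linf[OF bound_res])

lemma bound_scale: "\<Phi> \<in> Ebd \<Longrightarrow> c *\<^sub>C \<Phi> \<in> Ebd"
  unfolding bound_eigenspace_iff by (auto simp: res_scale V_scale res_linf res_coeff_def bracket_scale_right)

lemma bound_add: "\<Phi> \<in> Ebd \<Longrightarrow> \<Phi>' \<in> Ebd \<Longrightarrow> \<Phi> + \<Phi>' \<in> Ebd"
  unfolding bound_eigenspace_iff
  by (auto simp: res_add V_add res_linf res_coeff_add nvec_pairable V_lone1)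

lemma bound_zero_mem: "0 \<in> Ebd"
  unfolding bound_eigenspace_iff by (simp add: res_coeff_def)

lemma bound_sum: "(\<And>i. i \<in> I \<Longrightarrow> f i \<in> Ebd) \<Longrightarrow> (\<Sum>i\<in>I. f i) \<in> Ebd"
  by (induction I rule: infinite_finite_induct) (simp_all add: bound_zero_mem bound_add)

lemma bound_minus: "\<Phi> \<in> Ebd \<Longrightarrow> - \<Phi> \<in> Ebd"
  using bound_scale[of \<Phi> "-1"] by (simp add: scaleC_fun_minus_one)

lemma bound_diff: "\<Phi> \<in> Ebd \<Longrightarrow> \<Phi>' \<in> Ebd \<Longrightarrow> \<Phi> - \<Phi>' \<in> Ebd"
  using bound_add[of \<Phi> "- \<Phi>'"] bound_minus[of \<Phi>'] by simp

lemma bound_pairable: "\<Phi> \<in> Ebd \<Longrightarrow> a \<in> linf (- sb) \<Longrightarrow> pairable \<Phi> a"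
  by (rule pairable_lone_linf[OF Ebd_lone])

lemma init_fun_2_free_op: "H0 (init_fun 2 \<alpha>) = - onevec \<alpha>"
proof
  have i: "init_fun 2 \<alpha> = (rayfun \<alpha> (\<lambda>l. complex_of_real ((real (Suc l))\<^sup>2 / 2)) :: ('a, 'n) gfun)"
    unfolding init_fun_def ray_kernel_fun_def by (rule arg_cong[where f="rayfun \<alpha>"]) (simp add: ray_kernel_init)
  fix x show "H0 (init_fun 2 \<alpha>) x = (- onevec \<alpha>) x"
  proof (cases x)
    case (Core y)
    then show ?thesis by (simp add: i core_op_def)
  next
    case (Ray \<gamma> k)
    then show ?thesis unfolding i by (cases k) (auto simp: power2_eq_square field_simps)
  qed
qed

text \<open>For a bound state the free resolvent satisfies R0(kappa) V \<Phi> = - \<Phi> + kappa^2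
  R0(kappa) \<Phi>; this is its coefficient of kappa^2. The proof compares images under
  \<open>H0\<close> and values next to the core, the latter through the quadratic function
  \<open>init_fun 2 \<alpha>\<close>.\<close>

lemma G2_V_bound:
  assumes \<Phi>: "\<Phi> \<in> Ebd"
  shows "G2 (V \<Phi>) = G0 \<Phi>"
proof (rule free_op_unique[OF graph])
  have \<Phi>l: "\<Phi> \<in> lone 0" "\<Phi> \<in> lone 2" using beta by (auto intro!: lone_mono[OF Ebd_lone[OF \<Phi>]])
  have V2: "V \<Phi> \<in> lone 2" using beta by (intro V_lone' bound_linf \<Phi>) simp
  show "H0 (G2 (V \<Phi>)) = H0 (G0 \<Phi>)"
    by (simp add: free_op_free_coeff_2[OF graph V2] free_op_free_coeff_0[OF graph \<Phi>l(1)] res_eq[OF bound_res[OF \<Phi>]])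
  fix \<alpha> :: 'n
  have p2: "init_fun 2 \<alpha> \<in> linf (- 2)"
    unfolding init_fun_def using linfI[OF ray_kernel_fun_bound[of 2 \<alpha> 0]] by (simp add: One_nat_def)
  have "H0 \<Phi> = H0 (- G0 (V \<Phi>))" using res_eq[OF bound_res[OF \<Phi>]] by simp
  also have "\<dots> = - V \<Phi>"
    using free_op_free_coeff_0[OF graph V_lone'[OF bound_linf[OF \<Phi>]]] by (simp add: free_op_minus)
  finally have H0: "V \<Phi> = - H0 \<Phi>" by simp
  have "bracket (V \<Phi>) (init_fun 2 \<alpha>) = - bracket (H0 \<Phi>) (init_fun 2 \<alpha>)" by (simp add: H0 bracket_minus_left)
  also have "bracket (H0 \<Phi>) (init_fun 2 \<alpha>) = bracket \<Phi> (H0 (init_fun 2 \<alpha>))"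
    by (rule free_op_symmetric_lone[OF \<Phi>l(2) p2]) simp
  also have "- \<dots> = bracket \<Phi> (onevec \<alpha>)" by (simp add: init_fun_2_free_op bracket_minus_right)
  finally have "bracket (init_fun 2 \<alpha>) (V \<Phi>) = bracket (onevec \<alpha>) \<Phi>"
    by (metis bracket_commute)
  then show "G2 (V \<Phi>) (Ray \<alpha> 0) = G0 \<Phi> (Ray \<alpha> 0)" by (simp add: free_coeff_init init_fun_0 del: free_coeff.simps)
qed

lemma bracket_V_G2_bound:
  assumes b6: "6 \<le> \<beta>" and \<Phi>: "\<Phi> \<in> Ebd" and f: "f \<in> lone 2"
  shows "bracket (V \<Phi>) (G2 f) = bracket \<Phi> (G0 f)"
proof -
  have "\<Phi> = - decaying_part (V \<Phi>)" using res_decomp[OF bound_res[OF \<Phi>]] bound_res_coeff[OF \<Phi>] by simp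
  then have d: "decaying_part (V \<Phi>) = - \<Phi>" by (metis minus_minus)
  show ?thesis unfolding green_G2[OF b6 bound_res[OF \<Phi>] f] d using bound_res_coeff[OF \<Phi>] by (simp add: bracket_minus_left)
qed

lemma Ker_test:
  assumes k: "k \<in> Ker M" and a: "a \<in> linf (- real \<beta>)" and b: "b \<in> linf (- real \<beta>)"
    and F: "\<And>k. k \<in> KF \<Longrightarrow> bracket (v k) a = bracket (v k) b"
    and B: "\<And>k. k \<in> KB \<Longrightarrow> bracket (v k) a = bracket (v k) b"
  shows "bracket (v k) a = bracket (v k) b"
proof -
  obtain kb kf where k': "kb \<in> KB" "kf \<in> KF" "k = kb + kf" using Ker_M_decomp[OF k] by blast
  have p: "pairable (v k) a" "pairable (v k) b" for k by (auto intro: v_pairable a b)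
  show ?thesis unfolding k'(3) v_add
    by (simp add: bracket_add_left p F[OF k'(2)] B[OF k'(1)])
qed

text \<open>The difference lies in \<open>KF\<close>; tested with itself it has no
  \<open>res_coeff\<close>, so it lies in \<open>KB\<close> as well.\<close>

lemma KF_unique:
  assumes "x \<in> KF" "y \<in> KF" and eq: "\<And>k. k \<in> KF \<Longrightarrow> bracket (v k) (G1 (v x)) = bracket (v k) (G1 (v y))"
  shows "x = y"
proof -
  have d: "x - y \<in> KF" by (rule closed_csubspace_diff[OF closed_csubspace_KF assms(1,2)])
  have "(\<Sum>\<alpha>\<in>UNIV. cnj (res_coeff (v (x - y)) \<alpha>) * res_coeff (v x) \<alpha>)
      = (\<Sum>\<alpha>\<in>UNIV. cnj (res_coeff (v (x - y)) \<alpha>) * res_coeff (v y) \<alpha>)"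
    using eq[OF d] by (simp add: bracket_G1[OF v_lone1])
  then have "(\<Sum>\<alpha>\<in>UNIV. cnj (res_coeff (v (x - y)) \<alpha>) * res_coeff (v (x - y)) \<alpha>) = 0"
    by (simp add: res_coeff_v_diff[of x y] right_diff_distrib sum_subtractf)
  then have "res_coeff (v (x - y)) \<alpha> = 0" for \<alpha> by (rule res_coeff_sq_zero)
  then have "x - y \<in> KB" using KF_Ker[OF d] by (simp add: KB_def)
  then have "x - y = 0" using KB_KF_zero d by blast
  then show ?thesis by simp
qed

text \<open>With \<open>k = Md (va f)\<close> the equation \<open>M k = va f\<close> reads
  \<open>va X = U k\<close>, and \<open>V = v \<circ> U \<circ> va\<close> gives
  \<open>V X = v k\<close>. Hence \<open>X + G0 (V X) = f\<close>. The orthogonality assumption says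
  that \<open>va f\<close> is orthogonal to \<open>Ker M\<close>, that is, in the range of
  \<open>M\<close>.\<close>

lemma Md_solution:
  assumes f: "f \<in> linf (- real \<beta>)" and orth: "\<And>k. k \<in> Ker M \<Longrightarrow> bracket (v k) f = 0"
  defines "X \<equiv> f - G0 (v (Md (va f)))"
  shows "V X = v (Md (va f))" "X \<in> linf (- real \<beta>)"
proof -
  have "va f \<in> orth_compl (Ker M)" using orth by (simp add: orth_compl_def adj_cinner[OF f])
  from Md_spec[OF this] have M: "U (Md (va f)) + va (G0 (v (Md (va f)))) = va f" by (simp add: M_eq)
  show X: "X \<in> linf (- real \<beta>)" unfolding X_def by (intro linf_diff f G0_v_linf)
  have "va X = va f - va (G0 (v (Md (va f))))" unfolding X_def by (rule adj_diff[OF f G0_v_linf(2)])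
  also have "\<dots> = U (Md (va f))" using M by (metis add_diff_cancel_right')
  finally show "V X = v (Md (va f))" by (simp add: V_linf[OF X])
qed

text \<open>\<open>D\<close> is its own test function, being a resonance function orthogonal to the
  bound states, and the test removes its constants. The test class is restricted in this way because
  \<open>Pr_bracket\<close> evaluates resonance projections against such functions.\<close>

lemma threshold_unique:
  assumes D: "D \<in> linf (- real \<beta>)" "D = - G0 (V D)"
    and solv: "\<And>\<Psi>. \<Psi> \<in> Eres \<Longrightarrow> (\<And>\<Phi>. \<Phi> \<in> Ebd \<Longrightarrow> bracket \<Phi> \<Psi> = 0) \<Longrightarrow> bracket (V \<Psi>) (G1 (V D)) = 0"
    and orth: "\<And>\<Phi>. \<Phi> \<in> Ebd \<Longrightarrow> bracket \<Phi> D = 0"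
  shows "D = 0"
proof -
  have r: "D \<in> Eres" using D by (simp add: res_eigenspace_iff[of D])
  have "(\<Sum>\<alpha>\<in>UNIV. cnj (res_coeff (V D) \<alpha>) * res_coeff (V D) \<alpha>) = 0"
    using solv[OF r orth] by (simp add: bracket_G1[OF V_lone1[OF D(1)]])
  then have "res_coeff (V D) \<alpha> = 0" for \<alpha> by (rule res_coeff_sq_zero)
  then have b: "D \<in> Ebd" using r by (simp add: bound_eigenspace_iff)
  show ?thesis by (rule bound_zero[OF b orth[OF b]])
qed

lemma V_G0_v: "y \<in> Ker M \<Longrightarrow> V (G0 (v y)) = - v y"
proof -
  assume y: "y \<in> Ker M"
  have "V (- G0 (v y)) = v y" using V_res_of[OF y] by (simp only: res_of_def)
  then show ?thesis unfolding V_minus[OF G0_v_linf(2)] by (metis minus_minus)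
qed

lemma bracket_v_add: "a \<in> linf (- real \<beta>) \<Longrightarrow> b \<in> linf (- real \<beta>) \<Longrightarrow> bracket (v k) (a + b) = bracket (v k) a + bracket (v k) b"
  by (intro bracket_add_right v_pairable)

lemma bracket_v_diff: "a \<in> linf (- real \<beta>) \<Longrightarrow> b \<in> linf (- real \<beta>) \<Longrightarrow> bracket (v k) (a - b) = bracket (v k) a - bracket (v k) b"
  by (intro bracket_diff_right v_pairable)

lemma G1_linf_beta: "G1 f \<in> linf (- real \<beta>)"
  by (rule G1_linf) (use beta in simp)

lemma G1_linf_sb: "G1 f \<in> linf (- sb)"
  by (rule G1_linf) (use beta in simp)

lemma bracket_G1_v_add: "bracket (v k) (G1 (v (x + y))) = bracket (v k) (G1 (v x)) + bracket (v k) (G1 (v y))"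
  by (simp add: bracket_G1[OF v_lone1] res_coeff_v_add distrib_left sum.distrib)

lemma bracket_G1_v_diff: "bracket (v k) (G1 (v (x - y))) = bracket (v k) (G1 (v x)) - bracket (v k) (G1 (v y))"
  by (simp add: bracket_G1[OF v_lone1] res_coeff_v_diff right_diff_distrib sum_subtractf)

lemma G1_diff: "f \<in> lone 1 \<Longrightarrow> h \<in> lone 1 \<Longrightarrow> G1 (f - h) = G1 f - G1 h"
  by (rule free_coeff_diff[OF graph]) simp_all

lemma G1_V_diff: "X \<in> linf (- real \<beta>) \<Longrightarrow> Y \<in> linf (- real \<beta>) \<Longrightarrow> G1 (V (X - Y)) = G1 (V X) - G1 (V Y)"
  by (simp only: V_diff G1_diff V_lone1)

lemma V_lone0: "X \<in> linf (- real \<beta>) \<Longrightarrow> V X \<in> lone 0"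
  by (rule V_lone') simp_all

lemma G0_V_diff: "X \<in> linf (- real \<beta>) \<Longrightarrow> Y \<in> linf (- real \<beta>) \<Longrightarrow> G0 (V (X - Y)) = G0 (V X) - G0 (V Y)"
  by (simp only: V_diff) (rule free_coeff_diff[OF graph], simp_all add: V_lone0)

lemma G0_v_add: "G0 (v (x + y)) = G0 (v x) + G0 (v y)"
  unfolding v_add by (rule free_coeff_add[OF graph]) (simp_all add: v_lone')

lemma G0_v_diff: "G0 (v (x - y)) = G0 (v x) - G0 (v y)"
  unfolding v_diff by (rule free_coeff_diff[OF graph]) (simp_all add: v_lone')

lemma bound_bracket_zero: "X \<in> Ebd \<Longrightarrow> (\<And>Y. Y \<in> Ebd \<Longrightarrow> bracket Y Z = 0) \<Longrightarrow> bracket Z X = 0"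
  by (metis bracket_commute complex_cnj_zero)

lemma Ker_zero:
  assumes k: "k \<in> Ker M" and a: "a \<in> linf (- real \<beta>)"
    and F: "\<And>k. k \<in> KF \<Longrightarrow> bracket (v k) a = 0" and B: "\<And>k. k \<in> KB \<Longrightarrow> bracket (v k) a = 0"
  shows "bracket (v k) a = 0"
  using Ker_test[OF k a linf_zero] F B by simp

end

section \<open>Basis projections, the complementary system and the solution operator\<close>

locale resonance_data = factorized_potential E0 att V v U \<beta>
  for E0 :: "'a::finite set set" and att :: "'n::finite \<Rightarrow> 'a"
    and V :: "('a, 'n) gop" and v :: "'k::complex_hilbert \<Rightarrow> ('a, 'n) gfun" and U \<beta> +
  fixes L :: "'l set" and \<Phi> :: "'l \<Rightarrow> ('a, 'n) gfun" and I :: "'i set" and \<Psi> :: "'i \<Rightarrow> ('a, 'n) gfun"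
    and J :: "'j set" and c' :: "'j \<Rightarrow> 'n \<Rightarrow> complex"
  assumes bb: "bound_basis \<beta> H L \<Phi>"
    and rb: "resonance_basis \<beta> H I \<Psi>"
    and ob: "orthonormal_basis (I <+> J) (case_sum (\<lambda>\<gamma> \<alpha>. - bracket (nvec \<alpha>) (V (\<Psi> \<gamma>))) c')"
begin

abbreviation "Pb \<equiv> basis_projection L \<Phi>"
abbreviation "Pr \<equiv> basis_projection I \<Psi>"

lemma basis_projection_apply: "basis_projection K X u = (\<Sum>i\<in>K. bracket (X i) u *\<^sub>C X i)"
  by (simp add: basis_projection_def sum_fun_apply ketbra_def)

lemma \<Phi>_bound: "l \<in> L \<Longrightarrow> \<Phi> l \<in> Ebd"
  and finite_L: "finite L"
  and \<Phi>_span: "X \<in> Ebd \<Longrightarrow> \<exists>a. X = (\<Sum>l\<in>L. a l *\<^sub>C \<Phi> l)"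
  and \<Phi>_on: "l \<in> L \<Longrightarrow> m \<in> L \<Longrightarrow> bracket (\<Phi> l) (\<Phi> m) = (if l = m then 1 else 0)"
  using bb by (auto simp: bound_basis_def quotient_basis_def)

lemma Pb_bound: "Pb u \<in> Ebd"
  unfolding basis_projection_apply by (intro bound_sum bound_scale \<Phi>_bound)

lemma bound_linf_sb: "X \<in> Ebd \<Longrightarrow> X \<in> linf (- sb)"
  by (rule lone_imp_linf'[OF Ebd_lone]) (use beta in auto)

lemma Pb_orth:
  assumes X: "X \<in> Ebd" and u: "u \<in> linf (- sb)"
  shows "bracket X (u - Pb u) = 0"
proof -
  have l: "bracket (\<Phi> l) (u - Pb u) = 0" if "l \<in> L" for l
  proof -
    have p: "pairable (\<Phi> l) (bracket (\<Phi> m) u *\<^sub>C \<Phi> m)" if "m \<in> L" for m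
      using \<open>l \<in> L\<close> that by (intro bound_pairable linf_scale bound_linf_sb \<Phi>_bound)
    have "bracket (\<Phi> l) (Pb u) = (\<Sum>m\<in>L. bracket (\<Phi> m) u * (if l = m then 1 else 0))"
      unfolding basis_projection_apply using that
      by (subst bracket_sum_right[OF p]) (auto simp: bracket_scale_right \<Phi>_on intro!: sum.cong)
    also have "\<dots> = bracket (\<Phi> l) u" using that finite_L by (simp add: if_distrib cong: if_cong)
    finally show ?thesis
      by (subst bracket_diff_right) (auto intro!: bound_pairable \<Phi>_bound that u bound_linf_sb Pb_bound)
  qed
  obtain a where a: "X = (\<Sum>l\<in>L. a l *\<^sub>C \<Phi> l)" using \<Phi>_span[OF X] by blast
  have "pairable (a l *\<^sub>C \<Phi> l) (u - Pb u)" if "l \<in> L" for l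
    using that by (intro bound_pairable bound_scale \<Phi>_bound linf_diff u bound_linf_sb Pb_bound)
  then show ?thesis unfolding a by (simp add: bracket_sum_left bracket_scale_left l)
qed

lemma \<Psi>_res: "i \<in> I \<Longrightarrow> \<Psi> i \<in> Eres"
  and finite_I: "finite I"
  and \<Psi>_span: "X \<in> Eres \<Longrightarrow> \<exists>a. X - (\<Sum>i\<in>I. a i *\<^sub>C \<Psi> i) \<in> Ebd"
  and \<Psi>_orth: "i \<in> I \<Longrightarrow> X \<in> Ebd \<Longrightarrow> bracket X (\<Psi> i) = 0"
  using rb by (auto simp: resonance_basis_def quotient_basis_def orthogonal_to_def)

lemma finite_J: "finite J"
  using ob by (auto simp: orthonormal_basis_def)

lemma orthonormal:
  shows "i \<in> I \<Longrightarrow> i' \<in> I \<Longrightarrow>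
      (\<Sum>\<alpha>\<in>UNIV. cnj (res_coeff (V (\<Psi> i)) \<alpha>) * res_coeff (V (\<Psi> i')) \<alpha>) = (if i = i' then 1 else 0)"
    and "i \<in> I \<Longrightarrow> j \<in> J \<Longrightarrow> (\<Sum>\<alpha>\<in>UNIV. cnj (res_coeff (V (\<Psi> i)) \<alpha>) * c' j \<alpha>) = 0"
    and "j \<in> J \<Longrightarrow> j' \<in> J \<Longrightarrow> (\<Sum>\<alpha>\<in>UNIV. cnj (c' j \<alpha>) * c' j' \<alpha>) = (if j = j' then 1 else 0)"
proof -
  let ?c = "case_sum (\<lambda>\<gamma> \<alpha>. - bracket (nvec \<alpha>) (V (\<Psi> \<gamma>))) c'"
  have *: "x \<in> I <+> J \<Longrightarrow> y \<in> I <+> J \<Longrightarrow> (\<Sum>\<alpha>\<in>UNIV. cnj (?c x \<alpha>) * ?c y \<alpha>) = (if x = y then 1 else 0)" for x y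
    using ob by (auto simp: orthonormal_basis_def orthonormal_system_def)
  show "i \<in> I \<Longrightarrow> i' \<in> I \<Longrightarrow>
      (\<Sum>\<alpha>\<in>UNIV. cnj (res_coeff (V (\<Psi> i)) \<alpha>) * res_coeff (V (\<Psi> i')) \<alpha>) = (if i = i' then 1 else 0)"
    using *[OF InlI InlI, of i i'] by (simp add: res_coeff_def)
  show "i \<in> I \<Longrightarrow> j \<in> J \<Longrightarrow> (\<Sum>\<alpha>\<in>UNIV. cnj (res_coeff (V (\<Psi> i)) \<alpha>) * c' j \<alpha>) = 0"
    using *[OF InlI InrI, of i j] by (simp add: res_coeff_def sum_negf)
  show "j \<in> J \<Longrightarrow> j' \<in> J \<Longrightarrow> (\<Sum>\<alpha>\<in>UNIV. cnj (c' j \<alpha>) * c' j' \<alpha>) = (if j = j' then 1 else 0)"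
    using *[OF InrI InrI, of j j'] by simp
qed

text \<open>Orthogonality to the constants of all resonance functions removes that half of the
  orthonormal basis, so only the complementary system \<open>c'\<close> remains.\<close>

lemma complement_expansion:
  assumes d: "\<And>i. i \<in> I \<Longrightarrow> (\<Sum>\<alpha>\<in>UNIV. cnj (res_coeff (V (\<Psi> i)) \<alpha>) * d \<alpha>) = 0"
  shows "d \<alpha> = (\<Sum>j\<in>J. (\<Sum>\<gamma>\<in>UNIV. cnj (c' j \<gamma>) * d \<gamma>) * c' j \<alpha>)"
proof -
  let ?c = "case_sum (\<lambda>\<gamma> \<alpha>. - bracket (nvec \<alpha>) (V (\<Psi> \<gamma>))) c'"
  obtain a where a: "d = (\<Sum>x\<in>I <+> J. a x *\<^sub>C ?c x)" using ob by (auto simp: orthonormal_basis_def)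
  have fin: "finite (I <+> J)" using ob by (simp add: orthonormal_basis_def)
  have da: "d \<alpha> = (\<Sum>x\<in>I <+> J. a x * ?c x \<alpha>)" for \<alpha>
    using fun_cong[OF a, of \<alpha>] by (simp add: sum_fun_apply)
  have on: "x \<in> I <+> J \<Longrightarrow> y \<in> I <+> J \<Longrightarrow> (\<Sum>\<alpha>\<in>UNIV. cnj (?c x \<alpha>) * ?c y \<alpha>) = (if x = y then 1 else 0)" for x y
    using ob by (auto simp: orthonormal_basis_def orthonormal_system_def)
  have coef: "(\<Sum>\<alpha>\<in>UNIV. cnj (?c x \<alpha>) * d \<alpha>) = a x" if x: "x \<in> I <+> J" for x
  proof -
    have "(\<Sum>\<alpha>\<in>UNIV. cnj (?c x \<alpha>) * d \<alpha>) = (\<Sum>y\<in>I <+> J. a y * (\<Sum>\<alpha>\<in>UNIV. cnj (?c x \<alpha>) * ?c y \<alpha>))"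
      unfolding da sum_distrib_left by (subst sum.swap) (simp add: mult_ac)
    also have "\<dots> = (\<Sum>y\<in>I <+> J. if x = y then a y else 0)"
      using x by (intro sum.cong) (auto simp: on simp del: sum.case_distrib)
    also have "\<dots> = a x" using x by (simp only: sum.delta'[OF fin] if_True)
    finally show ?thesis .
  qed
  have "a (Inl i) = 0" if "i \<in> I" for i
    using coef[OF InlI[OF that]] d[OF that] by (simp add: res_coeff_def sum_negf)
  then have "d \<alpha> = (\<Sum>j\<in>J. a (Inr j) * c' j \<alpha>)"
    unfolding da by (simp add: sum.Plus finite_I finite_J)
  also have "\<dots> = (\<Sum>j\<in>J. (\<Sum>\<gamma>\<in>UNIV. cnj (c' j \<gamma>) * d \<gamma>) * c' j \<alpha>)"
  proof (rule sum.cong[OF refl])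
    fix j assume "j \<in> J"
    from coef[OF InrI[OF this]] show "a (Inr j) * c' j \<alpha> = (\<Sum>\<gamma>\<in>UNIV. cnj (c' j \<gamma>) * d \<gamma>) * c' j \<alpha>" by simp
  qed
  finally show ?thesis .
qed

lemma md_KF: "md y \<in> KF"
  and cinner_md: "k \<in> KF \<Longrightarrow> cinner k (mz (md y)) = cinner k y"
proof -
  have *: "i \<in> I \<Longrightarrow> i' \<in> I \<Longrightarrow>
    (\<Sum>\<alpha>\<in>UNIV. cnj (res_coeff (V (\<Psi> i)) \<alpha>) * res_coeff (V (\<Psi> i')) \<alpha>) = (if i = i' then 1 else 0)" for i i'
    by (rule orthonormal(1))
  show "md y \<in> KF" by (rule md_spec(1)[OF finite_I \<Psi>_res \<Psi>_span *])
  show "k \<in> KF \<Longrightarrow> cinner k (mz (md y)) = cinner k y" by (rule md_spec(2)[OF finite_I \<Psi>_res \<Psi>_span *])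
qed

text \<open>The form in which \<open>md\<close> is applied: on \<open>KF\<close>, the vector
  \<open>md (va f)\<close> reproduces the pairings of \<open>f\<close> under
  \<open>G1 \<circ> v\<close>. Subtracting it is how a right side is made orthogonal to
  \<open>Ker M\<close>.\<close>

lemma md_equation:
  assumes k: "k \<in> KF" and f: "f \<in> linf (- real \<beta>)"
  shows "bracket (v k) (G1 (v (md (va f)))) = bracket (v k) f"
  using cinner_md[OF k, of "va f"]
  by (simp add: cinner_mz[OF KF_Ker[OF k] KF_Ker[OF md_KF]] bracket_G1[OF v_lone1] adj_cinner[OF f])

lemma Eres_res_coeff:
  assumes X: "X \<in> Eres"
  shows "\<exists>a. \<forall>\<alpha>. res_coeff (V X) \<alpha> = (\<Sum>i\<in>I. a i * res_coeff (V (\<Psi> i)) \<alpha>)"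
proof -
  obtain a where a: "X - (\<Sum>i\<in>I. a i *\<^sub>C \<Psi> i) \<in> Ebd" using \<Psi>_span[OF X] by blast
  have l: "a i *\<^sub>C \<Psi> i \<in> linf (- real \<beta>)" if "i \<in> I" for i by (intro linf_scale res_linf \<Psi>_res that)
  have "V (\<Sum>i\<in>I. a i *\<^sub>C \<Psi> i) = (\<Sum>i\<in>I. a i *\<^sub>C V (\<Psi> i))"
    by (subst V_sum[OF l]) (auto simp: V_scale res_linf \<Psi>_res intro!: sum.cong)
  moreover have "V (X - (\<Sum>i\<in>I. a i *\<^sub>C \<Psi> i)) = V X - V (\<Sum>i\<in>I. a i *\<^sub>C \<Psi> i)"
    by (intro V_diff res_linf[OF X] linf_sum l)
  ultimately have "V X = V (X - (\<Sum>i\<in>I. a i *\<^sub>C \<Psi> i)) + (\<Sum>i\<in>I. a i *\<^sub>C V (\<Psi> i))" by simp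
  moreover have "res_coeff (V (X - (\<Sum>i\<in>I. a i *\<^sub>C \<Psi> i)) + (\<Sum>i\<in>I. a i *\<^sub>C V (\<Psi> i))) \<alpha>
      = (\<Sum>i\<in>I. a i * res_coeff (V (\<Psi> i)) \<alpha>)" for \<alpha>
  proof -
    have p: "pairable (nvec \<alpha>) (a i *\<^sub>C V (\<Psi> i))" if "i \<in> I" for i
      by (intro nvec_pairable lone_scale V_lone1 res_linf \<Psi>_res that)
    have "res_coeff (V (X - (\<Sum>i\<in>I. a i *\<^sub>C \<Psi> i)) + (\<Sum>i\<in>I. a i *\<^sub>C V (\<Psi> i))) \<alpha>
        = res_coeff (V (X - (\<Sum>i\<in>I. a i *\<^sub>C \<Psi> i))) \<alpha> + res_coeff (\<Sum>i\<in>I. a i *\<^sub>C V (\<Psi> i)) \<alpha>"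
      by (intro res_coeff_add nvec_pairable V_lone1 bound_linf a lone_sum lone_scale res_linf \<Psi>_res)
    then show ?thesis using bound_res_coeff[OF a] p by (simp add: res_coeff_def bracket_sum_right bracket_scale_right)
  qed
  ultimately have "res_coeff (V X) \<alpha> = (\<Sum>i\<in>I. a i * res_coeff (V (\<Psi> i)) \<alpha>)" for \<alpha> by simp
  then show ?thesis by blast
qed

lemma c'_orth:
  assumes X: "X \<in> Eres" and j: "j \<in> J"
  shows "(\<Sum>\<alpha>\<in>UNIV. cnj (res_coeff (V X) \<alpha>) * c' j \<alpha>) = 0"
proof -
  obtain a where a: "\<And>\<alpha>. res_coeff (V X) \<alpha> = (\<Sum>i\<in>I. a i * res_coeff (V (\<Psi> i)) \<alpha>)" using Eres_res_coeff[OF X] by blast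
  have "(\<Sum>\<alpha>\<in>UNIV. cnj (res_coeff (V X) \<alpha>) * c' j \<alpha>)
      = (\<Sum>i\<in>I. cnj (a i) * (\<Sum>\<alpha>\<in>UNIV. cnj (res_coeff (V (\<Psi> i)) \<alpha>) * c' j \<alpha>))"
    unfolding a cnj_sum complex_cnj_mult sum_distrib_right sum_distrib_left
    by (subst sum.swap) (simp add: mult_ac)
  then show ?thesis using orthonormal(2)[OF _ j] by simp
qed

text \<open>The solution operator that is common to all coefficients: \<open>f - G\<^sub>0 v k\<close> solves the threshold
  equation with right-hand side \<open>f\<close>, and the terms with \<open>y\<close> and the bound projection modify the
  solution by elements of the resonance space.\<close>

definition solve :: "('a, 'n) gfun \<Rightarrow> 'k \<Rightarrow> ('a, 'n) gfun"
  where "solve f y = f - G0 (v (Md (va f))) + G0 (v y)"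

lemma
  assumes f: "f \<in> linf (- sb)" and orth: "\<And>k. k \<in> Ker M \<Longrightarrow> bracket (v k) f = 0" and y: "y \<in> KF"
  shows solve_linf: "solve f y \<in> linf (- sb)" "solve f y - Pb (solve f y) \<in> linf (- sb)"
    and V_solve: "V (solve f y - Pb (solve f y)) = v (Md (va f)) - v y - V (Pb (solve f y))"
    and solve_eq: "solve f y - Pb (solve f y) + G0 (V (solve f y - Pb (solve f y))) = f"
    and solve_orth: "X \<in> Ebd \<Longrightarrow> bracket X (solve f y - Pb (solve f y)) = 0"
proof -
  let ?k = "Md (va f)"
  have s0: "0 \<le> sb" using beta by simp
  have gl: "G0 (v k) \<in> linf (- sb)" for k by (rule linf_mono[OF G0_v_linf(1) s0])
  show l: "solve f y \<in> linf (- sb)" unfolding solve_def by (intro linf_add linf_diff f gl)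
  show l': "solve f y - Pb (solve f y) \<in> linf (- sb)" by (intro linf_diff l bound_linf_sb Pb_bound)
  note fb = linf_sb[OF f]
  have V1: "V (f - G0 (v ?k)) = v ?k" and X: "f - G0 (v ?k) \<in> linf (- real \<beta>)" using Md_solution[OF fb orth] by auto
  have "V (- res_of y) = - v y" by (simp add: V_minus res_linf res_of_res KF_Ker[OF y] V_res_of)
  then have V2: "V (G0 (v y)) = - v y" by (simp add: res_of_def)
  have V3: "V (solve f y) = v ?k - v y"
    unfolding solve_def by (simp only: V_add[OF X G0_v_linf(2)] V1 V2) simp
  show V4: "V (solve f y - Pb (solve f y)) = v ?k - v y - V (Pb (solve f y))"
    using V_diff[OF linf_sb[OF l] bound_linf[OF Pb_bound]] V3 by simp
  have "G0 (v ?k - v y - V (Pb (solve f y))) = G0 (v ?k) - G0 (v y) - G0 (V (Pb (solve f y)))"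
    by (simp add: free_coeff_diff[OF graph] v_lone' V_lone' bound_linf Pb_bound lone_diff del: free_coeff.simps)
  moreover have "G0 (V (Pb (solve f y))) = - Pb (solve f y)" by (rule res_eq[OF bound_res[OF Pb_bound]])
  ultimately show "solve f y - Pb (solve f y) + G0 (V (solve f y - Pb (solve f y))) = f"
    unfolding V4 by (simp add: solve_def del: free_coeff.simps)
  show "X \<in> Ebd \<Longrightarrow> bracket X (solve f y - Pb (solve f y)) = 0" by (rule Pb_orth[OF _ l])
qed

text \<open>Bound states carry no \<open>res_coeff\<close>, so the bound correction is invisible to
  \<open>G1\<close>; only the shift by \<open>y\<close> changes the pairing.\<close>

lemma G1_solve:
  assumes f: "f \<in> linf (- sb)" and orth: "\<And>k. k \<in> Ker M \<Longrightarrow> bracket (v k) f = 0" and y: "y \<in> KF"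
  shows "bracket (v k) (G1 (V (solve f y - Pb (solve f y)))) = bracket (v k) (G1 (v (Md (va f)))) - bracket (v k) (G1 (v y))"
proof -
  have "res_coeff (v (Md (va f)) - v y - V (Pb (solve f y))) \<alpha> = res_coeff (v (Md (va f))) \<alpha> - res_coeff (v y) \<alpha>" for \<alpha>
  proof -
    have p: "pairable (nvec \<alpha>) (v k)" for k by (rule nvec_pairable[OF v_lone1])
    have q: "pairable (nvec \<alpha>) (V (Pb (solve f y)))" by (rule nvec_pairable[OF V_lone1[OF bound_linf[OF Pb_bound]]])
    show ?thesis using bound_res_coeff[OF Pb_bound, of "solve f y" \<alpha>] p q
      by (simp add: res_coeff_def bracket_diff_right pairable_diff_right)
  qed
  moreover have "V (solve f y - Pb (solve f y)) = v (Md (va f)) - v y - V (Pb (solve f y))"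
    by (rule V_solve[OF f orth y])
  ultimately have "res_coeff (V (solve f y - Pb (solve f y))) \<alpha> = res_coeff (v (Md (va f))) \<alpha> - res_coeff (v y) \<alpha>" for \<alpha>
    by metis
  then show ?thesis unfolding bracket_G1[OF v_lone1]
    by (simp add: right_diff_distrib sum_subtractf)
qed


section \<open>Generalized eigenfunctions with prescribed linear growth\<close>

subsection \<open>The non-resonance basis\<close>

abbreviation "nJ j \<equiv> (\<Sum>\<alpha>\<in>UNIV. c' j \<alpha> *\<^sub>C nvec \<alpha> :: ('a, 'n) gfun)"

definition "nonres j = ((id - Pb) \<cdot> (id - G0 \<cdot> (id - v \<cdot> md \<cdot> va \<cdot> G1) \<cdot> v \<cdot> Md \<cdot> va)) (nJ j)"

lemma sb_ge: "2 \<le> sb"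
  using beta by simp

lemma nJ_linf: "nJ j \<in> linf (- sb)"
  by (rule nsum_linf) (use sb_ge in simp)

lemma Ker_nJ: "k \<in> Ker M \<Longrightarrow> j \<in> J \<Longrightarrow> bracket (v k) (nJ j) = 0"
  using c'_orth[OF res_of_res] by (simp add: bracket_nsum[OF v_lone1] V_res_of)

lemma solve_composition:
  "(id - G0 \<cdot> (id - v \<cdot> md \<cdot> va \<cdot> G1) \<cdot> v \<cdot> Md \<cdot> va) f = solve f (md (va (G1 (v (Md (va f))))))"
  by (simp add: solve_def free_coeff_diff[OF graph] v_lone' del: free_coeff.simps)

abbreviation "yJ j \<equiv> md (va (G1 (v (Md (va (nJ j))))))"

lemma nonres_eq: "nonres j = solve (nJ j) (yJ j) - Pb (solve (nJ j) (yJ j))"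
  unfolding nonres_def comp_apply[of "id - Pb"] solve_composition by simp

lemma nonres_linf: "j \<in> J \<Longrightarrow> nonres j \<in> linf (- sb)"
  unfolding nonres_eq by (rule solve_linf(2)[OF nJ_linf Ker_nJ md_KF])

lemma nonres_solves: "j \<in> J \<Longrightarrow> nonres j + G0 (V (nonres j)) = nJ j"
  unfolding nonres_eq by (rule solve_eq[OF nJ_linf Ker_nJ md_KF])

lemma nonres_orth: "j \<in> J \<Longrightarrow> X \<in> Ebd \<Longrightarrow> bracket X (nonres j) = 0"
  unfolding nonres_eq by (rule solve_orth[OF nJ_linf Ker_nJ md_KF])

text \<open>By \<open>md_equation\<close> the shift \<open>yJ j\<close> cancels the contribution of
  \<open>Md\<close> on \<open>KF\<close>, and on \<open>KB\<close> every pairing with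
  \<open>G1\<close> vanishes.\<close>

lemma G1_nonres:
  assumes j: "j \<in> J" and k: "k \<in> Ker M"
  shows "bracket (v k) (G1 (V (nonres j))) = 0"
proof -
  have F: "bracket (v k) (G1 (V (nonres j))) = bracket (v k) 0" if "k \<in> KF" for k
    unfolding nonres_eq
    by (subst G1_solve[OF nJ_linf _ md_KF]) (auto simp: md_equation[OF that G1_linf_beta] intro: Ker_nJ j)
  have B: "bracket (v k) (G1 (V (nonres j))) = bracket (v k) 0" if "k \<in> KB" for k
    by (simp add: KB_G1[OF that])
  show ?thesis using Ker_test[OF k G1_linf_beta linf_zero F B] by simp
qed

lemma nonres_gen: assumes j: "j \<in> J" shows "nonres j \<in> Egen"
proof (rule gen_eigenspaceI)
  show "nonres j \<in> linf (- real \<beta>)" by (rule linf_sb[OF nonres_linf[OF j]])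
  show "nonres j = nJ j - G0 (V (nonres j))" using nonres_solves[OF j] by (metis add_diff_cancel_right')
qed

lemma G0_V_sum:
  assumes "\<And>j. j \<in> J \<Longrightarrow> X j \<in> linf (- real \<beta>)"
  shows "G0 (V (\<Sum>j\<in>J. a j *\<^sub>C X j)) = (\<Sum>j\<in>J. a j *\<^sub>C G0 (V (X j)))"
proof -
  have V: "V (\<Sum>j\<in>J. a j *\<^sub>C X j) = (\<Sum>j\<in>J. a j *\<^sub>C V (X j))"
    by (subst V_sum) (auto intro!: linf_scale assms sum.cong simp: V_scale[OF assms])
  show ?thesis
    unfolding V by (subst G0_sum) (auto intro!: lone_scale V_lone' assms simp: free_coeff_scale[OF graph])
qed

lemma nonres_sum_solves:
  "(\<Sum>j\<in>J. a j *\<^sub>C nonres j) + G0 (V (\<Sum>j\<in>J. a j *\<^sub>C nonres j))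
    = (\<Sum>\<alpha>\<in>UNIV. (\<Sum>j\<in>J. a j * c' j \<alpha>) *\<^sub>C nvec \<alpha>)"
proof -
  have "(\<Sum>j\<in>J. a j *\<^sub>C nonres j) + G0 (V (\<Sum>j\<in>J. a j *\<^sub>C nonres j))
      = (\<Sum>j\<in>J. a j *\<^sub>C nonres j + a j *\<^sub>C G0 (V (nonres j)))"
    by (subst G0_V_sum) (auto intro: linf_sb nonres_linf simp: sum.distrib simp del: free_coeff.simps)
  also have "\<dots> = (\<Sum>j\<in>J. a j *\<^sub>C nJ j)"
  proof (rule sum.cong[OF refl])
    fix j assume "j \<in> J"
    show "a j *\<^sub>C nonres j + a j *\<^sub>C G0 (V (nonres j)) = a j *\<^sub>C nJ j"
    proof
      fix x show "(a j *\<^sub>C nonres j + a j *\<^sub>C G0 (V (nonres j))) x = (a j *\<^sub>C nJ j) x"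
        using fun_cong[OF nonres_solves[OF \<open>j \<in> J\<close>], of x]
        by (simp only: plus_fun_apply scaleC_fun_apply distrib_left[symmetric])
    qed
  qed
  also have "\<dots> = (\<Sum>\<alpha>\<in>UNIV. (\<Sum>j\<in>J. a j * c' j \<alpha>) *\<^sub>C nvec \<alpha>)" (is "?l = ?r")
  proof
    fix x
    show "?l x = ?r x"
      by (simp add: sum_fun_apply sum_distrib_left sum_distrib_right mult.assoc) (rule sum.swap)
  qed
  finally show ?thesis .
qed

text \<open>The growth coefficients of \<open>nonres j\<close> are \<open>c' j\<close>. A
  combination in \<open>Eres\<close> has no growth, so it is trivial by orthonormality. Conversely,
  the growth vector of any generalized eigenfunction expands in \<open>c'\<close> by
  \<open>gen_res_orthogonal\<close>, and removing that combination leaves a homogeneous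
  equation.\<close>

theorem nonresonance_basis_nonres: "nonresonance_basis \<beta> H J nonres"
  unfolding nonresonance_basis_def quotient_basis_def
proof (intro conjI ballI allI impI)
  show "finite J" by (rule finite_J)
  show "nonres j \<in> Egen" if "j \<in> J" for j by (rule nonres_gen[OF that])
  fix a j assume a: "(\<Sum>j\<in>J. a j *\<^sub>C nonres j) \<in> Eres" and j: "j \<in> J"
  have n0: "(\<Sum>\<alpha>\<in>UNIV. (\<Sum>j\<in>J. a j * c' j \<alpha>) *\<^sub>C nvec \<alpha> :: ('a, 'n) gfun) = 0"
    unfolding nonres_sum_solves[symmetric] res_eq[OF a] by simp
  have z: "(\<Sum>j\<in>J. a j * c' j \<alpha>) = 0" for \<alpha>
    by (rule nsum_bounded_zero) (unfold n0, rule linf_zero)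
  have "(\<Sum>i\<in>J. a i * (\<Sum>\<alpha>\<in>UNIV. cnj (c' j \<alpha>) * c' i \<alpha>)) = (\<Sum>\<alpha>\<in>UNIV. cnj (c' j \<alpha>) * (\<Sum>i\<in>J. a i * c' i \<alpha>))"
    unfolding sum_distrib_left by (subst sum.swap) (simp add: mult_ac)
  then have "(\<Sum>i\<in>J. a i * (if j = i then 1 else 0)) = 0"
    using z orthonormal(3)[OF j] by simp
  then show "a j = 0" using finite_J j by (simp add: if_distrib cong: if_cong)
next
  fix X assume X: "X \<in> Egen"
  then obtain d where d: "X = (\<Sum>\<alpha>\<in>UNIV. d \<alpha> *\<^sub>C nvec \<alpha>) - G0 (V X)" by (rule gen_eigenspaceE)
  have "X - (\<Sum>\<alpha>\<in>UNIV. d \<alpha> *\<^sub>C nvec \<alpha>) = - G0 (V X)" by (subst d) simp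
  then have op: "X - (\<Sum>\<alpha>\<in>UNIV. d \<alpha> *\<^sub>C nvec \<alpha>) \<in> one_plus_lone (real \<beta> - 2)"
    using G0_one_plus_lone[OF V_lone[OF gen_linf[OF X]]] by simp
  define a where "a j = (\<Sum>\<gamma>\<in>UNIV. cnj (c' j \<gamma>) * d \<gamma>)" for j
  have da: "d \<alpha> = (\<Sum>j\<in>J. a j * c' j \<alpha>)" for \<alpha>
    unfolding a_def by (rule complement_expansion) (rule gen_res_orthogonal[OF X \<Psi>_res op])
  let ?S = "\<Sum>j\<in>J. a j *\<^sub>C nonres j"
  have S: "?S + G0 (V ?S) = (\<Sum>\<alpha>\<in>UNIV. d \<alpha> *\<^sub>C nvec \<alpha>)" unfolding nonres_sum_solves da ..
  have Sl: "?S \<in> linf (- real \<beta>)" by (intro linf_sum linf_scale linf_sb nonres_linf)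
  have "G0 (V (X - ?S)) = G0 (V X) - G0 (V ?S)"
    unfolding V_diff[OF gen_linf[OF X] Sl] by (rule free_coeff_diff[OF graph]) (auto intro: V_lone'[OF gen_linf[OF X]] V_lone'[OF Sl])
  moreover have "G0 (V X) = ?S + G0 (V ?S) - X"
    unfolding S using d by (metis add_diff_cancel_left' diff_add_cancel)
  ultimately have "X - ?S = - G0 (V (X - ?S))" by simp
  moreover have "X - ?S \<in> linf (- real \<beta>)" by (intro linf_diff gen_linf X Sl)
  ultimately have "X - ?S \<in> Eres" unfolding res_eigenspace_iff by blast
  then show "\<exists>a. X - (\<Sum>j\<in>J. a j *\<^sub>C nonres j) \<in> Eres" by blast
next
  fix j assume j: "j \<in> J"
  show "orthogonal_to Ebd (nonres j)"
    unfolding orthogonal_to_def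
  proof (intro ballI conjI)
    fix X assume X: "X \<in> Ebd"
    show "bracket X (nonres j) = 0" by (rule nonres_orth[OF j X])
    have "pairable X (nonres j)" by (rule bound_pairable[OF X nonres_linf[OF j]])
    then show "(\<lambda>x. cnj (X x) * nonres j x) \<in> lone 0" by (simp add: lone_def pairable_def norm_mult)
  qed
next
  show "\<exists>c. orthonormal_system J c \<and> (\<forall>i\<in>J. nonres i - (\<Sum>\<alpha>\<in>UNIV. c i \<alpha> *\<^sub>C nvec \<alpha>) \<in> one_plus_lone (real \<beta> - 2))"
  proof (intro exI[of _ c'] conjI ballI)
    show "orthonormal_system J c'" unfolding orthonormal_system_def by (intro ballI) (rule orthonormal(3))
    fix j assume j: "j \<in> J"
    have "nonres j - nJ j = - G0 (V (nonres j))" unfolding nonres_solves[OF j, symmetric] by simp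
    then show "nonres j - nJ j \<in> one_plus_lone (real \<beta> - 2)"
      using G0_one_plus_lone[OF V_lone[OF linf_sb[OF nonres_linf[OF j]]]] by simp
  qed
qed


section \<open>The resonance projection under the form of \<open>G1\<close>\<close>

subsection \<open>The resonance projection\<close>

lemma \<Psi>_bounded: "i \<in> I \<Longrightarrow> \<Psi> i \<in> linf (- 0)"
  by (rule res_bounded[OF \<Psi>_res])

lemma Pr_res: "Pr a \<in> Eres"
  unfolding basis_projection_apply by (intro res_sum res_scale \<Psi>_res)

lemma res_linf_sb: "X \<in> Eres \<Longrightarrow> X \<in> linf (- sb)"
  by (rule linf_mono[OF res_bounded]) (use sb_ge in auto)

lemma Pr_orth:
  assumes X: "X \<in> Ebd" shows "bracket X (Pr a) = 0"
proof -
  have "pairable X (bracket (\<Psi> i) a *\<^sub>C \<Psi> i)" if "i \<in> I" for i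
    by (intro bound_pairable X linf_scale res_linf_sb \<Psi>_res that)
  then show ?thesis unfolding basis_projection_apply
    by (simp add: bracket_sum_right bracket_scale_right \<Psi>_orth[OF _ X])
qed

lemma res_orth_span:
  assumes X: "X \<in> Eres" and orth: "\<And>Y. Y \<in> Ebd \<Longrightarrow> bracket Y X = 0"
  shows "\<exists>a. X = (\<Sum>i\<in>I. a i *\<^sub>C \<Psi> i)"
proof -
  obtain a where a: "X - (\<Sum>i\<in>I. a i *\<^sub>C \<Psi> i) \<in> Ebd" using \<Psi>_span[OF X] by blast
  have p: "pairable Y (a i *\<^sub>C \<Psi> i)" if "i \<in> I" "Y \<in> Ebd" for Y i
    by (intro bound_pairable linf_scale res_linf_sb \<Psi>_res that)
  have "bracket Y (X - (\<Sum>i\<in>I. a i *\<^sub>C \<Psi> i)) = 0" if Y: "Y \<in> Ebd" for Y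
  proof -
    have "bracket Y (\<Sum>i\<in>I. a i *\<^sub>C \<Psi> i) = 0"
      using p[OF _ Y] by (simp add: bracket_sum_right bracket_scale_right \<Psi>_orth[OF _ Y])
    moreover have "pairable Y (\<Sum>i\<in>I. a i *\<^sub>C \<Psi> i)" by (intro pairable_sum_right p Y)
    ultimately show ?thesis using orth[OF Y] bound_pairable[OF Y res_linf_sb[OF X]] by (simp add: bracket_diff_right)
  qed
  from bound_zero[OF a this[OF a]] show ?thesis by auto
qed

text \<open>A Parseval identity: the constants of the basis functions are orthonormal, and
  \<open>res_orth_span\<close> puts resonance functions orthogonal to the bound states into their
  span.\<close>

lemma Pr_res_coeff:
  assumes X: "X \<in> Eres" and orth: "\<And>Y. Y \<in> Ebd \<Longrightarrow> bracket Y X = 0" and a: "a \<in> lone 0"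
  shows "(\<Sum>\<alpha>\<in>UNIV. cnj (res_coeff (V X) \<alpha>) * res_coeff (V (Pr a)) \<alpha>) = bracket X a"
proof -
  obtain b where b: "X = (\<Sum>i\<in>I. b i *\<^sub>C \<Psi> i)" using res_orth_span[OF X orth] by blast
  have coef: "res_coeff (V (\<Sum>i\<in>I. d i *\<^sub>C \<Psi> i)) \<alpha> = (\<Sum>i\<in>I. d i * res_coeff (V (\<Psi> i)) \<alpha>)" for d \<alpha>
  proof -
    have "V (\<Sum>i\<in>I. d i *\<^sub>C \<Psi> i) = (\<Sum>i\<in>I. d i *\<^sub>C V (\<Psi> i))"
      by (subst V_sum) (auto simp: V_scale res_linf \<Psi>_res intro!: sum.cong linf_scale)
    moreover have "pairable (nvec \<alpha>) (d i *\<^sub>C V (\<Psi> i))" if "i \<in> I" for i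
      by (intro nvec_pairable lone_scale V_lone1 res_linf \<Psi>_res that)
    ultimately show ?thesis by (simp add: res_coeff_def bracket_sum_right bracket_scale_right)
  qed
  have "(\<Sum>\<alpha>\<in>UNIV. cnj (res_coeff (V X) \<alpha>) * res_coeff (V (Pr a)) \<alpha>)
      = (\<Sum>\<alpha>\<in>UNIV. \<Sum>i\<in>I. \<Sum>m\<in>I. cnj (b i) * bracket (\<Psi> m) a * (cnj (res_coeff (V (\<Psi> i)) \<alpha>) * res_coeff (V (\<Psi> m)) \<alpha>))"
    unfolding basis_projection_apply b coef by (simp add: sum_product mult_ac)
  also have "\<dots> = (\<Sum>i\<in>I. \<Sum>m\<in>I. \<Sum>\<alpha>\<in>UNIV. cnj (b i) * bracket (\<Psi> m) a * (cnj (res_coeff (V (\<Psi> i)) \<alpha>) * res_coeff (V (\<Psi> m)) \<alpha>))"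
    by (subst sum.swap, rule sum.cong[OF refl], rule sum.swap)
  also have "\<dots> = (\<Sum>i\<in>I. \<Sum>m\<in>I. cnj (b i) * bracket (\<Psi> m) a * (if i = m then 1 else 0))"
    by (intro sum.cong refl) (simp add: sum_distrib_left[symmetric] orthonormal(1))
  also have "\<dots> = (\<Sum>i\<in>I. cnj (b i) * bracket (\<Psi> i) a)"
    using finite_I by (intro sum.cong refl) (simp add: if_distrib cong: if_cong)
  also have "\<dots> = bracket X a"
  proof -
    have "pairable (b i *\<^sub>C \<Psi> i) a" if "i \<in> I" for i
      by (rule pairable_linf_lone[OF linf_scale[OF \<Psi>_bounded[OF that]] a])
    then show ?thesis unfolding b by (simp add: bracket_sum_left bracket_scale_left)
  qed
  finally show ?thesis .
qed

lemma Pr_diff: "a \<in> lone 0 \<Longrightarrow> b \<in> lone 0 \<Longrightarrow> Pr (a - b) = Pr a - Pr b"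
  unfolding basis_projection_apply sum_subtractf[symmetric]
proof (rule sum.cong[OF refl])
  fix i assume "a \<in> lone 0" "b \<in> lone 0" "i \<in> I"
  then have "bracket (\<Psi> i) (a - b) = bracket (\<Psi> i) a - bracket (\<Psi> i) b"
    by (intro bracket_diff_right pairable_linf_lone[OF \<Psi>_bounded])
  then show "bracket (\<Psi> i) (a - b) *\<^sub>C \<Psi> i = bracket (\<Psi> i) a *\<^sub>C \<Psi> i - bracket (\<Psi> i) b *\<^sub>C \<Psi> i"
    by (intro ext) (simp add: left_diff_distrib)
qed

lemma Pr_bracket:
  assumes X: "X \<in> Eres" and orth: "\<And>Y. Y \<in> Ebd \<Longrightarrow> bracket Y X = 0" and a: "a \<in> lone 0"
  shows "bracket (V X) (G1 (V (Pr a))) = - bracket X a"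
  using Pr_res_coeff[OF X orth a] by (simp add: bracket_G1[OF V_lone1[OF res_linf[OF X]]])

text \<open>This \<open>y\<close> lets \<open>md\<close> cancel, on \<open>KF\<close>, what the
  solution through \<open>Md\<close> leaves in the solvability condition.\<close>

lemma solve_G1_zero:
  assumes f: "f \<in> linf (- sb)" and orth: "\<And>k. k \<in> Ker M \<Longrightarrow> bracket (v k) f = 0" and k: "k \<in> Ker M"
  defines "y \<equiv> md (va (G1 (v (Md (va f)))))"
  shows "bracket (v k) (G1 (V (solve f y - Pb (solve f y)))) = 0"
proof (rule Ker_zero[OF k G1_linf_beta])
  fix k assume k: "k \<in> KF"
  have "bracket (v k) (G1 (V (solve f y - Pb (solve f y)))) = bracket (v k) (G1 (v (Md (va f)))) - bracket (v k) (G1 (v y))"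
    unfolding y_def by (rule G1_solve[OF f orth md_KF])
  then show "bracket (v k) (G1 (V (solve f y - Pb (solve f y)))) = 0"
    unfolding y_def md_equation[OF k G1_linf_beta] by simp
next
  fix k assume k: "k \<in> KB"
  show "bracket (v k) (G1 (V (solve f y - Pb (solve f y)))) = 0" by (rule KB_G1[OF k])
qed

end


section \<open>Identification of the coefficient of order zero\<close>

locale resonance_family = resonance_data E0 att V v U \<beta> L \<Phi> I \<Psi> J c' + resolvent_family E0 att V v U \<beta> w u W2 Wm W0
  for E0 :: "'a::finite set set" and att :: "'n::finite \<Rightarrow> 'a"
    and V :: "('a, 'n) gop" and v :: "'k::complex_hilbert \<Rightarrow> ('a, 'n) gfun" and U \<beta>
    and L :: "'l set" and \<Phi> :: "'l \<Rightarrow> ('a, 'n) gfun" and I :: "'i set" and \<Psi> :: "'i \<Rightarrow> ('a, 'n) gfun"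
    and J :: "'j set" and c' :: "'j \<Rightarrow> 'n \<Rightarrow> complex"
    and w and u W2 Wm W0 :: "('a, 'n) gfun"
begin

subsection \<open>The coefficient of order zero\<close>

text \<open>Names for the pieces of the formula: \<open>v r\<close> has the same
  \<open>res_coeff\<close> as \<open>V Wm\<close>; \<open>f0\<close> is the right side of the
  threshold equation for order 0 and \<open>k0\<close> its solution through \<open>Md\<close>;
  \<open>Bm\<close> is the bound state by which \<open>Wm\<close> differs from
  \<open>- G0 (v r)\<close>; \<open>x0\<close> in \<open>KF\<close> adjusts the solvability.\<close>

abbreviation "r \<equiv> md (va (G0 u))"
abbreviation "f0 \<equiv> G0 u - G1 (v r)"
abbreviation "k0 \<equiv> Md (va f0)"
abbreviation "g2 \<equiv> G2 (V Wm)"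
abbreviation "Bm \<equiv> Pb (G0 (v r))"
abbreviation "x0 \<equiv> md (va (G1 (v k0))) - md (va (G1 u)) + md (va (G2 (v r))) + md (va (G0 Bm))"
abbreviation "Z0 \<equiv> solve f0 x0 - Pb (solve f0 x0)"

lemma G0_u_linf: "G0 u \<in> linf (- sb)"
  by (rule free_coeff_linf_sb[OF beta6]) (use u_lone[of 0] beta in simp_all)

lemma G0_u_linf_beta: "G0 u \<in> linf (- real \<beta>)"
  by (rule linf_sb[OF G0_u_linf])

lemma f0_linf: "f0 \<in> linf (- sb)"
  by (intro linf_diff G0_u_linf G1_linf_sb)

lemma u_lone1: "u \<in> lone 1"
  by (rule u_lone) (use beta in simp)

lemma bracket_v_G0_u: "k \<in> KB \<Longrightarrow> bracket (v k) (G0 u) = 0"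
  using bracket_v_G0[OF KB_Ker u_lone1, of k] u_orth[OF KB_bound, of k] by simp

text \<open>On \<open>KF\<close> this is the defining property of \<open>md\<close>; on
  \<open>KB\<close> both sides vanish, the right one since \<open>u\<close> is orthogonal to bound
  states.\<close>

lemma bracket_G1_r:
  assumes k: "k \<in> Ker M" shows "bracket (v k) (G1 (v r)) = bracket (v k) (G0 u)"
  by (rule Ker_test[OF k G1_linf_beta G0_u_linf_beta])
    (simp_all add: md_equation[OF _ G0_u_linf_beta] KB_G1 bracket_v_G0_u del: free_coeff.simps)

lemma f0_orth: "k \<in> Ker M \<Longrightarrow> bracket (v k) f0 = 0"
  by (simp add: bracket_v_diff[OF G0_u_linf_beta G1_linf_beta] bracket_G1_r del: free_coeff.simps)

lemma v_ker_Wm: "v (ker_of Wm) = V Wm"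
  by (rule v_ker_of[OF W_linf(2)])

lemma bracket_G1_Wm:
  assumes k: "k \<in> Ker M" shows "bracket (v k) (G1 (V Wm)) = bracket (v k) (G0 u)"
proof -
  have "bracket (v k) (G1 (V Wm)) = - bracket (res_of k) u"
    unfolding Wm_pair[OF res_of_res[OF k]] V_res_of[OF k] by (rule bracket_G1[OF v_lone1])
  also have "\<dots> = bracket (v k) (G0 u)" by (rule bracket_v_G0[OF k u_lone1, symmetric])
  finally show ?thesis .
qed

text \<open>\<open>ker_of Wm\<close> and \<open>r\<close> satisfy the same weak equation on all of
  \<open>Ker M\<close>, so the self-pairing of their difference under \<open>G1\<close> is
  0.\<close>

lemma ker_Wm: "ker_of Wm - r \<in> KB"
proof -
  let ?t = "ker_of Wm - r"
  have t: "?t \<in> Ker M"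
    by (rule closed_csubspace_diff[OF closed_csubspace_Ker_M ker_of_Ker[OF Wm_res] KF_Ker[OF md_KF]])
  have "bracket (v ?t) (G1 (v ?t)) = 0"
    unfolding bracket_G1_v_diff v_ker_Wm bracket_G1_Wm[OF t] bracket_G1_r[OF t] by simp
  then have "(\<Sum>\<alpha>\<in>UNIV. cnj (res_coeff (v ?t) \<alpha>) * res_coeff (v ?t) \<alpha>) = 0"
    by (simp add: bracket_G1[OF v_lone1])
  then have "res_coeff (v ?t) \<alpha> = 0" for \<alpha> by (rule res_coeff_sq_zero)
  then show ?thesis using t by (simp add: KB_def)
qed

lemma res_coeff_Wm: "res_coeff (V Wm) \<alpha> = res_coeff (v r) \<alpha>"
  using ker_Wm res_coeff_v_diff[of "ker_of Wm" r \<alpha>] by (simp add: KB_def v_ker_Wm)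

lemma G1_Wm: "G1 (V Wm) = G1 (v r)"
  by (simp add: G1_eq res_coeff_Wm)

text \<open>\<open>Wm + G0 (v r)\<close> is a bound state, and orthogonality of \<open>Wm\<close> to
  bound states identifies it as the bound projection of \<open>G0 (v r)\<close>. This is the source
  of the summand with G_{0,0} P G_{0,0}.\<close>

lemma Wm_eq: "Wm = Bm - G0 (v r)"
proof -
  let ?B = "res_of (ker_of Wm - r)"
  have B: "?B \<in> Ebd" by (rule KB_bound[OF ker_Wm])
  have B_eq: "?B = Wm + G0 (v r)"
    unfolding res_of_def G0_v_diff v_ker_Wm res_eq[OF Wm_res] by simp
  have Gl: "G0 (v r) \<in> linf (- sb)" by (rule linf_mono[OF G0_v_linf(1)]) (use beta in simp)
  have D: "?B - Bm \<in> Ebd" by (intro bound_diff B Pb_bound)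
  have "?B - Bm = Wm + (G0 (v r) - Bm)" unfolding B_eq by simp
  moreover have "bracket X (Wm + (G0 (v r) - Bm)) = 0" if X: "X \<in> Ebd" for X
  proof -
    have "bracket X (Wm + (G0 (v r) - Bm)) = bracket X Wm + bracket X (G0 (v r) - Bm)"
      by (intro bracket_add_right bound_pairable X res_linf_sb Wm_res linf_diff Gl bound_linf_sb Pb_bound)
    then show ?thesis using Wm_orth[OF X] Pb_orth[OF X Gl] by simp
  qed
  ultimately have "bracket (?B - Bm) (?B - Bm) = 0" using D by metis
  then have "?B - Bm = 0" by (rule bound_zero[OF D])
  then have "Wm + G0 (v r) = Bm" unfolding B_eq by simp
  then show ?thesis by (metis add_diff_cancel_right')
qed

lemma V_Wm: "V Wm = V Bm + v r"
proof -
  have "V Wm = V (Bm - G0 (v r))" using Wm_eq by metis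
  also have "\<dots> = V Bm - V (G0 (v r))" by (rule V_diff[OF bound_linf[OF Pb_bound] G0_v_linf(2)])
  finally show ?thesis by (simp add: V_G0_v[OF KF_Ker[OF md_KF]])
qed

lemma V_Wm_lone2: "V Wm \<in> lone 2"
  by (rule V_W_lone(2)) (use beta in simp)

lemma G2_linf: "f \<in> lone 2 \<Longrightarrow> G2 f \<in> linf (- real \<beta>)"
  by (rule linf_sb[OF free_coeff_linf_sb[OF beta6]]) simp_all

lemma v_lone2: "v k \<in> lone 2"
  by (rule v_lone') (use beta in simp)

lemma V_bound_lone2: "X \<in> Ebd \<Longrightarrow> V X \<in> lone 2"
  by (rule V_lone'[OF bound_linf]) (use beta in simp_all)

lemma G2_add: "f \<in> lone 2 \<Longrightarrow> h \<in> lone 2 \<Longrightarrow> G2 (f + h) = G2 f + G2 h"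
  by (rule free_coeff_add[OF graph]) simp_all

text \<open>The bound component of \<open>Wm\<close> enters through \<open>G2_V_bound\<close>, which
  turns \<open>G2\<close> after \<open>V\<close> into \<open>G0\<close>.\<close>

lemma g2_eq: "g2 = G0 Bm + G2 (v r)"
  unfolding V_Wm G2_add[OF V_bound_lone2[OF Pb_bound] v_lone2] G2_V_bound[OF Pb_bound] ..

lemma g2_linf: "g2 \<in> linf (- sb)"
  by (rule free_coeff_linf_sb[OF beta6]) (use V_Wm_lone2 in simp_all)

lemma g2_linf_beta: "g2 \<in> linf (- real \<beta>)"
  by (rule linf_sb[OF g2_linf])

lemma KB_g2: "k \<in> KB \<Longrightarrow> bracket (v k) g2 = 0"
proof -
  assume k: "k \<in> KB"
  have "bracket (v k) g2 = bracket (res_of k) (G0 (V Wm))"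
    using bracket_V_G2_bound[OF beta6 KB_bound[OF k] V_Wm_lone2] by (simp only: V_res_of[OF KB_Ker[OF k]])
  also have "\<dots> = 0" by (simp add: res_eq[OF Wm_res] bracket_minus_right Wm_orth[OF KB_bound[OF k]])
  finally show ?thesis .
qed

lemma x0_KF: "x0 \<in> KF"
proof -
  note S = closed_csubspace_KF
  have a: "x + y \<in> KF" if "x \<in> KF" "y \<in> KF" for x y
    using closed_csubspace_diff[OF S that(1) closed_csubspace_minus[OF S that(2)]] by simp
  show ?thesis by (intro a closed_csubspace_diff[OF S] md_KF)
qed

lemma G0_Bm_linf: "G0 Bm \<in> linf (- real \<beta>)"
  by (rule linf0_beta[OF G0_bounded[OF lone_mono[OF Ebd_lone[OF Pb_bound]]]]) (use beta in simp)

text \<open>Each summand of \<open>x0\<close> answers one term of the solvability condition; the two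
  coming from \<open>Wm\<close> recombine to \<open>g2\<close> by \<open>g2_eq\<close>.\<close>

lemma x0_equation:
  assumes k: "k \<in> KF"
  shows "bracket (v k) (G1 (v x0)) = bracket (v k) (G1 (v k0)) - bracket (v k) (G1 u) + bracket (v k) g2"
  unfolding bracket_G1_v_add bracket_G1_v_diff md_equation[OF k G1_linf_beta] md_equation[OF k G0_Bm_linf]
    md_equation[OF k G2_linf[OF v_lone2]] g2_eq bracket_v_add[OF G0_Bm_linf G2_linf[OF v_lone2]]
  by simp

lemma Z0_linf: "Z0 \<in> linf (- sb)"
  and Z0_solves: "Z0 + G0 (V Z0) = f0"
  and Z0_orth: "X \<in> Ebd \<Longrightarrow> bracket X Z0 = 0"
  and V_Z0: "V Z0 = v k0 - v x0 - V (Pb (solve f0 x0))"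
  by (rule solve_linf[OF f0_linf f0_orth x0_KF] solve_eq[OF f0_linf f0_orth x0_KF]
      solve_orth[OF f0_linf f0_orth x0_KF] V_solve[OF f0_linf f0_orth x0_KF]; assumption?)+

lemma G1_Z0: "bracket (v k) (G1 (V Z0)) = bracket (v k) (G1 (v k0)) - bracket (v k) (G1 (v x0))"
  by (rule G1_solve[OF f0_linf f0_orth x0_KF])

lemma Z0_solvability:
  assumes k: "k \<in> Ker M"
  shows "bracket (v k) (G1 u) - bracket (v k) (G1 (V Z0)) = bracket (v k) g2"
proof -
  have "bracket (v k) (G1 u) - bracket (v k) (G1 (V Z0)) = bracket (v k) (G1 u - G1 (V Z0))"
    by (rule bracket_v_diff[OF G1_linf_beta G1_linf_beta, symmetric])
  also have "\<dots> = bracket (v k) g2"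
  proof (rule Ker_test[OF k linf_diff[OF G1_linf_beta G1_linf_beta] g2_linf_beta])
    fix k assume k: "k \<in> KF"
    show "bracket (v k) (G1 u - G1 (V Z0)) = bracket (v k) g2"
      unfolding bracket_v_diff[OF G1_linf_beta G1_linf_beta] G1_Z0 x0_equation[OF k]
      by simp
  next
    fix k assume k: "k \<in> KB"
    show "bracket (v k) (G1 u - G1 (V Z0)) = bracket (v k) g2"
      unfolding bracket_v_diff[OF G1_linf_beta G1_linf_beta] KB_G1[OF k] KB_g2[OF k] by simp
  qed
  finally show ?thesis .
qed

lemma W0_solvability':
  assumes X: "X \<in> Eres"
  shows "bracket (V X) (G1 u) - bracket (V X) (G1 (V W0)) = bracket (V X) g2"
  using W0_solvability[OF X] bracket_v_diff[OF G1_linf_beta G1_linf_beta, of "ker_of X" u "V W0"]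
  unfolding G1_diff[OF u_lone1 V_lone1[OF W_linf(3)]] v_ker_of[OF res_linf[OF X]] by simp

text \<open>\<open>W0\<close> and \<open>Z0\<close> share the threshold equation because
  \<open>V Wm\<close> and \<open>v r\<close> have the same image under \<open>G1\<close>. The choice
  of \<open>x0\<close> gives equal solvability conditions, and \<open>Pb\<close> removes the bound
  component.\<close>

theorem W0_formula: "W0 = Z0"
proof -
  let ?D = "W0 - Z0"
  have Zl: "Z0 \<in> linf (- real \<beta>)" by (rule linf_sb[OF Z0_linf])
  have u0: "u \<in> lone 0" by (rule u_lone) (use beta in simp)
  have "?D = 0"
  proof (rule threshold_unique)
    show "?D \<in> linf (- real \<beta>)" by (intro linf_diff W_linf Zl)
    have d: "G0 (u - V W0) = G0 u - G0 (V W0)"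
      by (rule free_coeff_diff[OF graph]) (simp_all add: u0 V_lone0[OF W_linf(3)])
    have e1: "W0 = G0 u - G0 (V W0) - G1 (v r)" using W0_eq unfolding G1_Wm d .
    have e2: "G0 u - G1 (v r) = Z0 + G0 (V Z0)" by (rule Z0_solves[symmetric])
    have *: "x = a - b - c \<Longrightarrow> a - c = y + d \<Longrightarrow> x - y = - (b - d)" for x y a b c d :: "('a, 'n) gfun"
      by (simp add: algebra_simps)
    show "?D = - G0 (V ?D)" unfolding G0_V_diff[OF W_linf(3) Zl] by (rule *[OF e1 e2])
    show "bracket (V X) (G1 (V ?D)) = 0" if X: "X \<in> Eres" for X
    proof -
      have "bracket (V X) (G1 (V ?D)) = bracket (V X) (G1 (V W0)) - bracket (V X) (G1 (V Z0))"
        unfolding G1_V_diff[OF W_linf(3) Zl] v_ker_of[OF res_linf[OF X], symmetric]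
        by (rule bracket_v_diff[OF G1_linf_beta G1_linf_beta])
      moreover have "bracket (V X) (G1 u) - bracket (V X) (G1 (V Z0)) = bracket (V X) g2"
        using Z0_solvability[OF ker_of_Ker[OF X]] unfolding v_ker_of[OF res_linf[OF X]] .
      ultimately show ?thesis using W0_solvability'[OF X] by (simp add: algebra_simps)
    qed
    show "bracket X ?D = 0" if X: "X \<in> Ebd" for X
      using W0_orth[OF X] Z0_orth[OF X] bound_pairable[OF X W0] bound_pairable[OF X Z0_linf]
      by (simp add: bracket_diff_right del: minus_apply)
  qed
  then show ?thesis by simp
qed

lemma coeff_0_composition:
  "(G0 - G0 \<cdot> v \<cdot> md \<cdot> va \<cdot> G1 - G1 \<cdot> v \<cdot> md \<cdot> va \<cdot> G0
    - G0 \<cdot> (id - v \<cdot> md \<cdot> va \<cdot> G1) \<cdot> v \<cdot> Md \<cdot> va \<cdot> (id - G1 \<cdot> v \<cdot> md \<cdot> va) \<cdot> G0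
    + G0 \<cdot> v \<cdot> md \<cdot> va \<cdot> G2 \<cdot> v \<cdot> md \<cdot> va \<cdot> G0
    + G0 \<cdot> v \<cdot> md \<cdot> va \<cdot> G0 \<cdot> Pb \<cdot> G0 \<cdot> v \<cdot> md \<cdot> va \<cdot> G0) u = solve f0 x0"
proof -
  have "G0 (v k0 - v (md (va (G1 (v k0))))) = G0 (v k0) - G0 (v (md (va (G1 (v k0)))))"
    by (rule free_coeff_diff[OF graph]) (simp_all add: v_lone')
  then show ?thesis unfolding solve_def G0_v_add G0_v_diff
    by (simp only: plus_fun_apply fun_diff_def comp_apply id_apply) (rule ext, simp only: plus_fun_apply fun_diff_def algebra_simps)
qed

end


section \<open>Identification of the coefficient of order one\<close>

locale resonance_family_1 = resonance_family E0 att V v U \<beta> L \<Phi> I \<Psi> J c' w u W2 Wm W0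
    + resolvent_family_1 E0 att V v U \<beta> w u W2 Wm W0 W1
  for E0 :: "'a::finite set set" and att :: "'n::finite \<Rightarrow> 'a"
    and V :: "('a, 'n) gop" and v :: "'k::complex_hilbert \<Rightarrow> ('a, 'n) gfun" and U \<beta>
    and L :: "'l set" and \<Phi> :: "'l \<Rightarrow> ('a, 'n) gfun" and I :: "'i set" and \<Psi> :: "'i \<Rightarrow> ('a, 'n) gfun"
    and J :: "'j set" and c' :: "'j \<Rightarrow> 'n \<Rightarrow> complex"
    and w and u W2 Wm W0 W1 :: "('a, 'n) gfun"
begin

subsection \<open>The coefficient of order one\<close>

text \<open>Names for order 1: \<open>f1\<close> is the datum \<open>g2\<close> made solvable by
  \<open>t\<close>, and \<open>Z1\<close> the corresponding solution; \<open>R1\<close> is the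
  resonance function that meets the solvability condition; \<open>B0\<close> is the bound component
  removed at order 0. \<open>V_W0\<close> shows that \<open>s1\<close>, \<open>v t\<close> and
  \<open>V B0\<close> add up to \<open>u - V W0\<close>.\<close>

abbreviation "Pn \<equiv> basis_projection J nonres"
abbreviation "s \<equiv> u - v k0"
abbreviation "t \<equiv> md (va g2)"
abbreviation "f1 \<equiv> g2 - G1 (v t)"
abbreviation "yZ \<equiv> md (va (G1 (v (Md (va f1)))))"
abbreviation "Z1 \<equiv> solve f1 yZ - Pb (solve f1 yZ)"
abbreviation "s1 \<equiv> s - v (md (va (G1 s)))"
abbreviation "R1 \<equiv> Pr (V (G3 (V Wm))) - Pr (V (G2 (v t))) - Pr (V (G2 s1))"
abbreviation "B0 \<equiv> Pb (solve f0 x0)"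

lemma u_lone0: "u \<in> lone 0"
  by (rule u_lone) (use beta in simp)

text \<open>Both functions lie in \<open>Eres\<close>, are orthogonal to bound states and have the
  pairing \<open>- bracket X u\<close>: for \<open>Wm\<close> this is the solvability limit, for
  \<open>Pr u\<close> the Parseval identity.\<close>

lemma Wm_formula: "Wm = Pr u"
proof -
  let ?D = "Wm - Pr u"
  have D: "?D \<in> Eres" by (intro res_diff Wm_res Pr_res)
  have "?D = 0"
  proof (rule threshold_unique)
    show "?D \<in> linf (- real \<beta>)" by (rule res_linf[OF D])
    show "?D = - G0 (V ?D)" using res_eq[OF D] by (metis minus_minus)
    show "bracket (V X) (G1 (V ?D)) = 0" if X: "X \<in> Eres" and o: "\<And>Y. Y \<in> Ebd \<Longrightarrow> bracket Y X = 0" for X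
    proof -
      have "bracket (V X) (G1 (V ?D)) = bracket (V X) (G1 (V Wm)) - bracket (V X) (G1 (V (Pr u)))"
        unfolding G1_V_diff[OF W_linf(2) res_linf[OF Pr_res]] v_ker_of[OF res_linf[OF X], symmetric]
        by (rule bracket_v_diff[OF G1_linf_beta G1_linf_beta])
      also have "bracket (V X) (G1 (V Wm)) = - bracket X u"
        unfolding Wm_pair[OF X] by (rule bracket_G1[OF V_lone1[OF res_linf[OF X]]])
      also have "bracket (V X) (G1 (V (Pr u))) = - bracket X u" by (rule Pr_bracket[OF X o u_lone0])
      finally show ?thesis by (simp only: diff_self)
    qed
    show "bracket X ?D = 0" if X: "X \<in> Ebd" for X
      using Wm_orth[OF X] Pr_orth[OF X] bound_pairable[OF X res_linf_sb[OF Wm_res]] bound_pairable[OF X res_linf_sb[OF Pr_res]]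
      by (simp add: bracket_diff_right del: minus_apply)
  qed
  then show ?thesis by simp
qed

lemma f1_linf: "f1 \<in> linf (- sb)"
  by (intro linf_diff g2_linf G1_linf_sb)

lemma f1_orth: "k \<in> Ker M \<Longrightarrow> bracket (v k) f1 = 0"
proof (rule Ker_zero)
  show "f1 \<in> linf (- real \<beta>)" by (rule linf_sb[OF f1_linf])
  show "bracket (v k) f1 = 0" if "k \<in> KF" for k
    unfolding bracket_v_diff[OF g2_linf_beta G1_linf_beta] md_equation[OF that g2_linf_beta] by simp
  show "bracket (v k) f1 = 0" if "k \<in> KB" for k
    unfolding bracket_v_diff[OF g2_linf_beta G1_linf_beta] KB_g2[OF that] KB_G1[OF that] by simp
qed

lemma s_lone: "i \<le> 3 \<Longrightarrow> s \<in> lone (real i)"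
  using beta by (intro lone_diff u_lone_nat v_lone') auto

lemma s1_lone2: "s1 \<in> lone 2"
  by (rule lone_diff[OF _ v_lone2]) (use s_lone[of 2] in simp)

text \<open>Both vectors lie in \<open>KF\<close> and have the same pairings under
  \<open>G1\<close>; the new form merges the terms with \<open>u\<close> and \<open>v k0\<close> by
  linearity of \<open>G1\<close> and those from \<open>Wm\<close> into \<open>g2\<close>.\<close>

lemma x0_eq: "x0 = t - md (va (G1 s))"
proof (rule KF_unique[OF x0_KF])
  show "t - md (va (G1 s)) \<in> KF" by (intro closed_csubspace_diff[OF closed_csubspace_KF] md_KF)
  fix k assume k: "k \<in> KF"
  show "bracket (v k) (G1 (v x0)) = bracket (v k) (G1 (v (t - md (va (G1 s)))))"
    unfolding x0_equation[OF k] bracket_G1_v_diff md_equation[OF k g2_linf_beta] md_equation[OF k G1_linf_beta]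
    unfolding G1_diff[OF u_lone1 v_lone1] bracket_v_diff[OF G1_linf_beta G1_linf_beta]
    by simp
qed

lemma V_W0: "u - V W0 = s1 + v t + V B0"
proof -
  have "V W0 = v k0 - v x0 - V B0" unfolding W0_formula by (rule V_Z0)
  then have e: "V W0 = v k0 - (v t - v (md (va (G1 s)))) - V B0" unfolding x0_eq v_diff .
  show ?thesis unfolding e by (simp add: algebra_simps del: free_coeff.simps)
qed

lemma V_W0_lone: "u - V W0 \<in> lone 1"
  by (intro lone_diff u_lone1 V_lone1 W_linf)

lemma G2_V_W0: "G2 (u - V W0) = G2 s1 + G2 (v t) + G0 B0"
  unfolding V_W0 G2_add[OF lone_add[OF s1_lone2 v_lone2] V_bound_lone2[OF Pb_bound]] G2_add[OF s1_lone2 v_lone2]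
    G2_V_bound[OF Pb_bound] ..

text \<open>With N = \<open>nonres j\<close>, the growth vector \<open>nJ j\<close> equals N plus
  \<open>G0 (V N)\<close>, and \<open>G0\<close> and \<open>V\<close> are moved across by symmetry.
  The equation of \<open>W0\<close> leaves the pairing of \<open>V N\<close> with
  \<open>G1 (V Wm)\<close>, which is 0 because N meets its own solvability condition.\<close>

lemma nonres_bracket:
  assumes j: "j \<in> J"
  shows "bracket (nJ j) (u - V W0) = bracket (nonres j) u"
proof -
  let ?N = "nonres j"
  have Nl: "?N \<in> linf (- real \<beta>)" by (rule linf_sb[OF nonres_linf[OF j]])
  have VN: "V ?N \<in> lone (real \<beta>)" by (rule V_lone[OF Nl])
  have up: "pairable ?N u" by (rule pairable_linf_lone[OF nonres_linf[OF j] u])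
  have Vp: "pairable ?N (V W0)" by (rule pairable_linf_lone[OF Nl V_lone[OF W_linf(3)]])
  have d0: "u - V W0 \<in> lone 0" by (intro lone_diff u_lone0 V_lone0 W_linf)
  have Gl: "G0 (u - V W0) \<in> linf (- real \<beta>)"
    by (rule linf0_beta[OF G0_bounded[OF V_W0_lone]])
  have p2: "pairable (G0 (V ?N)) (u - V W0)"
    by (rule pairable_linf_lone[OF G0_bounded[OF V_lone1[OF Nl]] d0])
  have W: "G0 (u - V W0) = W0 + G1 (V Wm)" using W0_eq by (metis diff_add_cancel)
  have "bracket (nJ j) (u - V W0) = bracket (?N + G0 (V ?N)) (u - V W0)" unfolding nonres_solves[OF j] ..
  also have "\<dots> = bracket ?N (u - V W0) + bracket (G0 (V ?N)) (u - V W0)"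
    by (rule bracket_add_left[OF pairable_diff_right[OF up Vp] p2])
  also have "bracket (G0 (V ?N)) (u - V W0) = bracket (V ?N) (G0 (u - V W0))"
    by (rule bracket_G0[OF VN V_W0_lone, symmetric])
  also have "\<dots> = bracket (V ?N) W0 + bracket (V ?N) (G1 (V Wm))"
    unfolding W by (intro bracket_add_right pairable_lone_linf[OF VN] W_linf G1_linf_beta)
  also have "bracket (V ?N) (G1 (V Wm)) = cnj (bracket (V Wm) (G1 (V ?N)))"
    unfolding bracket_G1[OF V_lone1[OF Nl]] bracket_G1[OF V_lone1[OF W_linf(2)]] by (simp add: mult.commute)
  also have "bracket (V Wm) (G1 (V ?N)) = 0"
    using G1_nonres[OF j ker_of_Ker[OF Wm_res]] unfolding v_ker_Wm .
  also have "bracket (V ?N) W0 = bracket ?N (V W0)" by (rule V_symmetric[OF Nl W_linf(3)])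
  also have "bracket ?N (u - V W0) = bracket ?N u - bracket ?N (V W0)" by (rule bracket_diff_right[OF up Vp])
  finally show ?thesis by (simp only: complex_cnj_zero add_0_right diff_add_cancel)
qed

text \<open>\<open>u - V W0\<close> and \<open>v t\<close> have equal pairings under
  \<open>G1\<close> with all resonance functions, so the growth vector of the difference expands in
  \<open>c'\<close>; \<open>nonres_bracket\<close> evaluates the coefficients. This is the origin of
  the non-resonance projection in order 1.\<close>

lemma first_order_defect: "G1 (u - V W0) = G1 (v t) - (\<Sum>\<alpha>\<in>UNIV. (\<Sum>j\<in>J. bracket (nonres j) u * c' j \<alpha>) *\<^sub>C nvec \<alpha>)"
proof -
  let ?a = "u - V W0 - v t"
  have a: "?a \<in> lone 1" by (intro lone_diff V_W0_lone v_lone1)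
  define d where "d \<alpha> = res_coeff ?a \<alpha>" for \<alpha>
  have G: "G1 (u - V W0) - G1 (v t) = G1 ?a" by (rule G1_diff[OF V_W0_lone v_lone1, symmetric])
  have zero: "(\<Sum>\<alpha>\<in>UNIV. cnj (res_coeff (V (\<Psi> i)) \<alpha>) * d \<alpha>) = 0" if i: "i \<in> I" for i
  proof -
    let ?k = "ker_of (\<Psi> i)"
    have k: "?k \<in> Ker M" "v ?k = V (\<Psi> i)" by (auto intro: ker_of_Ker v_ker_of res_linf \<Psi>_res i)
    have "bracket (v ?k) (G1 ?a) = bracket (v ?k) (G1 (u - V W0)) - bracket (v ?k) (G1 (v t))"
      unfolding G[symmetric] by (rule bracket_v_diff[OF G1_linf_beta G1_linf_beta])
    also have "bracket (v ?k) (G1 (u - V W0)) = bracket (v ?k) g2"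
      unfolding k(2) by (rule W0_solvability[OF \<Psi>_res[OF i]])
    also have "\<dots> - bracket (v ?k) (G1 (v t)) = bracket (v ?k) f1"
      by (rule bracket_v_diff[OF g2_linf_beta G1_linf_beta, symmetric])
    also have "\<dots> = 0" by (rule f1_orth[OF k(1)])
    finally show ?thesis unfolding k(2) bracket_G1[OF V_lone1[OF res_linf[OF \<Psi>_res[OF i]]]] d_def by (simp only: neg_equal_0_iff_equal)
  qed
  have coef: "(\<Sum>\<gamma>\<in>UNIV. cnj (c' j \<gamma>) * d \<gamma>) = bracket (nonres j) u" if j: "j \<in> J" for j
  proof -
    have p: "pairable (nJ j) b" if "b \<in> lone 1" for b
      by (rule pairable_linf_lone[OF nsum_linf that]) simp
    have "(\<Sum>\<gamma>\<in>UNIV. cnj (c' j \<gamma>) * d \<gamma>) = bracket (nJ j) ?a"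
      using pairable_sym[OF pairable_scale_right[OF pairable_sym[OF nvec_pairable[OF a]]]]
      by (simp add: bracket_sum_left bracket_scale_left d_def res_coeff_def)
    also have "\<dots> = bracket (nJ j) (u - V W0) - bracket (nJ j) (v t)"
      by (rule bracket_diff_right[OF p[OF V_W0_lone] p[OF v_lone1]])
    also have "bracket (nJ j) (v t) = 0"
      using Ker_nJ[OF KF_Ker[OF md_KF] j] by (metis bracket_commute complex_cnj_zero)
    finally show ?thesis unfolding nonres_bracket[OF j] by simp
  qed
  have "d \<alpha> = (\<Sum>j\<in>J. bracket (nonres j) u * c' j \<alpha>)" for \<alpha>
    using complement_expansion[of d \<alpha>, OF zero] by (simp add: coef)
  then have "G1 ?a = - (\<Sum>\<alpha>\<in>UNIV. (\<Sum>j\<in>J. bracket (nonres j) u * c' j \<alpha>) *\<^sub>C nvec \<alpha>)"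
    unfolding G1_eq d_def[symmetric] by simp
  then show ?thesis using G by (simp add: algebra_simps del: free_coeff.simps)
qed

lemma Pn_linf: "Pn f \<in> linf (- sb)"
  unfolding basis_projection_apply by (intro linf_sum linf_scale nonres_linf)

lemma Pn_orth:
  assumes X: "X \<in> Ebd" shows "bracket X (Pn f) = 0"
proof -
  have "pairable X (bracket (nonres j) f *\<^sub>C nonres j)" if "j \<in> J" for j
    by (intro bound_pairable X linf_scale nonres_linf that)
  then show ?thesis unfolding basis_projection_apply
    by (simp add: bracket_sum_right bracket_scale_right nonres_orth[OF _ X])
qed

lemma Pn_solves:
  "Pn f + G0 (V (Pn f)) = (\<Sum>\<alpha>\<in>UNIV. (\<Sum>j\<in>J. bracket (nonres j) f * c' j \<alpha>) *\<^sub>C nvec \<alpha>)"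
  unfolding basis_projection_apply by (rule nonres_sum_solves)

lemma Pn_G1:
  assumes k: "k \<in> Ker M" shows "bracket (v k) (G1 (V (Pn f))) = 0"
proof -
  have l: "bracket (nonres j) f *\<^sub>C nonres j \<in> linf (- real \<beta>)" if "j \<in> J" for j
    by (intro linf_scale linf_sb nonres_linf that)
  have V: "V (Pn f) = (\<Sum>j\<in>J. bracket (nonres j) f *\<^sub>C V (nonres j))"
    unfolding basis_projection_apply
    by (subst V_sum[OF l]) (auto intro!: sum.cong V_scale linf_sb nonres_linf)
  have p: "pairable (nvec \<alpha>) (bracket (nonres j) f *\<^sub>C V (nonres j))" if "j \<in> J" for j \<alpha>
    by (intro nvec_pairable lone_scale V_lone1 linf_sb nonres_linf that)
  have r: "res_coeff (V (Pn f)) \<alpha> = (\<Sum>j\<in>J. bracket (nonres j) f * res_coeff (V (nonres j)) \<alpha>)" for \<alpha>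
    unfolding V using p by (simp add: res_coeff_def bracket_sum_right bracket_scale_right)
  have "(\<Sum>\<alpha>\<in>UNIV. cnj (res_coeff (v k) \<alpha>) * res_coeff (V (Pn f)) \<alpha>)
      = (\<Sum>j\<in>J. bracket (nonres j) f * (\<Sum>\<alpha>\<in>UNIV. cnj (res_coeff (v k) \<alpha>) * res_coeff (V (nonres j)) \<alpha>))"
    unfolding r sum_distrib_left by (subst sum.swap) (simp add: mult_ac)
  moreover have "(\<Sum>\<alpha>\<in>UNIV. cnj (res_coeff (v k) \<alpha>) * res_coeff (V (nonres j)) \<alpha>) = 0" if "j \<in> J" for j
    using G1_nonres[OF that k] by (simp add: bracket_G1[OF v_lone1])
  ultimately show ?thesis by (simp add: bracket_G1[OF v_lone1])
qed

lemma Z1_linf: "Z1 \<in> linf (- sb)"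
  and Z1_solves: "Z1 + G0 (V Z1) = f1"
  and Z1_orth: "X \<in> Ebd \<Longrightarrow> bracket X Z1 = 0"
  by (rule solve_linf[OF f1_linf f1_orth md_KF] solve_eq[OF f1_linf f1_orth md_KF]
      solve_orth[OF f1_linf f1_orth md_KF]; assumption?)+

lemma R1_res: "R1 \<in> Eres"
  by (intro res_diff Pr_res)

lemma V_Wm_lone3: "V Wm \<in> lone 3"
  by (rule V_W_lone(2)) (use beta in simp)

lemma G3_linf: "f \<in> lone 3 \<Longrightarrow> G3 f \<in> linf (- real \<beta>)"
  by (rule linf_sb[OF free_coeff_linf_sb[OF beta6]]) simp_all

text \<open>\<open>Pr_bracket\<close> and symmetry of \<open>V\<close> turn the three resonance
  projections into pairings; the bound part \<open>B0\<close> of \<open>u - V W0\<close> drops out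
  against test functions orthogonal to the bound states.\<close>

lemma R1_bracket:
  assumes X: "X \<in> Eres" and orth: "\<And>Y. Y \<in> Ebd \<Longrightarrow> bracket Y X = 0"
  shows "bracket (V X) (G1 (V R1)) = bracket (V X) (G2 (u - V W0)) - bracket (V X) (G3 (V Wm))"
proof -
  have P: "bracket (V X) (G1 (V (Pr (V Y)))) = - bracket (V X) Y" if Y: "Y \<in> linf (- real \<beta>)" for Y
    using Pr_bracket[OF X orth V_lone0[OF Y]] V_symmetric[OF res_linf[OF X] Y] by simp
  have k: "v (ker_of X) = V X" by (rule v_ker_of[OF res_linf[OF X]])
  note Pl = res_linf[OF Pr_res]
  have "bracket (V X) (G1 (V R1))
      = bracket (V X) (G1 (V (Pr (V (G3 (V Wm)))))) - bracket (V X) (G1 (V (Pr (V (G2 (v t))))))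
        - bracket (V X) (G1 (V (Pr (V (G2 s1)))))"
    unfolding G1_V_diff[OF linf_diff[OF Pl Pl] Pl] G1_V_diff[OF Pl Pl] k[symmetric]
      bracket_v_diff[OF linf_diff[OF G1_linf_beta G1_linf_beta] G1_linf_beta]
      bracket_v_diff[OF G1_linf_beta G1_linf_beta] ..
  also have "\<dots> = bracket (V X) (G2 s1) + bracket (V X) (G2 (v t)) - bracket (V X) (G3 (V Wm))"
    unfolding P[OF G3_linf[OF V_Wm_lone3]] P[OF G2_linf[OF v_lone2]] P[OF G2_linf[OF s1_lone2]] by simp
  also have "bracket (V X) (G2 s1) + bracket (V X) (G2 (v t)) = bracket (V X) (G2 (u - V W0))"
  proof -
    have B: "B0 \<in> lone 1" by (rule lone_mono[OF Ebd_lone[OF Pb_bound]]) (use beta in simp)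
    have B': "G0 B0 \<in> linf (- real \<beta>)" by (rule linf0_beta[OF G0_bounded[OF B]])
    have "bracket (V X) (G0 B0) = - bracket X B0" by (rule bracket_V_G0[OF X B])
    also have "\<dots> = 0" using bound_bracket_zero[OF Pb_bound orth] by simp
    finally have 0: "bracket (V X) (G0 B0) = 0" .
    have "bracket (V X) (G2 (u - V W0)) = bracket (V X) (G2 s1) + bracket (V X) (G2 (v t)) + bracket (V X) (G0 B0)"
      unfolding G2_V_W0 k[symmetric]
      by (simp only: bracket_v_add linf_add G2_linf s1_lone2 v_lone2 B')
    then show ?thesis unfolding 0 by simp
  qed
  finally show ?thesis .
qed

text \<open>The two conditions can be matched independently: \<open>R1\<close> contributes nothing
  to the threshold equation, while \<open>Pn u\<close> and \<open>Z1\<close> contribute nothing to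
  the solvability condition.\<close>

theorem W1_formula: "W1 = R1 - Pn u - Z1"
proof -
  let ?T = "R1 - Pn u - Z1"
  have l: "R1 \<in> linf (- real \<beta>)" "Pn u \<in> linf (- real \<beta>)" "Z1 \<in> linf (- real \<beta>)"
    by (rule res_linf[OF R1_res] linf_sb[OF Pn_linf] linf_sb[OF Z1_linf])+
  have Tl: "?T \<in> linf (- real \<beta>)" by (intro linf_diff l)
  have Tl': "?T \<in> linf (- sb)" by (intro linf_diff res_linf_sb R1_res Pn_linf Z1_linf)
  have "W1 - ?T = 0"
  proof (rule threshold_unique)
    show "W1 - ?T \<in> linf (- real \<beta>)" by (intro linf_diff W1_linf l)
    have G: "G0 (V ?T) = G0 (V R1) - G0 (V (Pn u)) - G0 (V Z1)"
      unfolding G0_V_diff[OF linf_diff[OF l(1,2)] l(3)] G0_V_diff[OF l(1,2)] ..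
    define S where "S = (\<Sum>\<alpha>\<in>UNIV. (\<Sum>j\<in>J. bracket (nonres j) u * c' j \<alpha>) *\<^sub>C nvec \<alpha> :: ('a, 'n) gfun)"
    have *: "w1 = gw - g - h \<Longrightarrow> gw = gt - S \<Longrightarrow> r' = - r1 \<Longrightarrow> p + p' = S \<Longrightarrow> z + z' = g - gt
        \<Longrightarrow> w1 - (r1 - p - z) = - (h - (r' - p' - z'))" for w1 gw g h gt r1 r' p p' z z' :: "('a, 'n) gfun"
    proof -
      assume e: "w1 = gw - g - h" "gw = gt - S" "r' = - r1" "p + p' = S" "z + z' = g - gt"
      from e(5) have g: "g = z + z' + gt" by (simp add: algebra_simps)
      show "w1 - (r1 - p - z) = - (h - (r' - p' - z'))" unfolding e(1-3) e(4)[symmetric] g by (simp add: algebra_simps)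
    qed
    show "W1 - ?T = - G0 (V (W1 - ?T))"
      unfolding G0_V_diff[OF W1_linf Tl] G
      by (rule *[OF W1_eq first_order_defect[folded S_def] res_eq[OF R1_res] Pn_solves[of u, folded S_def] Z1_solves])
    show "bracket (V X) (G1 (V (W1 - ?T))) = 0" if X: "X \<in> Eres" and o: "\<And>Y. Y \<in> Ebd \<Longrightarrow> bracket Y X = 0" for X
    proof -
      have k: "v (ker_of X) = V X" "ker_of X \<in> Ker M" by (auto intro: v_ker_of res_linf ker_of_Ker X)
      have 1: "bracket (V X) (G1 (V (Pn u))) = 0" using Pn_G1[OF k(2), of u] unfolding k(1) .
      have 2: "bracket (V X) (G1 (V Z1)) = 0" using solve_G1_zero[OF f1_linf f1_orth k(2)] unfolding k(1) .
      have "bracket (V X) (G1 (V (W1 - ?T))) = bracket (V X) (G1 (V W1))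
          - (bracket (V X) (G1 (V R1)) - bracket (V X) (G1 (V (Pn u))) - bracket (V X) (G1 (V Z1)))"
        unfolding G1_V_diff[OF W1_linf Tl] G1_V_diff[OF linf_diff[OF l(1,2)] l(3)] G1_V_diff[OF l(1,2)] k(1)[symmetric]
          bracket_v_diff[OF G1_linf_beta linf_diff[OF linf_diff[OF G1_linf_beta G1_linf_beta] G1_linf_beta]]
          bracket_v_diff[OF linf_diff[OF G1_linf_beta G1_linf_beta] G1_linf_beta]
          bracket_v_diff[OF G1_linf_beta G1_linf_beta] ..
      then show ?thesis using R1_bracket[OF X o] W1_solvability[OF X] 1 2 by simp
    qed
    show "bracket X (W1 - ?T) = 0" if X: "X \<in> Ebd" for X
    proof -
      note p = bound_pairable[OF X]
      have R: "bracket X R1 = 0"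
        by (simp only: bracket_diff_right pairable_diff_right p[OF res_linf_sb[OF Pr_res]] Pr_orth[OF X]) simp
      have "bracket X (W1 - ?T) = bracket X W1 - (bracket X R1 - bracket X (Pn u) - bracket X Z1)"
        using p[OF W1] p[OF Tl'] p[OF res_linf_sb[OF R1_res]] p[OF Pn_linf] p[OF Z1_linf]
        by (simp only: bracket_diff_right pairable_diff_right)
      then show ?thesis using W1_orth[OF X] R Pn_orth[OF X] Z1_orth[OF X] by simp
    qed
  qed
  then show ?thesis by simp
qed

end


section \<open>Transfer from the expansion of the resolvent along real kappa\<close>

subsection \<open>From the resolvent expansion to the coefficients\<close>

text \<open>Off the spectrum every datum in \<open>ltwo\<close> is attained, so the
  \<open>inv_into\<close> in \<open>resolvent\<close> returns a genuine solution.\<close>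

lemma resolvent_solves:
  assumes "- \<kappa>\<^sup>2 \<notin> op_spectrum A" and u: "u \<in> ltwo"
  shows "resolvent A \<kappa> u \<in> ltwo" "A (resolvent A \<kappa> u) + \<kappa>\<^sup>2 *\<^sub>C resolvent A \<kappa> u = u"
proof -
  obtain S where S: "bounded_operator ltwo ltwo_norm ltwo ltwo_norm S"
      "\<And>u. u \<in> ltwo \<Longrightarrow> A (S u) - (- \<kappa>\<^sup>2) *\<^sub>C S u = u"
    using assms(1) by (auto simp: op_spectrum_def)
  have m: "- ((- \<kappa>\<^sup>2) *\<^sub>C f) = \<kappa>\<^sup>2 *\<^sub>C f" for f :: "('a, 'b) gfun" by (rule ext) simp
  have "A (S u) + \<kappa>\<^sup>2 *\<^sub>C S u = u" unfolding m[symmetric] using S(2)[OF u] by simp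
  then have im: "u \<in> (\<lambda>w. A w + \<kappa>\<^sup>2 *\<^sub>C w) ` ltwo" by (rule image_eqI[OF sym bdd_op_mem[OF S(1) u]])
  show "resolvent A \<kappa> u \<in> ltwo" unfolding resolvent_def by (rule inv_into_into[OF im])
  show "A (resolvent A \<kappa> u) + \<kappa>\<^sup>2 *\<^sub>C resolvent A \<kappa> u = u"
    unfolding resolvent_def by (rule f_inv_into_f[OF im])
qed

lemma kap_filterlim: "filterlim (\<lambda>\<theta>. complex_of_real (kap \<theta>)) (at 0 within {\<kappa>. Re \<kappa> > 0}) (at_right 0)"
proof -
  have "((\<lambda>\<theta>. complex_of_real (kap \<theta>)) \<longlongrightarrow> 0) (at_right 0)" using tendsto_of_real[OF kap_tendsto_0] by simp
  moreover have "\<forall>\<^sub>F \<theta> in at_right 0. complex_of_real (kap \<theta>) \<in> {\<kappa>. Re \<kappa> > 0} \<and> complex_of_real (kap \<theta>) \<noteq> 0"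
    using kap_small by eventually_elim auto
  ultimately show ?thesis by (simp add: filterlim_at)
qed

text \<open>Truncation at any order \<open>m\<close>: the omitted coefficients are bounded in the
  weighted norm and, for kappa at most 1, are absorbed into an error of order
  \<open>m + 1\<close>.\<close>

lemma resolvent_expansion_ray:
  assumes G: "resolvent_expansion \<beta> A G" and \<beta>: "6 \<le> \<beta>" and u: "u \<in> lone (real \<beta> - 2)"
  shows "\<forall>\<^sub>F \<theta> in at_right 0. resolvent A (kap \<theta>) u \<in> ltwo
      \<and> A (resolvent A (kap \<theta>) u) + complex_of_real ((kap \<theta>)\<^sup>2) *\<^sub>C resolvent A (kap \<theta>) u = u"
    and "j \<in> {-2..int \<beta> - 6} \<Longrightarrow> G j u \<in> linf (- (real \<beta> - 2))"
    and "-3 \<le> m \<Longrightarrow> m \<le> int \<beta> - 6 \<Longrightarrow> \<exists>C\<ge>0. \<forall>\<^sub>F \<theta> in at_right 0. \<forall>x.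
      cmod (resolvent A (kap \<theta>) u x - (\<Sum>j = -2..m. complex_of_real (kap \<theta>) powi j * G j u x))
        \<le> C * kap \<theta> powi (m + 1) * weight (real \<beta> - 2) x"
proof -
  let ?s = "real \<beta> - 2" and ?n = "int \<beta> - 6"
  let ?S = "\<lambda>\<theta>. \<Sum>j = -2..?n. complex_of_real (kap \<theta>) powi j *\<^sub>C G j u"
  have s: "0 \<le> ?s" using \<beta> by simp
  have u2: "u \<in> ltwo" by (rule lone_imp_ltwo[OF u s])
  have Gb: "G j u \<in> linf (- ?s)" if "j \<in> {-2..?n}" for j
    using bdd_op_mem[OF _ u] G that unfolding resolvent_expansion_def Let_def by blast
  then show "j \<in> {-2..?n} \<Longrightarrow> G j u \<in> linf (- ?s)" .
  obtain C where C: "\<forall>\<^sub>F \<kappa> in at 0 within {\<kappa>. Re \<kappa> > 0}. - \<kappa>\<^sup>2 \<notin> op_spectrum A \<and>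
        (\<forall>u\<in>lone ?s. linf_norm (- ?s) (resolvent A \<kappa> u - (\<Sum>j = - 2..?n. \<kappa> powi j *\<^sub>C G j u))
            \<le> C * cmod \<kappa> powi (int \<beta> - 5) * lone_norm ?s u)"
    using G unfolding resolvent_expansion_def Let_def by blast
  define D where "D = \<bar>C * lone_norm ?s u\<bar>"
  have "\<forall>\<^sub>F \<theta> in at_right 0. - (complex_of_real (kap \<theta>))\<^sup>2 \<notin> op_spectrum A \<and>
      linf_norm (- ?s) (resolvent A (kap \<theta>) u - ?S \<theta>) \<le> C * cmod (complex_of_real (kap \<theta>)) powi (int \<beta> - 5) * lone_norm ?s u"
    using eventually_compose_filterlim[OF C kap_filterlim] by eventually_elim (use u in blast)
  then have ev: "\<forall>\<^sub>F \<theta> in at_right 0. - (complex_of_real (kap \<theta>))\<^sup>2 \<notin> op_spectrum A \<and>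
      linf_norm (- ?s) (resolvent A (kap \<theta>) u - ?S \<theta>) \<le> D * kap \<theta> powi (int \<beta> - 5)"
    using kap_small
  proof eventually_elim
    case (elim \<theta>)
    have "C * cmod (complex_of_real (kap \<theta>)) powi (int \<beta> - 5) * lone_norm ?s u = (C * lone_norm ?s u) * kap \<theta> powi (int \<beta> - 5)"
      using elim by simp
    also have "\<dots> \<le> D * kap \<theta> powi (int \<beta> - 5)"
      unfolding D_def using elim by (intro mult_right_mono) auto
    finally show ?case using elim(1) order_trans by blast
  qed
  show "\<forall>\<^sub>F \<theta> in at_right 0. resolvent A (kap \<theta>) u \<in> ltwo
      \<and> A (resolvent A (kap \<theta>) u) + complex_of_real ((kap \<theta>)\<^sup>2) *\<^sub>C resolvent A (kap \<theta>) u = u"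
    using ev by eventually_elim (use resolvent_solves[OF _ u2] in \<open>auto simp: of_real_power\<close>)
  show "\<exists>C\<ge>0. \<forall>\<^sub>F \<theta> in at_right 0. \<forall>x.
      cmod (resolvent A (kap \<theta>) u x - (\<Sum>j = -2..m. complex_of_real (kap \<theta>) powi j * G j u x))
        \<le> C * kap \<theta> powi (m + 1) * weight ?s x" if m: "-3 \<le> m" "m \<le> ?n"
  proof -
    have "\<exists>c\<ge>0. \<forall>x. cmod (G j u x) \<le> c * weight ?s x" if "j \<in> {-2..?n}" for j
      using Gb[OF that] by (rule linfE) blast
    then obtain c where c: "\<And>j. j \<in> {-2..?n} \<Longrightarrow> c j \<ge> 0" "\<And>j x. j \<in> {-2..?n} \<Longrightarrow> cmod (G j u x) \<le> c j * weight ?s x"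
      by metis
    define K where "K = D + (\<Sum>j = m+1..?n. c j)"
    have "0 \<le> K" unfolding K_def D_def using m c(1) by (intro add_nonneg_nonneg sum_nonneg) auto
    moreover have "\<forall>\<^sub>F \<theta> in at_right 0. \<forall>x.
      cmod (resolvent A (kap \<theta>) u x - (\<Sum>j = -2..m. complex_of_real (kap \<theta>) powi j * G j u x))
        \<le> K * kap \<theta> powi (m + 1) * weight ?s x"
      using ev kap_small
    proof eventually_elim
      case (elim \<theta>)
      let ?k = "kap \<theta>"
      have k: "0 < ?k" "?k \<le> 1" using elim by auto
      have mono: "?k powi j \<le> ?k powi (m + 1)" if "m + 1 \<le> j" for j
        using that k by (intro power_int_decreasing) auto
      have R: "resolvent A ?k u \<in> ltwo" using resolvent_solves(1)[OF _ u2] elim by blast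
      have l: "resolvent A ?k u - ?S \<theta> \<in> linf (- ?s)"
        by (intro linf_diff ltwo_imp_linf[OF R s] linf_sum linf_scale Gb)
      show ?case
      proof
        fix x
        have "{-2..?n} = {-2..m} \<union> {m+1..?n}" using m by auto
        then have split: "?S \<theta> x = (\<Sum>j = -2..m. complex_of_real ?k powi j * G j u x) + (\<Sum>j = m+1..?n. complex_of_real ?k powi j * G j u x)"
          by (simp add: sum_fun_apply sum.union_disjoint)
        have "cmod (resolvent A ?k u x - (\<Sum>j = -2..m. complex_of_real ?k powi j * G j u x))
            = cmod ((resolvent A ?k u - ?S \<theta>) x + (\<Sum>j = m+1..?n. complex_of_real ?k powi j * G j u x))"
          using split by simp
        also have "\<dots> \<le> cmod ((resolvent A ?k u - ?S \<theta>) x) + (\<Sum>j = m+1..?n. cmod (complex_of_real ?k powi j * G j u x))"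
          by (intro order_trans[OF norm_triangle_ineq] add_left_mono norm_sum)
        also have "cmod ((resolvent A ?k u - ?S \<theta>) x) \<le> D * ?k powi (int \<beta> - 5) * weight ?s x"
          using linf_norm_bound[OF l, of x] elim mult_right_mono[OF _ weight_nonneg] by (meson order_trans)
        also have "D * ?k powi (int \<beta> - 5) * weight ?s x \<le> D * ?k powi (m + 1) * weight ?s x"
          using mono[of "int \<beta> - 5"] m by (intro mult_right_mono mult_left_mono) (auto simp: D_def)
        also have "(\<Sum>j = m+1..?n. cmod (complex_of_real ?k powi j * G j u x)) \<le> (\<Sum>j = m+1..?n. c j * ?k powi (m + 1) * weight ?s x)"
        proof (rule sum_mono)
          fix j assume j: "j \<in> {m+1..?n}"
          then have j': "j \<in> {-2..?n}" using m by auto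
          have "cmod (complex_of_real ?k powi j * G j u x) = ?k powi j * cmod (G j u x)"
            using k by (simp add: norm_mult norm_power_int)
          also have "\<dots> \<le> ?k powi (m + 1) * (c j * weight ?s x)"
            using j k by (intro mult_mono mono c(2)[OF j']) auto
          finally show "cmod (complex_of_real ?k powi j * G j u x) \<le> c j * ?k powi (m + 1) * weight ?s x"
            by (simp only: mult_ac)
        qed
        finally show "cmod (resolvent A ?k u x - (\<Sum>j = -2..m. complex_of_real ?k powi j * G j u x))
            \<le> K * ?k powi (m + 1) * weight ?s x"
          by (simp add: K_def distrib_right sum_distrib_right)
      qed
    qed
    ultimately show ?thesis by blast
  qed
qed

context resonance_data
begin

text \<open>A bound state is annihilated by \<open>H\<close>, so divided by \<open>c\<close> it
  solves the resolvent equation with itself as datum.\<close>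

lemma resolvent_bound_part:
  assumes R: "R \<in> ltwo" "H R + c *\<^sub>C R = f" and c: "c \<noteq> 0" and B: "B \<in> Ebd"
  shows "R - (1 / c) *\<^sub>C B \<in> ltwo" "H (R - (1 / c) *\<^sub>C B) + c *\<^sub>C (R - (1 / c) *\<^sub>C B) = f - B"
proof -
  have B2: "B \<in> ltwo" by (rule lone_imp_ltwo[OF Ebd_lone[OF B]]) (use beta in simp)
  have cB: "(1 / c) *\<^sub>C B \<in> ltwo" by (rule ltwo_scale[OF B2])
  show "R - (1 / c) *\<^sub>C B \<in> ltwo" by (rule ltwo_diff[OF R(1) cB])
  have l: "f \<in> linf (- real \<beta>)" if "f \<in> ltwo" for f by (rule ltwo_imp_linf[OF that]) simp
  have "(1 / c) *\<^sub>C B \<in> Ebd" by (rule bound_scale[OF B])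
  then have H: "H ((1 / c) *\<^sub>C B) = 0" by (simp add: bound_eigenspace_def gen_eigenspace_def)
  have "H (R - (1 / c) *\<^sub>C B) = H R - H ((1 / c) *\<^sub>C B)"
    by (simp only: plus_fun_apply free_op_diff V_diff[OF l[OF R(1)] l[OF cB]] add_diff_add)
  then have H': "H (R - (1 / c) *\<^sub>C B) = H R" unfolding H by simp
  have "c *\<^sub>C (R - (1 / c) *\<^sub>C B) = c *\<^sub>C R - B" using c by (intro ext) (simp add: right_diff_distrib)
  then show "H (R - (1 / c) *\<^sub>C B) + c *\<^sub>C (R - (1 / c) *\<^sub>C B) = f - B"
    unfolding H' R(2)[symmetric] by simp
qed

text \<open>Removing the bound component alters the datum and the order kappa^(-2) only; the orders
  -1 and 0 keep the coefficients of the original expansion.\<close>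

lemma resonance_familyI:
  assumes G: "resolvent_expansion \<beta> H G" and \<beta>: "6 \<le> \<beta>" and u: "u \<in> lone sb"
  shows "resonance_family E0 att V v U \<beta> L \<Phi> I \<Psi> J c'
    (\<lambda>\<theta>. resolvent H (kap \<theta>) u - (1 / complex_of_real ((kap \<theta>)\<^sup>2)) *\<^sub>C Pb u)
    (u - Pb u) (G (-2) u - Pb u) (G (-1) u) (G 0 u)" (is "resonance_family _ _ _ _ _ _ _ _ _ _ _ _ ?w ?p _ _ _")
proof unfold_locales
  have ul: "u \<in> linf (- sb)" by (rule lone_imp_linf'[OF u]) (use \<beta> in simp)
  note Gl = resolvent_expansion_ray(2)[OF G \<beta> u]
  show "6 \<le> \<beta>" by fact
  show "?p \<in> lone sb" by (intro lone_diff u Ebd_lone Pb_bound)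
  show "bracket X ?p = 0" if "X \<in> Ebd" for X by (rule Pb_orth[OF that ul])
  show "\<forall>\<^sub>F \<theta> in at_right 0. ?w \<theta> \<in> ltwo \<and> H (?w \<theta>) + complex_of_real ((kap \<theta>)\<^sup>2) *\<^sub>C ?w \<theta> = ?p"
    using resolvent_expansion_ray(1)[OF G \<beta> u] kap_small
  proof eventually_elim
    case (elim \<theta>)
    have c: "complex_of_real ((kap \<theta>)\<^sup>2) \<noteq> 0" using elim by simp
    from elim have R: "resolvent H (kap \<theta>) u \<in> ltwo"
        "H (resolvent H (kap \<theta>) u) + complex_of_real ((kap \<theta>)\<^sup>2) *\<^sub>C resolvent H (kap \<theta>) u = u" by blast+
    show ?case using resolvent_bound_part[OF R c Pb_bound] by blast
  qed
  show "G (-2) u - Pb u \<in> linf (- sb)" using \<beta> by (intro linf_diff Gl bound_linf_sb Pb_bound) simp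
  show "G (-1) u \<in> linf (- sb)" "G 0 u \<in> linf (- sb)" by (rule Gl, use \<beta> in simp)+
  have three: "(\<Sum>j = -2..0. f j) = f (-2) + f (-1) + f 0" for f :: "int \<Rightarrow> complex"
  proof -
    have "{-2..0::int} = {-2, -1, 0}" by auto
    then show ?thesis by (simp add: add.assoc)
  qed
  obtain C where "C \<ge> 0" and C: "\<forall>\<^sub>F \<theta> in at_right 0. \<forall>x.
      cmod (resolvent H (kap \<theta>) u x - (\<Sum>j = -2..0. complex_of_real (kap \<theta>) powi j * G j u x))
        \<le> C * kap \<theta> powi (0 + 1) * weight sb x"
    using resolvent_expansion_ray(3)[OF G \<beta> u, of 0] \<beta> by auto
  have "\<forall>\<^sub>F \<theta> in at_right 0. \<forall>x. cmod (?w \<theta> x - ((G (-2) u - Pb u) x / complex_of_real ((kap \<theta>)\<^sup>2)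
      + G (-1) u x / complex_of_real (kap \<theta>) + G 0 u x)) \<le> C * kap \<theta> * weight sb x"
    using C
  proof (eventually_elim, intro allI)
    fix \<theta> x
    assume e: "\<forall>x. cmod (resolvent H (kap \<theta>) u x - (\<Sum>j = -2..0. complex_of_real (kap \<theta>) powi j * G j u x))
        \<le> C * kap \<theta> powi (0 + 1) * weight sb x"
    have eq: "?w \<theta> x - ((G (-2) u - Pb u) x / complex_of_real ((kap \<theta>)\<^sup>2) + G (-1) u x / complex_of_real (kap \<theta>) + G 0 u x)
        = resolvent H (kap \<theta>) u x - (\<Sum>j = -2..0. complex_of_real (kap \<theta>) powi j * G j u x)"
      unfolding three by (simp add: power_int_def field_simps diff_divide_distrib)
    show "cmod (?w \<theta> x - ((G (-2) u - Pb u) x / complex_of_real ((kap \<theta>)\<^sup>2)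
      + G (-1) u x / complex_of_real (kap \<theta>) + G 0 u x)) \<le> C * kap \<theta> * weight sb x"
      unfolding eq using e[rule_format, of x] by simp
  qed
  then show "\<exists>C\<ge>0. \<forall>\<^sub>F \<theta> in at_right 0. \<forall>x. cmod (?w \<theta> x - ((G (-2) u - Pb u) x / complex_of_real ((kap \<theta>)\<^sup>2)
      + G (-1) u x / complex_of_real (kap \<theta>) + G 0 u x)) \<le> C * kap \<theta> * weight sb x"
    using \<open>C \<ge> 0\<close> by blast
qed

lemma resonance_family_1I:
  assumes G: "resolvent_expansion \<beta> H G" and \<beta>: "7 \<le> \<beta>" and u: "u \<in> lone sb"
  shows "resonance_family_1 E0 att V v U \<beta> L \<Phi> I \<Psi> J c'
    (\<lambda>\<theta>. resolvent H (kap \<theta>) u - (1 / complex_of_real ((kap \<theta>)\<^sup>2)) *\<^sub>C Pb u)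
    (u - Pb u) (G (-2) u - Pb u) (G (-1) u) (G 0 u) (G 1 u)" (is "resonance_family_1 _ _ _ _ _ _ _ _ _ _ _ _ ?w ?p _ _ _ _")
proof -
  have \<beta>6: "6 \<le> \<beta>" using \<beta> by simp
  interpret F: resonance_family E0 att V v U \<beta> L \<Phi> I \<Psi> J c' ?w ?p "G (-2) u - Pb u" "G (-1) u" "G 0 u"
    by (rule resonance_familyI[OF G \<beta>6 u])
  show ?thesis
  proof unfold_locales
    show "7 \<le> \<beta>" by fact
    show "G 1 u \<in> linf (- sb)" using \<beta> by (intro resolvent_expansion_ray(2)[OF G \<beta>6 u]) simp
    have four: "(\<Sum>j = -2..1. f j) = f (-2) + f (-1) + f 0 + f 1" for f :: "int \<Rightarrow> complex"
    proof -
      have "{-2..1::int} = {-2, -1, 0, 1}" by auto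
      then show ?thesis by (simp add: add.assoc)
    qed
    obtain C where "C \<ge> 0" and C: "\<forall>\<^sub>F \<theta> in at_right 0. \<forall>x.
        cmod (resolvent H (kap \<theta>) u x - (\<Sum>j = -2..1. complex_of_real (kap \<theta>) powi j * G j u x))
          \<le> C * kap \<theta> powi (1 + 1) * weight sb x"
      using resolvent_expansion_ray(3)[OF G \<beta>6 u, of 1] \<beta> by auto
    have "\<forall>\<^sub>F \<theta> in at_right 0. \<forall>x. cmod (?w \<theta> x - ((G (-2) u - Pb u) x / complex_of_real ((kap \<theta>)\<^sup>2)
        + G (-1) u x / complex_of_real (kap \<theta>) + G 0 u x + complex_of_real (kap \<theta>) * G 1 u x)) \<le> C * (kap \<theta>)\<^sup>2 * weight sb x"
      using C
    proof (eventually_elim, intro allI)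
      fix \<theta> x
      assume e: "\<forall>x. cmod (resolvent H (kap \<theta>) u x - (\<Sum>j = -2..1. complex_of_real (kap \<theta>) powi j * G j u x))
          \<le> C * kap \<theta> powi (1 + 1) * weight sb x"
      have eq: "?w \<theta> x - ((G (-2) u - Pb u) x / complex_of_real ((kap \<theta>)\<^sup>2) + G (-1) u x / complex_of_real (kap \<theta>) + G 0 u x
            + complex_of_real (kap \<theta>) * G 1 u x)
          = resolvent H (kap \<theta>) u x - (\<Sum>j = -2..1. complex_of_real (kap \<theta>) powi j * G j u x)"
        unfolding four by (simp add: power_int_def field_simps diff_divide_distrib)
      have pow: "kap \<theta> powi (1 + 1) = (kap \<theta>)\<^sup>2" by (simp add: power_int_def)
      show "cmod (?w \<theta> x - ((G (-2) u - Pb u) x / complex_of_real ((kap \<theta>)\<^sup>2)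
        + G (-1) u x / complex_of_real (kap \<theta>) + G 0 u x + complex_of_real (kap \<theta>) * G 1 u x)) \<le> C * (kap \<theta>)\<^sup>2 * weight sb x"
        unfolding eq using e[rule_format, of x] unfolding pow .
    qed
    then show "\<exists>C\<ge>0. \<forall>\<^sub>F \<theta> in at_right 0. \<forall>x. cmod (?w \<theta> x - ((G (-2) u - Pb u) x / complex_of_real ((kap \<theta>)\<^sup>2)
        + G (-1) u x / complex_of_real (kap \<theta>) + G 0 u x + complex_of_real (kap \<theta>) * G 1 u x)) \<le> C * (kap \<theta>)\<^sup>2 * weight sb x"
      using \<open>C \<ge> 0\<close> by blast
  qed
qed

text \<open>The identification is made for the datum \<open>u - Pb u\<close>, which is the rightmost
  factor of the formula; the leftmost one is the bound correction contained in
  \<open>F.W0_formula\<close>.\<close>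

theorem coefficient_0:
  assumes G: "resolvent_expansion \<beta> H G" and \<beta>: "6 \<le> \<beta>" and u: "u \<in> lone sb"
  shows "G 0 u =
    ((id - Pb) \<cdot>
      (G0 - G0 \<cdot> v \<cdot> md \<cdot> va \<cdot> G1 - G1 \<cdot> v \<cdot> md \<cdot> va \<cdot> G0
        - G0 \<cdot> (id - v \<cdot> md \<cdot> va \<cdot> G1) \<cdot> v \<cdot> Md \<cdot> va \<cdot> (id - G1 \<cdot> v \<cdot> md \<cdot> va) \<cdot> G0
        + G0 \<cdot> v \<cdot> md \<cdot> va \<cdot> G2 \<cdot> v \<cdot> md \<cdot> va \<cdot> G0
        + G0 \<cdot> v \<cdot> md \<cdot> va \<cdot> G0 \<cdot> Pb \<cdot> G0 \<cdot> v \<cdot> md \<cdot> va \<cdot> G0)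
      \<cdot> (id - Pb)) u"
proof -
  interpret F: resonance_family E0 att V v U \<beta> L \<Phi> I \<Psi> J c'
      "\<lambda>\<theta>. resolvent H (kap \<theta>) u - (1 / complex_of_real ((kap \<theta>)\<^sup>2)) *\<^sub>C Pb u"
      "u - Pb u" "G (-2) u - Pb u" "G (-1) u" "G 0 u"
    by (rule resonance_familyI[OF G \<beta> u])
  have p: "(id - Pb) f = f - Pb f" for f by simp
  show ?thesis
    unfolding comp_apply[of _ "id - Pb"] comp_apply[of "id - Pb"] p F.coeff_0_composition by (rule F.W0_formula)
qed

lemma Pr_bound: "X \<in> Ebd \<Longrightarrow> Pr X = 0"
proof -
  assume X: "X \<in> Ebd"
  have "bracket (\<Psi> i) X = 0" if "i \<in> I" for i by (rule bound_bracket_zero[OF X \<Psi>_orth[OF that]])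
  then show ?thesis unfolding basis_projection_apply by (intro ext) (simp add: sum_fun_apply)
qed

lemma Pn_diff_bound:
  assumes u: "u \<in> lone sb" and X: "X \<in> Ebd"
  shows "basis_projection J nonres (u - X) = basis_projection J nonres u"
  unfolding basis_projection_apply
proof (rule sum.cong[OF refl])
  fix j assume j: "j \<in> J"
  have "bracket (nonres j) (u - X) = bracket (nonres j) u - bracket (nonres j) X"
    by (intro bracket_diff_right pairable_linf_lone[OF nonres_linf[OF j]] u Ebd_lone X)
  also have "bracket (nonres j) X = 0" by (rule bound_bracket_zero[OF X nonres_orth[OF j]])
  finally show "bracket (nonres j) (u - X) *\<^sub>C nonres j = bracket (nonres j) u *\<^sub>C nonres j"
    by (simp only: diff_0_right)
qed

theorem coefficient_1:
  assumes G: "resolvent_expansion \<beta> H G" and \<beta>: "7 \<le> \<beta>" and u: "u \<in> lone sb"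
  shows "G 1 u =
    (- basis_projection J nonres + Pr \<cdot> V \<cdot> G3 \<cdot> V \<cdot> Pr - Pr \<cdot> V \<cdot> G2 \<cdot> v \<cdot> md \<cdot> va \<cdot> G2 \<cdot> V \<cdot> Pr
      - (id - Pb) \<cdot> (id - G0 \<cdot> (id - v \<cdot> md \<cdot> va \<cdot> G1) \<cdot> v \<cdot> Md \<cdot> va)
          \<cdot> (id - G1 \<cdot> v \<cdot> md \<cdot> va) \<cdot> G2 \<cdot> V \<cdot> Pr
      - Pr \<cdot> V \<cdot> G2 \<cdot> (id - v \<cdot> md \<cdot> va \<cdot> G1)
          \<cdot> (id - v \<cdot> Md \<cdot> va \<cdot> (id - G1 \<cdot> v \<cdot> md \<cdot> va) \<cdot> G0) \<cdot> (id - Pb)) u"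
proof -
  interpret F: resonance_family_1 E0 att V v U \<beta> L \<Phi> I \<Psi> J c'
      "\<lambda>\<theta>. resolvent H (kap \<theta>) u - (1 / complex_of_real ((kap \<theta>)\<^sup>2)) *\<^sub>C Pb u"
      "u - Pb u" "G (-2) u - Pb u" "G (-1) u" "G 0 u" "G 1 u"
    by (rule resonance_family_1I[OF G \<beta> u])
  have l0: "f \<in> lone 0" if "f \<in> lone sb" for f :: "('a, 'n) gfun" by (rule lone_mono[OF that]) (use \<beta> in simp)
  \<comment> \<open>Resonance functions are orthogonal to bound states, so removing the bound
    component does not change the resonance projection; this is why \<open>Pr\<close> stands alone
    on the right of several terms.\<close>
  have "Pr (u - Pb u) = Pr u - Pr (Pb u)" by (intro Pr_diff l0 u Ebd_lone Pb_bound)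
  then have Wm: "G (-1) u = Pr u" using F.Wm_formula Pr_bound[OF Pb_bound] by simp
  have S: "f - G0 (v a - v b) = solve' - G0 (v a) + G0 (v b)" if "solve' = f" for f solve' a b
    unfolding that v_diff[symmetric] G0_v_diff by simp
  have *: "a - b - c - p - z = - p + a - b - z - c" for a b c p z :: "('a, 'n) gfun"
    by (simp add: algebra_simps)
  show ?thesis
    by (simp only: minus_apply plus_fun_apply uminus_apply comp_apply id_apply Wm[symmetric] S[OF refl]
        F.W1_formula Pn_diff_bound[OF u Pb_bound] solve_def) (rule *)
qed

end


theorem theoremB7:
  fixes E0 :: "'a::finite set set" and att :: "'n::finite \<Rightarrow> 'a"
    and V :: "('a, 'n) gop"
    and v :: "'k::complex_hilbert \<Rightarrow> ('a, 'n) gfun" and U :: "'k \<Rightarrow> 'k"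
    and \<beta> :: nat
  defines "H \<equiv> free_op E0 att + V"
    and "va \<equiv> adj v"
    and "G00 \<equiv> free_coeff E0 att 0"
    and "G01 \<equiv> free_coeff E0 att 1"
    and "G02 \<equiv> free_coeff E0 att 2"
    and "G03 \<equiv> free_coeff E0 att 3"
    and "Md \<equiv> pseudo_inv (M_zero E0 att v U)"
    and "md \<equiv> pseudo_inv (m_zero E0 att v U)"
  assumes graph: "simple_connected_graph E0"
    and beta: "\<beta> \<ge> 4"
    and A: "assumption_A (real \<beta>) V v U"
    and third: "third_kind \<beta> H"
  shows "(\<forall>(L :: 'l set) \<Phi> (I :: 'i set) \<Psi> (J :: 'j set) c'.
      bound_basis \<beta> H L \<Phi> \<longrightarrow>
      resonance_basis \<beta> H I \<Psi> \<longrightarrow>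
      orthonormal_basis (I <+> J) (case_sum (\<lambda>\<gamma> \<alpha>. - bracket (nvec \<alpha>) (V (\<Psi> \<gamma>))) c') \<longrightarrow>
      (let Pb = basis_projection L \<Phi>;
           Pr = basis_projection I \<Psi>;
           \<Psi>' = (\<lambda>\<gamma>. ((id - Pb) \<cdot> (id - G00 \<cdot> (id - v \<cdot> md \<cdot> va \<cdot> G01) \<cdot> v \<cdot> Md \<cdot> va))
                       (\<Sum>\<alpha>\<in>UNIV. c' \<gamma> \<alpha> *\<^sub>C nvec \<alpha>));
           Pn = basis_projection J \<Psi>'
       in nonresonance_basis \<beta> H J \<Psi>' \<and>
          (\<forall>G. resolvent_expansion \<beta> H G \<longrightarrow>
             (\<beta> \<ge> 6 \<longrightarrow> (\<forall>u \<in> lone (real \<beta> - 2). G 0 u =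
               ((id - Pb) \<cdot>
                 (G00 - G00 \<cdot> v \<cdot> md \<cdot> va \<cdot> G01 - G01 \<cdot> v \<cdot> md \<cdot> va \<cdot> G00
                   - G00 \<cdot> (id - v \<cdot> md \<cdot> va \<cdot> G01) \<cdot> v \<cdot> Md \<cdot> va \<cdot> (id - G01 \<cdot> v \<cdot> md \<cdot> va) \<cdot> G00
                   + G00 \<cdot> v \<cdot> md \<cdot> va \<cdot> G02 \<cdot> v \<cdot> md \<cdot> va \<cdot> G00
                   + G00 \<cdot> v \<cdot> md \<cdot> va \<cdot> G00 \<cdot> Pb \<cdot> G00 \<cdot> v \<cdot> md \<cdot> va \<cdot> G00)
                 \<cdot> (id - Pb)) u)) \<and>
             (\<beta> \<ge> 7 \<longrightarrow> (\<forall>u \<in> lone (real \<beta> - 2). G 1 u =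
               (- Pn + Pr \<cdot> V \<cdot> G03 \<cdot> V \<cdot> Pr - Pr \<cdot> V \<cdot> G02 \<cdot> v \<cdot> md \<cdot> va \<cdot> G02 \<cdot> V \<cdot> Pr
                 - (id - Pb) \<cdot> (id - G00 \<cdot> (id - v \<cdot> md \<cdot> va \<cdot> G01) \<cdot> v \<cdot> Md \<cdot> va)
                     \<cdot> (id - G01 \<cdot> v \<cdot> md \<cdot> va) \<cdot> G02 \<cdot> V \<cdot> Pr
                 - Pr \<cdot> V \<cdot> G02 \<cdot> (id - v \<cdot> md \<cdot> va \<cdot> G01)
                     \<cdot> (id - v \<cdot> Md \<cdot> va \<cdot> (id - G01 \<cdot> v \<cdot> md \<cdot> va) \<cdot> G00) \<cdot> (id - Pb)) u)))))
    \<and> (\<forall>\<Psi>1 \<in> gen_eigenspace \<beta> H. \<forall>\<Psi>2 \<in> res_eigenspace \<beta> H. \<forall>c1 c2.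
      \<Psi>1 - (\<Sum>\<alpha>\<in>UNIV. c1 \<alpha> *\<^sub>C nvec \<alpha>) \<in> one_plus_lone (real \<beta> - 2) \<longrightarrow>
      \<Psi>2 - (\<Sum>\<alpha>\<in>UNIV. c2 \<alpha> *\<^sub>C onevec \<alpha>) \<in> lone (real \<beta> - 2) \<longrightarrow>
      (\<Sum>\<alpha>\<in>UNIV. cnj (c2 \<alpha>) * c1 \<alpha>) = 0)"
proof (intro conjI allI impI ballI)
  fix L :: "'l set" and \<Phi> and I :: "'i set" and \<Psi> and J :: "'j set" and c'
  assume "bound_basis \<beta> H L \<Phi>" "resonance_basis \<beta> H I \<Psi>"
    "orthonormal_basis (I <+> J) (case_sum (\<lambda>\<gamma> \<alpha>. - bracket (nvec \<alpha>) (V (\<Psi> \<gamma>))) c')"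
  then interpret R: resonance_data E0 att V v U \<beta> L \<Phi> I \<Psi> J c'
    by unfold_locales (use graph beta A in \<open>simp_all only: H_def\<close>)
  show "let Pb = basis_projection L \<Phi>;
           Pr = basis_projection I \<Psi>;
           \<Psi>' = (\<lambda>\<gamma>. ((id - Pb) \<cdot> (id - G00 \<cdot> (id - v \<cdot> md \<cdot> va \<cdot> G01) \<cdot> v \<cdot> Md \<cdot> va))
                       (\<Sum>\<alpha>\<in>UNIV. c' \<gamma> \<alpha> *\<^sub>C nvec \<alpha>));
           Pn = basis_projection J \<Psi>'
       in nonresonance_basis \<beta> H J \<Psi>' \<and>
          (\<forall>G. resolvent_expansion \<beta> H G \<longrightarrow>
             (\<beta> \<ge> 6 \<longrightarrow> (\<forall>u \<in> lone (real \<beta> - 2). G 0 u =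
               ((id - Pb) \<cdot>
                 (G00 - G00 \<cdot> v \<cdot> md \<cdot> va \<cdot> G01 - G01 \<cdot> v \<cdot> md \<cdot> va \<cdot> G00
                   - G00 \<cdot> (id - v \<cdot> md \<cdot> va \<cdot> G01) \<cdot> v \<cdot> Md \<cdot> va \<cdot> (id - G01 \<cdot> v \<cdot> md \<cdot> va) \<cdot> G00
                   + G00 \<cdot> v \<cdot> md \<cdot> va \<cdot> G02 \<cdot> v \<cdot> md \<cdot> va \<cdot> G00
                   + G00 \<cdot> v \<cdot> md \<cdot> va \<cdot> G00 \<cdot> Pb \<cdot> G00 \<cdot> v \<cdot> md \<cdot> va \<cdot> G00)
                 \<cdot> (id - Pb)) u)) \<and>
             (\<beta> \<ge> 7 \<longrightarrow> (\<forall>u \<in> lone (real \<beta> - 2). G 1 u =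
               (- Pn + Pr \<cdot> V \<cdot> G03 \<cdot> V \<cdot> Pr - Pr \<cdot> V \<cdot> G02 \<cdot> v \<cdot> md \<cdot> va \<cdot> G02 \<cdot> V \<cdot> Pr
                 - (id - Pb) \<cdot> (id - G00 \<cdot> (id - v \<cdot> md \<cdot> va \<cdot> G01) \<cdot> v \<cdot> Md \<cdot> va)
                     \<cdot> (id - G01 \<cdot> v \<cdot> md \<cdot> va) \<cdot> G02 \<cdot> V \<cdot> Pr
                 - Pr \<cdot> V \<cdot> G02 \<cdot> (id - v \<cdot> md \<cdot> va \<cdot> G01)
                     \<cdot> (id - v \<cdot> Md \<cdot> va \<cdot> (id - G01 \<cdot> v \<cdot> md \<cdot> va) \<cdot> G00) \<cdot> (id - Pb)) u)))"
    unfolding Let_def assms(1-8) R.nonres_def[abs_def, symmetric]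
    by (intro conjI allI impI ballI R.nonresonance_basis_nonres R.coefficient_0 R.coefficient_1)
next
  interpret P: factorized_potential E0 att V v U \<beta> by unfold_locales (rule graph, rule beta, rule A)
  fix \<Psi>1 \<Psi>2 c1 c2
  assume a: "\<Psi>1 \<in> gen_eigenspace \<beta> H" "\<Psi>2 \<in> res_eigenspace \<beta> H"
    "\<Psi>1 - (\<Sum>\<alpha>\<in>UNIV. c1 \<alpha> *\<^sub>C nvec \<alpha>) \<in> one_plus_lone (real \<beta> - 2)"
    "\<Psi>2 - (\<Sum>\<alpha>\<in>UNIV. c2 \<alpha> *\<^sub>C onevec \<alpha>) \<in> lone (real \<beta> - 2)"
  have "c2 \<alpha> = - P.res_coeff (V \<Psi>2) \<alpha>" for \<alpha>
    by (rule P.res_coeff_unique[OF a(2)[unfolded H_def] a(4)]) (use beta in simp)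
  moreover have "(\<Sum>\<alpha>\<in>UNIV. cnj (P.res_coeff (V \<Psi>2) \<alpha>) * c1 \<alpha>) = 0"
    by (rule P.gen_res_orthogonal[OF a(1,2)[unfolded H_def] a(3)])
  ultimately show "(\<Sum>\<alpha>\<in>UNIV. cnj (c2 \<alpha>) * c1 \<alpha>) = 0" by (simp add: sum_negf)
qed

end
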